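(* Let $\Omega \subset \mathbb{C}$ be a connected open set, let $p,q \in \overline{\Omega}$, and let $\gamma$ be a path in $\Omega$ (e.p.e.) joining $p$ and $q$. Then $\overline{[\gamma]}$ contains an efficient path, and this efficient path is unique up to reparameterization.
   Context: A path in $\Omega$ (e.p.e., "except possibly at endpoints") joining $p$ and $q$ is a continuous $\gamma:[0,1]\to\mathbb{C}$ with $\gamma(0)=p$, $\gamma(1)=q$ and $\gamma(s)\in\Omega$ for all $s\in(0,1)$. $\overline{[\gamma]}$ is the set of all paths $\lambda:[0,1]\to\mathbb{C}$ for which there is a continuous $h:[0,1]\times[0,1]\to\mathbb{C}$ with $h(\cdot,0)=\gamma$, $h(\cdot,1)=\lambda$, and such that for every $t\in[0,1)$ the path $h_t=h(\cdot,t)$ is a path in $\Omega$ (e.p.e.) joining $p$ and $q$ (so paths in $\overline{[\gamma]}$ may meet $\partial\Omega$ at interior times). A path $\lambda\in\overline{[\gamma]}$ is efficient if: for all $s_1<s_2$ in $[0,1]$, letting $\lambda'$ agree with $\lambda$ off $[s_1,s_2]$ and let $\lambda'|_{[s_1,s_2]}$ parameterize the straight segment from $\lambda(s_1)$ to $\lambda(s_2)$ (constant if these are equal), if $\lambda'\in\overline{[\gamma]}$ then $\lambda=\lambda'$ up to reparameterization. *)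

theory Defs
  imports "HOL-Analysis.Analysis"
begin

definition epe_path :: "complex set \<Rightarrow> complex \<Rightarrow> complex \<Rightarrow> (real \<Rightarrow> complex) \<Rightarrow> bool" where
  "epe_path \<Omega> p q g \<longleftrightarrow> path g \<and> pathstart g = p \<and> pathfinish g = q \<and>
     (\<forall>s\<in>{0<..<1}. g s \<in> \<Omega>)"

definition closure_class :: "complex set \<Rightarrow> complex \<Rightarrow> complex \<Rightarrow> (real \<Rightarrow> complex) \<Rightarrow> (real \<Rightarrow> complex) set" where
  "closure_class \<Omega> p q \<gamma> = {lam. path lam \<and>
     (\<exists>h :: real \<times> real \<Rightarrow> complex.
        continuous_on ({0..1} \<times> {0..1}) h \<and>
        (\<forall>s\<in>{0..1}. h (s, 0) = \<gamma> s) \<and>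
        (\<forall>s\<in>{0..1}. h (s, 1) = lam s) \<and>
        (\<forall>t\<in>{0..<1}. epe_path \<Omega> p q (\<lambda>s. h (s, t))))}"

definition reparam_equiv :: "(real \<Rightarrow> complex) \<Rightarrow> (real \<Rightarrow> complex) \<Rightarrow> bool" where
  "reparam_equiv lam mu \<longleftrightarrow> (\<exists>\<phi> \<psi> :: real \<Rightarrow> real.
      continuous_on {0..1} \<phi> \<and> continuous_on {0..1} \<psi> \<and>
      mono_on {0..1} \<phi> \<and> mono_on {0..1} \<psi> \<and>
      \<phi> ` {0..1} = {0..1} \<and> \<psi> ` {0..1} = {0..1} \<and>
      (\<forall>s\<in>{0..1}. lam (\<phi> s) = mu (\<psi> s)))"

definition straighten :: "(real \<Rightarrow> complex) \<Rightarrow> real \<Rightarrow> real \<Rightarrow> (real \<Rightarrow> complex)" where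
  "straighten lam s1 s2 = (\<lambda>s. if s1 \<le> s \<and> s \<le> s2
       then linepath (lam s1) (lam s2) ((s - s1) / (s2 - s1)) else lam s)"

definition efficient :: "complex set \<Rightarrow> complex \<Rightarrow> complex \<Rightarrow> (real \<Rightarrow> complex) \<Rightarrow> (real \<Rightarrow> complex) \<Rightarrow> bool" where
  "efficient \<Omega> p q \<gamma> lam \<longleftrightarrow> lam \<in> closure_class \<Omega> p q \<gamma> \<and>
     (\<forall>s1 s2. 0 \<le> s1 \<and> s1 < s2 \<and> s2 \<le> 1 \<and> straighten lam s1 s2 \<in> closure_class \<Omega> p q \<gamma>
        \<longrightarrow> reparam_equiv lam (straighten lam s1 s2))"

end

theory Submission
  imports Defs "HOL-Library.Diagonal_Subsequence" "HOL-Complex_Analysis.Great_Picard"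
begin

text \<open>
  Both parts rest on one observation. Let \<open>H\<close> be a homotopy defined on the unit square and let \<open>u\<close> be a unit
  vector. Where \<open>H\<close> takes values in \<open>\<Omega>\<close>, it maps a continuum contained in a level set of \<open>u \<bullet> H\<close> onto a segment
  in \<open>\<Omega>\<close>, and every curve in the square joining two points of the continuum is mapped to a curve homotopic
  in \<open>\<Omega>\<close> to the straight segment between the images of these points.

  Existence: among the paths homotopic to \<open>\<gamma>\<close>, lexicographically minimise the truncated variations of the
  projections to a countable dense set of directions. Bounded variations permit an equicontinuous
  reparameterization, hence a uniform limit. By minimality no straightening along a level set shortens the
  paths noticeably, so each homotopy back to \<open>\<gamma>\<close> contains level sets that run from one end to the other.
  These cut the homotopy between two late paths into cells which can be replaced by small ones, and so the
  limit belongs to the closed class. Straightening it there does not change any of the variations, and this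
  forces the straightened piece to have been a monotone parameterization of a segment.

  Uniqueness: join two efficient paths by a homotopy on the square. If a connected set with both ends on the
  lower edge satisfied \<open>u \<bullet> H \<ge> c\<close> while \<open>u \<bullet> H < c\<close> somewhere on the edge between the ends, the lower path
  could be straightened there and would lose variation. Hence level sets starting on one edge reach the
  other. In each direction this matches the two paths, the matchings have a common part, and by planarity
  that part is monotone up to intervals of constancy.
\<close>

section \<open>Truncated variation\<close>

text \<open>Length cannot serve as the quantity to minimise: the boundary of \<Omega> is arbitrary,
  and every path in the class may have infinite length. Truncated variation of a projection is
  finite and, unlike ordinary variation, continuous under uniform convergence. No single number
  detects straightness, so infinitely many directions and thresholds are controlled at once, through
  weighted finite sums. The second obstacle is that a uniform limit is not visibly in the closed
  class. Two homotopic paths that are uniformly close may wind differently around a tiny hole at one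
  time and make up for it at another, so that no small homotopy joins them. Much of the existence
  part therefore turns a given homotopy between close paths into one that stays close to the limit;
  stacking such homotopies with errors tending to zero ends at the limit. The same conversion
  returns in the uniqueness part, since efficiency speaks of straightenings of the limit path, while
  level sets of a homotopy only produce straightenings of slices inside \<Omega>.\<close>

text \<open>Steps of size below \<open>e\<close> do not count, which makes the variation of every continuous function finite.\<close>

definition trunc :: "real \<Rightarrow> real \<Rightarrow> real \<Rightarrow> real" where
  "trunc e x y = max 0 (\<bar>x - y\<bar> - e)"

fun tvsum :: "real \<Rightarrow> (real \<Rightarrow> real) \<Rightarrow> real list \<Rightarrow> real" where
  "tvsum e f (u # v # us) = trunc e (f u) (f v) + tvsum e f (v # us)"
| "tvsum e f us = 0"

definition partitions :: "real \<Rightarrow> real list set" where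
  "partitions s = {us. sorted us \<and> set us \<subseteq> {0..s}}"

definition TV :: "real \<Rightarrow> (real \<Rightarrow> real) \<Rightarrow> real \<Rightarrow> real" where
  "TV e f s = (SUP us\<in>partitions s. tvsum e f us)"

lemma trunc_nonneg [simp]: "0 \<le> trunc e x y"
  by (simp add: trunc_def)

lemma trunc_same [simp]: "0 \<le> e \<Longrightarrow> trunc e x x = 0"
  by (simp add: trunc_def)

lemma tvsum_append:
  "us \<noteq> [] \<Longrightarrow> vs \<noteq> [] \<Longrightarrow>
    tvsum e f (us @ vs) = tvsum e f us + trunc e (f (last us)) (f (hd vs)) + tvsum e f vs"
proof (induction e f us rule: tvsum.induct)
  case ("2_2" e f v)
  then show ?case by (cases vs) auto
qed auto

lemma tvsum_cong: "(\<And>u. u \<in> set us \<Longrightarrow> f u = g u) \<Longrightarrow> tvsum e f us = tvsum e g us"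
  by (induction e f us rule: tvsum.induct) auto

text \<open>An error proportional to the step length telescopes along a partition, so the total
  error does not depend on the number of points. Both \<open>tvsum_bounded\<close> and
  \<open>TV_uniform_upper\<close> rest on this.\<close>

lemma tvsum_mono_pairs:
  assumes "\<And>u v. u \<in> set us \<Longrightarrow> v \<in> set us \<Longrightarrow> u \<le> v \<Longrightarrow>
      trunc e (f u) (f v) \<le> trunc e' (g u) (g v) + C * (v - u)"
    and "sorted us" "us \<noteq> []"
  shows "tvsum e f us \<le> tvsum e' g us + C * (last us - hd us)"
  using assms
proof (induction e f us rule: tvsum.induct)
  case (1 e f u v us)
  have "tvsum e f (v # us) \<le> tvsum e' g (v # us) + C * (last (v # us) - hd (v # us))"
    using 1 by (intro "1.IH") (auto simp del: last.simps)
  moreover have "trunc e (f u) (f v) \<le> trunc e' (g u) (g v) + C * (v - u)"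
    using 1 by auto
  ultimately show ?case by (auto simp: algebra_simps simp del: last.simps) (simp add: algebra_simps)
qed auto

lemma partitions_last_hd:
  assumes "us \<in> partitions s" "us \<noteq> []"
  shows "last us - hd us \<le> s"
proof -
  have "last us \<in> set us" "hd us \<in> set us" using assms by auto
  then have "last us \<in> {0..s}" "hd us \<in> {0..s}" using assms(1) unfolding partitions_def by blast+
  then show ?thesis by simp
qed

lemma uniform_modulus:
  fixes f :: "real \<Rightarrow> 'a::metric_space"
  assumes "continuous_on {0..1} f" "0 < e"
  obtains d where "0 < d" "\<And>u v. u \<in> {0..1} \<Longrightarrow> v \<in> {0..1} \<Longrightarrow> \<bar>u - v\<bar> < d \<Longrightarrow> dist (f u) (f v) < e"
proof -
  have "uniformly_continuous_on {0..1} f"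
    using assms compact_uniformly_continuous by blast
  then obtain d where "0 < d" "\<forall>u\<in>{0..1}. \<forall>v\<in>{0..1}. dist v u < d \<longrightarrow> dist (f v) (f u) < e"
    using assms(2) unfolding uniformly_continuous_on_def by blast
  then show ?thesis
    by (intro that[of d]) (auto simp: dist_real_def dist_commute)
qed

text \<open>By uniform continuity a step shorter than \<open>d\<close> moves \<open>f\<close> by
  less than \<open>e\<close> and is truncated away. A longer step contributes at most
  \<open>2 * M\<close>, which is at most \<open>C\<close> times its length, and the lengths add up
  to at most 1.\<close>

lemma tvsum_bounded:
  assumes "continuous_on {0..1} f" "0 < e"
  obtains B where "0 \<le> B" "\<And>us. us \<in> partitions 1 \<Longrightarrow> tvsum e f us \<le> B"
proof -
  obtain d where d: "0 < d" "\<And>u v. u \<in> {0..1} \<Longrightarrow> v \<in> {0..1} \<Longrightarrow> \<bar>u - v\<bar> < d \<Longrightarrow> dist (f u) (f v) < e"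
    using uniform_modulus[OF assms] by metis
  have "bounded (f ` {0..1})"
    using assms(1) compact_continuous_image compact_imp_bounded by blast
  then obtain M where M: "0 < M" "\<And>u. u \<in> {0..1} \<Longrightarrow> \<bar>f u\<bar> \<le> M"
    by (auto simp: bounded_pos)
  define C where "C = 2 * M / d"
  have C: "0 \<le> C" using M d by (simp add: C_def)
  have pair: "trunc e (f u) (f v) \<le> C * (v - u)" if "u \<in> {0..1}" "v \<in> {0..1}" "u \<le> v" for u v
  proof (cases "v - u < d")
    case True
    then have "dist (f u) (f v) < e" using d(2)[of u v] that by auto
    then have "trunc e (f u) (f v) = 0" by (simp add: trunc_def dist_real_def)
    then show ?thesis using C that by simp
  next
    case False
    have "trunc e (f u) (f v) \<le> 2 * M"
      using M(2)[OF that(1)] M(2)[OF that(2)] assms(2) M(1) unfolding trunc_def by linarith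
    also have "\<dots> = C * d" using d by (simp add: C_def)
    also have "\<dots> \<le> C * (v - u)" using False C by (intro mult_left_mono) auto
    finally show ?thesis .
  qed
  show ?thesis
  proof (rule that[OF C])
    fix us assume us: "us \<in> partitions 1"
    show "tvsum e f us \<le> C"
    proof (cases "us = []")
      case False
      \<comment> \<open>The zero function is a dummy for the comparison: only the linear error term
        survives.\<close>
      have "tvsum e f us \<le> tvsum 1 (\<lambda>_. 0) us + C * (last us - hd us)"
      proof (rule tvsum_mono_pairs)
        fix u v assume "u \<in> set us" "v \<in> set us" "u \<le> v"
        then show "trunc e (f u) (f v) \<le> trunc 1 ((\<lambda>_. 0) u) ((\<lambda>_. 0) v) + C * (v - u)"
          using pair[of u v] us by (auto simp: partitions_def subset_iff)
      qed (use us False in \<open>auto simp: partitions_def\<close>)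
      also have "tvsum 1 (\<lambda>_. 0) us = 0"
        by (induction "1::real" "\<lambda>_::real. 0::real" us rule: tvsum.induct) auto
      also have "C * (last us - hd us) \<le> C * 1"
        using us False C partitions_last_hd[OF us False] by (intro mult_left_mono) auto
      finally show ?thesis by simp
    qed (use C in auto)
  qed
qed

lemma partitions_mono: "s \<le> s' \<Longrightarrow> partitions s \<subseteq> partitions s'"
  by (auto simp: partitions_def)

lemma TV_bdd:
  assumes "continuous_on {0..1} f" "0 < e" "s \<le> 1"
  shows "bdd_above (tvsum e f ` partitions s)"
proof -
  obtain B where "\<And>us. us \<in> partitions 1 \<Longrightarrow> tvsum e f us \<le> B"
    using tvsum_bounded[OF assms(1,2)] by metis
  then show ?thesis
    using partitions_mono[OF assms(3)] by (intro bdd_aboveI[of _ B]) auto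
qed

lemma Nil_partitions [simp]: "[] \<in> partitions s"
  by (simp add: partitions_def)

lemma TV_upper:
  assumes "continuous_on {0..1} f" "0 < e" "s \<le> 1" "us \<in> partitions s"
  shows "tvsum e f us \<le> TV e f s"
  unfolding TV_def by (intro cSUP_upper assms TV_bdd)

lemma TV_least:
  assumes "\<And>us. us \<in> partitions s \<Longrightarrow> tvsum e f us \<le> B"
  shows "TV e f s \<le> B"
  unfolding TV_def using assms Nil_partitions by (intro cSUP_least) blast+

lemma TV_nonneg:
  assumes "continuous_on {0..1} f" "0 < e" "s \<le> 1"
  shows "0 \<le> TV e f s"
  using TV_upper[OF assms Nil_partitions] by simp

lemma tvsum_snoc_le: "tvsum e f us \<le> tvsum e f (us @ [s])"
  by (cases "us = []") (auto simp: tvsum_append)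

lemma tvsum_Cons_le: "tvsum e f us \<le> tvsum e f (s # us)"
  by (cases us) auto

text \<open>A partition of \<open>[0,s]\<close> can be continued by the points \<open>s\<close> and
  \<open>s'\<close>. Read backwards, where the variation hardly grows the function moves by little
  more than \<open>e\<close>; this drives \<open>equicontinuous_reparam\<close>.\<close>

lemma TV_step:
  assumes f: "continuous_on {0..1} f" and e: "0 < e" and s: "0 \<le> s" "s \<le> s'" "s' \<le> 1"
  shows "TV e f s + trunc e (f s) (f s') \<le> TV e f s'"
proof -
  have "TV e f s \<le> TV e f s' - trunc e (f s) (f s')"
  proof (rule TV_least)
    fix us assume us: "us \<in> partitions s"
    have "tvsum e f us + trunc e (f s) (f s') \<le> tvsum e f (us @ [s]) + trunc e (f s) (f s')"
      using tvsum_snoc_le by auto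
    also have "\<dots> = tvsum e f ((us @ [s]) @ [s'])"
      by (subst tvsum_append) auto
    also have "\<dots> \<le> TV e f s'"
      using us s by (intro TV_upper f e) (auto simp: partitions_def sorted_append)
    finally show "tvsum e f us \<le> TV e f s' - trunc e (f s) (f s')" by simp
  qed
  then show ?thesis by simp
qed

lemma TV_mono:
  assumes "continuous_on {0..1} f" "0 < e" "0 \<le> s" "s \<le> s'" "s' \<le> 1"
  shows "TV e f s \<le> TV e f s'"
  using TV_step[OF assms] trunc_nonneg[of e "f s" "f s'"] by linarith

lemma sorted_split_le:
  fixes us :: "real list"
  assumes "sorted us"
  shows "us = filter (\<lambda>u. u \<le> s) us @ filter (\<lambda>u. \<not> u \<le> s) us"
  using assms
proof (induction us)
  case (Cons a us)
  show ?case
  proof (cases "a \<le> s")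
    case False
    then have "filter (\<lambda>u. u \<le> s) us = []"
      using Cons.prems by (auto simp: filter_empty_conv)
    moreover have "filter (\<lambda>u. \<not> u \<le> s) us = us"
      using False Cons.prems by (auto simp: filter_id_conv)
    ultimately show ?thesis using False by simp
  qed (use Cons in auto)
qed auto

lemma sorted_split_less:
  fixes us :: "real list"
  assumes "sorted us"
  shows "us = filter (\<lambda>u. \<not> s \<le> u) us @ filter (\<lambda>u. s \<le> u) us"
  using assms
proof (induction us)
  case (Cons a us)
  show ?case
  proof (cases "s \<le> a")
    case True
    then have "filter (\<lambda>u. \<not> s \<le> u) us = []"
      using Cons.prems by (auto simp: filter_empty_conv)
    moreover have "filter (\<lambda>u. s \<le> u) us = us"
      using True Cons.prems by (auto simp: filter_id_conv)
    ultimately show ?thesis using True by simp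
  qed (use Cons in auto)
qed auto

lemma tvsum_small:
  assumes "\<And>u v. u \<in> set us \<Longrightarrow> v \<in> set us \<Longrightarrow> \<bar>f u - f v\<bar> \<le> e"
  shows "tvsum e f us = 0"
  using assms by (induction e f us rule: tvsum.induct) (auto simp: trunc_def)

lemma trunc_triangle: "trunc e x z \<le> trunc e x y + \<bar>y - z\<bar>"
  unfolding trunc_def by linarith

text \<open>All steps inside \<open>[s,s']\<close> are truncated away. The single step that jumps
  across \<open>s\<close> is compared with the step ending at \<open>s\<close> itself, at cost
  \<open>w\<close>.\<close>

lemma TV_extend:
  assumes f: "continuous_on {0..1} f" and e: "0 < e" and s: "0 \<le> s" "s \<le> s'" "s' \<le> 1"
    and w: "\<And>u v. u \<in> {s..s'} \<Longrightarrow> v \<in> {s..s'} \<Longrightarrow> \<bar>f u - f v\<bar> \<le> w" "w \<le> e"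
  shows "TV e f s' \<le> TV e f s + w"
proof (rule TV_least)
  fix us assume us: "us \<in> partitions s'"
  define L M where "L = filter (\<lambda>u. u \<le> s) us" and "M = filter (\<lambda>u. \<not> u \<le> s) us"
  have eq: "us = L @ M"
    using us sorted_split_le by (auto simp: L_def M_def partitions_def)
  have w0: "0 \<le> w" using w(1)[of s s] s by auto
  have M0: "tvsum e f M = 0"
  proof (rule tvsum_small)
    fix u v assume "u \<in> set M" "v \<in> set M"
    then have "\<bar>f u - f v\<bar> \<le> w"
      using us by (intro w) (auto simp: M_def partitions_def subset_iff)
    then show "\<bar>f u - f v\<bar> \<le> e" using w(2) by simp
  qed
  have Ls: "L @ [s] \<in> partitions s"
    using us s by (auto simp: L_def partitions_def sorted_append sorted_wrt_filter)
  consider "L = []" | "M = []" | "L \<noteq> []" "M \<noteq> []" by blast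
  then show "tvsum e f us \<le> TV e f s + w"
  proof cases
    case 1
    then show ?thesis using eq M0 TV_nonneg[OF f e, of s] s w0 by auto
  next
    case 2
    have "tvsum e f us \<le> tvsum e f (L @ [s])" using eq 2 tvsum_snoc_le by auto
    also have "\<dots> \<le> TV e f s" using Ls s by (intro TV_upper f e) auto
    finally show ?thesis using w0 by simp
  next
    case 3
    have hd: "hd M \<in> set M" using 3 by simp
    then have "\<bar>f s - f (hd M)\<bar> \<le> w"
      using us s by (intro w) (auto simp: M_def partitions_def subset_iff)
    then have "trunc e (f (last L)) (f (hd M)) \<le> trunc e (f (last L)) (f s) + w"
      using trunc_triangle[of e "f (last L)" "f (hd M)" "f s"] by linarith
    then have "tvsum e f us \<le> tvsum e f (L @ [s]) + w"
      using 3 M0 by (simp add: eq tvsum_append)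
    also have "tvsum e f (L @ [s]) \<le> TV e f s" using Ls s by (intro TV_upper f e) auto
    finally show ?thesis by simp
  qed
qed

lemma TV_continuous:
  assumes f: "continuous_on {0..1} f" and e: "0 < e"
  shows "continuous_on {0..1} (TV e f)"
proof (rule continuous_onI)
  fix s k :: real assume s: "s \<in> {0..1}" and k: "0 < k"
  define w where "w = min e (k/2)"
  have w: "0 < w" "w \<le> e" "w < k" using e k by (auto simp: w_def)
  obtain d where d: "0 < d" "\<And>u v. u \<in> {0..1} \<Longrightarrow> v \<in> {0..1} \<Longrightarrow> \<bar>u - v\<bar> < d \<Longrightarrow> dist (f u) (f v) < w"
    using uniform_modulus[OF f w(1)] by metis
  have main: "\<bar>TV e f a - TV e f b\<bar> \<le> w" if "0 \<le> a" "a \<le> b" "b \<le> 1" "b - a < d" for a b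
  proof -
    have "TV e f b \<le> TV e f a + w"
    proof (rule TV_extend[OF f e])
      fix u v assume "u \<in> {a..b}" "v \<in> {a..b}"
      then have "dist (f u) (f v) < w" using that by (intro d) auto
      then show "\<bar>f u - f v\<bar> \<le> w" by (simp add: dist_real_def)
    qed (use that w in auto)
    moreover have "TV e f a \<le> TV e f b" using that by (intro TV_mono f e) auto
    ultimately show ?thesis by simp
  qed
  show "\<exists>d>0. \<forall>x'\<in>{0..1}. dist x' s < d \<longrightarrow> dist (TV e f x') (TV e f s) \<le> k"
  proof (intro exI[of _ d] conjI ballI impI)
    fix x' assume x': "x' \<in> {0..1}" "dist x' s < d"
    show "dist (TV e f x') (TV e f s) \<le> k"
    proof (cases "x' \<le> s")
      case True
      then show ?thesis using main[of x' s] x' s w by (auto simp: dist_real_def)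
    next
      case False
      then show ?thesis using main[of s x'] x' s w by (auto simp: dist_real_def)
    qed
  qed (rule d)
qed

text \<open>Ordinary variation is only lower semicontinuous, since \<open>g\<close> may wiggle;
  truncation removes small wiggles. Steps shorter than \<open>d0\<close> contribute nothing for
  \<open>g\<close>, and there are about \<open>1 / d0\<close> longer ones at most, each gaining at
  most \<open>2 * d\<close>.\<close>

lemma TV_uniform_upper:
  assumes f: "continuous_on {0..1} f" and e: "0 < e" and k: "0 < k"
  obtains d where "0 < d" "\<And>g. (\<And>s. s \<in> {0..1} \<Longrightarrow> \<bar>f s - g s\<bar> \<le> d) \<Longrightarrow> TV e g 1 \<le> TV e f 1 + k"
proof -
  obtain d0 where d0: "0 < d0" "\<And>u v. u \<in> {0..1} \<Longrightarrow> v \<in> {0..1} \<Longrightarrow> \<bar>u - v\<bar> < d0 \<Longrightarrow> dist (f u) (f v) < e/2"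
    using uniform_modulus[OF f, of "e/2"] e by auto
  \<comment> \<open>The first bound gives \<open>e/2 + 2 * d \<le> e\<close> for the short steps,
    the second one \<open>2 * d / d0 \<le> k\<close> for the long ones.\<close>
  define d where "d = min (e/4) (k * d0 / 2)"
  have d: "0 < d" "4 * d \<le> e" "2 * d / d0 \<le> k" using e k d0 by (auto simp: d_def field_simps min_def)
  show ?thesis
  proof (rule that[OF d(1)])
    fix g assume g: "\<And>s. s \<in> {0..1} \<Longrightarrow> \<bar>f s - g s\<bar> \<le> d"
    have pair: "trunc e (g u) (g v) \<le> trunc e (f u) (f v) + (2*d/d0) * (v - u)"
      if "u \<in> {0..1}" "v \<in> {0..1}" "u \<le> v" for u v
    proof (cases "v - u < d0")
      case True
      then have "\<bar>f u - f v\<bar> < e/2" using d0(2)[of u v] that by (auto simp: dist_real_def)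
      then have "\<bar>g u - g v\<bar> \<le> e" using g[of u] g[of v] that d by linarith
      then show ?thesis using that d d0 by (simp add: trunc_def)
    next
      case False
      have "trunc e (g u) (g v) \<le> trunc e (f u) (f v) + 2 * d"
        using g[of u] g[of v] that unfolding trunc_def by linarith
      also have "2 * d = (2*d/d0) * d0" using d0 by simp
      also have "\<dots> \<le> (2*d/d0) * (v - u)" using False d d0 by (intro mult_left_mono) auto
      finally show ?thesis by simp
    qed
    show "TV e g 1 \<le> TV e f 1 + k"
    proof (rule TV_least)
      fix us assume us: "us \<in> partitions 1"
      show "tvsum e g us \<le> TV e f 1 + k"
      proof (cases "us = []")
        case True
        then show ?thesis using TV_nonneg[OF f e, of 1] k by simp
      next
        case False
        have "tvsum e g us \<le> tvsum e f us + (2*d/d0) * (last us - hd us)"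
        proof (rule tvsum_mono_pairs)
          fix u v assume "u \<in> set us" "v \<in> set us" "u \<le> v"
          then show "trunc e (g u) (g v) \<le> trunc e (f u) (f v) + (2*d/d0) * (v - u)"
            using pair[of u v] us by (auto simp: partitions_def subset_iff)
        qed (use us False in \<open>auto simp: partitions_def\<close>)
        also have "tvsum e f us \<le> TV e f 1" using us by (intro TV_upper f e) auto
        also have "(2*d/d0) * (last us - hd us) \<le> (2*d/d0) * 1"
          using us False d d0 partitions_last_hd[OF us False] by (intro mult_left_mono) auto
        finally show ?thesis using d by simp
      qed
    qed
  qed
qed

lemma tvsum_uniform:
  assumes "\<And>s. s \<in> set us \<Longrightarrow> \<bar>f s - g s\<bar> \<le> d" "0 \<le> d"
  shows "tvsum e f us \<le> tvsum e g us + 2 * d * length us"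
  using assms
proof (induction e f us rule: tvsum.induct)
  case (1 e f u v us)
  have "tvsum e f (v # us) \<le> tvsum e g (v # us) + 2 * d * length (v # us)"
    using 1 by (intro "1.IH") auto
  moreover have "trunc e (f u) (f v) \<le> trunc e (g u) (g v) + 2 * d"
    using "1.prems"(1)[of u] "1.prems"(1)[of v] unfolding trunc_def by auto
  ultimately show ?case by (simp add: algebra_simps)
qed auto

text \<open>One partition that almost attains the supremum has finitely many points and therefore
  sees only a small change of the function.\<close>

lemma TV_uniform_lower:
  assumes f: "continuous_on {0..1} f" and e: "0 < e" and k: "0 < k"
  obtains d where "0 < d" "\<And>g. continuous_on {0..1} g \<Longrightarrow> (\<And>s. s \<in> {0..1} \<Longrightarrow> \<bar>f s - g s\<bar> \<le> d) \<Longrightarrow> TV e f 1 - k \<le> TV e g 1"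
proof -
  have "\<exists>us\<in>partitions 1. TV e f 1 - k/2 < tvsum e f us"
  proof (rule ccontr)
    assume "\<not> ?thesis"
    then have "TV e f 1 \<le> TV e f 1 - k/2" by (intro TV_least) force
    then show False using k by simp
  qed
  then obtain us where us: "us \<in> partitions 1" "TV e f 1 - k/2 < tvsum e f us" by blast
  define d where "d = k / (4 * (length us + 1))"
  have d: "0 < d" using k by (simp add: d_def)
  have dl: "2 * d * length us \<le> k/2" using k by (simp add: d_def field_simps)
  show ?thesis
  proof (rule that[OF d])
    fix g assume g: "continuous_on {0..1} g" "\<And>s. s \<in> {0..1} \<Longrightarrow> \<bar>f s - g s\<bar> \<le> d"
    have "tvsum e f us \<le> tvsum e g us + 2 * d * length us"
      using us g d by (intro tvsum_uniform) (auto simp: partitions_def subset_iff)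
    also have "tvsum e g us \<le> TV e g 1" using us by (intro TV_upper g e) auto
    finally show "TV e f 1 - k \<le> TV e g 1" using us dl by linarith
  qed
qed

lemma TV_reparam_le:
  assumes f: "continuous_on {0..1} f" and e: "0 < e"
    and h: "mono_on {0..1} h" "h ` {0..1} \<subseteq> {0..1}"
  shows "TV e (\<lambda>s. f (h s)) 1 \<le> TV e f 1"
proof (rule TV_least)
  fix us assume us: "us \<in> partitions 1"
  have "tvsum e (\<lambda>s. f (h s)) us = tvsum e f (map h us)"
    by (induction e "\<lambda>s. f (h s)" us rule: tvsum.induct) auto
  also have "\<dots> \<le> TV e f 1"
  proof (rule TV_upper[OF f e])
    have "sorted (map h us)"
      using us h(1) unfolding partitions_def mono_on_def sorted_map
      by (auto intro!: sorted_wrt_mono_rel[of us "(\<le>)"] simp: subset_iff)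
    then show "map h us \<in> partitions 1"
      using us h(2) by (auto simp: partitions_def)
  qed auto
  finally show "tvsum e (\<lambda>s. f (h s)) us \<le> TV e f 1" .
qed

text \<open>The map \<open>h\<close> may be constant on intervals, so in general it has no inverse.
  Any selection \<open>r\<close> with \<open>h (r s) = s\<close> is monotone, and that is enough for
  the converse inequality.\<close>

lemma TV_reparam:
  assumes f: "continuous_on {0..1} f" and e: "0 < e"
    and h: "mono_on {0..1} h" "h ` {0..1} = {0..1}" "continuous_on {0..1} h"
  shows "TV e (\<lambda>s. f (h s)) 1 = TV e f 1"
proof (rule antisym)
  show "TV e (\<lambda>s. f (h s)) 1 \<le> TV e f 1"
    using h by (intro TV_reparam_le f e) auto
  define r where "r = inv_into {0..1::real} h"
  have r: "r s \<in> {0..1}" "h (r s) = s" if "s \<in> {0..1}" for s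
    using that h(2) inv_into_into[of s h "{0..1}"] f_inv_into_f[of s h "{0..1}"] by (auto simp: r_def)
  have rm: "mono_on {0..1} r"
  proof (rule mono_onI)
    fix a b :: real assume ab: "a \<in> {0..1}" "b \<in> {0..1}" "a \<le> b"
    show "r a \<le> r b"
    proof (rule ccontr)
      assume "\<not> r a \<le> r b"
      then have "h (r b) \<le> h (r a)" using mono_onD[OF h(1) r(1)[OF ab(2)] r(1)[OF ab(1)]] by simp
      then have "a = b" using r(2)[OF ab(1)] r(2)[OF ab(2)] ab(3) by simp
      then show False using \<open>\<not> r a \<le> r b\<close> by simp
    qed
  qed
  have fh: "continuous_on {0..1} (\<lambda>s. f (h s))"
    using continuous_on_compose2[OF f h(3)] h(2) by auto
  have "TV e (\<lambda>s. (\<lambda>s. f (h s)) (r s)) 1 \<le> TV e (\<lambda>s. f (h s)) 1"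
    using rm r by (intro TV_reparam_le fh e) auto
  moreover have "TV e (\<lambda>s. f (h (r s))) 1 = TV e f 1"
    unfolding TV_def using r by (intro SUP_cong refl tvsum_cong) (auto simp: partitions_def subset_iff)
  ultimately show "TV e f 1 \<le> TV e (\<lambda>s. f (h s)) 1" by simp
qed


section \<open>Replacing a function by its chord on an interval\<close>

definition affine_patch :: "(real \<Rightarrow> real) \<Rightarrow> real \<Rightarrow> real \<Rightarrow> real \<Rightarrow> real" where
  "affine_patch f a b s = (if a \<le> s \<and> s \<le> b then (1 - (s - a) / (b - a)) * f a + (s - a) / (b - a) * f b else f s)"

lemma trunc_commute: "trunc e x y = trunc e y x"
  by (simp add: trunc_def abs_minus_commute)

lemma trunc_convex:
  assumes "0 \<le> w" "w \<le> 1"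
  shows "trunc e l ((1 - w) * A + w * B) \<le> (1 - w) * trunc e l A + w * trunc e l B"
proof -
  have *: "l - ((1 - w) * A + w * B) = (1 - w) * (l - A) + w * (l - B)" by (simp add: algebra_simps)
  have "\<bar>l - ((1 - w) * A + w * B)\<bar> \<le> \<bar>(1 - w) * (l - A)\<bar> + \<bar>w * (l - B)\<bar>"
    unfolding * by (rule abs_triangle_ineq)
  also have "\<dots> = (1 - w) * \<bar>l - A\<bar> + w * \<bar>l - B\<bar>"
    using assms by (simp add: abs_mult)
  finally have "\<bar>l - ((1 - w) * A + w * B)\<bar> - e \<le> (1 - w) * (\<bar>l - A\<bar> - e) + w * (\<bar>l - B\<bar> - e)"
    by (simp add: algebra_simps)
  also have "\<dots> \<le> (1 - w) * trunc e l A + w * trunc e l B"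
    using assms by (intro add_mono mult_left_mono) (auto simp: trunc_def)
  finally show ?thesis
    using assms by (auto simp: trunc_def)
qed

text \<open>As a function of its middle point the two-step sum is convex, so it is largest at an end
  of any segment containing that point. This is how points on a chord are moved to its ends.\<close>

lemma trunc_pair_max:
  assumes "0 \<le> w" "w \<le> 1" "y = (1 - w) * A + w * B"
  shows "trunc e l y + trunc e y r \<le> max (trunc e l A + trunc e A r) (trunc e l B + trunc e B r)"
proof -
  let ?S = "\<lambda>y. trunc e l y + trunc e y r"
  have "?S y \<le> (1 - w) * ?S A + w * ?S B"
    using trunc_convex[OF assms(1,2), of e l A B] trunc_convex[OF assms(1,2), of e r A B]
    by (simp add: assms(3) trunc_commute[of e _ r] algebra_simps)
  also have "\<dots> \<le> (1 - w) * max (?S A) (?S B) + w * max (?S A) (?S B)"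
    using assms by (intro add_mono mult_left_mono) auto
  also have "\<dots> = max (?S A) (?S B)" by (simp add: algebra_simps)
  finally show ?thesis .
qed

text \<open>The steps of an affine function all go the same way, so their sizes add up while each is
  truncated separately; merging them into one step can only gain.\<close>

lemma tvsum_affine:
  assumes "\<And>u v. u \<in> set us \<Longrightarrow> v \<in> set us \<Longrightarrow> f v - f u = k * (v - u)" "sorted us" "us \<noteq> []" "0 \<le> e"
  shows "tvsum e f us \<le> trunc e (f (hd us)) (f (last us))"
proof -
  have "tvsum e f us \<le> max 0 (\<bar>k\<bar> * (last us - hd us) - e)"
    using assms
  proof (induction e f us rule: tvsum.induct)
    case (1 e f u v us)
    have IH: "tvsum e f (v # us) \<le> max 0 (\<bar>k\<bar> * (last (v # us) - hd (v # us)) - e)"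
      using 1 by (intro "1.IH") (auto simp del: last.simps)
    have "last (v # us) \<in> set (v # us)" by (rule last_in_set) simp
    then have le: "v \<le> last (v # us)" "u \<le> v"
      using "1.prems"(2) by (auto simp del: last.simps)
    have eq: "f v - f u = k * (v - u)" using "1.prems"(1)[of u v] by simp
    have "\<bar>f u - f v\<bar> = \<bar>f v - f u\<bar>" by simp
    also have "\<dots> = \<bar>k\<bar> * (v - u)" using le unfolding eq by (simp add: abs_mult)
    finally have "trunc e (f u) (f v) = max 0 (\<bar>k\<bar> * (v - u) - e)" by (simp add: trunc_def)
    moreover have "0 \<le> \<bar>k\<bar> * (v - u)" "0 \<le> \<bar>k\<bar> * (last (v # us) - v)"
      "\<bar>k\<bar> * (last (v # us) - u) = \<bar>k\<bar> * (v - u) + \<bar>k\<bar> * (last (v # us) - v)"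
      using le by (simp_all del: last.simps) (simp add: algebra_simps)
    ultimately show ?case using IH \<open>0 \<le> e\<close> by (simp del: last.simps) (auto simp: max_def split: if_splits)
  qed auto
  moreover have "\<bar>f (hd us) - f (last us)\<bar> = \<bar>k\<bar> * (last us - hd us)"
  proof -
    have "hd us \<le> last us" using assms(2,3) by (cases us) auto
    moreover have "f (last us) - f (hd us) = k * (last us - hd us)" using assms by auto
    moreover have "\<bar>f (hd us) - f (last us)\<bar> = \<bar>f (last us) - f (hd us)\<bar>" by simp
    ultimately show ?thesis by (simp add: abs_mult)
  qed
  ultimately show ?thesis by (simp add: trunc_def)
qed

text \<open>By \<open>tvsum_affine\<close> only the first and the last inner point matter. Convexity
  moves the first one to \<open>a\<close> or onto the last one, and afterwards the last one to
  \<open>a\<close> or \<open>b\<close>. This leaves the three patterns \<open>a\<close>,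
  \<open>b\<close> and \<open>a, b\<close> on the right.\<close>

lemma tvsum_patch_cases:
  assumes ab: "a < b" and e: "0 \<le> e" and M: "sorted M" "set M \<subseteq> {a<..<b}" "M \<noteq> []"
    and g: "g = affine_patch f a b"
  shows "trunc e l (g (hd M)) + tvsum e g M + trunc e (g (last M)) r \<le>
    max (max (trunc e l (f a) + trunc e (f a) r) (trunc e l (f b) + trunc e (f b) r))
        (trunc e l (f a) + trunc e (f a) (f b) + trunc e (f b) r)"
proof -
  define w where "w = (\<lambda>s. (s - a) / (b - a))"
  have gM: "g s = (1 - w s) * f a + w s * f b" if "s \<in> set M" for s
    using that M g by (auto simp: affine_patch_def w_def)
  have w01: "0 < w s \<and> w s < 1" if "s \<in> set M" for s
    using that M ab by (auto simp: w_def field_simps)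
  have hl: "hd M \<in> set M" "last M \<in> set M" using M by auto
  have hle: "hd M \<le> last M" using M(1,3) by (cases M) auto
  then have wle: "w (hd M) \<le> w (last M)" using ab by (auto simp: w_def divide_right_mono)
  have "tvsum e g M \<le> trunc e (g (hd M)) (g (last M))"
  proof (rule tvsum_affine[where k = "(f b - f a) / (b - a)"])
    fix u v assume "u \<in> set M" "v \<in> set M"
    then have "g v - g u = (w v - w u) * (f b - f a)" by (simp add: gM algebra_simps)
    also have "w v - w u = (v - u) / (b - a)" by (simp add: w_def diff_divide_distrib[symmetric])
    finally show "g v - g u = (f b - f a) / (b - a) * (v - u)" by simp
  qed (use M e in auto)
  moreover have "trunc e l (g (hd M)) + trunc e (g (hd M)) (g (last M)) \<le>
      max (trunc e l (f a) + trunc e (f a) (g (last M))) (trunc e l (g (last M)) + trunc e (g (last M)) (g (last M)))"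
  proof (rule trunc_pair_max)
    \<comment> \<open>In this ratio the value at \<open>hd M\<close> divides the chord from
      \<open>f a\<close> to the value at \<open>last M\<close>.\<close>
    let ?q = "w (hd M) / w (last M)"
    show "0 \<le> ?q" "?q \<le> 1" using w01[OF hl(1)] w01[OF hl(2)] wle by auto
    have "?q * w (last M) = w (hd M)" using w01[OF hl(2)] by simp
    moreover have "(1 - ?q) * f a + ?q * g (last M) = f a + ?q * w (last M) * (f b - f a)"
      by (simp add: gM[OF hl(2)] algebra_simps)
    ultimately show "g (hd M) = (1 - ?q) * f a + ?q * g (last M)"
      by (simp add: gM[OF hl(1)] algebra_simps)
  qed
  moreover have "trunc e (f a) (g (last M)) + trunc e (g (last M)) r \<le>
      max (trunc e (f a) (f a) + trunc e (f a) r) (trunc e (f a) (f b) + trunc e (f b) r)"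
    using w01[OF hl(2)] by (intro trunc_pair_max[where w = "w (last M)"]) (auto simp: gM[OF hl(2)])
  moreover have "trunc e l (g (last M)) + trunc e (g (last M)) r \<le>
      max (trunc e l (f a) + trunc e (f a) r) (trunc e l (f b) + trunc e (f b) r)"
    using w01[OF hl(2)] by (intro trunc_pair_max[where w = "w (last M)"]) (auto simp: gM[OF hl(2)])
  ultimately show ?thesis using e by simp
qed

text \<open>The inner points of a partition are traded for the points \<open>a\<close> and
  \<open>b\<close>, where the patch agrees with \<open>f\<close>. The variation of the patch is
  thereby bounded by a sum formed with \<open>f\<close> itself.\<close>

lemma tvsum_patch_le:
  assumes f: "continuous_on {0..1} f" and e: "0 < e" and ab: "0 \<le> a" "a < b" "b \<le> 1"
    and us: "us \<in> partitions 1"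
    and g: "g = affine_patch f a b"
  obtains L R X where "L \<noteq> []" "R \<noteq> []" "sorted L" "sorted R" "set L \<subseteq> {0..a}" "set R \<subseteq> {b..1}"
    "X \<in> {[], [a], [b], [a,b]}" "tvsum e g us \<le> tvsum e f (L @ X @ R)"
proof -
  \<comment> \<open>Adding 0 and 1 cannot lower the sum and makes both outer parts nonempty.\<close>
  define vs where "vs = 0 # us @ [1]"
  have vs: "sorted vs" "set vs \<subseteq> {0..1}"
    using us by (auto simp: vs_def partitions_def sorted_append)
  have le: "tvsum e g us \<le> tvsum e g vs"
    unfolding vs_def by (metis order_trans tvsum_Cons_le tvsum_snoc_le)
  define L V where "L = filter (\<lambda>u. u \<le> a) vs" and "V = filter (\<lambda>u. \<not> u \<le> a) vs"
  define M R where "M = filter (\<lambda>u. \<not> b \<le> u) V" and "R = filter (\<lambda>u. b \<le> u) V"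
  have vsLV: "vs = L @ V" using sorted_split_le[OF vs(1)] by (simp add: L_def V_def)
  have sV: "sorted V" using vs(1) by (simp add: V_def sorted_wrt_filter)
  have VMR: "V = M @ R" using sorted_split_less[OF sV] by (simp add: M_def R_def)
  have Lne: "L \<noteq> []" using ab by (auto simp: L_def vs_def)
  have Rne: "R \<noteq> []" using ab by (auto simp: R_def V_def vs_def filter_empty_conv)
  have sL: "sorted L" "set L \<subseteq> {0..a}" using vs by (auto simp: L_def sorted_wrt_filter)
  have sR: "sorted R" "set R \<subseteq> {b..1}" using vs sV by (auto simp: R_def sorted_wrt_filter) (auto simp: V_def)
  have sM: "sorted M" "set M \<subseteq> {a<..<b}" using vs sV by (auto simp: M_def sorted_wrt_filter) (auto simp: V_def)
  have ga: "g u = f u" if "u \<le> a \<or> b \<le> u" for u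
    using that ab by (cases "u = a"; cases "u = b") (auto simp: g affine_patch_def)
  have gL: "tvsum e g L = tvsum e f L" using sL ga by (intro tvsum_cong) auto
  have gR: "tvsum e g R = tvsum e f R" using sR ga by (intro tvsum_cong) auto
  have lL: "g (last L) = f (last L)" using subsetD[OF sL(2) last_in_set[OF Lne]] by (intro ga) auto
  have hR: "g (hd R) = f (hd R)" using subsetD[OF sR(2) hd_in_set[OF Rne]] by (intro ga) auto
  show ?thesis
  proof (cases "M = []")
    case True
    have "tvsum e g us \<le> tvsum e f (L @ [] @ R)"
      using le Lne Rne gL gR lL hR True by (simp add: vsLV VMR tvsum_append)
    then show ?thesis using that Lne Rne sL sR by blast
  next
    case False
    let ?l = "f (last L)" and ?r = "f (hd R)"
    have "tvsum e g us \<le> tvsum e f L + (trunc e ?l (g (hd M)) + tvsum e g M + trunc e (g (last M)) ?r) + tvsum e f R"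
      using le Lne Rne gL gR lL hR False by (simp add: vsLV VMR tvsum_append)
    moreover note tvsum_patch_cases[OF ab(2) _ sM False g, of e ?l ?r]
    moreover have "tvsum e f (L @ [a] @ R) = tvsum e f L + (trunc e ?l (f a) + trunc e (f a) ?r) + tvsum e f R"
      using Lne Rne by (cases R) (simp_all add: tvsum_append)
    moreover have "tvsum e f (L @ [b] @ R) = tvsum e f L + (trunc e ?l (f b) + trunc e (f b) ?r) + tvsum e f R"
      using Lne Rne by (cases R) (simp_all add: tvsum_append)
    moreover have "tvsum e f (L @ [a,b] @ R) = tvsum e f L + (trunc e ?l (f a) + trunc e (f a) (f b) + trunc e (f b) ?r) + tvsum e f R"
      using Lne Rne by (cases R) (simp_all add: tvsum_append)
    ultimately have "tvsum e g us \<le> max (max (tvsum e f (L @ [a] @ R)) (tvsum e f (L @ [b] @ R))) (tvsum e f (L @ [a,b] @ R))"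
      using e by (simp add: max_def split: if_splits)
    then consider "tvsum e g us \<le> tvsum e f (L @ [a] @ R)" | "tvsum e g us \<le> tvsum e f (L @ [b] @ R)" |
      "tvsum e g us \<le> tvsum e f (L @ [a,b] @ R)" by linarith
    then show ?thesis using that Lne Rne sL sR by cases blast+
  qed
qed

lemma TV_patch_le:
  assumes f: "continuous_on {0..1} f" and e: "0 < e" and ab: "0 \<le> a" "a < b" "b \<le> 1"
  shows "TV e (affine_patch f a b) 1 \<le> TV e f 1"
proof (rule TV_least)
  fix us assume us: "us \<in> partitions 1"
  obtain L R X where LR: "L \<noteq> []" "R \<noteq> []" "sorted L" "sorted R" "set L \<subseteq> {0..a}" "set R \<subseteq> {b..1}"
    "X \<in> {[], [a], [b], [a,b]}" "tvsum e (affine_patch f a b) us \<le> tvsum e f (L @ X @ R)"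
    using tvsum_patch_le[OF assms us refl] by metis
  have "L @ X @ R \<in> partitions 1"
    using LR(3-7) ab by (fastforce simp: partitions_def sorted_append)
  then have "tvsum e f (L @ X @ R) \<le> TV e f 1" by (intro TV_upper f e) auto
  then show "tvsum e (affine_patch f a b) us \<le> TV e f 1" using LR by linarith
qed

text \<open>The patch sees at most the steps through \<open>f a\<close> and \<open>f b\<close>,
  whereas \<open>f\<close> itself may pass through \<open>a\<close>, \<open>s1\<close>,
  \<open>s2\<close>, \<open>s3\<close> and \<open>b\<close>. By the triangle inequality this gains
  the backtracking \<open>2 * d\<close>, and each of the six steps from \<open>last L\<close> to
  \<open>hd R\<close> loses at most \<open>e\<close> by truncation.\<close>

lemma TV_patch_drop:
  assumes f: "continuous_on {0..1} f" and e: "0 < e" and ab: "0 \<le> a" "a < b" "b \<le> 1"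
    and s: "a \<le> s1" "s1 \<le> s2" "s2 \<le> s3" "s3 \<le> b"
    and d: "\<bar>f s1 - f s2\<bar> + \<bar>f s2 - f s3\<bar> \<ge> \<bar>f s1 - f s3\<bar> + 2 * d"
  shows "TV e (affine_patch f a b) 1 \<le> TV e f 1 - (2 * d - 6 * e)"
proof (rule TV_least)
  fix us assume us: "us \<in> partitions 1"
  obtain L R X where LR: "L \<noteq> []" "R \<noteq> []" "sorted L" "sorted R" "set L \<subseteq> {0..a}" "set R \<subseteq> {b..1}"
    "X \<in> {[], [a], [b], [a,b]}" "tvsum e (affine_patch f a b) us \<le> tvsum e f (L @ X @ R)"
    using tvsum_patch_le[OF f e ab us refl] by metis
  let ?l = "f (last L)" and ?r = "f (hd R)"
  have X: "tvsum e f (L @ X @ R) \<le> tvsum e f L + (\<bar>?l - f a\<bar> + \<bar>f a - f b\<bar> + \<bar>f b - ?r\<bar>) + tvsum e f R"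
    using LR(1,2,7) e by (cases R) (auto simp: tvsum_append trunc_def)
  let ?Y = "[a, s1, s2, s3, b]"
  have "L @ ?Y @ R \<in> partitions 1"
    using LR(3-6) ab s by (fastforce simp: partitions_def sorted_append)
  then have "tvsum e f (L @ ?Y @ R) \<le> TV e f 1" by (intro TV_upper f e) auto
  moreover have "tvsum e f (L @ ?Y @ R) \<ge> tvsum e f L + (\<bar>?l - f a\<bar> + \<bar>f a - f s1\<bar> + \<bar>f s1 - f s2\<bar> + \<bar>f s2 - f s3\<bar> + \<bar>f s3 - f b\<bar> + \<bar>f b - ?r\<bar> - 6 * e) + tvsum e f R"
  proof -
    have "tvsum e f (L @ ?Y @ R) = tvsum e f L + (trunc e ?l (f a) + trunc e (f a) (f s1) + trunc e (f s1) (f s2)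
        + trunc e (f s2) (f s3) + trunc e (f s3) (f b) + trunc e (f b) ?r) + tvsum e f R"
      using LR(1,2) by (cases R) (auto simp: tvsum_append)
    moreover have "\<bar>x - y\<bar> - e \<le> trunc e x y" for x y by (simp add: trunc_def)
    note this[of ?l "f a"] this[of "f a" "f s1"] this[of "f s1" "f s2"] this[of "f s2" "f s3"] this[of "f s3" "f b"] this[of "f b" ?r]
    ultimately show ?thesis by linarith
  qed
  ultimately show "tvsum e (affine_patch f a b) us \<le> TV e f 1 - (2 * d - 6 * e)"
    using LR(8) X d by linarith
qed

lemma inner_straighten:
  "u \<bullet> straighten lam a b s = affine_patch (\<lambda>s. u \<bullet> lam s) a b s"
  by (simp add: straighten_def affine_patch_def linepath_def inner_add_right inner_scaleR_right)

section \<open>Level sets in the unit square\<close>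

abbreviation sq :: "(real \<times> real) set" where "sq \<equiv> {0..1} \<times> {0..1}"

lemma sq_convex: "convex sq" and sq_compact: "compact sq" and sq_closed: "closed sq"
  by (auto intro!: convex_Times compact_Times closed_Times)

lemma interior_sq: "interior sq = {0<..<1} \<times> {0<..<1}"
  by (simp add: interior_Times)

lemma frontier_sq_iff: "z \<in> frontier sq \<longleftrightarrow> z \<in> sq \<and> (fst z = 0 \<or> fst z = 1 \<or> snd z = 0 \<or> snd z = 1)"
  by (cases z) (auto simp: frontier_def interior_sq sq_closed)

text \<open>Let \<open>V\<close> be the component of \<open>U - C\<close> that contains
  \<open>y\<close>. The closure of \<open>V\<close> and the set \<open>U - V\<close> are both
  connected and cover \<open>U\<close>, so their intersection \<open>G\<close>, the frontier of
  \<open>V\<close> in \<open>U\<close>, is connected because convex sets are unicoherent. On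
  \<open>G\<close> the value is exactly \<open>v\<close>: near a point of smaller value a whole
  neighbourhood would belong to \<open>C\<close> and keep \<open>V\<close> away.\<close>

lemma level_separation:
  fixes f :: "'a::euclidean_space \<Rightarrow> real"
  assumes U: "convex U" "compact U" and f: "continuous_on U f"
    and x: "x \<in> U" "f x \<le> v" and y: "y \<in> U"
    and C: "C = connected_component_set {z\<in>U. f z \<le> v} x" and yC: "y \<notin> C"
  obtains G where "compact G" "connected G" "G \<subseteq> C" "\<And>z. z \<in> G \<Longrightarrow> f z = v"
    "\<And>\<Gamma>. connected \<Gamma> \<Longrightarrow> \<Gamma> \<subseteq> U \<Longrightarrow> y \<in> \<Gamma> \<Longrightarrow> \<Gamma> \<inter> C \<noteq> {} \<Longrightarrow> \<Gamma> \<inter> G \<noteq> {}"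
proof -
  let ?Y = "{z\<in>U. f z \<le> v}"
  have clU: "closed U" using U compact_imp_closed by blast
  have "closed ?Y"
    using f clU continuous_closed_preimage[OF f clU, of "{..v}"] by (auto simp: vimage_def Int_def)
  moreover have "?Y = U \<inter> ?Y" by auto
  ultimately have "compact ?Y" using compact_Int_closed[OF U(2), of ?Y] by metis
  moreover have xY: "x \<in> ?Y" using x by simp
  ultimately have cC: "compact C"
    unfolding C by (intro compact_components[OF _ componentsI])
  have conC: "connected C" by (simp add: C)
  have xC: "x \<in> C" unfolding C using xY connected_component_refl[of x ?Y] by blast
  have CY: "C \<subseteq> ?Y" unfolding C by (rule connected_component_subset)
  define V where "V = connected_component_set (U - C) y"
  have yU: "y \<in> U - C" using y yC by simp
  have Vcomp: "V \<in> components (U - C)" using yU unfolding V_def by (rule componentsI)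
  have yV: "y \<in> V" using yU by (simp add: V_def connected_component_refl_eq)
  have VU: "V \<subseteq> U - C" unfolding V_def by (rule connected_component_subset)
  have conV: "connected V" by (simp add: V_def)
  have opUC: "openin (top_of_set U) (U - C)"
    using openin_open_Int[of "- C" U] cC compact_imp_closed[OF cC] by (simp add: Diff_eq open_Compl)
  have locU: "locally connected U" using U(1) convex_imp_locally_connected by blast
  have opV: "openin (top_of_set U) V"
    using openin_components_locally_connected[OF locally_open_subset[OF locU opUC] Vcomp] opUC openin_trans by blast
  define T where "T = U - V"
  have conT: "connected T"
    unfolding T_def using component_diff_connected[OF conC convex_connected[OF U(1)] _ Vcomp] CY by auto
  obtain W where W: "open W" "V = U \<inter> W" using opV unfolding openin_open by blast
  have "T = U - W" using W by (auto simp: T_def)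
  then have clT: "closed T" using clU W(1) by (simp add: closed_Diff)
  define S where "S = closure V"
  have SU: "S \<subseteq> U" unfolding S_def using VU clU by (intro closure_minimal) auto
  have conS: "connected S" unfolding S_def using conV by (rule connected_imp_connected_closure)
  have "S \<union> T = U" using SU closure_subset[of V] VU by (auto simp: S_def T_def)
  moreover have "closedin (top_of_set U) S" "closedin (top_of_set U) T"
    using SU clT by (auto simp: S_def T_def intro!: closed_subset)
  ultimately have conG: "connected (S \<inter> T)"
    using convex_imp_unicoherent[OF U(1), unfolded unicoherent_def, rule_format, of S T] conS conT by simp
  define G where "G = S \<inter> T"
  have cG: "compact G"
  proof -
    have "G = U \<inter> (S \<inter> T)" using SU by (auto simp: G_def)
    then show ?thesis using compact_Int_closed[OF U(2), of "S \<inter> T"] clT by (simp add: S_def closed_Int)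
  qed
  \<comment> \<open>A point of the closure of \<open>V\<close> outside \<open>C\<close> could be
    added to \<open>V\<close>, against the maximality of a component.\<close>
  have GC: "G \<subseteq> C"
  proof
    fix z assume z: "z \<in> G"
    show "z \<in> C"
    proof (rule ccontr)
      assume "z \<notin> C"
      have "connected (insert z V)"
        using connected_intermediate_closure[OF conV, of "insert z V"] z closure_subset[of V]
        by (auto simp: G_def S_def)
      moreover have "insert z V \<subseteq> U - C" using \<open>z \<notin> C\<close> VU z by (auto simp: G_def T_def)
      ultimately have "insert z V \<subseteq> V"
        using connected_component_maximal[of y "insert z V" "U - C"] yV by (simp add: V_def)
      then show False using z by (auto simp: G_def T_def)
    qed
  qed
  have fG: "f z = v" if z: "z \<in> G" for z
  proof (rule ccontr)
    assume "f z \<noteq> v"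
    then have lt: "f z < v" using z GC CY by force
    have zU: "z \<in> U" using z by (auto simp: G_def T_def)
    obtain d where d: "d > 0" "\<And>z'. z' \<in> U \<Longrightarrow> dist z' z < d \<Longrightarrow> dist (f z') (f z) < v - f z"
      using f[unfolded continuous_on_iff, rule_format, OF zU, of "v - f z"] lt by auto
    have "connected (ball z d \<inter> U)"
      using U(1) by (intro convex_connected convex_Int) auto
    moreover have "ball z d \<inter> U \<subseteq> ?Y"
    proof
      fix z' assume z': "z' \<in> ball z d \<inter> U"
      then have "dist (f z') (f z) < v - f z" by (intro d) (auto simp: dist_commute)
      then show "z' \<in> ?Y" using z' by (auto simp: dist_real_def)
    qed
    moreover have "z \<in> ball z d \<inter> U" using zU d by simp
    ultimately have "ball z d \<inter> U \<subseteq> connected_component_set ?Y z"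
      by (intro connected_component_maximal)
    also have "\<dots> = C" unfolding C using connected_component_eq[of z ?Y x] subsetD[OF GC z] C by simp
    finally have "ball z d \<inter> U \<inter> V = {}" using VU by auto
    moreover obtain z' where "z' \<in> V" "dist z' z < d"
      using z d(1) unfolding G_def S_def by (meson IntD1 closure_approachable)
    then have "z' \<in> ball z d \<inter> V" by (simp add: dist_commute)
    ultimately show False using VU by auto
  qed
  have hit: "\<Gamma> \<inter> G \<noteq> {}" if "connected \<Gamma>" "\<Gamma> \<subseteq> U" "y \<in> \<Gamma>" "\<Gamma> \<inter> C \<noteq> {}" for \<Gamma>
  proof
    assume "\<Gamma> \<inter> G = {}"
    moreover have "closed S" "closed T" using clT by (auto simp: S_def)
    moreover have "\<Gamma> \<subseteq> S \<union> T" using that \<open>S \<union> T = U\<close> by simp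
    moreover have "S \<inter> \<Gamma> \<noteq> {}" using that yV closure_subset by (auto simp: S_def)
    moreover have "T \<inter> \<Gamma> \<noteq> {}" using that VU CY by (auto simp: T_def)
    ultimately show False using connected_closedD[OF that(1), of S T] by (auto simp: G_def)
  qed
  show ?thesis
  proof (rule that)
    show "connected G" using conG by (simp add: G_def)
  qed (fact cG GC fG hit)+
qed

lemma connected_frontier_sq: "connected (frontier sq)"
proof (rule connected_frontier_simple)
  show "connected sq" using sq_convex convex_connected by blast
  show "connected (- sq)"
    using sq_convex sq_compact compact_imp_bounded by (intro connected_complement_bounded_convex) auto
qed

section \<open>Folding maps of the square into half-planes\<close>

lemma ortho_expand:
  assumes "norm (u::complex) = 1"
  shows "z = (u \<bullet> z) *\<^sub>R u + ((\<i> * u) \<bullet> z) *\<^sub>R (\<i> * u)"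
proof -
  have "Re u * Re u + Im u * Im u = 1"
    using assms by (metis cmod_power2 one_power2 power2_eq_square)
  then show ?thesis
    unfolding complex_eq_iff inner_complex_def
    by simp algebra
qed

lemma ortho_norm_le:
  assumes "norm (u::complex) = 1"
  shows "norm z \<le> \<bar>u \<bullet> z\<bar> + \<bar>(\<i> * u) \<bullet> z\<bar>"
proof -
  have "norm z \<le> norm ((u \<bullet> z) *\<^sub>R u) + norm (((\<i> * u) \<bullet> z) *\<^sub>R (\<i> * u))"
    by (subst ortho_expand[OF assms]) (rule norm_triangle_ineq)
  then show ?thesis using assms by (simp add: norm_mult)
qed

text \<open>The set \<open>E\<close> is the part of the region below level \<open>c\<close> that is
  attached to the boundary of the square. The frontier of each hole \<open>V y\<close> of
  \<open>E\<close> is connected and lies on level \<open>c\<close>, so \<open>R\<close> maps it onto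
  a segment of the line \<open>u \<bullet> w = c\<close>. The hole is filled by clamping the
  tangential coordinate \<open>psi\<close> to this segment. All new values are old values on the
  frontier of a hole; hence folding never leaves a set that contained the image of the
  interior.\<close>

lemma fold_halfplane:
  fixes R :: "real \<times> real \<Rightarrow> complex"
  assumes u: "norm (u::complex) = 1" and R: "continuous_on sq R"
    and bd: "\<And>z. z \<in> frontier sq \<Longrightarrow> u \<bullet> R z < c"
  obtains R' where "continuous_on sq R'" "\<And>z. z \<in> frontier sq \<Longrightarrow> R' z = R z"
    "\<And>z. z \<in> sq \<Longrightarrow> u \<bullet> R' z \<le> c" "R' ` interior sq \<subseteq> R ` interior sq"
proof -
  let ?Y = "{z\<in>sq. u \<bullet> R z \<le> c}"
  define psi where "psi = (\<lambda>z. (\<i> * u) \<bullet> R z)"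
  define E where "E = connected_component_set ?Y (0,0)"
  have fr0: "(0,0) \<in> frontier sq" by (simp add: frontier_sq_iff)
  have frsq: "frontier sq \<subseteq> sq" using frontier_sq_iff by blast
  have frY: "frontier sq \<subseteq> ?Y" using bd frsq by (auto simp: less_imp_le)
  have frE: "frontier sq \<subseteq> E"
    unfolding E_def by (rule connected_component_maximal[OF fr0 connected_frontier_sq frY])
  have contu: "continuous_on sq (\<lambda>z. u \<bullet> R z)" using R by (intro continuous_intros)
  have contpsi: "continuous_on sq psi" unfolding psi_def using R by (intro continuous_intros)
  have "closed ?Y"
    using continuous_closed_preimage[OF contu sq_closed, of "{..c}"] by (auto simp: vimage_def Int_def)
  then have "closed E" unfolding E_def using closed_connected_component by blast
  have conE: "connected E" by (simp add: E_def)
  have EY: "E \<subseteq> ?Y" unfolding E_def by (rule connected_component_subset)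
  define V where "V = (\<lambda>y. connected_component_set (- E) y)"
  have V: "open (V y)" "y \<in> V y" "V y \<subseteq> interior sq" "connected (V y)" "V y \<inter> E = {}"
    "connected (frontier (V y))" "frontier (V y) \<subseteq> E" "frontier (V y) \<noteq> {}" "compact (frontier (V y))"
    "frontier (V y) \<subseteq> interior sq"
    "\<And>z. z \<in> frontier (V y) \<Longrightarrow> u \<bullet> R z = c" if y: "y \<in> sq - E" for y
  proof -
    have Vc: "V y \<in> components (- E)" using y unfolding V_def by (intro componentsI) auto
    show o: "open (V y)" unfolding V_def using \<open>closed E\<close> by (intro open_connected_component) auto
    show yV: "y \<in> V y" using y by (simp add: V_def connected_component_refl_eq)
    show conV: "connected (V y)" by (simp add: V_def)
    show VE: "V y \<inter> E = {}" using connected_component_subset[of "- E" y] by (auto simp: V_def)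
    have "V y \<subseteq> sq"
    proof (rule ccontr)
      assume "\<not> V y \<subseteq> sq"
      then have "V y \<inter> frontier sq \<noteq> {}"
        using conV yV y by (intro connected_Int_frontier) auto
      then show False using VE frE by auto
    qed
    then show Vi: "V y \<subseteq> interior sq" using o interior_maximal by blast
    show "connected (frontier (V y))" using conE Vc by (rule connected_frontier_component_complement)
    show fE: "frontier (V y) \<subseteq> E"
      using frontier_of_connected_component_subset[of "- E" y] \<open>closed E\<close>
      frontier_subset_closed[of E] by (auto simp: V_def frontier_complement)
    have bV: "bounded (V y)" using \<open>V y \<subseteq> sq\<close> sq_compact bounded_subset compact_imp_bounded by blast
    then show "frontier (V y) \<noteq> {}" using yV frontier_eq_empty[of "V y"] not_bounded_UNIV by auto
    show "compact (frontier (V y))" using bV compact_frontier_bounded by blast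
    show fc: "u \<bullet> R z = c" if z: "z \<in> frontier (V y)" for z
    proof (rule ccontr)
      assume ne: "u \<bullet> R z \<noteq> c"
      have zE: "z \<in> E" using z fE by auto
      then have lt: "u \<bullet> R z < c" and zs: "z \<in> sq" using EY ne by auto
      obtain d where d: "d > 0" "\<And>z'. z' \<in> sq \<Longrightarrow> dist z' z < d \<Longrightarrow> dist (u \<bullet> R z') (u \<bullet> R z) < c - u \<bullet> R z"
        using contu[unfolded continuous_on_iff, rule_format, OF zs, of "c - u \<bullet> R z"] lt by auto
      have "connected (ball z d \<inter> sq)" using sq_convex by (intro convex_connected convex_Int) auto
      moreover have "ball z d \<inter> sq \<subseteq> ?Y"
      proof
        fix z' assume z': "z' \<in> ball z d \<inter> sq"
        then have "dist (u \<bullet> R z') (u \<bullet> R z) < c - u \<bullet> R z" by (intro d) (auto simp: dist_commute)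
        then show "z' \<in> ?Y" using z' by (auto simp: dist_real_def)
      qed
      moreover have "z \<in> ball z d \<inter> sq" using zs d by simp
      ultimately have "ball z d \<inter> sq \<subseteq> connected_component_set ?Y z"
        by (intro connected_component_maximal)
      also have "\<dots> = E" using zE connected_component_eq[of z ?Y "(0,0)"] by (simp add: E_def)
      finally have "ball z d \<inter> V y = {}" using VE \<open>V y \<subseteq> sq\<close> by auto
      moreover obtain z' where "z' \<in> V y" "dist z' z < d"
        using z d(1) unfolding frontier_def by (meson DiffD1 closure_approachable)
      then have "z' \<in> ball z d \<inter> V y" by (simp add: dist_commute)
      ultimately show False by blast
    qed
    show "frontier (V y) \<subseteq> interior sq"
    proof
      fix z assume z: "z \<in> frontier (V y)"
      then have "z \<notin> frontier sq" using fc[OF z] bd[of z] by auto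
      moreover have "z \<in> sq" using z fE EY by auto
      ultimately show "z \<in> interior sq" by (simp add: frontier_def sq_closed)
    qed
  qed
  define lo hi where "lo = (\<lambda>y. Inf (psi ` frontier (V y)))" and "hi = (\<lambda>y. Sup (psi ` frontier (V y)))"
  have lohi: "psi ` frontier (V y) = {lo y..hi y} \<and> lo y \<le> hi y" if y: "y \<in> sq - E" for y
  proof -
    have "frontier (V y) \<subseteq> sq" using V(10)[OF y] interior_subset by blast
    then have cp: "continuous_on (frontier (V y)) psi" using contpsi continuous_on_subset by blast
    have "connected (psi ` frontier (V y))" "compact (psi ` frontier (V y))"
      using cp V(6,9)[OF y] by (auto intro: connected_continuous_image compact_continuous_image)
    then obtain a b where ab: "psi ` frontier (V y) = {a..b}"
      using connected_compact_interval_1 by metis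
    moreover have "a \<le> b" using ab V(8)[OF y] by (metis atLeastatMost_empty_iff image_is_empty)
    ultimately show ?thesis by (simp add: lo_def hi_def)
  qed
  define R' where "R' = (\<lambda>y. if y \<in> E then R y else c *\<^sub>R u + max (lo y) (min (hi y) (psi y)) *\<^sub>R (\<i> * u))"
  have uu: "u \<bullet> u = 1" "u \<bullet> (\<i> * u) = 0" "(\<i> * u) \<bullet> (\<i> * u) = 1" "(\<i> * u) \<bullet> u = 0"
    using u by (auto simp: dot_square_norm norm_mult inner_complex_def)
  have R'V: "\<exists>z\<in>frontier (V y). R' y = R z" if y: "y \<in> sq - E" for y
  proof -
    have "max (lo y) (min (hi y) (psi y)) \<in> psi ` frontier (V y)"
      using lohi[OF y] by auto
    then obtain z where z: "z \<in> frontier (V y)" "psi z = max (lo y) (min (hi y) (psi y))" by force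
    have "R z = (u \<bullet> R z) *\<^sub>R u + psi z *\<^sub>R (\<i> * u)" unfolding psi_def by (rule ortho_expand[OF u])
    then have "R' y = R z" using y z V(11)[OF y z(1)] by (simp add: R'_def)
    then show ?thesis using z by blast
  qed
  have cont: "continuous_on sq R'"
  proof (rule continuous_onI)
    fix y0 e assume y0: "y0 \<in> sq" and e: "(0::real) < e"
    show "\<exists>d>0. \<forall>y\<in>sq. dist y y0 < d \<longrightarrow> dist (R' y) (R' y0) \<le> e"
    proof (cases "y0 \<in> E")
      case False
      then have y0E: "y0 \<in> sq - E" using y0 by simp
      obtain d1 where d1: "d1 > 0" "ball y0 d1 \<subseteq> V y0"
        using V(1,2)[OF y0E] open_contains_ball by blast
      define k where "k = (\<lambda>y. c *\<^sub>R u + max (lo y0) (min (hi y0) (psi y)) *\<^sub>R (\<i> * u))"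
      have "continuous_on sq k" unfolding k_def using contpsi by (intro continuous_intros)
      then obtain d2 where d2: "d2 > 0" "\<And>y. y \<in> sq \<Longrightarrow> dist y y0 < d2 \<Longrightarrow> dist (k y) (k y0) < e"
        unfolding continuous_on_iff using y0 e by blast
      have eq: "R' y = k y" if y: "y \<in> V y0" for y
      proof -
        have "V y = V y0" using y connected_component_eq[of y "- E" y0] by (simp add: V_def)
        moreover have "y \<notin> E" using y V(5)[OF y0E] by auto
        ultimately show ?thesis by (simp add: R'_def k_def lo_def hi_def)
      qed
      show ?thesis
      proof (intro exI[of _ "min d1 d2"] conjI ballI impI)
        fix y assume y: "y \<in> sq" "dist y y0 < min d1 d2"
        then have "y \<in> V y0" using d1 by (auto simp: dist_commute)
        then show "dist (R' y) (R' y0) \<le> e"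
          using eq[of y] eq[OF V(2)[OF y0E]] d2(2)[of y] y by auto
      qed (use d1 d2 in auto)
    next
      case True
      obtain d where d: "d > 0" "\<And>y. y \<in> sq \<Longrightarrow> dist y y0 < d \<Longrightarrow> dist (R y) (R y0) < e/4"
        using R[unfolded continuous_on_iff, rule_format, OF y0, of "e/4"] e by auto
      show ?thesis
      proof (intro exI[of _ d] conjI ballI impI)
        fix y assume y: "y \<in> sq" "dist y y0 < d"
        show "dist (R' y) (R' y0) \<le> e"
        proof (cases "y \<in> E")
          case yE: True
          then show ?thesis using True d(2)[OF y] e by (simp add: R'_def)
        next
          case yE: False
          then have yE': "y \<in> sq - E" using y by simp
          \<comment> \<open>On the way to \<open>y0\<close> the hole is left at a point
            \<open>z\<close> of its frontier, which is still close to \<open>y0\<close>. There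
            \<open>psi\<close> lies between \<open>lo y\<close> and \<open>hi y\<close>, so clamping
            moves \<open>psi y\<close> by at most its distance from \<open>psi z\<close>.\<close>
          have "closed_segment y y0 \<inter> frontier (V y) \<noteq> {}"
          proof (rule connected_Int_frontier)
            show "closed_segment y y0 \<inter> V y \<noteq> {}" using V(2)[OF yE'] by auto
            show "closed_segment y y0 - V y \<noteq> {}" using V(5)[OF yE'] True by auto
          qed auto
          then obtain z where z: "z \<in> closed_segment y y0" "z \<in> frontier (V y)" by blast
          have zs: "z \<in> sq" using z y y0 sq_convex by (meson closed_segment_subset subsetD)
          have zd: "dist z y0 < d"
            using z(1) y(2) by (metis dist_in_closed_segment dist_commute le_less_trans)
          have zc: "u \<bullet> R z = c" using V(11)[OF yE' z(2)] .
          have zp: "psi z \<in> {lo y..hi y}" using lohi[OF yE'] z(2) by blast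
          let ?t = "max (lo y) (min (hi y) (psi y))"
          have t: "\<bar>?t - psi y\<bar> \<le> \<bar>psi z - psi y\<bar>" using zp by (auto simp: max_def min_def)
          have norms: "\<bar>v \<bullet> a - v \<bullet> b\<bar> \<le> dist a b" if "norm v = 1" for v a b :: complex
            using Cauchy_Schwarz_ineq2[of v "a - b"] that by (simp add: inner_diff_right dist_norm)
          have iu: "norm (\<i> * u) = 1" using u by (simp add: norm_mult)
          have "R' y - R y0 = c *\<^sub>R u + ?t *\<^sub>R (\<i> * u) - R y0" using yE by (simp add: R'_def)
          then have "u \<bullet> (R' y - R y0) = c - u \<bullet> R y0" "(\<i> * u) \<bullet> (R' y - R y0) = ?t - psi y0"
            using uu by (simp_all add: inner_diff_right inner_add_right psi_def)
          then have "norm (R' y - R y0) \<le> \<bar>c - u \<bullet> R y0\<bar> + \<bar>?t - psi y0\<bar>"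
            using ortho_norm_le[OF u, of "R' y - R y0"] by simp
          also have "\<bar>c - u \<bullet> R y0\<bar> \<le> dist (R z) (R y0)" using norms[OF u, of "R z" "R y0"] zc by simp
          also have "\<bar>?t - psi y0\<bar> \<le> \<bar>psi z - psi y\<bar> + \<bar>psi y - psi y0\<bar>" using t by linarith
          also have "\<bar>psi z - psi y\<bar> \<le> dist (R z) (R y)" unfolding psi_def by (rule norms[OF iu])
          also have "\<bar>psi y - psi y0\<bar> \<le> dist (R y) (R y0)" unfolding psi_def by (rule norms[OF iu])
          finally have "norm (R' y - R y0) \<le> dist (R z) (R y0) + (dist (R z) (R y) + dist (R y) (R y0))" by simp
          also have "dist (R z) (R y) \<le> dist (R z) (R y0) + dist (R y) (R y0)"
            by (metis dist_triangle2)
          finally show ?thesis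
            using d(2)[OF zs zd] d(2)[OF y] True by (simp add: R'_def dist_norm)
        qed
      qed (rule d)
    qed
  qed
  show ?thesis
  proof (rule that[OF cont])
    show "R' z = R z" if "z \<in> frontier sq" for z using that frE by (auto simp: R'_def)
    show "u \<bullet> R' z \<le> c" if z: "z \<in> sq" for z
    proof (cases "z \<in> E")
      case True then show ?thesis using EY by (auto simp: R'_def)
    next
      case False then show ?thesis using uu by (simp add: R'_def inner_add_right)
    qed
    show "R' ` interior sq \<subseteq> R ` interior sq"
    proof
      fix w assume "w \<in> R' ` interior sq"
      then obtain y where y: "y \<in> interior sq" "w = R' y" by blast
      show "w \<in> R ` interior sq"
      proof (cases "y \<in> E")
        case True then show ?thesis using y by (simp add: R'_def)
      next
        case False
        then have "y \<in> sq - E" using y interior_subset by blast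
        then show ?thesis using R'V V(10) y by blast
      qed
    qed
  qed
qed

section \<open>Homotopies of paths with fixed endpoints\<close>

text \<open>Both ends are treated alike, which makes being joined by such a homotopy symmetric and
  transitive. The one-sided version suited to the closed class is \<open>cc_hom\<close>.\<close>

definition epe_hom :: "complex set \<Rightarrow> complex \<Rightarrow> complex \<Rightarrow> (real \<Rightarrow> complex) \<Rightarrow> (real \<Rightarrow> complex) \<Rightarrow> (real \<times> real \<Rightarrow> complex) \<Rightarrow> bool" where
  "epe_hom \<Omega> p q g g' H \<longleftrightarrow> continuous_on sq H \<and> (\<forall>s\<in>{0..1}. H (s,0) = g s \<and> H (s,1) = g' s) \<and>
     (\<forall>t\<in>{0..1}. H (0,t) = p \<and> H (1,t) = q) \<and> (\<forall>s\<in>{0<..<1}. \<forall>t\<in>{0..1}. H (s,t) \<in> \<Omega>)"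

definition tpaste :: "(real \<times> real \<Rightarrow> 'a) \<Rightarrow> (real \<times> real \<Rightarrow> 'a) \<Rightarrow> real \<times> real \<Rightarrow> 'a" where
  "tpaste H K = (\<lambda>(s,t). if t \<le> 1/2 then H (s, 2*t) else K (s, 2*t - 1))"

definition trev :: "(real \<times> real \<Rightarrow> 'a) \<Rightarrow> real \<times> real \<Rightarrow> 'a" where
  "trev H = (\<lambda>(s,t). H (s, 1 - t))"

lemma epe_homD:
  assumes "epe_hom \<Omega> p q g g' H"
  shows "continuous_on sq H" "\<And>s. s \<in> {0..1} \<Longrightarrow> H (s,0) = g s" "\<And>s. s \<in> {0..1} \<Longrightarrow> H (s,1) = g' s"
    "\<And>t. t \<in> {0..1} \<Longrightarrow> H (0,t) = p" "\<And>t. t \<in> {0..1} \<Longrightarrow> H (1,t) = q"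
    "\<And>s t. 0 < s \<Longrightarrow> s < 1 \<Longrightarrow> t \<in> {0..1} \<Longrightarrow> H (s,t) \<in> \<Omega>"
  using assms unfolding epe_hom_def by auto

lemma epe_homI:
  assumes "continuous_on sq H" "\<And>s. s \<in> {0..1} \<Longrightarrow> H (s,0) = g s" "\<And>s. s \<in> {0..1} \<Longrightarrow> H (s,1) = g' s"
    "\<And>t. t \<in> {0..1} \<Longrightarrow> H (0,t) = p" "\<And>t. t \<in> {0..1} \<Longrightarrow> H (1,t) = q"
    "\<And>s t. 0 < s \<Longrightarrow> s < 1 \<Longrightarrow> t \<in> {0..1} \<Longrightarrow> H (s,t) \<in> \<Omega>"
  shows "epe_hom \<Omega> p q g g' H"
  using assms unfolding epe_hom_def by auto

lemma continuous_slice: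
  assumes "continuous_on sq H" "t \<in> {0..1}"
  shows "continuous_on {0..1} (\<lambda>s. H (s,t))"
  using assms by (intro continuous_on_compose2[OF assms(1)] continuous_intros) auto

lemma epe_slice:
  assumes "epe_hom \<Omega> p q g g' H" "t \<in> {0..1}"
  shows "epe_path \<Omega> p q (\<lambda>s. H (s,t))"
  using epe_homD[OF assms(1)] assms(2) continuous_slice[OF epe_homD(1)[OF assms(1)] assms(2)]
  by (auto simp: epe_path_def path_def pathstart_def pathfinish_def)

lemma epe_hom_refl:
  assumes "epe_path \<Omega> p q g"
  shows "epe_hom \<Omega> p q g g (\<lambda>(s,t). g s)"
proof (rule epe_homI)
  have "continuous_on {0..1} g" using assms by (simp add: epe_path_def path_def)
  then show "continuous_on sq (\<lambda>(s, t). g s)"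
    unfolding case_prod_unfold by (rule continuous_on_compose2) (auto intro!: continuous_intros)
qed (use assms in \<open>auto simp: epe_path_def pathstart_def pathfinish_def\<close>)

lemma epe_hom_sym:
  assumes "epe_hom \<Omega> p q g g' H"
  shows "epe_hom \<Omega> p q g' g (trev H)"
proof (rule epe_homI)
  show "continuous_on sq (trev H)"
    unfolding trev_def case_prod_unfold
    by (intro continuous_on_compose2[OF epe_homD(1)[OF assms]] continuous_intros) auto
qed (use epe_homD[OF assms] in \<open>auto simp: trev_def\<close>)

lemma continuous_tpaste:
  fixes H K :: "real \<times> real \<Rightarrow> 'a::topological_space"
  assumes "continuous_on sq H" "continuous_on sq K" "\<And>s. s \<in> {0..1} \<Longrightarrow> H (s,1) = K (s,0)"
  shows "continuous_on sq (tpaste H K)"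
proof -
  have "continuous_on sq (\<lambda>z. if snd z \<le> 1/2 then H (fst z, 2 * snd z) else K (fst z, 2 * snd z - 1))"
  proof (rule continuous_on_cases_le)
    show "continuous_on {z \<in> sq. snd z \<le> 1/2} (\<lambda>z. H (fst z, 2 * snd z))"
      by (intro continuous_on_compose2[OF assms(1)] continuous_intros) auto
    show "continuous_on {z \<in> sq. 1/2 \<le> snd z} (\<lambda>z. K (fst z, 2 * snd z - 1))"
      by (intro continuous_on_compose2[OF assms(2)] continuous_intros) auto
    fix z :: "real \<times> real" assume "z \<in> sq" "snd z = 1/2"
    then have e: "2 * snd z = 1" "fst z \<in> {0..1}" by (auto simp: mem_Times_iff)
    show "H (fst z, 2 * snd z) = K (fst z, 2 * snd z - 1)" using assms(3)[OF e(2)] by (simp add: e(1))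
  qed (intro continuous_intros)
  then show ?thesis by (simp add: tpaste_def case_prod_unfold)
qed

lemma epe_hom_trans:
  assumes H: "epe_hom \<Omega> p q g g' H" and K: "epe_hom \<Omega> p q g' g'' K"
  shows "epe_hom \<Omega> p q g g'' (tpaste H K)"
proof (rule epe_homI)
  show "continuous_on sq (tpaste H K)"
    using epe_homD[OF H] epe_homD[OF K] by (intro continuous_tpaste) auto
qed (use epe_homD[OF H] epe_homD[OF K] in \<open>auto simp: tpaste_def\<close>)

definition epeh :: "complex set \<Rightarrow> complex \<Rightarrow> complex \<Rightarrow> (real \<Rightarrow> complex) \<Rightarrow> (real \<Rightarrow> complex) \<Rightarrow> bool" where
  "epeh \<Omega> p q g g' \<longleftrightarrow> (\<exists>H. epe_hom \<Omega> p q g g' H)"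

lemma epeh_refl: "epe_path \<Omega> p q g \<Longrightarrow> epeh \<Omega> p q g g"
  unfolding epeh_def by (blast intro: epe_hom_refl)

lemma epeh_sym: "epeh \<Omega> p q g g' \<Longrightarrow> epeh \<Omega> p q g' g"
  unfolding epeh_def by (blast intro: epe_hom_sym)

lemma epeh_trans: "epeh \<Omega> p q g g' \<Longrightarrow> epeh \<Omega> p q g' g'' \<Longrightarrow> epeh \<Omega> p q g g''"
  unfolding epeh_def by (blast intro: epe_hom_trans)

lemma epeh_path: "epeh \<Omega> p q g g' \<Longrightarrow> epe_path \<Omega> p q g'"
proof -
  assume "epeh \<Omega> p q g g'"
  then obtain H where H: "epe_hom \<Omega> p q g g' H" by (auto simp: epeh_def)
  have "epe_path \<Omega> p q (\<lambda>s. H (s,1))" using epe_slice[OF H] by auto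
  moreover have "continuous_on {0..1} g' \<longleftrightarrow> continuous_on {0..1} (\<lambda>s. H (s,1))"
    using epe_homD(3)[OF H] by (intro continuous_on_cong) auto
  ultimately show ?thesis
    using epe_homD(3)[OF H] by (auto simp: epe_path_def path_def pathstart_def pathfinish_def)
qed

lemma epeh_cont: "epeh \<Omega> p q g g' \<Longrightarrow> continuous_on {0..1} g'"
  using epeh_path by (auto simp: epe_path_def path_def)

lemma cc_obtain:
  assumes "lam \<in> closure_class \<Omega> p q \<gamma>"
  obtains h where "continuous_on sq h" "\<And>s. s \<in> {0..1} \<Longrightarrow> h (s,0) = \<gamma> s" "\<And>s. s \<in> {0..1} \<Longrightarrow> h (s,1) = lam s"
    "\<And>t. t \<in> {0..1} \<Longrightarrow> h (0,t) = p" "\<And>t. t \<in> {0..1} \<Longrightarrow> h (1,t) = q"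
    "\<And>s t. 0 < s \<Longrightarrow> s < 1 \<Longrightarrow> 0 \<le> t \<Longrightarrow> t < 1 \<Longrightarrow> h (s,t) \<in> \<Omega>"
proof -
  obtain h where h: "continuous_on sq h" "\<forall>s\<in>{0..1}. h (s, 0) = \<gamma> s" "\<forall>s\<in>{0..1}. h (s, 1) = lam s"
    "\<forall>t\<in>{0..<1}. epe_path \<Omega> p q (\<lambda>s. h (s, t))"
    using assms unfolding closure_class_def by blast
  have e: "h (0,t) = p" "h (1,t) = q" if "t \<in> {0..<1}" for t
    using h(4) that by (auto simp: epe_path_def pathstart_def pathfinish_def)
  have c: "continuous_on {0..1} (\<lambda>t. h (s,t))" if "s \<in> {0..1}" for s
    using that by (intro continuous_on_compose2[OF h(1)] continuous_intros) auto
  have cl: "(1::real) \<in> closure {0..<1}" by simp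
  \<comment> \<open>The definition of the class fixes the endpoints only for t < 1; continuity
    carries this to t = 1.\<close>
  have *: "h (s,1) = w" if "s \<in> {0..1}" "\<And>t. t \<in> {0..<1} \<Longrightarrow> h (s,t) = w" for s w
  proof -
    have "\<And>t. t \<in> closure {0..<1::real} \<Longrightarrow> h (s,t) = w"
      by (rule continuous_constant_on_closure[of "{0..<1}"]) (use c[OF that(1)] that(2) in auto)
    then show ?thesis using cl by blast
  qed
  have "h (0,t) = p" "h (1,t) = q" if "t \<in> {0..1}" for t
    using that e *[of 0 p] *[of 1 q] by (cases "t = 1"; auto)+
  then show ?thesis
    using that[of h] h by (auto simp: epe_path_def)
qed

text \<open>The image \<open>I\<close> of \<open>D\<close> is a connected subset of a line, hence
  convex, and some neighbourhood \<open>B\<close> of it is convex, open and inside \<Omega>. The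
  preimage of \<open>B\<close> is relatively open and contains the connected set \<open>D\<close>,
  so \<open>x\<close> and \<open>y\<close> are joined in it by a path \<open>g0\<close>; the detour
  is made because \<open>D\<close> may fail to be path connected. In the convex set \<open>S\<close>
  the path \<open>g\<close> deforms to \<open>g0\<close>, and in the convex set \<open>B\<close> the
  image of \<open>g0\<close> deforms to the segment.\<close>

lemma leaf:
  assumes \<Omega>: "open \<Omega>" and S: "convex S" and H: "continuous_on S H" "H ` S \<subseteq> \<Omega>"
    and D: "compact D" "connected D" "D \<subseteq> S" and u: "norm (u::complex) = 1" and v: "\<And>z. z \<in> D \<Longrightarrow> u \<bullet> H z = v"
    and xy: "x \<in> D" "y \<in> D" and g: "path g" "path_image g \<subseteq> S" "pathstart g = x" "pathfinish g = (y::'a::euclidean_space)"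
  shows "homotopic_paths \<Omega> (H \<circ> g) (linepath (H x) (H y))"
proof -
  define I where "I = H ` D"
  have HD: "continuous_on D H" using H(1) D(3) continuous_on_subset by blast
  have cI: "compact I" "connected I"
    unfolding I_def using HD D by (auto intro: compact_continuous_image connected_continuous_image)
  have I\<Omega>: "I \<subseteq> \<Omega>" using H(2) D(3) by (auto simp: I_def)
  have Iv: "u \<bullet> z = v" if "z \<in> I" for z using that v by (auto simp: I_def)
  have "convex I"
  proof (rule convexI)
    fix a b :: complex and m n :: real assume ab: "a \<in> I" "b \<in> I" and mn: "0 \<le> m" "0 \<le> n" "m + n = 1"
    let ?z = "m *\<^sub>R a + n *\<^sub>R b" and ?psi = "\<lambda>z. (\<i> * u) \<bullet> z"
    have "connected (?psi ` I)" using cI(2) by (intro connected_continuous_image continuous_intros)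
    then have "is_interval (?psi ` I)" using is_interval_connected_1 by blast
    then have cv: "convex (?psi ` I)" using is_interval_convex by blast
    have "m *\<^sub>R ?psi a + n *\<^sub>R ?psi b \<in> ?psi ` I"
      using ab mn by (intro convexD[OF cv]) auto
    then obtain z where z: "z \<in> I" "?psi z = ?psi ?z"
      by (auto simp: inner_add_right inner_scaleR_right)
    have "u \<bullet> ?z = (m + n) * v" using Iv[OF ab(1)] Iv[OF ab(2)] by (simp add: inner_add_right algebra_simps)
    then have "u \<bullet> ?z = u \<bullet> z" using Iv[OF z(1)] mn by simp
    then have "?z = z" using ortho_expand[OF u, of ?z] ortho_expand[OF u, of z] z(2) by simp
    then show "?z \<in> I" using z by simp
  qed
  obtain e where e: "e > 0" "(\<Union>x\<in>I. ball x e) \<subseteq> \<Omega>"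
    using compact_subset_open_imp_ball_epsilon_subset[OF cI(1) \<Omega> I\<Omega>] by blast
  \<comment> \<open>As a Minkowski sum the set is visibly convex; as a union of balls it is visibly
    open.\<close>
  define B where "B = (\<Union>x\<in>I. \<Union>y\<in>ball 0 e. {x + y})"
  have "convex B" unfolding B_def using \<open>convex I\<close> by (intro convex_sums) auto
  have Beq: "B = (\<Union>x\<in>I. ball x e)"
  proof -
    have "(\<Union>y\<in>ball 0 e. {x + y}) = ball x e" for x :: complex
    proof -
      have "w \<in> ball x e \<Longrightarrow> w \<in> (\<Union>y\<in>ball 0 e. {x + y})" for w
        by (intro UN_I[of "w - x"]) (auto simp: dist_norm norm_minus_commute)
      then show ?thesis by (auto simp: dist_norm)
    qed
    then show ?thesis by (simp add: B_def)
  qed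
  have "open B" unfolding Beq by blast
  have B\<Omega>: "B \<subseteq> \<Omega>" using e(2) Beq by simp
  have IB: "I \<subseteq> B" using e(1) by (auto simp: Beq)
  define W where "W = {z \<in> S. H z \<in> B}"
  have opW: "openin (top_of_set S) W"
    unfolding W_def using continuous_openin_preimage_gen[OF H(1) \<open>open B\<close>] by (simp add: vimage_def Int_def)
  have DW: "D \<subseteq> W" using D(3) IB by (auto simp: W_def I_def)
  have "locally path_connected W"
    using locally_open_subset[OF convex_imp_locally_path_connected[OF S] opW] .
  then have eqc: "path_component_set W x = connected_component_set W x"
    using path_component_eq_connected_component_set by blast
  have "D \<subseteq> connected_component_set W x"
    using connected_component_maximal[OF xy(1) D(2) DW] .
  then have "path_component W x y" using xy(2) eqc by auto
  then obtain g0 where g0: "path g0" "path_image g0 \<subseteq> W" "pathstart g0 = x" "pathfinish g0 = y"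
    unfolding path_component_def by blast
  have WS: "W \<subseteq> S" by (auto simp: W_def)
  have "homotopic_paths S g g0"
    using convex_imp_simply_connected[OF S] g g0 WS unfolding simply_connected_eq_homotopic_paths by auto
  then have 1: "homotopic_paths \<Omega> (H \<circ> g) (H \<circ> g0)"
    using H by (intro homotopic_paths_continuous_image) auto
  have pH: "path (H \<circ> g0)" using g0 WS H(1) by (meson continuous_on_subset path_continuous_image order_trans)
  have iH: "path_image (H \<circ> g0) \<subseteq> B" using g0(2) by (auto simp: path_image_def W_def)
  have xB: "H x \<in> B" "H y \<in> B" using xy IB by (auto simp: I_def)
  have "homotopic_paths B (H \<circ> g0) (linepath (H x) (H y))"
    using convex_imp_simply_connected[OF \<open>convex B\<close>] pH iH g0 xB closed_segment_subset[OF xB \<open>convex B\<close>]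
    unfolding simply_connected_eq_homotopic_paths by (auto simp: pathstart_compose pathfinish_compose)
  then have "homotopic_paths \<Omega> (H \<circ> g0) (linepath (H x) (H y))"
    using B\<Omega> homotopic_paths_subset by blast
  with 1 show ?thesis by (rule homotopic_paths_trans)
qed

section \<open>Changing the side curves of a cell\<close>

lemma glue_right:
  fixes R k :: "real \<times> real \<Rightarrow> complex"
  assumes R: "continuous_on sq R" and k: "continuous_on sq k"
    and k0: "\<And>t. t \<in> {0..1} \<Longrightarrow> k (0,t) = R (1,t)"
    and kb: "\<And>x. x \<in> {0..1} \<Longrightarrow> k (x,0) = R (1,0)" "\<And>x. x \<in> {0..1} \<Longrightarrow> k (x,1) = R (1,1)"
    and R\<Omega>: "\<And>x t. 0 < x \<Longrightarrow> x < 1 \<Longrightarrow> 0 < t \<Longrightarrow> t < 1 \<Longrightarrow> R (x,t) \<in> \<Omega>"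
    and k\<Omega>: "\<And>z. z \<in> sq \<Longrightarrow> k z \<in> \<Omega>"
  obtains R' where "continuous_on sq R'" "\<And>x. x \<in> {0..1} \<Longrightarrow> R' (x,0) = R (x,0)" "\<And>x. x \<in> {0..1} \<Longrightarrow> R' (x,1) = R (x,1)"
    "\<And>t. t \<in> {0..1} \<Longrightarrow> R' (0,t) = R (0,t)" "\<And>t. t \<in> {0..1} \<Longrightarrow> R' (1,t) = k (1,t)"
    "\<And>x t. 0 < x \<Longrightarrow> x < 1 \<Longrightarrow> 0 < t \<Longrightarrow> t < 1 \<Longrightarrow> R' (x,t) \<in> \<Omega>"
proof -
  \<comment> \<open>The homotopy \<open>k\<close> is inserted in a strip of width \<open>h t\<close>
    along the right side, while \<open>R\<close> is squeezed into the rest. The width vanishes at t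
    = 0 and t = 1, so the parameterizations of the lower and upper edges are untouched; being at
    most 1/4, it keeps \<open>1 - h t\<close> away from zero.\<close>
  define h where "h = (\<lambda>t::real. t * (1 - t))"
  have h0: "0 \<le> h t" if "t \<in> {0..1}" for t using that by (auto simp: h_def)
  have hpos: "0 < h t" if "0 < t" "t < 1" for t using that by (auto simp: h_def)
  have h1: "h t \<le> 1/4" for t
  proof -
    have "0 \<le> (t - 1/2)^2" by simp
    then show ?thesis by (simp add: h_def power2_eq_square algebra_simps)
  qed
  have conth: "continuous_on A (\<lambda>z::real\<times>real. h (snd z))" for A
    unfolding h_def by (intro continuous_intros)
  \<comment> \<open>The coordinate across the strip. At t = 0 and t = 1 it is 0 by the convention
    for division by zero, and it has no limit there; continuity is rescued because \<open>k\<close>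
    is constant along these two edges.\<close>
  define y where "y = (\<lambda>z::real\<times>real. (fst z - 1 + h (snd z)) / h (snd z))"
  define R' where "R' = (\<lambda>z. if fst z + h (snd z) \<le> 1 then R (fst z / (1 - h (snd z)), snd z) else k (y z, snd z))"
  let ?B = "{z \<in> sq. 1 \<le> fst z + h (snd z)}"
  have yB: "y z \<in> {0..1}" if "z \<in> ?B" for z
  proof (cases "h (snd z) = 0")
    case False
    then have "0 < h (snd z)" using h0[of "snd z"] that by auto
    then show ?thesis using that by (auto simp: y_def field_simps)
  qed (simp add: y_def)
  have contB: "continuous_on ?B (\<lambda>z. k (y z, snd z))"
    unfolding continuous_on_eq_continuous_within
  proof
    fix z0 assume z0: "z0 \<in> ?B"
    show "continuous (at z0 within ?B) (\<lambda>z. k (y z, snd z))"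
    proof (cases "0 < snd z0 \<and> snd z0 < 1")
      case True
      let ?N = "{z::real\<times>real. 0 < snd z \<and> snd z < 1}"
      have "open ?N" by (intro open_Collect_conj open_Collect_less continuous_intros)
      have "continuous_on (?B \<inter> ?N) (\<lambda>z. k (y z, snd z))"
      proof (rule continuous_on_compose2[OF k])
        show "continuous_on (?B \<inter> ?N) (\<lambda>z. (y z, snd z))"
          unfolding y_def using hpos by (intro continuous_intros conth) force
        show "(\<lambda>z. (y z, snd z)) ` (?B \<inter> ?N) \<subseteq> sq" using yB by force
      qed
      then have "continuous (at z0 within ?B \<inter> ?N) (\<lambda>z. k (y z, snd z))"
        using z0 True by (auto simp: continuous_on_eq_continuous_within)
      moreover have "at z0 within ?B \<inter> ?N = at z0 within ?B"
        using True \<open>open ?N\<close> by (intro at_within_nhd[of _ ?N]) auto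
      ultimately show ?thesis by simp
    next
      case False
      then have t0: "snd z0 = 0 \<or> snd z0 = 1" using z0 by force
      then have hz: "h (snd z0) = 0" by (auto simp: h_def)
      have eqk: "k (x, snd z0) = k (y z0, snd z0)" if "x \<in> {0..1}" for x
        using t0 that kb yB[OF z0] by auto
      show ?thesis
        unfolding continuous_within_eps_delta
      proof (intro allI impI)
        fix e :: real assume e: "e > 0"
        have "uniformly_continuous_on sq k" using k sq_compact compact_uniformly_continuous by blast
        then obtain d where d: "d > 0" "\<And>z z'. z \<in> sq \<Longrightarrow> z' \<in> sq \<Longrightarrow> dist z' z < d \<Longrightarrow> dist (k z') (k z) < e"
          using e unfolding uniformly_continuous_on_def by metis
        show "\<exists>d>0. \<forall>x'\<in>?B. dist x' z0 < d \<longrightarrow> dist (k (y x', snd x')) (k (y z0, snd z0)) < e"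
        proof (intro exI[of _ d] conjI ballI impI)
          fix z assume z: "z \<in> ?B" "dist z z0 < d"
          have "dist (y z, snd z) (y z, snd z0) = dist (snd z) (snd z0)" by (simp add: dist_Pair_Pair)
          also have "\<dots> < d" using z(2) dist_snd_le[of z z0] by linarith
          finally have "dist (k (y z, snd z)) (k (y z, snd z0)) < e"
            using yB[OF z(1)] z z0 by (intro d) (auto simp: mem_Times_iff)
          then show "dist (k (y z, snd z)) (k (y z0, snd z0)) < e" using eqk[OF yB[OF z(1)]] by simp
        qed (rule d)
      qed
    qed
  qed
  have cont: "continuous_on sq R'"
    unfolding R'_def
  proof (rule continuous_on_cases_le)
    show "continuous_on {z \<in> sq. fst z + h (snd z) \<le> 1} (\<lambda>z. R (fst z / (1 - h (snd z)), snd z))"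
    proof (rule continuous_on_compose2[OF R])
      show "continuous_on {z \<in> sq. fst z + h (snd z) \<le> 1} (\<lambda>z. (fst z / (1 - h (snd z)), snd z))"
      proof (intro continuous_intros conth ballI)
        fix z :: "real \<times> real" show "1 - h (snd z) \<noteq> 0" using h1[of "snd z"] by linarith
      qed
      show "(\<lambda>z. (fst z / (1 - h (snd z)), snd z)) ` {z \<in> sq. fst z + h (snd z) \<le> 1} \<subseteq> sq"
      proof -
        have "0 \<le> a / (1 - h b) \<and> a / (1 - h b) \<le> 1" if "a + h b \<le> 1" "0 \<le> a" for a b
          using that h1[of b] by (auto simp: field_simps)
        then show ?thesis by auto
      qed
    qed
    show "continuous_on sq (\<lambda>z. fst z + h (snd z))" by (intro continuous_intros conth)
    fix z assume z: "z \<in> sq" "fst z + h (snd z) = 1"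
    then have "fst z = 1 - h (snd z)" by simp
    moreover have "1 - h (snd z) \<noteq> 0" using h1[of "snd z"] by linarith
    moreover have "y z = 0" using z by (simp add: y_def)
    ultimately have eqs: "fst z / (1 - h (snd z)) = 1" "y z = 0" by simp_all
    show "R (fst z / (1 - h (snd z)), snd z) = k (y z, snd z)"
      unfolding eqs using z k0[of "snd z"] by (auto simp: mem_Times_iff)
  qed (rule contB)
  show ?thesis
  proof (rule that[OF cont])
    show "R' (x,0) = R (x,0)" "R' (x,1) = R (x,1)" if "x \<in> {0..1}" for x
      using that by (auto simp: R'_def h_def)
    show "R' (0,t) = R (0,t)" if "t \<in> {0..1}" for t
      using h1[of t] by (auto simp: R'_def)
    show "R' (1,t) = k (1,t)" if t: "t \<in> {0..1}" for t
    proof (cases "0 < t \<and> t < 1")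
      case True
      then show ?thesis using hpos[of t] by (auto simp: R'_def y_def)
    next
      case False
      then have "t = 0 \<or> t = 1" using t by auto
      then show ?thesis using kb[of 1] by (auto simp: R'_def h_def)
    qed
    show "R' (x,t) \<in> \<Omega>" if x: "0 < x" "x < 1" and t: "0 < t" "t < 1" for x t
    proof (cases "x + h t \<le> 1")
      case True
      have pos: "0 < 1 - h t" using h1[of t] by linarith
      show ?thesis
      proof (cases "x / (1 - h t) = 1")
        case True' : True
        then have "R' (x,t) = k (0,t)" using True k0[of t] t by (simp add: R'_def)
        then show ?thesis using k\<Omega>[of "(0,t)"] t by simp
      next
        case False
        then have "x / (1 - h t) < 1" "0 < x / (1 - h t)" using True pos x by (auto simp: field_simps)
        then show ?thesis using True R\<Omega> t by (simp add: R'_def)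
      qed
    next
      case False
      then have "(x,t) \<in> ?B" using x t by auto
      then have "y (x,t) \<in> {0..1}" by (rule yB)
      then show ?thesis using False k\<Omega>[of "(y (x,t), t)"] t by (simp add: R'_def)
    qed
  qed
qed

lemma glue_left:
  fixes R k :: "real \<times> real \<Rightarrow> complex"
  assumes R: "continuous_on sq R" and k: "continuous_on sq k"
    and k0: "\<And>t. t \<in> {0..1} \<Longrightarrow> k (0,t) = R (0,t)"
    and kb: "\<And>x. x \<in> {0..1} \<Longrightarrow> k (x,0) = R (0,0)" "\<And>x. x \<in> {0..1} \<Longrightarrow> k (x,1) = R (0,1)"
    and R\<Omega>: "\<And>x t. 0 < x \<Longrightarrow> x < 1 \<Longrightarrow> 0 < t \<Longrightarrow> t < 1 \<Longrightarrow> R (x,t) \<in> \<Omega>"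
    and k\<Omega>: "\<And>z. z \<in> sq \<Longrightarrow> k z \<in> \<Omega>"
  obtains R' where "continuous_on sq R'" "\<And>x. x \<in> {0..1} \<Longrightarrow> R' (x,0) = R (x,0)" "\<And>x. x \<in> {0..1} \<Longrightarrow> R' (x,1) = R (x,1)"
    "\<And>t. t \<in> {0..1} \<Longrightarrow> R' (1,t) = R (1,t)" "\<And>t. t \<in> {0..1} \<Longrightarrow> R' (0,t) = k (1,t)"
    "\<And>x t. 0 < x \<Longrightarrow> x < 1 \<Longrightarrow> 0 < t \<Longrightarrow> t < 1 \<Longrightarrow> R' (x,t) \<in> \<Omega>"
proof -
  define S where "S = (\<lambda>z. R (1 - fst z, snd z))"
  have S: "continuous_on sq S"
    unfolding S_def by (intro continuous_on_compose2[OF R] continuous_intros) auto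
  obtain S' where S': "continuous_on sq S'" "\<And>x. x \<in> {0..1} \<Longrightarrow> S' (x,0) = S (x,0)" "\<And>x. x \<in> {0..1} \<Longrightarrow> S' (x,1) = S (x,1)"
    "\<And>t. t \<in> {0..1} \<Longrightarrow> S' (0,t) = S (0,t)" "\<And>t. t \<in> {0..1} \<Longrightarrow> S' (1,t) = k (1,t)"
    "\<And>x t. 0 < x \<Longrightarrow> x < 1 \<Longrightarrow> 0 < t \<Longrightarrow> t < 1 \<Longrightarrow> S' (x,t) \<in> \<Omega>"
    by (rule glue_right[OF S k, of \<Omega>]) (use k0 kb R\<Omega> k\<Omega> in \<open>auto simp: S_def\<close>)
  show ?thesis
  proof (rule that[of "\<lambda>z. S' (1 - fst z, snd z)"])
    show "continuous_on sq (\<lambda>z. S' (1 - fst z, snd z))"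
      by (intro continuous_on_compose2[OF S'(1)] continuous_intros) auto
  qed (use S' in \<open>auto simp: S_def\<close>)
qed

lemma fold_step:
  fixes R :: "real \<times> real \<Rightarrow> complex"
  assumes "norm (u::complex) = 1" "continuous_on sq R" "\<And>z. z \<in> frontier sq \<Longrightarrow> u \<bullet> R z < c" "R ` interior sq \<subseteq> A"
  obtains R' where "continuous_on sq R'" "\<And>z. z \<in> frontier sq \<Longrightarrow> R' z = R z"
    "R' ` interior sq \<subseteq> A \<inter> {w. u \<bullet> w \<le> c}"
proof -
  obtain R' where R': "continuous_on sq R'" "\<And>z. z \<in> frontier sq \<Longrightarrow> R' z = R z"
    "\<And>z. z \<in> sq \<Longrightarrow> u \<bullet> R' z \<le> c" "R' ` interior sq \<subseteq> R ` interior sq"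
    using fold_halfplane[OF assms(1-3)] by blast
  then have "R' ` interior sq \<subseteq> A \<inter> {w. u \<bullet> w \<le> c}"
    using assms(4) interior_subset[of sq] by blast
  then show ?thesis using that R'(1,2) by blast
qed

text \<open>Folding leaves the boundary values alone, so the four half-planes bounding a box of half
  side \<kappa> around \<open>z\<close> can be treated one after the other. The factor 2 comes from
  bounding the norm by the sum of the two coordinates.\<close>

lemma fold_box:
  fixes R :: "real \<times> real \<Rightarrow> complex"
  assumes R: "continuous_on sq R" "R ` interior sq \<subseteq> \<Omega>"
    and bd: "\<And>w. w \<in> frontier sq \<Longrightarrow> dist (R w) z < \<kappa>"
  obtains R' where "continuous_on sq R'" "\<And>w. w \<in> frontier sq \<Longrightarrow> R' w = R w"
    "R' ` interior sq \<subseteq> \<Omega>" "\<And>w. w \<in> sq \<Longrightarrow> dist (R' w) z \<le> 2 * \<kappa>"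
proof -
  have bd': "u \<bullet> R w < u \<bullet> z + \<kappa>" if "norm u = 1" "w \<in> frontier sq" for u w
    using norm_cauchy_schwarz[of u "R w - z"] bd[OF that(2)] that(1) by (simp add: inner_diff_right dist_norm)
  obtain R1 where R1: "continuous_on sq R1" "\<And>w. w \<in> frontier sq \<Longrightarrow> R1 w = R w"
    "R1 ` interior sq \<subseteq> \<Omega> \<inter> {w. 1 \<bullet> w \<le> 1 \<bullet> z + \<kappa>}"
    by (rule fold_step[where u = 1 and c = "1 \<bullet> z + \<kappa>", OF _ R(1) _ R(2)]) (use bd'[of 1] in auto)
  obtain R2 where R2: "continuous_on sq R2" "\<And>w. w \<in> frontier sq \<Longrightarrow> R2 w = R1 w"
    "R2 ` interior sq \<subseteq> \<Omega> \<inter> {w. 1 \<bullet> w \<le> 1 \<bullet> z + \<kappa>} \<inter> {w. (-1) \<bullet> w \<le> (-1) \<bullet> z + \<kappa>}"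
    by (rule fold_step[where u = "-1" and c = "(-1) \<bullet> z + \<kappa>", OF _ R1(1) _ R1(3)]) (use R1(2) bd'[of "-1"] in auto)
  obtain R3 where R3: "continuous_on sq R3" "\<And>w. w \<in> frontier sq \<Longrightarrow> R3 w = R2 w"
    "R3 ` interior sq \<subseteq> \<Omega> \<inter> {w. 1 \<bullet> w \<le> 1 \<bullet> z + \<kappa>} \<inter> {w. (-1) \<bullet> w \<le> (-1) \<bullet> z + \<kappa>} \<inter> {w. \<i> \<bullet> w \<le> \<i> \<bullet> z + \<kappa>}"
    by (rule fold_step[where u = "\<i>" and c = "\<i> \<bullet> z + \<kappa>", OF _ R2(1) _ R2(3)]) (use R1(2) R2(2) bd'[of "\<i>"] in auto)
  obtain R4 where R4: "continuous_on sq R4" "\<And>w. w \<in> frontier sq \<Longrightarrow> R4 w = R3 w"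
    "R4 ` interior sq \<subseteq> \<Omega> \<inter> {w. 1 \<bullet> w \<le> 1 \<bullet> z + \<kappa>} \<inter> {w. (-1) \<bullet> w \<le> (-1) \<bullet> z + \<kappa>} \<inter> {w. \<i> \<bullet> w \<le> \<i> \<bullet> z + \<kappa>} \<inter> {w. (-\<i>) \<bullet> w \<le> (-\<i>) \<bullet> z + \<kappa>}"
    by (rule fold_step[where u = "-\<i>" and c = "(-\<i>) \<bullet> z + \<kappa>", OF _ R3(1) _ R3(3)]) (use R1(2) R2(2) R3(2) bd'[of "-\<i>"] in auto)
  show ?thesis
  proof (rule that[OF R4(1)])
    show *: "R4 w = R w" if "w \<in> frontier sq" for w using that R1 R2 R3 R4 by auto
    show "R4 ` interior sq \<subseteq> \<Omega>" using R4(3) by auto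
    show "dist (R4 w) z \<le> 2 * \<kappa>" if w: "w \<in> sq" for w
    proof (cases "w \<in> frontier sq")
      case True
      then have "dist (R4 w) z < \<kappa>" using * bd by simp
      then show ?thesis using zero_le_dist[of "R4 w" z] by linarith
    next
      case False
      then have "w \<in> interior sq" using w by (simp add: frontier_def sq_closed)
      then have "R4 w \<in> R4 ` interior sq" by (rule imageI)
      from subsetD[OF R4(3) this] have "\<bar>Re (R4 w - z)\<bar> \<le> \<kappa>" "\<bar>Im (R4 w - z)\<bar> \<le> \<kappa>"
        by (auto simp: inner_complex_def)
      then show ?thesis using cmod_le[of "R4 w - z"] by (simp add: dist_norm)
    qed
  qed
qed

text \<open>The first alternative is needed for the vertical edges \<open>r = r' = 0\<close> and \<open>r = r' = 1\<close>, which need not lie in \<open>\<Omega>\<close>.\<close>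

definition link :: "complex set \<Rightarrow> (real \<times> real \<Rightarrow> complex) \<Rightarrow> real \<Rightarrow> real \<Rightarrow> (real \<Rightarrow> complex) \<Rightarrow> bool" where
  "link \<Omega> G r r' \<sigma> \<longleftrightarrow> (\<forall>t\<in>{0..1}. \<sigma> t = G ((1-t)*r + t*r', t)) \<or> homotopic_paths \<Omega> (G \<circ> linepath (r,0) (r',1)) \<sigma>"

lemma linepath_sq: "linepath (r,0) (r',1) t = ((1-t)*r + t*r', t::real)"
  by (simp add: linepath_def)

lemma link_cases:
  assumes "link \<Omega> G r r' \<sigma>"
  obtains "\<And>t. t \<in> {0..1} \<Longrightarrow> \<sigma> t = G ((1-t)*r + t*r', t)"
  | k where "continuous_on sq k" "\<And>t. t \<in> {0..1} \<Longrightarrow> k (0,t) = G ((1-t)*r + t*r', t)" "\<And>t. t \<in> {0..1} \<Longrightarrow> k (1,t) = \<sigma> t"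
    "\<And>x. x \<in> {0..1} \<Longrightarrow> k (x,0) = G (r,0)" "\<And>x. x \<in> {0..1} \<Longrightarrow> k (x,1) = G (r',1)" "\<And>z. z \<in> sq \<Longrightarrow> k z \<in> \<Omega>"
  using assms unfolding link_def
proof
  assume "homotopic_paths \<Omega> (G \<circ> linepath (r,0) (r',1)) \<sigma>"
  then obtain k where k: "continuous_on sq k" "k ` sq \<subseteq> \<Omega>" "\<forall>t\<in>{0..1}. k (0,t) = (G \<circ> linepath (r,0) (r',1)) t"
    "\<forall>t\<in>{0..1}. k (1,t) = \<sigma> t"
    "\<forall>x\<in>{0..1}. pathstart (k \<circ> Pair x) = pathstart (G \<circ> linepath (r,0) (r',1)) \<and> pathfinish (k \<circ> Pair x) = pathfinish (G \<circ> linepath (r,0) (r',1))"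
    unfolding homotopic_paths by (auto simp: image_subset_iff_funcset)
  show ?thesis
    using k by (intro that(2)[of k]) (auto simp: linepath_sq pathstart_def pathfinish_def)
qed (rule that(1), blast)

lemma link_in:
  assumes "link \<Omega> G r r' \<sigma>" and G: "epe_hom \<Omega> p q \<nu> \<nu>' G" and r: "0 < r" "r < 1" "0 < r'" "r' < 1" and t: "t \<in> {0..1}"
  shows "\<sigma> t \<in> \<Omega>"
  using assms(1)
proof (cases rule: link_cases)
  case 1
  have "0 < (1-t)*r + t*r'" "(1-t)*r + t*r' < 1"
    using t r convex_bound_lt[of r 1 r' "1-t" t] convex_bound_lt[of "-r" 0 "-r'" "1-t" t] by auto
  then show ?thesis
    using 1[OF t] epe_homD(6)[OF G] t by auto
next
  case (2 k)
  then show ?thesis using 2(3)[OF t] 2(6)[of "(1,t)"] t by simp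
qed

text \<open>The part of \<open>G\<close> between two slanted segments is spread over the square;
  each side whose link is a genuine homotopy is then changed by gluing that homotopy in. The
  segments do not cross, because their ends come in the same order at the bottom and at the
  top.\<close>

lemma piece:
  assumes G: "epe_hom \<Omega> p q \<nu> \<nu>' G" and r: "0 \<le> r1" "r1 < r2" "r2 \<le> 1" "0 \<le> r1'" "r1' < r2'" "r2' \<le> 1"
    and l1: "link \<Omega> G r1 r1' \<sigma>1" and l2: "link \<Omega> G r2 r2' \<sigma>2"
  obtains R where "continuous_on sq R" "\<And>x. x \<in> {0..1} \<Longrightarrow> R (x,0) = \<nu> ((1-x)*r1 + x*r2)"
    "\<And>x. x \<in> {0..1} \<Longrightarrow> R (x,1) = \<nu>' ((1-x)*r1' + x*r2')"
    "\<And>t. t \<in> {0..1} \<Longrightarrow> R (0,t) = \<sigma>1 t" "\<And>t. t \<in> {0..1} \<Longrightarrow> R (1,t) = \<sigma>2 t"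
    "\<And>x t. 0 < x \<Longrightarrow> x < 1 \<Longrightarrow> 0 < t \<Longrightarrow> t < 1 \<Longrightarrow> R (x,t) \<in> \<Omega>"
proof -
  define a b where "a = (\<lambda>t. (1-t)*r1 + t*r1')" and "b = (\<lambda>t. (1-t)*r2 + t*r2')"
  have ab: "0 \<le> a t" "a t < b t" "b t \<le> 1" if t: "t \<in> {0..1}" for t
  proof -
    show "0 \<le> a t" using t r by (auto simp: a_def)
    show "b t \<le> 1" using t r convex_bound_le[of r2 1 r2' "1-t" t] by (auto simp: b_def)
    have "0 < (1-t) * (r2 - r1) + t * (r2' - r1')"
    proof (cases "t = 0")
      case False
      then have "0 < t * (r2' - r1')" "0 \<le> (1-t) * (r2 - r1)" using t r by auto
      then show ?thesis by linarith
    qed (use r in auto)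
    then show "a t < b t" by (simp add: a_def b_def algebra_simps)
  qed
  define c where "c = (\<lambda>z::real\<times>real. (1 - fst z) * a (snd z) + fst z * b (snd z))"
  have c01: "c z \<in> {0..1}" if "z \<in> sq" for z
  proof -
    have t: "snd z \<in> {0..1}" "fst z \<in> {0..1}" using that by (auto simp: mem_Times_iff)
    then have "a (snd z) \<le> 1" "0 \<le> b (snd z)" using ab[OF t(1)] by linarith+
    then show ?thesis using t ab[OF t(1)] convex_bound_le[of "a (snd z)" 1 "b (snd z)" "1 - fst z" "fst z"] by (auto simp: c_def)
  qed
  have cpos: "0 < c (x,t)" "c (x,t) < 1" if x: "0 < x" "x < 1" and t: "t \<in> {0..1}" for x t
  proof -
    have "0 < x * (b t - a t)" "0 < (1-x) * (b t - a t)" using x ab[OF t] by auto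
    then have "a t < c (x,t)" "c (x,t) < b t" by (auto simp: c_def algebra_simps)
    then show "0 < c (x,t)" "c (x,t) < 1" using ab[OF t] by linarith+
  qed
  define R0 where "R0 = (\<lambda>z. G (c z, snd z))"
  have R0: "continuous_on sq R0"
    unfolding R0_def
  proof (rule continuous_on_compose2[OF epe_homD(1)[OF G]])
    show "continuous_on sq (\<lambda>z. (c z, snd z))" unfolding c_def a_def b_def by (intro continuous_intros)
    show "(\<lambda>z. (c z, snd z)) ` sq \<subseteq> sq" using c01 by (auto simp: mem_Times_iff)
  qed
  have R0b: "R0 (x,0) = \<nu> ((1-x)*r1 + x*r2)" "R0 (x,1) = \<nu>' ((1-x)*r1' + x*r2')" if "x \<in> {0..1}" for x
    using c01[of "(x,0)"] c01[of "(x,1)"] that epe_homD(2,3)[OF G] by (auto simp: R0_def c_def a_def b_def)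
  have R0e: "R0 (0,t) = G ((1-t)*r1 + t*r1', t)" "R0 (1,t) = G ((1-t)*r2 + t*r2', t)" for t
    by (auto simp: R0_def c_def a_def b_def)
  have R0i: "R0 (x,t) \<in> \<Omega>" if "0 < x" "x < 1" "0 < t" "t < 1" for x t
    using cpos[of x t] that epe_homD(6)[OF G] by (auto simp: R0_def)
  obtain R1 where R1: "continuous_on sq R1" "\<And>x. x \<in> {0..1} \<Longrightarrow> R1 (x,0) = R0 (x,0)"
    "\<And>x. x \<in> {0..1} \<Longrightarrow> R1 (x,1) = R0 (x,1)" "\<And>t. t \<in> {0..1} \<Longrightarrow> R1 (0,t) = R0 (0,t)"
    "\<And>t. t \<in> {0..1} \<Longrightarrow> R1 (1,t) = \<sigma>2 t" "\<And>x t. 0 < x \<Longrightarrow> x < 1 \<Longrightarrow> 0 < t \<Longrightarrow> t < 1 \<Longrightarrow> R1 (x,t) \<in> \<Omega>"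
    using l2
  proof (cases rule: link_cases)
    case 1
    then show ?thesis using that[of R0] R0 R0e R0i by simp
  next
    case (2 k)
    obtain R' where "continuous_on sq R'" "\<And>x. x \<in> {0..1} \<Longrightarrow> R' (x,0) = R0 (x,0)" "\<And>x. x \<in> {0..1} \<Longrightarrow> R' (x,1) = R0 (x,1)"
      "\<And>t. t \<in> {0..1} \<Longrightarrow> R' (0,t) = R0 (0,t)" "\<And>t. t \<in> {0..1} \<Longrightarrow> R' (1,t) = k (1,t)"
      "\<And>x t. 0 < x \<Longrightarrow> x < 1 \<Longrightarrow> 0 < t \<Longrightarrow> t < 1 \<Longrightarrow> R' (x,t) \<in> \<Omega>"
      by (rule glue_right[OF R0 2(1), of \<Omega>]) (use 2 R0e R0i in auto)
    then show ?thesis using that[of R'] 2(3) by simp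
  qed
  obtain R2 where R2: "continuous_on sq R2" "\<And>x. x \<in> {0..1} \<Longrightarrow> R2 (x,0) = R1 (x,0)"
    "\<And>x. x \<in> {0..1} \<Longrightarrow> R2 (x,1) = R1 (x,1)" "\<And>t. t \<in> {0..1} \<Longrightarrow> R2 (1,t) = R1 (1,t)"
    "\<And>t. t \<in> {0..1} \<Longrightarrow> R2 (0,t) = \<sigma>1 t" "\<And>x t. 0 < x \<Longrightarrow> x < 1 \<Longrightarrow> 0 < t \<Longrightarrow> t < 1 \<Longrightarrow> R2 (x,t) \<in> \<Omega>"
    using l1
  proof (cases rule: link_cases)
    case 1
    then show ?thesis using that[of R1] R1 R0e by simp
  next
    case (2 k)
    obtain R' where "continuous_on sq R'" "\<And>x. x \<in> {0..1} \<Longrightarrow> R' (x,0) = R1 (x,0)" "\<And>x. x \<in> {0..1} \<Longrightarrow> R' (x,1) = R1 (x,1)"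
      "\<And>t. t \<in> {0..1} \<Longrightarrow> R' (1,t) = R1 (1,t)" "\<And>t. t \<in> {0..1} \<Longrightarrow> R' (0,t) = k (1,t)"
      "\<And>x t. 0 < x \<Longrightarrow> x < 1 \<Longrightarrow> 0 < t \<Longrightarrow> t < 1 \<Longrightarrow> R' (x,t) \<in> \<Omega>"
      by (rule glue_left[OF R1(1) 2(1), of \<Omega>]) (use 2 R0e R1 in auto)
    then show ?thesis using that[of R'] 2(3) by simp
  qed
  show ?thesis
    using that[OF R2(1)] R2 R1 R0b by simp
qed

text \<open>A homotopy built up to the slanted segment from \<open>(r,0)\<close> to
  \<open>(r',1)\<close>. Values in \<Omega> are demanded only for 0 < t < 1 and strictly left of
  that segment: this is what a filled cell delivers, and the two remaining rows are known from \<nu>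
  and \<nu>'.\<close>

definition partial_hom where
  "partial_hom \<Omega> p \<nu> \<nu>' lam \<epsilon> r r' \<sigma> F \<longleftrightarrow>
    continuous_on {z \<in> sq. fst z \<le> (1 - snd z)*r + snd z*r'} F \<and>
    (\<forall>s\<in>{0..r}. F (s,0) = \<nu> s) \<and> (\<forall>s\<in>{0..r'}. F (s,1) = \<nu>' s) \<and>
    (\<forall>t\<in>{0..1}. F (0,t) = p \<and> F ((1-t)*r + t*r', t) = \<sigma> t) \<and>
    (\<forall>t\<in>{0<..<1}. \<forall>s. 0 < s \<and> s < (1-t)*r + t*r' \<longrightarrow> F (s,t) \<in> \<Omega>) \<and>
    (\<forall>t\<in>{0..1}. \<forall>s. 0 \<le> s \<and> s \<le> (1-t)*r + t*r' \<longrightarrow> dist (F (s,t)) (lam s) \<le> (\<epsilon>::real))"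

text \<open>The next cell is folded into a box around \<open>z\<close>, which makes it small however
  far \<open>G\<close> strays there, and is attached along the common side \<open>\<sigma>1\<close>.
  The inner points of that side have to lie in \<Omega>. This is the purpose of \<open>z0\<close>:
  either the side is the left edge of the square, or both its ends are interior and
  \<open>link_in\<close> applies.\<close>

lemma partial_extend:
  assumes F: "partial_hom \<Omega> p \<nu> \<nu>' lam \<epsilon> r1 r1' \<sigma>1 F"
    and G: "epe_hom \<Omega> p q \<nu> \<nu>' G" and r: "0 \<le> r1" "r1 < r2" "r2 \<le> 1" "0 \<le> r1'" "r1' < r2'" "r2' \<le> 1"
    and l1: "link \<Omega> G r1 r1' \<sigma>1" and l2: "link \<Omega> G r2 r2' \<sigma>2"
    and z0: "r1 = 0 \<and> r1' = 0 \<or> 0 < r1 \<and> 0 < r1'"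
    and bd: "\<And>s. s \<in> {r1..r2} \<Longrightarrow> dist (\<nu> s) z < \<kappa>" "\<And>s. s \<in> {r1'..r2'} \<Longrightarrow> dist (\<nu>' s) z < \<kappa>"
      "\<And>t. t \<in> {0..1} \<Longrightarrow> dist (\<sigma>1 t) z < \<kappa>" "\<And>t. t \<in> {0..1} \<Longrightarrow> dist (\<sigma>2 t) z < \<kappa>"
    and lam: "\<And>s. min r1 r1' \<le> s \<Longrightarrow> s \<le> max r2 r2' \<Longrightarrow> 2 * \<kappa> + dist z (lam s) \<le> \<epsilon>"
  shows "\<exists>F'. partial_hom \<Omega> p \<nu> \<nu>' lam \<epsilon> r2 r2' \<sigma>2 F'"
proof -
  have "\<exists>R0. continuous_on sq R0 \<and> (\<forall>x\<in>{0..1}. R0 (x,0) = \<nu> ((1-x)*r1 + x*r2) \<and> R0 (x,1) = \<nu>' ((1-x)*r1' + x*r2')) \<and>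
    (\<forall>t\<in>{0..1}. R0 (0,t) = \<sigma>1 t \<and> R0 (1,t) = \<sigma>2 t) \<and> (\<forall>x\<in>{0<..<1}. \<forall>t\<in>{0<..<1}. R0 (x,t) \<in> \<Omega>)"
    by (rule piece[OF G r l1 l2], rule exI, intro conjI ballI) auto
  then obtain R0 where R0: "continuous_on sq R0" "\<And>x. x \<in> {0..1} \<Longrightarrow> R0 (x,0) = \<nu> ((1-x)*r1 + x*r2)"
    "\<And>x. x \<in> {0..1} \<Longrightarrow> R0 (x,1) = \<nu>' ((1-x)*r1' + x*r2')"
    "\<And>t. t \<in> {0..1} \<Longrightarrow> R0 (0,t) = \<sigma>1 t" "\<And>t. t \<in> {0..1} \<Longrightarrow> R0 (1,t) = \<sigma>2 t"
    "\<And>x t. 0 < x \<Longrightarrow> x < 1 \<Longrightarrow> 0 < t \<Longrightarrow> t < 1 \<Longrightarrow> R0 (x,t) \<in> \<Omega>"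
    by auto
  have cvx: "(1-x)*a + x*b \<in> {a..b}" if "x \<in> {0..1}" "a < b" for x a b :: real
  proof -
    have "0 \<le> x * (b - a)" "0 \<le> (1-x) * (b - a)" using that by auto
    then show ?thesis by (auto simp: algebra_simps)
  qed
  have R0bd: "dist (R0 w) z < \<kappa>" if w: "w \<in> frontier sq" for w
  proof -
    obtain x t where xt: "w = (x,t)" "x \<in> {0..1}" "t \<in> {0..1}" "x = 0 \<or> x = 1 \<or> t = 0 \<or> t = 1"
      using w by (cases w) (auto simp: frontier_sq_iff)
    from xt(4) show ?thesis
      using R0(2,3)[OF xt(2)] R0(4,5)[OF xt(3)] bd(3,4)[OF xt(3)]
        bd(1)[OF cvx[OF xt(2) r(2)]] bd(2)[OF cvx[OF xt(2) r(5)]] xt(1) by auto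
  qed
  have "R0 ` interior sq \<subseteq> \<Omega>" using R0(6) by (auto simp: interior_sq)
  then obtain R where R: "continuous_on sq R" "\<And>w. w \<in> frontier sq \<Longrightarrow> R w = R0 w"
    "R ` interior sq \<subseteq> \<Omega>" "\<And>w. w \<in> sq \<Longrightarrow> dist (R w) z \<le> 2 * \<kappa>"
    using fold_box[OF R0(1) _ R0bd] by metis
  have Rb: "R (x,0) = \<nu> ((1-x)*r1 + x*r2)" "R (x,1) = \<nu>' ((1-x)*r1' + x*r2')" if "x \<in> {0..1}" for x
    using that R(2)[of "(x,0)"] R(2)[of "(x,1)"] R0(2,3)[OF that] by (auto simp: frontier_sq_iff)
  have Re: "R (0,t) = \<sigma>1 t" "R (1,t) = \<sigma>2 t" if "t \<in> {0..1}" for t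
    using that R(2)[of "(0,t)"] R(2)[of "(1,t)"] R0(4,5)[OF that] by (auto simp: frontier_sq_iff)
  have Ri: "R (x,t) \<in> \<Omega>" if "0 < x" "x < 1" "0 < t" "t < 1" for x t
    using R(3) that by (auto simp: interior_sq image_subset_iff)
  define a b where "a = (\<lambda>t. (1-t)*r1 + t*r1')" and "b = (\<lambda>t. (1-t)*r2 + t*r2')"
  have ab: "a t < b t" if t: "t \<in> {0..1}" for t
  proof -
    have "0 < (1-t) * (r2 - r1) + t * (r2' - r1')"
    proof (cases "t = 0")
      case False
      then have "0 < t * (r2' - r1')" "0 \<le> (1-t) * (r2 - r1)" using t r by auto
      then show ?thesis by linarith
    qed (use r in auto)
    then show "a t < b t" by (simp add: a_def b_def algebra_simps)
  qed
  have aR: "min r1 r1' \<le> a t" "b t \<le> max r2 r2'" if t: "t \<in> {0..1}" for t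
  proof -
    have "(1-t) * min r1 r1' \<le> (1-t) * r1" "t * min r1 r1' \<le> t * r1'" using t by (auto intro!: mult_left_mono)
    then show "min r1 r1' \<le> a t" unfolding a_def by (simp add: algebra_simps)
    have "(1-t) * r2 \<le> (1-t) * max r2 r2'" "t * r2' \<le> t * max r2 r2'" using t by (auto intro!: mult_left_mono)
    then show "b t \<le> max r2 r2'" unfolding b_def by (simp add: algebra_simps)
  qed
  have a0: "0 \<le> a t" if "t \<in> {0..1}" for t using that r by (auto simp: a_def)
  define y where "y = (\<lambda>z::real\<times>real. (fst z - a (snd z)) / (b (snd z) - a (snd z)))"
  define F' where "F' = (\<lambda>z. if fst z - a (snd z) \<le> 0 then F z else R (y z, snd z))"
  let ?D = "{z \<in> sq. fst z \<le> b (snd z)}"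
  have y01: "y (s,t) \<in> {0..1}" if "t \<in> {0..1}" "a t \<le> s" "s \<le> b t" for s t
    using that ab[OF that(1)] by (auto simp: y_def field_simps)
  have Fd: "continuous_on {z \<in> sq. fst z \<le> a (snd z)} F" "\<And>s. s \<in> {0..r1} \<Longrightarrow> F (s,0) = \<nu> s" "\<And>s. s \<in> {0..r1'} \<Longrightarrow> F (s,1) = \<nu>' s"
    "\<And>t. t \<in> {0..1} \<Longrightarrow> F (0,t) = p" "\<And>t. t \<in> {0..1} \<Longrightarrow> F (a t, t) = \<sigma>1 t"
    "\<And>s t. 0 < t \<Longrightarrow> t < 1 \<Longrightarrow> 0 < s \<Longrightarrow> s < a t \<Longrightarrow> F (s,t) \<in> \<Omega>"
    "\<And>s t. t \<in> {0..1} \<Longrightarrow> 0 \<le> s \<Longrightarrow> s \<le> a t \<Longrightarrow> dist (F (s,t)) (lam s) \<le> \<epsilon>"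
    using F by (auto simp: partial_hom_def a_def)
  have cont: "continuous_on ?D F'"
    unfolding F'_def
  proof (rule continuous_on_cases_le)
    have "{z \<in> ?D. fst z - a (snd z) \<le> 0} \<subseteq> {z \<in> sq. fst z \<le> a (snd z)}" by auto
    then show "continuous_on {z \<in> ?D. fst z - a (snd z) \<le> 0} F" using Fd(1) continuous_on_subset by blast
    show "continuous_on {z \<in> ?D. 0 \<le> fst z - a (snd z)} (\<lambda>z. R (y z, snd z))"
    proof (rule continuous_on_compose2[OF R(1)])
      show "continuous_on {z \<in> ?D. 0 \<le> fst z - a (snd z)} (\<lambda>z. (y z, snd z))"
        unfolding y_def a_def b_def
      proof (intro continuous_intros ballI)
        fix z assume "z \<in> {z \<in> {z \<in> sq. fst z \<le> (1 - snd z) * r2 + snd z * r2'}. 0 \<le> fst z - ((1 - snd z) * r1 + snd z * r1')}"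
        then have "snd z \<in> {0..1}" by auto
        from ab[OF this] show "(1 - snd z) * r2 + snd z * r2' - ((1 - snd z) * r1 + snd z * r1') \<noteq> 0"
          by (simp add: a_def b_def)
      qed
      show "(\<lambda>z. (y z, snd z)) ` {z \<in> ?D. 0 \<le> fst z - a (snd z)} \<subseteq> sq"
        using y01 by auto
    qed
    show "continuous_on ?D (\<lambda>z. fst z - a (snd z))" unfolding a_def by (intro continuous_intros)
    fix z assume z: "z \<in> ?D" "fst z - a (snd z) = 0"
    then have t: "snd z \<in> {0..1}" by auto
    have "y z = 0" using z by (simp add: y_def)
    moreover have "F z = \<sigma>1 (snd z)" using Fd(5)[OF t] z by (cases z) auto
    ultimately show "F z = R (y z, snd z)" using Re(1)[OF t] by simp
  qed
  have yinv: "(1 - y (s,t)) * a t + y (s,t) * b t = s" if "t \<in> {0..1}" for s t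
  proof -
    have "y (s,t) * (b t - a t) = s - a t" using ab[OF that] by (simp add: y_def)
    then show ?thesis by (simp add: algebra_simps)
  qed
  have "partial_hom \<Omega> p \<nu> \<nu>' lam \<epsilon> r2 r2' \<sigma>2 F'"
    unfolding partial_hom_def
  proof (intro conjI ballI allI impI)
    show "continuous_on {z \<in> sq. fst z \<le> (1 - snd z) * r2 + snd z * r2'} F'" using cont by (simp add: b_def)
    show "F' (s,0) = \<nu> s" if "s \<in> {0..r2}" for s
    proof (cases "s \<le> r1")
      case False
      then have "y (s,0) \<in> {0..1}" using that by (intro y01) (auto simp: a_def b_def)
      then show ?thesis using False Rb(1) yinv[of 0 s] by (simp add: F'_def a_def b_def)
    qed (use that Fd(2) in \<open>auto simp: F'_def a_def\<close>)
    show "F' (s,1) = \<nu>' s" if "s \<in> {0..r2'}" for s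
    proof (cases "s \<le> r1'")
      case False
      then have "y (s,1) \<in> {0..1}" using that by (intro y01) (auto simp: a_def b_def)
      then show ?thesis using False Rb(2) yinv[of 1 s] by (simp add: F'_def a_def b_def)
    qed (use that Fd(3) in \<open>auto simp: F'_def a_def\<close>)
    show "F' (0,t) = p" if t: "t \<in> {0..1}" for t
      using Fd(4)[OF t] a0[OF t] by (simp add: F'_def)
    show "F' ((1-t)*r2 + t*r2', t) = \<sigma>2 t" if t: "t \<in> {0..1}" for t
      using Re(2)[OF t] ab[OF t] by (simp add: F'_def y_def b_def)
    show "F' (s,t) \<in> \<Omega>" if t: "t \<in> {0<..<1}" and s: "0 < s \<and> s < (1-t)*r2 + t*r2'" for s t
    proof -
      have t': "t \<in> {0..1}" using t by auto
      consider "s < a t" | "s = a t" | "a t < s" by linarith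
      then show ?thesis
      proof cases
        case 1 then show ?thesis using Fd(6)[of t s] t s by (simp add: F'_def)
      next
        case 2
        then have "r1 \<noteq> 0 \<or> r1' \<noteq> 0" using s by (auto simp: a_def)
        then have "\<sigma>1 t \<in> \<Omega>" using z0 r t' by (intro link_in[OF l1 G]) auto
        then show ?thesis using 2 Fd(5)[OF t'] by (simp add: F'_def)
      next
        case 3
        then have "0 < y (s,t)" "y (s,t) < 1" using s ab[OF t'] by (auto simp: y_def b_def field_simps)
        then show ?thesis using 3 Ri t by (simp add: F'_def)
      qed
    qed
    show "dist (F' (s,t)) (lam s) \<le> \<epsilon>" if t: "t \<in> {0..1}" and s: "0 \<le> s \<and> s \<le> (1-t)*r2 + t*r2'" for s t
    proof (cases "s \<le> a t")
      case True
      then show ?thesis using Fd(7)[OF t] s by (simp add: F'_def)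
    next
      case False
      have "y (s,t) \<in> {0..1}" using False t s by (intro y01) (auto simp: b_def)
      then have "dist (R (y (s,t), t)) z \<le> 2 * \<kappa>" using t by (intro R(4)) auto
      moreover have "2 * \<kappa> + dist z (lam s) \<le> \<epsilon>"
        using aR[OF t] False s by (intro lam) (auto simp: b_def)
      ultimately show ?thesis
        using False dist_triangle[of "R (y (s,t), t)" "lam s" z] by (simp add: F'_def)
    qed
  qed
  then show ?thesis by blast
qed

section \<open>Small homotopies and limits of paths\<close>

text \<open>The links cut \<open>G\<close> into narrow cells, which are replaced one after the
  other. Where \<open>lam\<close> is constant no link is at hand, and the current cell is simply
  made longer, since the limit does not move. A link is within \<open>3 * \<kappa>\<close> of
  \<open>lam\<close> at the left end of its interval, hence within \<open>4 * \<kappa>\<close> at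
  the right end; folding doubles this, and the oscillation of \<open>lam\<close> adds one more
  \<kappa>, which makes 9.\<close>

lemma small_homotopy:
  fixes N :: nat
  assumes G: "epe_hom \<Omega> p q \<nu> \<nu>' G" and N: "0 < N" and \<kappa>: "0 < \<kappa>"
    and osc: "\<And>i s s'. i < N \<Longrightarrow> s \<in> {real i/N..real (Suc i)/N} \<Longrightarrow> s' \<in> {real i/N..real (Suc i)/N} \<Longrightarrow> dist (lam s) (lam s') < \<kappa>"
    and close: "\<And>s. s \<in> {0..1} \<Longrightarrow> dist (\<nu> s) (lam s) < \<kappa>" "\<And>s. s \<in> {0..1} \<Longrightarrow> dist (\<nu>' s) (lam s) < \<kappa>"
    and links: "\<And>i s s'. i < N \<Longrightarrow> s \<in> {real i/N..real (Suc i)/N} \<Longrightarrow> s' \<in> {real i/N..real (Suc i)/N} \<Longrightarrow> lam s \<noteq> lam s' \<Longrightarrow>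
      \<exists>r r' \<sigma>. real i/N < r \<and> r < real (Suc i)/N \<and> real i/N < r' \<and> r' < real (Suc i)/N \<and> link \<Omega> G r r' \<sigma> \<and>
        (\<forall>t\<in>{0..1}. dist (\<sigma> t) (lam (real i/N)) < 3 * \<kappa>)"
  shows "\<exists>F. epe_hom \<Omega> p q \<nu> \<nu>' F \<and> (\<forall>z\<in>sq. dist (F z) (lam (fst z)) \<le> 9 * \<kappa>)"
proof -
  let ?P = "partial_hom \<Omega> p \<nu> \<nu>' lam (9 * \<kappa>)"
  have \<nu>0: "\<nu> 0 = p" "\<nu>' 1 = q" "\<nu>' 0 = p"
    using epe_homD(2,3,4)[OF G, of 0] epe_homD(3,4,5)[OF G, of 1] by auto
  \<comment> \<open>Here \<open>i\<close> counts the intervals already treated and \<open>j\<close>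
    marks the right end of the interval that contains the last link; between \<open>j/N\<close> and
    \<open>i/N\<close> the limit is constant. For \<open>j = 0\<close> the left edge of the square
    plays the role of the link.\<close>
  define Inv where "Inv = (\<lambda>i j r r' \<sigma>. j \<le> i \<and> (\<exists>F. ?P r r' \<sigma> F) \<and> link \<Omega> G r r' \<sigma> \<and>
     (\<forall>t\<in>{0..1}. dist (\<sigma> t) (lam (real j/N)) < 4 * \<kappa>) \<and>
     (j = 0 \<and> r = 0 \<and> r' = 0 \<or> 0 < j \<and> (real j - 1)/N < r \<and> r < real j/N \<and> (real j - 1)/N < r' \<and> r' < real j/N) \<and>
     (\<forall>s\<in>{real j/N..real i/N}. lam s = lam (real j/N)))"
  have InvD: "j \<le> i" "\<exists>F. ?P r r' \<sigma> F" "link \<Omega> G r r' \<sigma>" "\<forall>t\<in>{0..1}. dist (\<sigma> t) (lam (real j/N)) < 4 * \<kappa>"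
    "j = 0 \<and> r = 0 \<and> r' = 0 \<or> 0 < j \<and> (real j - 1)/N < r \<and> r < real j/N \<and> (real j - 1)/N < r' \<and> r' < real j/N"
    "\<And>s. s \<in> {real j/N..real i/N} \<Longrightarrow> lam s = lam (real j/N)" if "Inv i j r r' \<sigma>" for i j r r' \<sigma>
    using that unfolding Inv_def by blast+
  have near: "dist (lam (real j/N)) (lam s) < \<kappa>" if I: "Inv i j r r' \<sigma>" and s: "min r r' \<le> s" "s \<le> real i/N" "0 \<le> s" and i: "i \<le> N" for i j r r' \<sigma> s
  proof (cases "real j/N \<le> s")
    case True
    then show ?thesis using InvD(6)[OF I, of s] s \<kappa> by simp
  next
    case False
    then have j: "0 < j" using s N by (cases "j = 0") auto
    then have "(real j - 1)/N < s" using InvD(5)[OF I] s by (auto simp: min_def split: if_splits)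
    moreover have "real (j - 1) = real j - 1" "Suc (j - 1) = j" using j by auto
    ultimately have "dist (lam (real j/N)) (lam s) < \<kappa>"
      using InvD(1)[OF I] j i False by (intro osc[of "j - 1"]) (auto simp: divide_right_mono)
    then show ?thesis .
  qed
  have step: "\<exists>F. ?P r2 r2' \<sigma>2 F"
    if I: "Inv i j r r' \<sigma>" and i: "i \<le> N" "real i/N \<le> e" "e \<le> 1"
      and r2: "r < r2" "r2 \<le> e" "r' < r2'" "r2' \<le> e" and l2: "link \<Omega> G r2 r2' \<sigma>2"
      and s2: "\<And>t. t \<in> {0..1} \<Longrightarrow> dist (\<sigma>2 t) (lam (real i/N)) < 4 * \<kappa>"
      and e: "\<And>s. s \<in> {real i/N..e} \<Longrightarrow> dist (lam (real i/N)) (lam s) < \<kappa>" for i j r r' \<sigma> r2 r2' \<sigma>2 e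
  proof -
    obtain F where F: "?P r r' \<sigma> F" using InvD(2)[OF I] by blast
    have ji: "real j/N \<le> real i/N" using InvD(1)[OF I] by (simp add: divide_right_mono)
    have eqz: "lam (real i/N) = lam (real j/N)" using InvD(6)[OF I, of "real i/N"] ji by simp
    have r0: "0 \<le> r" "0 \<le> r'" "r = 0 \<and> r' = 0 \<or> 0 < r \<and> 0 < r'"
    proof -
      have "r = 0 \<and> r' = 0 \<or> 0 < r \<and> 0 < r'"
      proof (cases "j = 0")
        case False
        then have "0 \<le> (real j - 1)/N" by simp
        then show ?thesis using InvD(5)[OF I] False by linarith
      qed (use InvD(5)[OF I] in auto)
      then show "0 \<le> r" "0 \<le> r'" "r = 0 \<and> r' = 0 \<or> 0 < r \<and> 0 < r'" by auto
    qed
    have nr: "dist (lam (real j/N)) (lam s) < \<kappa>" if "min r r' \<le> s" "s \<le> e" for s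
    proof (cases "s \<le> real i/N")
      case True
      then show ?thesis using near[OF I that(1) True _ i(1)] r0 that by auto
    next
      case False
      then show ?thesis using e[of s] that eqz by auto
    qed
    show ?thesis
    proof (rule partial_extend[OF F G, where z = "lam (real j/N)" and \<kappa> = "4 * \<kappa>"])
      show "dist (\<nu> s) (lam (real j/N)) < 4 * \<kappa>" if "s \<in> {r..r2}" for s
        proof -
        have "min r r' \<le> s" "s \<le> e" "s \<in> {0..1}" using that r0 r2 i by auto
        then show ?thesis using nr[of s] close(1)[of s] \<kappa> dist_triangle2[of "\<nu> s" "lam (real j/N)" "lam s"] by simp
      qed
      show "dist (\<nu>' s) (lam (real j/N)) < 4 * \<kappa>" if "s \<in> {r'..r2'}" for s
        proof -
        have "min r r' \<le> s" "s \<le> e" "s \<in> {0..1}" using that r0 r2 i by auto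
        then show ?thesis using nr[of s] close(2)[of s] \<kappa> dist_triangle2[of "\<nu>' s" "lam (real j/N)" "lam s"] by simp
      qed
      show "2 * (4 * \<kappa>) + dist (lam (real j/N)) (lam s) \<le> 9 * \<kappa>" if "min r r' \<le> s" "s \<le> max r2 r2'" for s
        using nr[of s] that r2 by (auto simp: max_def split: if_splits)
    qed (use InvD(3,4)[OF I] r0 r2 i l2 s2 eqz in auto)
  qed
  have "\<exists>j r r' \<sigma>. Inv i j r r' \<sigma>" if "i \<le> N" for i
    using that
  proof (induction i)
    case 0
    have "?P 0 0 (\<lambda>_. p) (\<lambda>_. p)"
      using close(1)[of 0] \<nu>0 \<kappa> by (auto simp: partial_hom_def)
    moreover have "link \<Omega> G 0 0 (\<lambda>_. p)" using epe_homD(4)[OF G] by (auto simp: link_def)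
    moreover have "dist p (lam 0) < 4 * \<kappa>" using close(1)[of 0] \<nu>0 \<kappa> by auto
    ultimately have "Inv 0 0 0 0 (\<lambda>_. p)" unfolding Inv_def by auto
    then show ?case by blast
  next
    case (Suc i)
    then obtain j r r' \<sigma> where I: "Inv i j r r' \<sigma>" by auto
    have iN: "i < N" using Suc by simp
    have ji: "real j/N \<le> real i/N" using InvD(1)[OF I] by (simp add: divide_right_mono)
    have eqz: "lam (real i/N) = lam (real j/N)" using InvD(6)[OF I, of "real i/N"] ji by simp
    have le: "real i/N \<le> real (Suc i)/N" "real (Suc i)/N \<le> 1" using Suc.prems N by (auto simp: divide_right_mono)
    show ?case
    proof (cases "\<exists>s\<in>{real i/N..real (Suc i)/N}. lam s \<noteq> lam (real i/N)")
      case False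
      have "lam s = lam (real j/N)" if "s \<in> {real j/N..real (Suc i)/N}" for s
        using that InvD(6)[OF I, of s] False eqz by (cases "s \<le> real i/N") auto
      then have c: "\<forall>s\<in>{real j/N..real (Suc i)/N}. lam s = lam (real j/N)" by blast
      have "Inv (Suc i) j r r' \<sigma>"
        unfolding Inv_def by (intro conjI InvD(2-5)[OF I] c) (use InvD(1)[OF I] in simp)
      then show ?thesis by blast
    next
      case True
      then obtain s where s: "s \<in> {real i/N..real (Suc i)/N}" "lam s \<noteq> lam (real i/N)" by blast
      obtain r2 r2' \<sigma>2 where r2: "real i/N < r2" "r2 < real (Suc i)/N" "real i/N < r2'" "r2' < real (Suc i)/N" "link \<Omega> G r2 r2' \<sigma>2"
        and s2: "\<And>t. t \<in> {0..1} \<Longrightarrow> dist (\<sigma>2 t) (lam (real i/N)) < 3 * \<kappa>"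
        using links[OF iN s(1) _ s(2)] le by (metis atLeastAtMost_iff order_refl)
      have rr: "r \<le> real i/N" "r' \<le> real i/N" using InvD(5)[OF I] ji by auto
      have o: "dist (lam (real i/N)) (lam s) < \<kappa>" if "s \<in> {real i/N..real (Suc i)/N}" for s
        using osc[OF iN _ that] le by auto
      have "\<exists>F. ?P r2 r2' \<sigma>2 F"
      proof (rule step[OF I, where e = "real (Suc i)/N"])
        show "dist (\<sigma>2 t) (lam (real i/N)) < 4 * \<kappa>" if "t \<in> {0..1}" for t using s2[OF that] \<kappa> by linarith
      qed (use iN le r2 rr o in auto)
      moreover have "dist (\<sigma>2 t) (lam (real (Suc i)/N)) < 4 * \<kappa>" if "t \<in> {0..1}" for t
        using s2[OF that] o[of "real (Suc i)/N"] le dist_triangle[of "\<sigma>2 t" "lam (real (Suc i)/N)" "lam (real i/N)"] by auto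
      ultimately have "Inv (Suc i) (Suc i) r2 r2' \<sigma>2" unfolding Inv_def using r2 by auto
      then show ?thesis by blast
    qed
  qed
  then obtain j r r' \<sigma> where I: "Inv N j r r' \<sigma>" by blast
  have jN: "real j/N \<le> 1" using InvD(1)[OF I] N by simp
  have NN: "real N/N = 1" using N by simp
  \<comment> \<open>The right edge of the square is a trivial link and closes the last cell, which
    may be long if \<open>lam\<close> is constant towards the end.\<close>
  have "\<exists>F. ?P 1 1 (\<lambda>_. q) F"
  proof (rule step[OF I, where e = 1])
    show "r < 1" "r' < 1" using InvD(5)[OF I] jN by auto
    show "link \<Omega> G 1 1 (\<lambda>_. q)" using epe_homD(5)[OF G] by (auto simp: link_def)
    show "dist q (lam (real N/N)) < 4 * \<kappa>" using close(2)[of 1] \<nu>0 \<kappa> NN by auto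
    show "dist (lam (real N/N)) (lam s) < \<kappa>" if "s \<in> {real N/N..1}" for s using that NN \<kappa> by auto
  qed (use NN in auto)
  then obtain F where F: "?P 1 1 (\<lambda>_. q) F" by blast
  have sqeq: "{z \<in> sq. fst z \<le> (1 - snd z) * 1 + snd z * 1} = sq" by auto
  have Fd: "continuous_on sq F" "\<And>s. s \<in> {0..1} \<Longrightarrow> F (s,0) = \<nu> s" "\<And>s. s \<in> {0..1} \<Longrightarrow> F (s,1) = \<nu>' s"
    "\<And>t. t \<in> {0..1} \<Longrightarrow> F (0,t) = p" "\<And>t. t \<in> {0..1} \<Longrightarrow> F (1,t) = q"
    "\<And>s t. 0 < t \<Longrightarrow> t < 1 \<Longrightarrow> 0 < s \<Longrightarrow> s < 1 \<Longrightarrow> F (s,t) \<in> \<Omega>"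
    "\<And>s t. t \<in> {0..1} \<Longrightarrow> s \<in> {0..1} \<Longrightarrow> dist (F (s,t)) (lam s) \<le> 9 * \<kappa>"
    using F unfolding partial_hom_def sqeq by auto
  have "epe_hom \<Omega> p q \<nu> \<nu>' F"
  proof (rule epe_homI)
    show "F (s,t) \<in> \<Omega>" if "0 < s" "s < 1" "t \<in> {0..1}" for s t
    proof -
      have "\<nu> s \<in> \<Omega>" "\<nu>' s \<in> \<Omega>" 
        using epe_homD(2,3)[OF G, of s] epe_homD(6)[OF G, of s 0] epe_homD(6)[OF G, of s 1] that by auto
      moreover have "t = 0 \<or> t = 1 \<or> 0 < t \<and> t < 1" using that(3) by auto
      ultimately show ?thesis using Fd(2)[of s] Fd(3)[of s] Fd(6)[of t s] that by auto
    qed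
  qed (use Fd in auto)
  then show ?thesis using Fd(7) by auto
qed

text \<open>The homotopies are stacked over time intervals of length 1, and the half-line of times
  is compressed to [0,1) by the inverse of t/(1-t). Continuity at t = 1 holds because the k-th piece
  stays within \<open>e k\<close> of \<open>lam\<close>.\<close>

lemma limit_in_class:
  assumes \<gamma>: "epeh \<Omega> p q \<gamma> (\<nu> 0)" and F: "\<And>k. epe_hom \<Omega> p q (\<nu> k) (\<nu> (Suc k)) (F k)"
    and e: "e \<longlonglongrightarrow> (0::real)" "\<And>k z. z \<in> sq \<Longrightarrow> dist (F k z) (lam (fst z)) \<le> e k"
    and lam: "path lam"
  shows "lam \<in> closure_class \<Omega> p q \<gamma>"
proof -
  obtain F0 where F0: "epe_hom \<Omega> p q \<gamma> (\<nu> 0) F0" using \<gamma> by (auto simp: epeh_def)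
  \<comment> \<open>Indices are shifted by one: piece 0 leads from \<gamma> to
    \<open>\<nu> 0\<close>, and piece \<open>Suc k\<close> is \<open>F k\<close>.\<close>
  define E where "E = (\<lambda>k. case k of 0 \<Rightarrow> F0 | Suc k \<Rightarrow> F k)"
  define m where "m = (\<lambda>k. case k of 0 \<Rightarrow> \<gamma> | Suc k \<Rightarrow> \<nu> k)"
  have E: "epe_hom \<Omega> p q (m k) (m (Suc k)) (E k)" for k
    using F0 F by (auto simp: E_def m_def split: nat.splits)
  define Z where "Z = (\<lambda>z::real\<times>real. E (nat \<lfloor>snd z\<rfloor>) (fst z, snd z - \<lfloor>snd z\<rfloor>))"
  have Zk: "Z (s,T) = E k (s, T - k)" if "real k \<le> T" "T \<le> Suc k" "s \<in> {0..1}" for s T k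
  proof (cases "T = Suc k")
    case True
    moreover have "nat (1 + int k) = Suc k" by simp
    ultimately have "Z (s,T) = E (Suc k) (s,0)" by (simp add: Z_def)
    also have "\<dots> = E k (s,1)" using epe_homD(3)[OF E[of k] that(3)] epe_homD(2)[OF E[of "Suc k"] that(3)] by simp
    finally show ?thesis using True by simp
  next
    case False
    then have "\<lfloor>T\<rfloor> = int k" using that by linarith
    then show ?thesis by (simp add: Z_def)
  qed
  have contZ: "continuous_on ({0..1} \<times> {0..real n}) Z" for n
  proof (induction n)
    case 0
    have "continuous_on ({0..1} \<times> {0}) (\<lambda>z. E 0 (fst z, snd z))"
      by (intro continuous_on_compose2[OF epe_homD(1)[OF E]] continuous_intros) auto
    moreover have "Z z = E 0 (fst z, snd z)" if "z \<in> {0..1} \<times> {0}" for z using that by (auto simp: Z_def)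
    ultimately have "continuous_on ({0..1} \<times> {0}) Z" by (metis (no_types, lifting) continuous_on_cong)
    then show ?case by simp
  next
    case (Suc n)
    have "continuous_on ({0..1} \<times> {real n..Suc n}) (\<lambda>z. E n (fst z, snd z - n))"
      by (intro continuous_on_compose2[OF epe_homD(1)[OF E]] continuous_intros) auto
    moreover have "Z z = E n (fst z, snd z - n)" if "z \<in> {0..1} \<times> {real n..Suc n}" for z using that Zk[of n "snd z" "fst z"] by auto
    ultimately have "continuous_on ({0..1} \<times> {real n..Suc n}) Z" by (metis (no_types, lifting) continuous_on_cong)
    then have "continuous_on ({0..1} \<times> {0..real n} \<union> {0..1} \<times> {real n..Suc n}) Z"
      using Suc by (intro continuous_on_closed_Un) (auto intro: closed_Times)
    moreover have "{0..1::real} \<times> {0..real n} \<union> {0..1} \<times> {real n..Suc n} = {0..1} \<times> {0..real (Suc n)}" by auto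
    ultimately show ?case by simp
  qed
  have Zp: "Z (0,T) = p" "Z (1,T) = q" if "0 \<le> T" for T
  proof -
    have "T - \<lfloor>T\<rfloor> \<in> {0..1}" by simp linarith
    then show "Z (0,T) = p" "Z (1,T) = q" using epe_homD(4,5)[OF E] by (auto simp: Z_def)
  qed
  have Z\<Omega>: "Z (s,T) \<in> \<Omega>" if "0 < s" "s < 1" "0 \<le> T" for s T
  proof -
    have "T - \<lfloor>T\<rfloor> \<in> {0..1}" by simp linarith
    then show ?thesis using epe_homD(6)[OF E that(1,2)] by (auto simp: Z_def)
  qed
  have Zd: "dist (Z (s,T)) (lam s) \<le> e k" if "real (Suc k) \<le> T" "T \<le> Suc (Suc k)" "s \<in> {0..1}" for s T k
    using Zk[OF that] e(2)[of "(s, T - Suc k)" k] that by (auto simp: E_def)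
  define h where "h = (\<lambda>z. if snd z = 1 then lam (fst z) else Z (fst z, snd z / (1 - snd z)))"
  have lamc: "continuous_on {0..1} lam" using lam by (simp add: path_def)
  have conth: "continuous_on sq h"
    unfolding continuous_on_eq_continuous_within
  proof
    fix z0 assume z0: "z0 \<in> sq"
    show "continuous (at z0 within sq) h"
    proof (cases "snd z0 = 1")
      case False
      then have t0: "snd z0 < 1" using z0 by auto
      define t1 where "t1 = (snd z0 + 1)/2"
      have t1: "snd z0 < t1" "t1 < 1" using t0 by (auto simp: t1_def)
      let ?N = "{z::real\<times>real. snd z < t1}"
      have oN: "open ?N" by (intro open_Collect_less continuous_intros)
      obtain n where n: "t1 / (1 - t1) \<le> real n" using real_arch_simple by blast
      have "continuous_on (sq \<inter> ?N) (\<lambda>z. Z (fst z, snd z / (1 - snd z)))"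
      proof (rule continuous_on_compose2[OF contZ[of n]])
        show "continuous_on (sq \<inter> ?N) (\<lambda>z. (fst z, snd z / (1 - snd z)))"
          using t1 by (intro continuous_intros) auto
        have "t / (1 - t) \<le> real n" if "0 \<le> t" "t < t1" for t
        proof -
          have "t / (1 - t) \<le> t1 / (1 - t1)" using that t1 by (intro frac_le) auto
          then show ?thesis using n by simp
        qed
        then show "(\<lambda>z. (fst z, snd z / (1 - snd z))) ` (sq \<inter> ?N) \<subseteq> {0..1} \<times> {0..real n}"
          using t1 by auto
      qed
      moreover have "h z = Z (fst z, snd z / (1 - snd z))" if "z \<in> sq \<inter> ?N" for z using that t1 by (auto simp: h_def)
      ultimately have "continuous_on (sq \<inter> ?N) h" by (metis (no_types, lifting) continuous_on_cong)
      then have "continuous (at z0 within sq \<inter> ?N) h"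
        using z0 t1 by (auto simp: continuous_on_eq_continuous_within)
      moreover have "at z0 within sq \<inter> ?N = at z0 within sq"
        using t1 oN by (intro at_within_nhd[of _ ?N]) auto
      ultimately show ?thesis by simp
    next
      case True
      have s0: "fst z0 \<in> {0..1}" using z0 by auto
      show ?thesis
        unfolding continuous_within_eps_delta
      proof (intro allI impI)
        fix d :: real assume d: "0 < d"
        obtain K where K: "\<And>k. k \<ge> K \<Longrightarrow> \<bar>e k\<bar> < d/2"
          using LIMSEQ_D[OF e(1), of "d/2"] d by auto
        obtain d1 where d1: "d1 > 0" "\<And>u v. u \<in> {0..1} \<Longrightarrow> v \<in> {0..1} \<Longrightarrow> \<bar>u - v\<bar> < d1 \<Longrightarrow> dist (lam u) (lam v) < d/2"
          using uniform_modulus[OF lamc, of "d/2"] d by (metis half_gt_zero)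
        \<comment> \<open>For t > 1 - d2 the stacked time t/(1-t) is at least \<open>K + 1\<close>,
          so it falls into some \<open>F k\<close> with \<open>k \<ge> K\<close>.\<close>
        define d2 where "d2 = 1 / (real K + 3)"
        have d2: "0 < d2" by (simp add: d2_def)
        show "\<exists>d'>0. \<forall>z\<in>sq. dist z z0 < d' \<longrightarrow> dist (h z) (h z0) < d"
        proof (intro exI[of _ "min d1 d2"] conjI ballI impI)
          fix z assume z: "z \<in> sq" "dist z z0 < min d1 d2"
          have "\<bar>fst z - fst z0\<bar> < d1" "\<bar>snd z - 1\<bar> < d2"
            using z(2) dist_fst_le[of z z0] dist_snd_le[of z z0] True by (auto simp: dist_real_def)
          then have l: "dist (lam (fst z)) (lam (fst z0)) < d/2" using z s0 by (intro d1) auto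
          have h0: "h z0 = lam (fst z0)" using True by (simp add: h_def)
          have "dist (h z) (lam (fst z)) < d/2"
          proof (cases "snd z = 1")
            case False
            then have t: "0 \<le> snd z" "snd z < 1" "1 - d2 < snd z" using z \<open>\<bar>snd z - 1\<bar> < d2\<close> by auto
            let ?T = "snd z / (1 - snd z)"
            have "real K + 1 \<le> ?T"
            proof -
              have "(real K + 3) * (1 - snd z) < 1"
                using t by (simp add: d2_def field_simps)
              then have "(real K + 1) * (1 - snd z) \<le> snd z" using t by (simp add: algebra_simps)
              then show ?thesis using t by (simp add: pos_le_divide_eq)
            qed
            then obtain k where k: "real (Suc k) \<le> ?T" "?T \<le> Suc (Suc k)" "k \<ge> K"
            proof -
              have "\<lfloor>?T\<rfloor> \<ge> int K + 1" using \<open>real K + 1 \<le> ?T\<close> by (simp add: le_floor_iff)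
              then show ?thesis
                by (intro that[of "nat \<lfloor>?T\<rfloor> - 1"]) (auto simp: of_nat_diff, linarith+)
            qed
            have "dist (h z) (lam (fst z)) \<le> e k"
              using Zd[OF k(1,2), of "fst z"] z False by (auto simp: h_def)
            also have "\<dots> < d/2" using K[OF k(3)] by simp
            finally show ?thesis .
          qed (use d in \<open>auto simp: h_def\<close>)
          then show "dist (h z) (h z0) < d"
            using l h0 dist_triangle_half_l by (metis dist_commute)
        qed (use d1 d2 in auto)
      qed
    qed
  qed
  have "epe_path \<Omega> p q (\<lambda>s. h (s,t))" if t: "t \<in> {0..<1}" for t
  proof -
    have T: "0 \<le> t / (1 - t)" "t \<noteq> 1" using t by auto
    then show ?thesis
      using continuous_slice[OF conth, of t] t Zp[OF T(1)] Z\<Omega>[OF _ _ T(1)]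
      by (auto simp: epe_path_def path_def pathstart_def pathfinish_def h_def)
  qed
  moreover have "\<forall>s\<in>{0..1}. h (s,0) = \<gamma> s"
    using Zk[of 0 0] epe_homD(2)[OF E[of 0]] by (auto simp: h_def m_def)
  moreover have "\<forall>s\<in>{0..1}. h (s,1) = lam s" by (simp add: h_def)
  ultimately show ?thesis using conth lam unfolding closure_class_def by blast
qed

section \<open>Straightening a path as a homotopy\<close>

lemma straighten_eq:
  assumes "a < b"
  shows "straighten g a b s = g (min s a) + (g (max s b) - g b) + max 0 (min 1 ((s - a) / (b - a))) *\<^sub>R (g b - g a)"
proof -
  consider "s < a" | "a \<le> s" "s \<le> b" | "b < s" by linarith
  then show ?thesis
  proof cases
    case 1
    then have "(s - a) / (b - a) < 0" using assms by (simp add: divide_neg_pos)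
    then show ?thesis using 1 assms by (simp add: straighten_def)
  next
    case 2
    then have "0 \<le> (s - a) / (b - a)" "(s - a) / (b - a) \<le> 1" using assms by auto
    then show ?thesis using 2 by (simp add: straighten_def linepath_def algebra_simps)
  next
    case 3
    then have "1 < (s - a) / (b - a)" using assms by simp
    then show ?thesis using 3 assms by (simp add: straighten_def)
  qed
qed

lemma straighten_off: "s \<le> a \<or> b \<le> s \<Longrightarrow> a < b \<Longrightarrow> straighten g a b s = g s"
  by (cases "s = a"; cases "s = b") (auto simp: straighten_def linepath_def)

lemma straighten_on: "a \<le> s \<Longrightarrow> s \<le> b \<Longrightarrow> straighten g a b s = linepath (g a) (g b) ((s - a) / (b - a))"
  by (simp add: straighten_def)

lemma straighten_cont:
  assumes "continuous_on {0..1} g" "0 \<le> a" "a < b" "b \<le> 1"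
  shows "continuous_on {0..1} (straighten g a b)"
proof -
  have "continuous_on {0..1} (\<lambda>s. g (min s a) + (g (max s b) - g b) + max 0 (min 1 ((s - a) / (b - a))) *\<^sub>R (g b - g a))"
    using assms by (intro continuous_intros continuous_on_compose2[OF assms(1)]) auto
  then show ?thesis using straighten_eq[OF assms(3), of g] by presburger
qed

text \<open>As in \<open>straighten_eq\<close>, clamping replaces a case distinction, so continuity
  requires no pasting. That the homotopy does not move \<open>g\<close> outside \<open>[a,b]\<close>
  is recorded because later this part has to stay close to a limit path.\<close>

lemma straighten_hom:
  assumes g: "epe_path \<Omega> p q g" and ab: "0 < a" "a < b" "b < 1"
    and hp: "homotopic_paths \<Omega> (\<lambda>x. g (a + x * (b - a))) (linepath (g a) (g b))"
  obtains J where "epe_hom \<Omega> p q (straighten g a b) g J"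
    "\<And>s t. s \<in> {0..1} \<Longrightarrow> t \<in> {0..1} \<Longrightarrow> s \<le> a \<or> b \<le> s \<Longrightarrow> J (s,t) = g s"
proof -
  obtain k where k: "continuous_on sq k" "k ` sq \<subseteq> \<Omega>" "\<forall>t\<in>{0..1}. k (0,t) = g (a + t * (b - a))"
    "\<forall>t\<in>{0..1}. k (1,t) = linepath (g a) (g b) t"
    "\<forall>x\<in>{0..1}. pathstart (k \<circ> Pair x) = pathstart (\<lambda>x. g (a + x * (b - a))) \<and> pathfinish (k \<circ> Pair x) = pathfinish (\<lambda>x. g (a + x * (b - a)))"
    using hp unfolding homotopic_paths by (auto simp: image_subset_iff_funcset)
  have k0: "k (x,0) = g a" "k (x,1) = g b" if "x \<in> {0..1}" for x
    using k(5) that by (auto simp: pathstart_def pathfinish_def)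
  have gc: "continuous_on {0..1} g" using g by (simp add: epe_path_def path_def)
  define c where "c = (\<lambda>s. max 0 (min 1 ((s - a) / (b - a))))"
  have c01: "c s \<in> {0..1}" for s by (auto simp: c_def)
  define J where "J = (\<lambda>z. g (min (fst z) a) + (g (max (fst z) b) - g b) + (k (1 - snd z, c (fst z)) - g a))"
  have cont: "continuous_on sq J"
    unfolding J_def
  proof (intro continuous_intros continuous_on_compose2[OF gc] continuous_on_compose2[OF k(1)])
    show "continuous_on sq (\<lambda>x. c (fst x))" unfolding c_def using ab by (intro continuous_intros) auto
  qed (use ab c01 in auto)
  have J1: "J (s,t) = g s" if "s \<in> {0..1}" "t \<in> {0..1}" "s \<le> a \<or> b \<le> s" for s t
    using that(3)
  proof
    assume "s \<le> a"
    then have "c s = 0" using ab by (simp add: c_def divide_nonpos_pos)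
    then show ?thesis using \<open>s \<le> a\<close> ab that k0[of "1 - t"] by (simp add: J_def)
  next
    assume "b \<le> s"
    then have "c s = 1" using ab by (simp add: c_def)
    then show ?thesis using \<open>b \<le> s\<close> ab that k0[of "1 - t"] by (simp add: J_def)
  qed
  have J2: "J (s,t) = k (1 - t, (s - a) / (b - a))" if "a \<le> s" "s \<le> b" for s t
    using that ab by (auto simp: J_def c_def min_def max_def)
  have q01: "(s - a) / (b - a) \<in> {0..1}" if "a \<le> s" "s \<le> b" for s
    using that ab by auto
  have "epe_hom \<Omega> p q (straighten g a b) g J"
  proof (rule epe_homI[OF cont])
    show "J (s,0) = straighten g a b s" if "s \<in> {0..1}" for s
    proof (cases "a \<le> s \<and> s \<le> b")
      case True
      then show ?thesis using J2[of s 0] k(4) q01[of s] straighten_on[of a s b g] by simp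
    next
      case False
      then show ?thesis using J1[of s 0] straighten_off[of s a b g] that ab by auto
    qed
    show "J (s,1) = g s" if "s \<in> {0..1}" for s
    proof (cases "a \<le> s \<and> s \<le> b")
      case True
      then have "J (s,1) = g (a + (s - a) / (b - a) * (b - a))" using J2[of s 1] k(3) q01[of s] by simp
      then show ?thesis using ab by simp
    next
      case False
      then show ?thesis using J1[of s 1] that by auto
    qed
    show "J (0,t) = p" "J (1,t) = q" if "t \<in> {0..1}" for t
      using J1[of 0 t] J1[of 1 t] that ab g by (auto simp: epe_path_def pathstart_def pathfinish_def)
    show "J (s,t) \<in> \<Omega>" if "0 < s" "s < 1" "t \<in> {0..1}" for s t
    proof (cases "a \<le> s \<and> s \<le> b")
      case True
      then have "(1 - t, (s - a) / (b - a)) \<in> sq" using that(3) q01[of s] by auto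
      then show ?thesis using True J2[of s t] k(2) by auto
    next
      case False
      then show ?thesis using J1[of s t] that g by (auto simp: epe_path_def)
    qed
  qed
  then show ?thesis using that J1 by blast
qed

text \<open>This is \<open>leaf\<close> for a continuum that touches the lower edge twice, applied
  on the strip 0 < s < 1, where \<open>H\<close> has its values in \<Omega> up to and including both
  horizontal edges.\<close>

lemma level_straighten:
  assumes \<Omega>: "open \<Omega>" and H: "epe_hom \<Omega> p q g g' H" and u: "norm (u::complex) = 1"
    and D: "compact D" "connected D" "D \<subseteq> {0<..<1} \<times> {0..1}" "\<And>z. z \<in> D \<Longrightarrow> u \<bullet> H z = v"
    and ab: "(a,0) \<in> D" "(b,0) \<in> D" "a < b"
  obtains J where "epe_hom \<Omega> p q (straighten g a b) g J"
    "\<And>s t. s \<in> {0..1} \<Longrightarrow> t \<in> {0..1} \<Longrightarrow> s \<le> a \<or> b \<le> s \<Longrightarrow> J (s,t) = g s"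
proof -
  let ?S = "{0<..<1::real} \<times> {0..1::real}"
  have ab01: "0 < a" "b < 1" using D(3) ab by auto
  have S: "convex ?S" by (intro convex_Times) auto
  have HS: "continuous_on ?S H" using epe_homD(1)[OF H] by (rule continuous_on_subset) auto
  have H\<Omega>: "H ` ?S \<subseteq> \<Omega>" using epe_homD(6)[OF H] by auto
  have seg: "path_image (linepath (a,0) (b,0)) \<subseteq> ?S"
    unfolding path_image_linepath by (rule closed_segment_subset) (use S D(3) ab in blast)+
  have hp: "homotopic_paths \<Omega> (H \<circ> linepath (a,0) (b,0)) (linepath (H (a,0)) (H (b,0)))"
    by (rule leaf[OF \<Omega> S HS H\<Omega> D(1-3) u D(4) ab(1,2)]) (use seg in auto)
  have g: "epe_path \<Omega> p q g" using epeh_path epeh_sym H unfolding epeh_def by blast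
  have eq: "(H \<circ> linepath (a,0) (b,0)) x = g (a + x * (b - a))" if "x \<in> {0..1}" for x
  proof -
    have "linepath (a,0) (b,0) x = (a + x * (b - a), 0)" by (simp add: linepath_def algebra_simps)
    moreover have "a + x * (b - a) \<in> {0..1}"
    proof -
      have "0 \<le> x * (b - a)" "x * (b - a) \<le> b - a" using that ab(3) mult_right_mono[of x 1 "b - a"] by auto
      then show ?thesis using ab01 by auto
    qed
    ultimately show ?thesis using epe_homD(2)[OF H] by (metis o_apply)
  qed
  have Hab: "H (a,0) = g a" "H (b,0) = g b" using epe_homD(2)[OF H] ab01 ab(3) by auto
  have "homotopic_paths \<Omega> (\<lambda>x. g (a + x * (b - a))) (H \<circ> linepath (a,0) (b,0))"
  proof (rule homotopic_paths_eq)
    have "path (H \<circ> linepath (a,0) (b,0))" "path_image (H \<circ> linepath (a,0) (b,0)) \<subseteq> \<Omega>"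
      using hp homotopic_paths_imp_path homotopic_paths_imp_subset by blast+
    moreover have "path (\<lambda>x. g (a + x * (b - a))) \<longleftrightarrow> path (H \<circ> linepath (a,0) (b,0))"
      unfolding path_def using eq by (intro continuous_on_cong) auto
    moreover have "path_image (\<lambda>x. g (a + x * (b - a))) = path_image (H \<circ> linepath (a,0) (b,0))"
      unfolding path_image_def using eq by (intro image_cong) auto
    ultimately show "path (\<lambda>x. g (a + x * (b - a)))" "path_image (\<lambda>x. g (a + x * (b - a))) \<subseteq> \<Omega>" by auto
  qed (use eq in auto)
  then have "homotopic_paths \<Omega> (\<lambda>x. g (a + x * (b - a))) (linepath (g a) (g b))"
    using hp homotopic_paths_trans Hab by metis
  then show ?thesis using straighten_hom[OF g ab01(1) ab(3) ab01(2)] that by blast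
qed

lemma level_straighten_epeh:
  assumes "open \<Omega>" "epe_hom \<Omega> p q g g' H" "norm (u::complex) = 1"
    "compact D" "connected D" "D \<subseteq> {0<..<1} \<times> {0..1}" "\<And>z. z \<in> D \<Longrightarrow> u \<bullet> H z = v"
    "(a,0) \<in> D" "(b,0) \<in> D" "a < b"
  shows "epeh \<Omega> p q (straighten g a b) g"
  unfolding epeh_def by (rule level_straighten[OF assms]) (assumption | rule exI)+

section \<open>Level sets from one end of a homotopy to the other\<close>

lemma connected_U:
  assumes "\<alpha> \<in> {0..1}" "\<beta> \<in> {0..1}"
  shows "connected ({0..\<alpha>} \<times> {0::real} \<union> {0} \<times> {0..1} \<union> {0..1} \<times> {1} \<union> {1} \<times> {0..1} \<union> {\<beta>..1::real} \<times> {0::real})"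
proof -
  have c: "connected (A \<times> B)" if "connected A" "connected B" for A B :: "real set" using that by (rule connected_Times)
  have U: "connected (A \<union> B)" if "connected A" "connected B" "w \<in> A" "w \<in> B" for A B and w :: "real \<times> real"
    using that by (intro connected_Un) auto
  have 1: "connected ({0..\<alpha>} \<times> {0::real} \<union> {0::real} \<times> {0..1::real})"
    by (rule U[of _ _ "(0,0)"]) (use assms in \<open>auto intro!: c\<close>)
  have 2: "connected (({0..\<alpha>} \<times> {0::real} \<union> {0::real} \<times> {0..1::real}) \<union> {0..1} \<times> {1})"
    by (rule U[OF 1, of _ "(0,1)"]) (auto intro!: c)
  have 3: "connected (({0..\<alpha>} \<times> {0::real} \<union> {0::real} \<times> {0..1::real}) \<union> {0..1} \<times> {1} \<union> {1} \<times> {0..1})"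
    by (rule U[OF 2, of _ "(1,1)"]) (auto intro!: c)
  show ?thesis
    by (rule U[OF 3, of _ "(1,0)"]) (use assms in \<open>auto intro!: c\<close>)
qed

text \<open>The separating continuum of level \<open>v\<close> meets the lower edge between \<alpha>
  and \<beta> and also the complementary arc of the boundary. It avoids the vertical edges because
  \<open>v\<close> differs from the values at \<open>p\<close> and \<open>q\<close>. So it either
  reaches the upper edge or returns to the lower edge beyond \<alpha> or \<beta>; in the latter case
  straightening between the two contacts skips that point.\<close>

lemma cross_or_bump:
  assumes \<Omega>: "open \<Omega>" and H: "epe_hom \<Omega> p q g g' H" and u: "norm (u::complex) = 1"
    and ab: "\<alpha> \<in> {0..1}" "\<beta> \<in> {0..1}" "\<alpha> < \<beta>" and v: "u \<bullet> g \<alpha> < v" "v < u \<bullet> g \<beta>" "v \<noteq> u \<bullet> p" "v \<noteq> u \<bullet> q"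
  obtains r \<rho> where "\<alpha> < r" "r < \<beta>" "0 < \<rho>" "\<rho> < 1" "u \<bullet> g r = v" "u \<bullet> g' \<rho> = v"
      "homotopic_paths \<Omega> (H \<circ> linepath (r,0) (\<rho>,1)) (linepath (g r) (g' \<rho>))"
  | a b s where "0 < a" "a < s" "s < b" "b < 1" "s = \<alpha> \<or> s = \<beta>" "u \<bullet> g a = v" "u \<bullet> g b = v"
      "epeh \<Omega> p q (straighten g a b) g"
proof -
  note cross = that(1) and bump = that(2)
  let ?S = "{0<..<1::real} \<times> {0..1::real}"
  have Hb: "H (s,0) = g s" "H (s,1) = g' s" if "s \<in> {0..1}" for s using epe_homD(2,3)[OF H that] by auto
  have contf: "continuous_on sq (\<lambda>z. u \<bullet> H z)" using epe_homD(1)[OF H] by (intro continuous_intros)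
  define C where "C = connected_component_set {z \<in> sq. u \<bullet> H z \<le> v} (\<alpha>,0)"
  have aC: "(\<alpha>,0) \<in> C" using ab v Hb by (auto simp: C_def intro!: connected_component_refl)
  have bC: "(\<beta>,0) \<notin> C"
    using connected_component_subset[of "{z \<in> sq. u \<bullet> H z \<le> v}" "(\<alpha>,0)"] v Hb ab by (force simp: C_def)
  obtain D where D: "compact D" "connected D" "D \<subseteq> C" "\<And>z. z \<in> D \<Longrightarrow> u \<bullet> H z = v"
    and hit: "\<And>\<Gamma>. connected \<Gamma> \<Longrightarrow> \<Gamma> \<subseteq> sq \<Longrightarrow> (\<beta>,0) \<in> \<Gamma> \<Longrightarrow> \<Gamma> \<inter> C \<noteq> {} \<Longrightarrow> \<Gamma> \<inter> D \<noteq> {}"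
    by (rule level_separation[OF sq_convex sq_compact contf _ _ _ C_def bC]) (use ab v Hb in \<open>auto simp: less_imp_le\<close>)
  have Dsq: "D \<subseteq> sq" using D(3) connected_component_subset[of "{z \<in> sq. u \<bullet> H z \<le> v}" "(\<alpha>,0)"] by (auto simp: C_def)
  have DS: "D \<subseteq> ?S"
  proof
    fix z assume z: "z \<in> D"
    obtain x t where xt: "z = (x,t)" "x \<in> {0..1}" "t \<in> {0..1}" using Dsq z by (cases z) auto
    have "x \<noteq> 0" "x \<noteq> 1" using D(4)[OF z] v epe_homD(4,5)[OF H xt(3)] xt(1) by auto
    then show "z \<in> ?S" using xt by auto
  qed
  have "({\<alpha>..\<beta>} \<times> {0}) \<inter> D \<noteq> {}"
  proof (intro hit)
    have "(\<alpha>,0) \<in> {\<alpha>..\<beta>} \<times> {0} \<inter> C" using ab aC by auto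
    then show "{\<alpha>..\<beta>} \<times> {0} \<inter> C \<noteq> {}" by blast
  qed (use ab in \<open>auto intro!: connected_Times\<close>)
  then obtain r where r: "\<alpha> \<le> r" "r \<le> \<beta>" "(r,0) \<in> D" by auto
  have gr: "u \<bullet> g r = v" using D(4)[OF r(3)] Hb[of r] r ab by auto
  then have r': "\<alpha> < r" "r < \<beta>" using r v by (auto simp: less_le)
  let ?\<Gamma> = "{0..\<alpha>} \<times> {0} \<union> {0} \<times> {0..1} \<union> {0..1} \<times> {1} \<union> {1} \<times> {0..1} \<union> {\<beta>..1} \<times> {0}"
  have "?\<Gamma> \<inter> D \<noteq> {}"
  proof (intro hit connected_U)
    have "(\<alpha>,0) \<in> ?\<Gamma> \<inter> C" using ab aC by auto
    then show "?\<Gamma> \<inter> C \<noteq> {}" by blast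
  qed (use ab in auto)
  then obtain x t where w: "(x,t) \<in> ?\<Gamma>" "(x,t) \<in> D" by (metis Int_emptyI prod.exhaust)
  have xS: "0 < x" "x < 1" using w(2) DS by auto
  have fin: thesis if xt: "x \<le> \<alpha>" "t = 0"
  proof -
    have gx: "u \<bullet> g x = v" using D(4)[OF w(2)] Hb[of x] xS xt by auto
    have xD: "(x,0) \<in> D" "x < r" using w(2) xt r' by auto
    have "epeh \<Omega> p q (straighten g x r) g"
      by (rule level_straighten_epeh[OF \<Omega> H u D(1,2) DS D(4) xD(1) r(3) xD(2)])
    moreover have "x < \<alpha>" using gx v(1) xt by (cases "x = \<alpha>") auto
    moreover have "r < 1" using r' ab by auto
    ultimately show ?thesis
      using xt r' gr gx xS ab by (intro bump[of x \<alpha> r]) auto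
  qed
  have fin2: thesis if xt: "\<beta> \<le> x" "t = 0"
  proof -
    have gx: "u \<bullet> g x = v" using D(4)[OF w(2)] Hb[of x] xS xt by auto
    have xD: "(x,0) \<in> D" "r < x" using w(2) xt r' by auto
    have "epeh \<Omega> p q (straighten g r x) g"
      by (rule level_straighten_epeh[OF \<Omega> H u D(1,2) DS D(4) r(3) xD])
    moreover have "\<beta> < x" using gx v(2) xt by (cases "x = \<beta>") auto
    moreover have "0 < r" using r' ab by auto
    ultimately show ?thesis
      using xt r' gr gx xS ab by (intro bump[of r \<beta> x]) auto
  qed
  have fin3: thesis if xt: "t = 1"
  proof -
    have gx: "u \<bullet> g' x = v" using D(4)[OF w(2)] Hb[of x] xS xt by auto
    have S: "convex ?S" by (intro convex_Times) auto
    have HS: "continuous_on ?S H" using epe_homD(1)[OF H] by (rule continuous_on_subset) auto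
    have H\<Omega>: "H ` ?S \<subseteq> \<Omega>" using epe_homD(6)[OF H] by auto
    have seg: "path_image (linepath (r,0) (x,1)) \<subseteq> ?S"
      unfolding path_image_linepath by (rule closed_segment_subset) (use S DS w(2) r(3) xt in blast)+
    have "homotopic_paths \<Omega> (H \<circ> linepath (r,0) (x,1)) (linepath (H (r,0)) (H (x,1)))"
      by (rule leaf[OF \<Omega> S HS H\<Omega> D(1,2) DS u D(4)]) (use seg r(3) w(2) xt in auto)
    then have "homotopic_paths \<Omega> (H \<circ> linepath (r,0) (x,1)) (linepath (g r) (g' x))"
      using Hb[of r] Hb[of x] xS r ab by auto
    then show ?thesis using r' xS gr gx by (intro cross[of r x]) auto
  qed
  show ?thesis using w(1) fin fin2 fin3 xS by auto
qed

definition small_hom :: "complex set \<Rightarrow> complex \<Rightarrow> complex \<Rightarrow> (real \<Rightarrow> complex) \<Rightarrow> real \<Rightarrow> (real \<Rightarrow> complex) \<Rightarrow> (real \<Rightarrow> complex) \<Rightarrow> bool" where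
  "small_hom \<Omega> p q lam \<kappa> g g' \<longleftrightarrow> (\<exists>F. epe_hom \<Omega> p q g g' F \<and> (\<forall>z\<in>sq. dist (F z) (lam (fst z)) \<le> \<kappa>))"

text \<open>For each tolerance one may pass to a subsequence whose members are pairwise joined by
  homotopies near \<open>lam\<close>. The diagonal sequence does this for all tolerances 1/(k+1) at
  once, and its consecutive terms feed \<open>limit_in_class\<close>.\<close>

lemma class_of_limit:
  fixes \<nu> :: "nat \<Rightarrow> real \<Rightarrow> complex"
  assumes \<nu>: "\<And>n. epeh \<Omega> p q \<gamma> (\<nu> n)" and lam: "path lam"
    and sm: "\<And>\<kappa> (\<psi>::nat \<Rightarrow> nat). 0 < \<kappa> \<Longrightarrow> strict_mono \<psi> \<Longrightarrow> \<exists>\<psi>'::nat \<Rightarrow> nat. strict_mono \<psi>' \<and> (\<forall>n m. small_hom \<Omega> p q lam \<kappa> (\<nu> (\<psi> (\<psi>' n))) (\<nu> (\<psi> (\<psi>' m))))"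
  shows "lam \<in> closure_class \<Omega> p q \<gamma>"
proof -
  define P where "P = (\<lambda>(k::nat) (s::nat \<Rightarrow> nat). \<forall>n m. small_hom \<Omega> p q lam (1 / real (Suc k)) (\<nu> (s n)) (\<nu> (s m)))"
  interpret subseqs P
  proof
    fix n and s :: "nat \<Rightarrow> nat" assume "strict_mono s"
    then show "\<exists>r'. strict_mono r' \<and> P n (s \<circ> r')" using sm[of "1 / real (Suc n)" s] by (auto simp: P_def)
  qed
  have dia: "P k (diagseq \<circ> ((+) (Suc k)))" for k
    by (rule diagseq_holds) (auto simp: P_def)
  define \<mu> where "\<mu> = (\<lambda>k. \<nu> (diagseq (Suc k)))"
  have "small_hom \<Omega> p q lam (1 / real (Suc k)) (\<mu> k) (\<mu> (Suc k))" for k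
  proof -
    have "P k s \<Longrightarrow> small_hom \<Omega> p q lam (1 / real (Suc k)) (\<nu> (s 0)) (\<nu> (s 1))" for s by (simp add: P_def)
    from this[OF dia] show ?thesis by (simp add: \<mu>_def)
  qed
  then obtain F where F: "\<And>k. epe_hom \<Omega> p q (\<mu> k) (\<mu> (Suc k)) (F k)"
    "\<And>k z. z \<in> sq \<Longrightarrow> dist (F k z) (lam (fst z)) \<le> 1 / real (Suc k)"
    unfolding small_hom_def by metis
  show ?thesis
  proof (rule limit_in_class[where \<nu> = \<mu> and F = F and e = "\<lambda>k. 1 / real (Suc k)"])
    show "epeh \<Omega> p q \<gamma> (\<mu> 0)" unfolding \<mu>_def by (rule \<nu>)
    show "(\<lambda>k. 1 / real (Suc k)) \<longlonglongrightarrow> 0" by (rule LIMSEQ_Suc[OF lim_1_over_n])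
  qed (use F lam in auto)
qed

section \<open>Directional variations and minimising sequences\<close>

text \<open>The index \<open>j\<close> encodes a rational direction together with a truncation threshold.\<close>

definition dirn :: "nat \<Rightarrow> complex" where
  "dirn j = (case (from_nat (fst (prod_decode j)) :: rat \<times> rat) of (x, y) \<Rightarrow> Complex (of_rat x) (of_rat y))"

definition epsn :: "nat \<Rightarrow> real" where
  "epsn j = 1 / (real (snd (prod_decode j)) + 1)"

definition tv :: "nat \<Rightarrow> (real \<Rightarrow> complex) \<Rightarrow> real" where
  "tv j g = TV (epsn j) (\<lambda>s. dirn j \<bullet> g s) 1"

lemma epsn_pos: "0 < epsn j"
  by (simp add: epsn_def)

lemma index_exists: "\<exists>j. dirn j = Complex (of_rat x) (of_rat y) \<and> epsn j = 1 / (real b + 1)"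
proof -
  have "dirn (prod_encode (to_nat (x,y), b)) = Complex (of_rat x) (of_rat y)"
    "epsn (prod_encode (to_nat (x,y), b)) = 1 / (real b + 1)"
    by (simp_all add: dirn_def epsn_def)
  then show ?thesis by blast
qed

lemma cont_inner: "continuous_on {0..1} g \<Longrightarrow> continuous_on {0..1} (\<lambda>s. (u::complex) \<bullet> g s)"
  by (intro continuous_intros)

lemma tv_nonneg: "continuous_on {0..1} g \<Longrightarrow> 0 \<le> tv j g"
  unfolding tv_def by (intro TV_nonneg cont_inner epsn_pos) auto

lemma inner_dist_le: "\<bar>(u::complex) \<bullet> a - u \<bullet> b\<bar> \<le> norm u * dist a b"
  using Cauchy_Schwarz_ineq2[of u "a - b"] by (simp add: inner_diff_right dist_norm)

lemma tv_upper:
  assumes g: "continuous_on {0..1} g" and k: "0 < k"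
  obtains d where "0 < d" "\<And>g'. (\<And>s. s \<in> {0..1} \<Longrightarrow> dist (g s) (g' s) \<le> d) \<Longrightarrow> tv j g' \<le> tv j g + k"
proof -
  obtain d where d: "0 < d" "\<And>f. (\<And>s. s \<in> {0..1} \<Longrightarrow> \<bar>dirn j \<bullet> g s - f s\<bar> \<le> d) \<Longrightarrow> TV (epsn j) f 1 \<le> TV (epsn j) (\<lambda>s. dirn j \<bullet> g s) 1 + k"
    using TV_uniform_upper[OF cont_inner[OF g] epsn_pos k] by metis
  \<comment> \<open>The direction may be zero, hence the added 1.\<close>
  define d' where "d' = d / (norm (dirn j) + 1)"
  have pos: "0 < norm (dirn j) + 1" using norm_ge_zero[of "dirn j"] by linarith
  have d': "0 < d'" "norm (dirn j) * d' \<le> d"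
    using d(1) pos by (auto simp: d'_def field_simps)
  show ?thesis
  proof (rule that[OF d'(1)])
    fix g' assume g': "\<And>s. s \<in> {0..1} \<Longrightarrow> dist (g s) (g' s) \<le> d'"
    show "tv j g' \<le> tv j g + k"
      unfolding tv_def
    proof (rule d(2))
      fix s :: real assume "s \<in> {0..1}"
      then have "norm (dirn j) * dist (g s) (g' s) \<le> norm (dirn j) * d'" using g' by (intro mult_left_mono) auto
      then show "\<bar>dirn j \<bullet> g s - dirn j \<bullet> g' s\<bar> \<le> d"
        using inner_dist_le[of "dirn j" "g s" "g' s"] d'(2) by linarith
    qed
  qed
qed

lemma tv_lower:
  assumes g: "continuous_on {0..1} g" and k: "0 < k"
  obtains d where "0 < d" "\<And>g'. continuous_on {0..1} g' \<Longrightarrow> (\<And>s. s \<in> {0..1} \<Longrightarrow> dist (g s) (g' s) \<le> d) \<Longrightarrow> tv j g - k \<le> tv j g'"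
proof -
  obtain d where d: "0 < d" "\<And>f. continuous_on {0..1} f \<Longrightarrow> (\<And>s. s \<in> {0..1} \<Longrightarrow> \<bar>dirn j \<bullet> g s - f s\<bar> \<le> d) \<Longrightarrow> TV (epsn j) (\<lambda>s. dirn j \<bullet> g s) 1 - k \<le> TV (epsn j) f 1"
    using TV_uniform_lower[OF cont_inner[OF g] epsn_pos k] by metis
  define d' where "d' = d / (norm (dirn j) + 1)"
  have pos: "0 < norm (dirn j) + 1" using norm_ge_zero[of "dirn j"] by linarith
  have d': "0 < d'" "norm (dirn j) * d' \<le> d"
    using d(1) pos by (auto simp: d'_def field_simps)
  show ?thesis
  proof (rule that[OF d'(1)])
    fix g' assume g': "continuous_on {0..1} g'" "\<And>s. s \<in> {0..1} \<Longrightarrow> dist (g s) (g' s) \<le> d'"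
    show "tv j g - k \<le> tv j g'"
      unfolding tv_def
    proof (rule d(2)[OF cont_inner[OF g'(1)]])
      fix s :: real assume "s \<in> {0..1}"
      then have "norm (dirn j) * dist (g s) (g' s) \<le> norm (dirn j) * d'" using g' by (intro mult_left_mono) auto
      then show "\<bar>dirn j \<bullet> g s - dirn j \<bullet> g' s\<bar> \<le> d"
        using inner_dist_le[of "dirn j" "g s" "g' s"] d'(2) by linarith
    qed
  qed
qed

lemma tv_tendsto:
  assumes g: "continuous_on {0..1} g" and gn: "\<And>n. continuous_on {0..1} (gn n)"
    and lim: "\<And>e. 0 < e \<Longrightarrow> \<exists>N. \<forall>n\<ge>N. \<forall>s\<in>{0..1}. dist (gn n s) (g s) < e"
  shows "(\<lambda>n. tv j (gn n)) \<longlonglongrightarrow> tv j g"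
proof (rule LIMSEQ_I)
  fix r :: real assume r: "0 < r"
  obtain d1 where d1: "0 < d1" "\<And>g'. (\<And>s. s \<in> {0..1} \<Longrightarrow> dist (g s) (g' s) \<le> d1) \<Longrightarrow> tv j g' \<le> tv j g + r/2"
    using tv_upper[OF g, of "r/2" j] r by auto
  obtain d2 where d2: "0 < d2" "\<And>g'. continuous_on {0..1} g' \<Longrightarrow> (\<And>s. s \<in> {0..1} \<Longrightarrow> dist (g s) (g' s) \<le> d2) \<Longrightarrow> tv j g - r/2 \<le> tv j g'"
    using tv_lower[OF g, of "r/2" j] r by auto
  obtain N where N: "\<forall>n\<ge>N. \<forall>s\<in>{0..1}. dist (gn n s) (g s) < min d1 d2" using lim[of "min d1 d2"] d1(1) d2(1) by auto
  show "\<exists>no. \<forall>n\<ge>no. norm (tv j (gn n) - tv j g) < r"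
  proof (intro exI[of _ N] allI impI)
    fix n assume "n \<ge> N"
    then have *: "dist (g s) (gn n s) < d1 \<and> dist (g s) (gn n s) < d2" if "s \<in> {0..1}" for s
      using N that by (auto simp: dist_commute)
    have "tv j (gn n) \<le> tv j g + r/2" by (rule d1(2)) (use * in force)
    moreover have "tv j g - r/2 \<le> tv j (gn n)" by (rule d2(2)[OF gn]) (use * in force)
    ultimately show "norm (tv j (gn n) - tv j g) < r" using r by (simp add: abs_less_iff)
  qed
qed

lemma tv_reparam:
  assumes "continuous_on {0..1} g" "mono_on {0..1} h" "h ` {0..1} = {0..1}" "continuous_on {0..1} h"
  shows "tv j (\<lambda>s. g (h s)) = tv j g"
  unfolding tv_def using TV_reparam[OF cont_inner[OF assms(1)] epsn_pos assms(2-4)] by simp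

lemma tv_straighten_le:
  assumes "continuous_on {0..1} g" "0 \<le> a" "a < b" "b \<le> 1"
  shows "tv j (straighten g a b) \<le> tv j g"
  unfolding tv_def inner_straighten by (intro TV_patch_le cont_inner epsn_pos assms)

definition cc_hom :: "complex set \<Rightarrow> complex \<Rightarrow> complex \<Rightarrow> (real \<Rightarrow> complex) \<Rightarrow> (real \<Rightarrow> complex) \<Rightarrow> (real \<times> real \<Rightarrow> complex) \<Rightarrow> bool" where
  "cc_hom \<Omega> p q g lam h \<longleftrightarrow> continuous_on sq h \<and> (\<forall>s\<in>{0..1}. h (s,0) = g s \<and> h (s,1) = lam s) \<and>
     (\<forall>t\<in>{0..1}. h (0,t) = p \<and> h (1,t) = q) \<and> (\<forall>s\<in>{0<..<1}. \<forall>t\<in>{0..<1}. h (s,t) \<in> \<Omega>)"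

lemma cc_homD:
  assumes "cc_hom \<Omega> p q g lam h"
  shows "continuous_on sq h" "\<And>s. s \<in> {0..1} \<Longrightarrow> h (s,0) = g s" "\<And>s. s \<in> {0..1} \<Longrightarrow> h (s,1) = lam s"
    "\<And>t. t \<in> {0..1} \<Longrightarrow> h (0,t) = p" "\<And>t. t \<in> {0..1} \<Longrightarrow> h (1,t) = q"
    "\<And>s t. 0 < s \<Longrightarrow> s < 1 \<Longrightarrow> 0 \<le> t \<Longrightarrow> t < 1 \<Longrightarrow> h (s,t) \<in> \<Omega>"
  using assms unfolding cc_hom_def by auto

lemma cc_hom_exists: "lam \<in> closure_class \<Omega> p q g \<Longrightarrow> \<exists>h. cc_hom \<Omega> p q g lam h"
  by (erule cc_obtain, rule exI) (auto simp: cc_hom_def)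

lemma cc_approx:
  assumes "\<nu> \<in> closure_class \<Omega> p q \<gamma>" "0 < d"
  obtains g where "epeh \<Omega> p q \<gamma> g" "\<And>s. s \<in> {0..1} \<Longrightarrow> dist (\<nu> s) (g s) \<le> d"
proof -
  obtain h where "cc_hom \<Omega> p q \<gamma> \<nu> h" using cc_hom_exists[OF assms(1)] by blast
  note h = cc_homD[OF this]
  have "uniformly_continuous_on sq h" using h(1) sq_compact compact_uniformly_continuous by blast
  then obtain e where e: "e > 0" "\<And>z z'. z \<in> sq \<Longrightarrow> z' \<in> sq \<Longrightarrow> dist z' z < e \<Longrightarrow> dist (h z') (h z) < d"
    using assms(2) unfolding uniformly_continuous_on_def by metis
  define t where "t = max 0 (1 - e/2)"
  have t: "0 \<le> t" "t < 1" "1 - t < e" using e by (auto simp: t_def)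
  show ?thesis
  proof (rule that[of "\<lambda>s. h (s,t)"])
    have "epe_hom \<Omega> p q \<gamma> (\<lambda>s. h (s,t)) (\<lambda>z. h (fst z, t * snd z))"
    proof (rule epe_homI)
      have tt: "0 \<le> t * x \<and> t * x \<le> t" if "0 \<le> x" "x \<le> 1" for x
        using that t by (auto simp: mult_left_le)
      show "continuous_on sq (\<lambda>z. h (fst z, t * snd z))"
        using tt t by (intro continuous_on_compose2[OF h(1)] continuous_intros) force
      show "h (fst (s,x), t * snd (s,x)) \<in> \<Omega>" if "0 < s" "s < 1" "x \<in> {0..1}" for s x
        using tt[of x] that t h(6)[of s "t * x"] by auto
      show "h (fst (0,x), t * snd (0,x)) = p" "h (fst (1,x), t * snd (1,x)) = q" if "x \<in> {0..1}" for x
        using tt[of x] that t h(4)[of "t * x"] h(5)[of "t * x"] by auto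
    qed (use h in auto)
    then show "epeh \<Omega> p q \<gamma> (\<lambda>s. h (s,t))" by (auto simp: epeh_def)
    show "dist (\<nu> s) (h (s,t)) \<le> d" if s: "s \<in> {0..1}" for s
    proof -
      have "dist (h (s,1)) (h (s,t)) < d" using s t by (intro e(2)) (auto simp: dist_Pair_Pair dist_real_def)
      then show ?thesis using h(3)[OF s] by simp
    qed
  qed
qed

text \<open>The path \<open>lam n\<close> minimises \<open>\<Phi> n\<close>, a weighted sum of the
  first \<open>n\<close> variations, up to 1/(n+1). The third conclusion says that late in the
  sequence no variation can be lowered noticeably unless another one rises. The fourth says that the
  limits of the variations cannot be beaten inside the closed class either: by upper semicontinuity
  its members are approximated by competitors whose variations are at most slightly larger.\<close>

lemma minimizing_sequence:
  assumes \<gamma>: "epe_path \<Omega> p q \<gamma>"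
  obtains lam :: "nat \<Rightarrow> real \<Rightarrow> complex" where "\<And>n. epeh \<Omega> p q \<gamma> (lam n)" "\<And>j. \<exists>B. \<forall>n. tv j (lam n) \<le> B"
    "\<And>j \<kappa>. 0 < \<kappa> \<Longrightarrow> \<exists>N. \<forall>n\<ge>N. \<forall>g. epeh \<Omega> p q \<gamma> g \<and> (\<forall>i. tv i g \<le> tv i (lam n)) \<longrightarrow> tv j (lam n) - \<kappa> < tv j g"
    "\<And>(\<psi>::nat \<Rightarrow> nat) L \<nu> j. strict_mono \<psi> \<Longrightarrow> (\<And>j. (\<lambda>n. tv j (lam (\<psi> n))) \<longlonglongrightarrow> L j) \<Longrightarrow> \<nu> \<in> closure_class \<Omega> p q \<gamma> \<Longrightarrow>
       (\<And>j. tv j \<nu> \<le> L j) \<Longrightarrow> tv j \<nu> = L j"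
proof -
  define S where "S = {g. epeh \<Omega> p q \<gamma> g}"
  have \<gamma>S: "\<gamma> \<in> S" using epeh_refl[OF \<gamma>] by (simp add: S_def)
  have Sc: "continuous_on {0..1} g" if "g \<in> S" for g using that epeh_cont by (auto simp: S_def)
  \<comment> \<open>These weights give \<open>\<Phi> n \<gamma> \<le> 2\<close> for every
    \<open>n\<close>, so the increasing infima \<open>m n\<close> stay bounded.\<close>
  define w where "w = (\<lambda>j. 1 / (2^j * (1 + tv j \<gamma>)))"
  have tv0: "0 \<le> tv j g" if "g \<in> S" for j g using tv_nonneg[OF Sc[OF that]] .
  have w: "0 < w j" for j using tv0[OF \<gamma>S, of j] by (simp add: w_def)
  have w\<gamma>: "w j * tv j \<gamma> \<le> (1/2)^j" for j
  proof -
    have "w j * tv j \<gamma> = (1/2)^j * (tv j \<gamma> / (1 + tv j \<gamma>))" by (simp add: w_def power_divide)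
    also have "\<dots> \<le> (1/2)^j * 1" using tv0[OF \<gamma>S, of j] by (intro mult_left_mono) auto
    finally show ?thesis by simp
  qed
  define \<Phi> where "\<Phi> = (\<lambda>n g. \<Sum>j<n. w j * tv j g)"
  have \<Phi>0: "0 \<le> \<Phi> n g" if "g \<in> S" for n g
    unfolding \<Phi>_def using w tv0[OF that] by (intro sum_nonneg mult_nonneg_nonneg) (auto simp: less_imp_le)
  have \<Phi>mono: "\<Phi> n g \<le> \<Phi> n' g" if "n \<le> n'" "g \<in> S" for n n' g
    unfolding \<Phi>_def using that w tv0[OF that(2)] by (intro sum_mono2) (auto simp: less_imp_le)
  have \<Phi>\<gamma>: "\<Phi> n \<gamma> \<le> 2" for n
  proof -
    have "\<Phi> n \<gamma> \<le> (\<Sum>j<n. (1/2)^j)" unfolding \<Phi>_def using w\<gamma> by (intro sum_mono)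
    also have "\<dots> \<le> 2" by (simp add: sum_gp_strict)
    finally show ?thesis .
  qed
  have bdd: "bdd_below (\<Phi> n ` S)" for n using \<Phi>0 by (intro bdd_belowI[of _ 0]) auto
  define m where "m = (\<lambda>n. Inf (\<Phi> n ` S))"
  have m_le: "m n \<le> \<Phi> n g" if "g \<in> S" for n g unfolding m_def using bdd that by (intro cINF_lower)
  have "\<exists>g\<in>S. \<Phi> n g < m n + 1 / (real n + 1)" for n
  proof (rule ccontr)
    assume "\<not> ?thesis"
    then have "m n + 1 / (real n + 1) \<le> m n" unfolding m_def using \<gamma>S
      by (intro cINF_greatest) (auto simp: not_less m_def)
    moreover have "0 < 1 / (real n + 1)" by simp
    ultimately show False by linarith
  qed
  then obtain lam where lam: "\<And>n. lam n \<in> S" "\<And>n. \<Phi> n (lam n) < m n + 1 / (real n + 1)" by metis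
  have m2: "m n \<le> 2" for n using m_le[OF \<gamma>S, of n] \<Phi>\<gamma>[of n] by linarith
  have m_mono: "incseq m"
  proof (rule monoI)
    fix x y :: nat assume "x \<le> y"
    show "m x \<le> m y" unfolding m_def
    proof (rule cINF_mono)
      fix g assume "g \<in> S"
      then show "\<exists>g'\<in>S. \<Phi> x g' \<le> \<Phi> y g" using \<Phi>mono[OF \<open>x \<le> y\<close>] by blast
    qed (use \<gamma>S bdd in auto)
  qed
  have "bdd_above (range m)" using m2 by (intro bdd_aboveI[of _ 2]) auto
  then have mlim: "m \<longlonglongrightarrow> (SUP n. m n)" and msup: "\<And>n. m n \<le> (SUP n. m n)"
    using m_mono by (auto intro: LIMSEQ_incseq_SUP cSUP_upper)
  define M where "M = (SUP n. m n)"
  have term_le: "w j * tv j g \<le> \<Phi> n g" if "j < n" "g \<in> S" for j n g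
    unfolding \<Phi>_def using that w tv0[OF that(2)] by (intro member_le_sum[of j "{..<n}" "\<lambda>j. w j * tv j g"]) (auto simp: less_imp_le)
  show ?thesis
  proof (rule that[of lam])
    show "epeh \<Omega> p q \<gamma> (lam n)" for n using lam(1) by (simp add: S_def)
    show "\<exists>B. \<forall>n. tv j (lam n) \<le> B" for j
    proof -
      have big: "tv j (lam n) \<le> 3 / w j" if "j < n" for n
      proof -
        have "w j * tv j (lam n) \<le> m n + 1 / (real n + 1)" using term_le[OF that lam(1)] lam(2)[of n] by (meson le_less_trans less_imp_le)
        also have "\<dots> \<le> 2 + 1" using m2[of n] by (intro add_mono) (auto simp: field_simps)
        finally show ?thesis using w[of j] by (simp add: field_simps)
      qed
      \<comment> \<open>For \<open>n \<le> j\<close> the j-th variation does not occur in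
        \<open>\<Phi> n\<close>; these finitely many values are covered by the maximum.\<close>
      have "tv j (lam n) \<le> Max (insert (3 / w j) ((\<lambda>n. tv j (lam n)) ` {..j}))" for n
      proof (cases "j < n")
        case True
        then show ?thesis using big by (intro order_trans[OF big[OF True] Max_ge]) auto
      next
        case False
        then show ?thesis by (intro Max_ge) auto
      qed
      then show ?thesis by blast
    qed
    show "\<exists>N. \<forall>n\<ge>N. \<forall>g. epeh \<Omega> p q \<gamma> g \<and> (\<forall>i. tv i g \<le> tv i (lam n)) \<longrightarrow> tv j (lam n) - \<kappa> < tv j g" if \<kappa>: "0 < \<kappa>" for j \<kappa>
    proof -
      obtain N0 where N0: "1 / (real N0 + 1) < w j * \<kappa>"
        using reals_Archimedean[of "w j * \<kappa>"] w[of j] \<kappa> by (auto simp: inverse_eq_divide add.commute)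
      show ?thesis
      proof (intro exI[of _ "max N0 (Suc j)"] allI impI)
        fix n g assume n: "max N0 (Suc j) \<le> n" and g: "epeh \<Omega> p q \<gamma> g \<and> (\<forall>i. tv i g \<le> tv i (lam n))"
        have gS: "g \<in> S" using g by (simp add: S_def)
        show "tv j (lam n) - \<kappa> < tv j g"
        proof (rule ccontr)
          assume "\<not> ?thesis"
          then have "tv j g \<le> tv j (lam n) - \<kappa>" by simp
          then have 1: "w j * tv j g \<le> w j * tv j (lam n) - w j * \<kappa>"
            using mult_left_mono[of "tv j g" "tv j (lam n) - \<kappa>" "w j"] w[of j] by (simp add: algebra_simps)
          have jn: "j \<in> {..<n}" using n by auto
          have "\<Phi> n g = w j * tv j g + (\<Sum>i\<in>{..<n} - {j}. w i * tv i g)"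
            unfolding \<Phi>_def using jn by (intro sum.remove) auto
          also have "\<dots> \<le> (w j * tv j (lam n) - w j * \<kappa>) + (\<Sum>i\<in>{..<n} - {j}. w i * tv i (lam n))"
            using 1 g w by (intro add_mono sum_mono mult_left_mono) (auto simp: less_imp_le)
          also have "\<dots> = \<Phi> n (lam n) - w j * \<kappa>"
            unfolding \<Phi>_def using jn by (subst sum.remove[of _ j]) auto
          also have "\<dots> < m n + 1 / (real n + 1) - w j * \<kappa>" using lam(2)[of n] by simp
          also have "\<dots> \<le> m n"
          proof -
            have "1 / (real n + 1) \<le> 1 / (real N0 + 1)" using n by (intro divide_left_mono) auto
            then show ?thesis using N0 by linarith
          qed
          finally show False using m_le[OF gS, of n] by simp
        qed
      qed
    qed
    show "tv j \<nu> = L j" if \<psi>: "strict_mono \<psi>" and L: "\<And>j. (\<lambda>n. tv j (lam (\<psi> n))) \<longlonglongrightarrow> L j"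
      and \<nu>: "\<nu> \<in> closure_class \<Omega> p q \<gamma>" and le: "\<And>j. tv j \<nu> \<le> L j" for \<psi> L \<nu> j
    proof (rule ccontr)
      assume "tv j \<nu> \<noteq> L j"
      then have c: "0 < w j * (L j - tv j \<nu>)" using le[of j] w[of j] by simp
      have \<nu>c: "continuous_on {0..1} \<nu>" using \<nu> by (auto simp: closure_class_def path_def)
      \<comment> \<open>The path \<nu> may touch the boundary and is then no competitor itself, so
        it is replaced by a nearby slice of a homotopy leading to it.\<close>
      have m\<nu>: "m n \<le> \<Phi> n \<nu>" for n
      proof (rule field_le_epsilon)
        fix k :: real assume k: "0 < k"
        define k' where "k' = k / (1 + (\<Sum>i<n. w i))"
        have sw: "0 < 1 + (\<Sum>i<n. w i)" using w by (intro add_pos_nonneg sum_nonneg) (auto simp: less_imp_le)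
        have k': "0 < k'" "(\<Sum>i<n. w i) * k' \<le> k"
          using k sw by (auto simp: k'_def field_simps)
        have "\<exists>d>0. \<forall>g'. (\<forall>s\<in>{0..1}. dist (\<nu> s) (g' s) \<le> d) \<longrightarrow> tv i g' \<le> tv i \<nu> + k'" for i
          using tv_upper[OF \<nu>c k'(1), of i] by metis
        then obtain d where d: "\<And>i. 0 < d i" "\<And>i g'. (\<forall>s\<in>{0..1}. dist (\<nu> s) (g' s) \<le> d i) \<Longrightarrow> tv i g' \<le> tv i \<nu> + k'"
          by metis
        define e where "e = Min (insert 1 (d ` {..<n}))"
        have e: "0 < e" "\<And>i. i < n \<Longrightarrow> e \<le> d i" using d(1) by (auto simp: e_def)
        obtain g where g: "epeh \<Omega> p q \<gamma> g" "\<And>s. s \<in> {0..1} \<Longrightarrow> dist (\<nu> s) (g s) \<le> e"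
          using cc_approx[OF \<nu> e(1)] by metis
        have "tv i g \<le> tv i \<nu> + k'" if "i < n" for i
          using g(2) e(2)[OF that] by (intro d(2)) force
        then have "\<Phi> n g \<le> (\<Sum>i<n. w i * (tv i \<nu> + k'))"
          unfolding \<Phi>_def using w by (intro sum_mono mult_left_mono) (auto simp: less_imp_le)
        also have "\<dots> = \<Phi> n \<nu> + (\<Sum>i<n. w i) * k'"
          by (simp add: \<Phi>_def distrib_left sum.distrib sum_distrib_right)
        finally show "m n \<le> \<Phi> n \<nu> + k" using k'(2) m_le[of g n] g(1) by (simp add: S_def)
      qed
      \<comment> \<open>On the paths of the sequence \<open>\<Phi> n\<close> is at most
        \<open>\<Phi> (\<psi> k)\<close>, which almost equals \<open>m (\<psi> k)\<close> there; the
        bound survives in the limit.\<close>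
      have upper: "(\<Sum>i<n. w i * L i) \<le> M" for n
      proof (rule LIMSEQ_le)
        show "(\<lambda>k. \<Sum>i<n. w i * tv i (lam (\<psi> k))) \<longlonglongrightarrow> (\<Sum>i<n. w i * L i)" by (intro tendsto_intros L)
        have "(\<lambda>k. m k + 1 / (real k + 1)) \<longlonglongrightarrow> M + 0"
          unfolding M_def using LIMSEQ_Suc[OF lim_1_over_n] by (intro tendsto_add mlim) (simp add: add.commute)
        then show "(\<lambda>k. m (\<psi> k) + 1 / (real (\<psi> k) + 1)) \<longlonglongrightarrow> M"
          using LIMSEQ_subseq_LIMSEQ[OF _ \<psi>] by (fastforce simp: o_def)
        show "\<exists>N. \<forall>k\<ge>N. (\<Sum>i<n. w i * tv i (lam (\<psi> k))) \<le> m (\<psi> k) + 1 / (real (\<psi> k) + 1)"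
        proof (intro exI[of _ n] allI impI)
          fix k assume "n \<le> k"
          then have "n \<le> \<psi> k" using seq_suble[OF \<psi>, of k] by linarith
          then have "\<Phi> n (lam (\<psi> k)) \<le> \<Phi> (\<psi> k) (lam (\<psi> k))" using lam(1) by (intro \<Phi>mono)
          then show "(\<Sum>i<n. w i * tv i (lam (\<psi> k))) \<le> m (\<psi> k) + 1 / (real (\<psi> k) + 1)"
            using lam(2)[of "\<psi> k"] by (simp add: \<Phi>_def)
        qed
      qed
      \<comment> \<open>A strict loss at the index \<open>j\<close> would persist for all larger
        \<open>n\<close> and keep \<open>m n\<close> away from its supremum.\<close>
      have "m n \<le> M - w j * (L j - tv j \<nu>)" if n: "j < n" for n
      proof -
        have jn: "j \<in> {..<n}" using n by simp
        have "\<Phi> n \<nu> = w j * tv j \<nu> + (\<Sum>i\<in>{..<n} - {j}. w i * tv i \<nu>)"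
          unfolding \<Phi>_def using jn by (intro sum.remove) auto
        also have "\<dots> \<le> w j * tv j \<nu> + (\<Sum>i\<in>{..<n} - {j}. w i * L i)"
          using le w by (intro add_mono sum_mono mult_left_mono) (auto simp: less_imp_le)
        also have "\<dots> = (\<Sum>i<n. w i * L i) - w j * (L j - tv j \<nu>)"
          using jn by (subst sum.remove[of "{..<n}" j "\<lambda>i. w i * L i"]) (auto simp: algebra_simps)
        also have "\<dots> \<le> M - w j * (L j - tv j \<nu>)" using upper[of n] by simp
        finally show ?thesis using m\<nu>[of n] by simp
      qed
      then have "M \<le> M - w j * (L j - tv j \<nu>)"
        using mlim unfolding M_def[symmetric]
        by (intro LIMSEQ_le_const2[of m]) (auto intro!: exI[of _ "Suc j"])
      then show False using c by simp
    qed
  qed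
qed

text \<open>A substitute for parameterization by arc length. The new parameter \<tau> is the
  normalised sum of \<open>s\<close> and of all truncated variations of both coordinates. Where it
  moves by little so does each variation, and by \<open>TV_step\<close> the path then moves by
  little more than the threshold \<open>ep k\<close>, uniformly in \<open>n\<close>. The summand
  \<open>s\<close> makes \<tau> strictly increasing, so that it has a continuous inverse
  \<rho>.\<close>

lemma equicontinuous_reparam:
  fixes g :: "nat \<Rightarrow> real \<Rightarrow> complex"
  assumes g: "\<And>n. continuous_on {0..1} (g n)" and bd: "\<And>j. \<exists>B. \<forall>n. tv j (g n) \<le> B"
  obtains \<rho> :: "nat \<Rightarrow> real \<Rightarrow> real" where "\<And>n. continuous_on {0..1} (\<rho> n)" "\<And>n. strict_mono_on {0..1} (\<rho> n)"
    "\<And>n. \<rho> n 0 = 0" "\<And>n. \<rho> n 1 = 1" "\<And>n. \<rho> n ` {0..1} = {0..1}"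
    "\<And>e. 0 < e \<Longrightarrow> \<exists>d>0. \<forall>n. \<forall>s\<in>{0..1}. \<forall>s'\<in>{0..1}. \<bar>s - s'\<bar> < d \<longrightarrow> dist (g n (\<rho> n s)) (g n (\<rho> n s')) < e"
proof -
  define ep where "ep = (\<lambda>k::nat. 1 / (real k + 1))"
  have ep: "0 < ep k" for k by (simp add: ep_def)
  define V where "V = (\<lambda>k n s. TV (ep k) (\<lambda>s. Re (g n s)) s + TV (ep k) (\<lambda>s. Im (g n s)) s)"
  have cRe: "continuous_on {0..1} (\<lambda>s. Re (g n s))" and cIm: "continuous_on {0..1} (\<lambda>s. Im (g n s))" for n
    using g by (auto intro!: continuous_intros)
  have "\<exists>B. \<forall>n. V k n 1 \<le> B" for k
  proof -
    obtain j1 where j1: "dirn j1 = 1" "epsn j1 = ep k" using index_exists[of 1 0 k] by (auto simp: ep_def complex_eq_iff)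
    obtain j2 where j2: "dirn j2 = \<i>" "epsn j2 = ep k" using index_exists[of 0 1 k] by (auto simp: ep_def complex_eq_iff)
    obtain B1 B2 where "\<forall>n. tv j1 (g n) \<le> B1" "\<forall>n. tv j2 (g n) \<le> B2" using bd by metis
    then have "\<forall>n. V k n 1 \<le> B1 + B2"
      using j1 j2 by (auto simp: V_def tv_def inner_complex_def intro!: add_mono)
    then show ?thesis by blast
  qed
  then obtain B where B: "\<And>k n. V k n 1 \<le> B k" by metis
  have Vstep: "V k n s + (trunc (ep k) (Re (g n s)) (Re (g n s')) + trunc (ep k) (Im (g n s)) (Im (g n s'))) \<le> V k n s'"
    if "0 \<le> s" "s \<le> s'" "s' \<le> 1" for k n s s'
    using TV_step[OF cRe ep that, of k n] TV_step[OF cIm ep that, of k n] by (simp add: V_def)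
  have Vmono: "V k n s \<le> V k n s'" if "0 \<le> s" "s \<le> s'" "s' \<le> 1" for k n s s'
    using Vstep[OF that, of k n] trunc_nonneg[of "ep k" "Re (g n s)" "Re (g n s')"] trunc_nonneg[of "ep k" "Im (g n s)" "Im (g n s')"] by linarith
  have V0: "0 \<le> V k n s" if "s \<le> 1" for k n s
    unfolding V_def using TV_nonneg[OF cRe ep that] TV_nonneg[OF cIm ep that] by (simp add: add_nonneg_nonneg)
  have B0: "0 \<le> B k" for k using V0[of 1 k 0] B[of k 0] by simp
  \<comment> \<open>Since \<open>B k\<close> does not depend on \<open>n\<close>, the series is
    dominated by a fixed geometric one and the total growth \<open>Z n\<close> is at most 1 +
    2.\<close>
  define c where "c = (\<lambda>k. (1/2)^k / (1 + B k))"
  have c: "0 < c k" for k using B0[of k] by (simp add: c_def)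
  have cV: "0 \<le> c k * V k n s" "c k * V k n s \<le> (1/2)^k" if "s \<in> {0..1}" for k n s
  proof -
    show "0 \<le> c k * V k n s" using c[of k] V0[of s k n] that by simp
    have "V k n s \<le> 1 + B k" using Vmono[of s 1 k n] B[of k n] that by auto
    then have "c k * V k n s \<le> c k * (1 + B k)" using c[of k] by (intro mult_left_mono) auto
    also have "\<dots> = (1/2)^k" using B0[of k] by (simp add: c_def)
    finally show "c k * V k n s \<le> (1/2)^k" .
  qed
  have sm: "summable (\<lambda>k. c k * V k n s)" if "s \<in> {0..1}" for n s
    by (rule summable_comparison_test'[of "\<lambda>k. (1/2)^k" 0]) (use cV[OF that] in auto)
  define \<sigma> where "\<sigma> = (\<lambda>n s. s + (\<Sum>k. c k * V k n s))"
  have Vc: "continuous_on {0..1} (V k n)" for k n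
    unfolding V_def using TV_continuous[OF cRe ep] TV_continuous[OF cIm ep] by (intro continuous_intros)
  have \<sigma>c: "continuous_on {0..1} (\<sigma> n)" for n
  proof -
    have "uniform_limit {0..1} (\<lambda>N s. \<Sum>k<N. c k * V k n s) (\<lambda>s. \<Sum>k. c k * V k n s) sequentially"
      by (rule Weierstrass_m_test[of _ _ "\<lambda>k. (1/2)^k"]) (use cV in auto)
    then have "continuous_on {0..1} (\<lambda>s. \<Sum>k. c k * V k n s)"
      by (rule uniform_limit_theorem[rotated]) (auto intro!: continuous_intros Vc always_eventually)
    then show ?thesis unfolding \<sigma>_def by (intro continuous_intros)
  qed
  have \<sigma>diff: "s' - s + c k * (V k n s' - V k n s) \<le> \<sigma> n s' - \<sigma> n s" if "0 \<le> s" "s \<le> s'" "s' \<le> 1" for k n s s'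
  proof -
    have s: "s \<in> {0..1}" "s' \<in> {0..1}" using that by auto
    have "sum (\<lambda>k. c k * V k n s' - c k * V k n s) {k} \<le> (\<Sum>k. c k * V k n s' - c k * V k n s)"
      using Vmono[OF that] c by (intro sum_le_suminf summable_diff sm s) (auto simp: mult_left_mono less_imp_le)
    also have "\<dots> = (\<Sum>k. c k * V k n s') - (\<Sum>k. c k * V k n s)"
      by (rule suminf_diff[symmetric]) (use sm s in auto)
    finally show ?thesis by (simp add: \<sigma>_def algebra_simps)
  qed
  have \<sigma>diff0: "s' - s \<le> \<sigma> n s' - \<sigma> n s" if "0 \<le> s" "s \<le> s'" "s' \<le> 1" for n s s'
  proof -
    have "0 \<le> c 0 * (V 0 n s' - V 0 n s)" using c[of 0] Vmono[OF that, of 0 n] by simp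
    then show ?thesis using \<sigma>diff[OF that, of 0 n] by linarith
  qed
  define Z where "Z = (\<lambda>n. \<sigma> n 1 - \<sigma> n 0)"
  have Z: "1 \<le> Z n" "Z n \<le> 3" for n
  proof -
    show "1 \<le> Z n" using \<sigma>diff0[of 0 1 n] by (simp add: Z_def)
    have "(\<Sum>k. c k * V k n 1) \<le> (\<Sum>k. (1/2)^k)"
      by (intro suminf_le sm) (use cV[of 1] in auto)
    also have "\<dots> = 2" by (simp add: suminf_geometric)
    finally have "\<sigma> n 1 \<le> 3" by (simp add: \<sigma>_def)
    moreover have "0 \<le> \<sigma> n 0" using cV[of 0] by (auto simp: \<sigma>_def intro!: suminf_nonneg sm)
    ultimately show "Z n \<le> 3" by (simp add: Z_def)
  qed
  define \<tau> where "\<tau> = (\<lambda>n s. (\<sigma> n s - \<sigma> n 0) / Z n)"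
  have Zp: "0 < Z n" for n using Z(1)[of n] by linarith
  have \<tau>c: "continuous_on {0..1} (\<tau> n)" for n unfolding \<tau>_def using \<sigma>c Zp[of n] by (intro continuous_intros) auto
  have \<tau>e: "\<tau> n 0 = 0" "\<tau> n 1 = 1" for n using Zp[of n] by (auto simp: \<tau>_def Z_def)
  have \<tau>s: "\<tau> n s < \<tau> n s'" if "0 \<le> s" "s < s'" "s' \<le> 1" for n s s'
    unfolding \<tau>_def using \<sigma>diff0[of s s' n] that Zp[of n] by (intro divide_strict_right_mono) auto
  have \<tau>inj: "inj_on (\<tau> n) {0..1}" for n
  proof (rule inj_onI)
    fix x y assume xy: "x \<in> {0..1}" "y \<in> {0..1}" "\<tau> n x = \<tau> n y"
    show "x = y"
    proof (rule ccontr)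
      assume "x \<noteq> y"
      then consider "x < y" | "y < x" by linarith
      then show False using \<tau>s[of x y n] \<tau>s[of y x n] xy by cases auto
    qed
  qed
  have \<tau>im: "\<tau> n ` {0..1} = {0..1}" for n
  proof
    show "\<tau> n ` {0..1} \<subseteq> {0..1}"
    proof
      fix y assume "y \<in> \<tau> n ` {0..1}"
      then obtain x where x: "x \<in> {0..1}" "y = \<tau> n x" by blast
      have "x = 0 \<or> 0 < x" "x = 1 \<or> x < 1" using x by auto
      then show "y \<in> {0..1}" using \<tau>s[of 0 x n] \<tau>s[of x 1 n] \<tau>e[of n] x by auto
    qed
    show "{0..1} \<subseteq> \<tau> n ` {0..1}"
    proof
      fix y :: real assume y: "y \<in> {0..1}"
      then obtain x where "0 \<le> x" "x \<le> 1" "\<tau> n x = y"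
        using IVT'[of "\<tau> n" 0 y 1] \<tau>c[of n] \<tau>e[of n] by auto
      then show "y \<in> \<tau> n ` {0..1}" by auto
    qed
  qed
  define \<rho> where "\<rho> = (\<lambda>n. inv_into {0..1} (\<tau> n))"
  have \<rho>: "\<rho> n y \<in> {0..1}" "\<tau> n (\<rho> n y) = y" if "y \<in> {0..1}" for n y
    using that \<tau>im[of n] inv_into_into[of y "\<tau> n" "{0..1}"] f_inv_into_f[of y "\<tau> n" "{0..1}"] by (auto simp: \<rho>_def)
  have \<rho>\<tau>: "\<rho> n (\<tau> n x) = x" if "x \<in> {0..1}" for n x
    unfolding \<rho>_def using \<tau>inj that by (rule inv_into_f_f)
  have \<rho>mono: "\<rho> n y < \<rho> n y'" if "y \<in> {0..1}" "y' \<in> {0..1}" "y < y'" for n y y'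
  proof (rule ccontr)
    assume "\<not> ?thesis"
    then have "\<tau> n (\<rho> n y') \<le> \<tau> n (\<rho> n y)"
      using \<tau>s[of "\<rho> n y'" "\<rho> n y" n] \<rho>(1)[OF that(1), of n] \<rho>(1)[OF that(2), of n] by (cases "\<rho> n y' = \<rho> n y") auto
    then show False using \<rho>(2) that by auto
  qed
  show ?thesis
  proof (rule that[of \<rho>])
    show "continuous_on {0..1} (\<rho> n)" for n
      using continuous_on_inv[OF \<tau>c[of n], of "\<rho> n"] \<rho>\<tau>[of _ n] \<tau>im[of n] by auto
    show "strict_mono_on {0..1} (\<rho> n)" for n using \<rho>mono by (auto simp: strict_mono_on_def)
    show "\<rho> n 0 = 0" "\<rho> n 1 = 1" for n using \<rho>\<tau>[of 0 n] \<rho>\<tau>[of 1 n] \<tau>e by auto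
    show "\<rho> n ` {0..1} = {0..1}" for n 
    proof
      show "\<rho> n ` {0..1} \<subseteq> {0..1}" using \<rho>(1) by blast
      show "{0..1} \<subseteq> \<rho> n ` {0..1}"
      proof
        fix x :: real assume x: "x \<in> {0..1}"
        then have "\<tau> n x \<in> {0..1}" using \<tau>im[of n] by blast
        then show "x \<in> \<rho> n ` {0..1}" using \<rho>\<tau>[OF x, of n] by (metis image_eqI)
      qed
    qed
    fix e :: real assume e: "0 < e"
    obtain k where k: "ep k < e/8" using reals_Archimedean[of "e/8"] e by (auto simp: ep_def inverse_eq_divide add.commute)
    \<comment> \<open>The division by 3 compensates the normalising factor \<open>Z n\<close>. As
      \<open>ep k < e/8\<close>, each coordinate then moves by less than
      \<open>e/8 + e/8\<close>.\<close>
    define d where "d = c k * (e/8) / 3"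
    have d: "0 < d" "3 * d = c k * (e/8)" using c[of k] e by (auto simp: d_def)
    have main: "dist (g n (\<rho> n y)) (g n (\<rho> n y')) < e" if y: "y \<in> {0..1}" "y' \<in> {0..1}" "y \<le> y'" "y' - y < d" for n y y'
    proof -
      define s s' where "s = \<rho> n y" and "s' = \<rho> n y'"
      have s: "s \<in> {0..1}" "s' \<in> {0..1}" using \<rho>(1) y by (auto simp: s_def s'_def)
      have ss: "s \<le> s'" using \<rho>mono[OF y(1,2), of n] y(3) by (cases "y = y'") (auto simp: s_def s'_def)
      have "\<tau> n s' - \<tau> n s < d" using y \<rho>(2) by (simp add: s_def s'_def)
      then have "\<sigma> n s' - \<sigma> n s < d * Z n"
        using Zp[of n] by (simp add: \<tau>_def diff_divide_distrib[symmetric] pos_divide_less_eq)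
      also have "\<dots> \<le> d * 3" using Z(2)[of n] d by (intro mult_left_mono) auto
      finally have "c k * (V k n s' - V k n s) < c k * (e/8)"
        using \<sigma>diff[of s s' k n] s ss d by auto
      then have "V k n s' - V k n s < e/8" using c[of k] by (simp add: mult_less_cancel_left_pos)
      then have "trunc (ep k) (Re (g n s)) (Re (g n s')) + trunc (ep k) (Im (g n s)) (Im (g n s')) < e/8"
        using Vstep[of s s' k n] s ss by auto
      then have "\<bar>Re (g n s) - Re (g n s')\<bar> < e/4" "\<bar>Im (g n s) - Im (g n s')\<bar> < e/4"
        using k trunc_nonneg[of "ep k" "Re (g n s)" "Re (g n s')"] trunc_nonneg[of "ep k" "Im (g n s)" "Im (g n s')"]
        unfolding trunc_def by linarith+
      then have "cmod (g n s - g n s') < e" using cmod_le[of "g n s - g n s'"] e by simp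
      then show ?thesis by (simp add: s_def s'_def dist_norm)
    qed
    show "\<exists>d>0. \<forall>n. \<forall>s\<in>{0..1}. \<forall>s'\<in>{0..1}. \<bar>s - s'\<bar> < d \<longrightarrow> dist (g n (\<rho> n s)) (g n (\<rho> n s')) < e"
    proof (intro exI[of _ d] conjI allI ballI impI d(1))
      fix n s s' assume "s \<in> {0..1}" "s' \<in> {0..1}" "\<bar>s - s'\<bar> < d"
      then show "dist (g n (\<rho> n s)) (g n (\<rho> n s')) < e"
        using main[of s s' n] main[of s' s n] by (cases "s \<le> s'") (auto simp: dist_commute)
    qed
  qed
qed


text \<open>The parameter is moved linearly from \<open>s\<close> to \<open>\<rho> s\<close>. Strict
  monotonicity keeps interior times interior, where the path is in \<Omega>.\<close>

lemma epeh_reparam: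
  assumes g: "epeh \<Omega> p q \<gamma> g" and \<rho>: "continuous_on {0..1} \<rho>" "strict_mono_on {0..1} \<rho>" "\<rho> 0 = 0" "\<rho> 1 = 1"
  shows "epeh \<Omega> p q \<gamma> (\<lambda>s. g (\<rho> s))"
proof -
  have gc: "continuous_on {0..1} g" using epeh_cont[OF g] .
  have ge: "g 0 = p" "g 1 = q" "\<And>s. 0 < s \<Longrightarrow> s < 1 \<Longrightarrow> g s \<in> \<Omega>"
    using epeh_path[OF g] by (auto simp: epe_path_def pathstart_def pathfinish_def)
  have \<rho>i: "0 < \<rho> s \<and> \<rho> s < 1" if "0 < s" "s < 1" for s
    using \<rho>(2)[unfolded strict_mono_on_def, rule_format, of 0 s] \<rho>(2)[unfolded strict_mono_on_def, rule_format, of s 1] that \<rho> by auto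
  have \<rho>01: "\<rho> s \<in> {0..1}" if "s \<in> {0..1}" for s
    using \<rho>i[of s] that \<rho> by (cases "s = 0"; cases "s = 1") auto
  define y where "y = (\<lambda>z::real\<times>real. (1 - snd z) * fst z + snd z * \<rho> (fst z))"
  have y01: "y z \<in> {0..1}" if "z \<in> sq" for z
    using that \<rho>01[of "fst z"] convex_bound_le[of "fst z" 1 "\<rho> (fst z)" "1 - snd z" "snd z"] by (auto simp: y_def)
  have yi: "0 < y (s,t)" "y (s,t) < 1" if "0 < s" "s < 1" "t \<in> {0..1}" for s t
    using that \<rho>i[of s] convex_bound_lt[of s 1 "\<rho> s" "1 - t" t] convex_bound_lt[of "-s" 0 "- \<rho> s" "1 - t" t] by (auto simp: y_def)
  have "epe_hom \<Omega> p q g (\<lambda>s. g (\<rho> s)) (\<lambda>z. g (y z))"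
  proof (rule epe_homI)
    show "continuous_on sq (\<lambda>z. g (y z))"
    proof (rule continuous_on_compose2[OF gc])
      show "continuous_on sq y" unfolding y_def
        by (intro continuous_intros continuous_on_compose2[OF \<rho>(1)]) auto
    qed (use y01 in auto)
  qed (use ge \<rho> yi in \<open>auto simp: y_def\<close>)
  then show ?thesis using g epeh_trans unfolding epeh_def by blast
qed

section \<open>Linking two paths through a common base path\<close>

lemma line_connected_convex:
  assumes u: "norm (u::complex) = 1" and I: "connected I" "\<And>z. z \<in> I \<Longrightarrow> u \<bullet> z = v"
  shows "convex I"
proof (rule convexI)
  fix a b :: complex and m n :: real assume ab: "a \<in> I" "b \<in> I" and mn: "0 \<le> m" "0 \<le> n" "m + n = 1"
  let ?z = "m *\<^sub>R a + n *\<^sub>R b" and ?psi = "\<lambda>z. (\<i> * u) \<bullet> z"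
  have "connected (?psi ` I)" using I(1) by (intro connected_continuous_image continuous_intros)
  then have "is_interval (?psi ` I)" using is_interval_connected_1 by blast
  then have cv: "convex (?psi ` I)" using is_interval_convex by blast
  have "m *\<^sub>R ?psi a + n *\<^sub>R ?psi b \<in> ?psi ` I"
    using ab mn by (intro convexD[OF cv]) auto
  then obtain z where z: "z \<in> I" "?psi z = ?psi ?z"
    by (auto simp: inner_add_right inner_scaleR_right)
  have "u \<bullet> ?z = (m + n) * v" using I(2)[OF ab(1)] I(2)[OF ab(2)] by (simp add: inner_add_right algebra_simps)
  then have "u \<bullet> ?z = u \<bullet> z" using I(2)[OF z(1)] mn by simp
  then have "?z = z" using ortho_expand[OF u, of ?z] ortho_expand[OF u, of z] z(2) by simp
  then show "?z \<in> I" using z by simp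
qed

lemma homotopic_in_convex:
  fixes T :: "'a::real_normed_vector set"
  assumes "convex T" "path g" "path h" "path_image g \<subseteq> T" "path_image h \<subseteq> T" "pathstart g = pathstart h" "pathfinish g = pathfinish h"
  shows "homotopic_paths T g h"
  using convex_imp_simply_connected[OF assms(1)] assms unfolding simply_connected_eq_homotopic_paths by auto

text \<open>In the strip the slanted segment deforms into three legs: through \<open>H\<close> to
  the base path \<gamma>, along \<gamma> from \<rho> to \<rho>', and back through \<open>H'\<close>.
  The image of each leg is homotopic to a segment on the line \<open>u \<bullet> z = v\<close>, for
  the middle leg because the arc of \<gamma> lies in the convex set \<open>B\<close>. Segments on
  one line that are joined end to end form a convex subset of \<Omega>, in which they contract to
  the straight segment between the outer ends.\<close>

lemma link_via_base:
  assumes H: "epe_hom \<Omega> p q g \<gamma> H" and H': "epe_hom \<Omega> p q g' \<gamma> H'" and u: "norm (u::complex) = 1"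
    and r: "0 < r" "r < 1" "0 < r'" "r' < 1" "0 < \<rho>" "\<rho> < 1" "0 < \<rho>'" "\<rho>' < 1"
    and lv: "u \<bullet> g r = v" "u \<bullet> g' r' = v" "u \<bullet> \<gamma> \<rho> = v" "u \<bullet> \<gamma> \<rho>' = v"
    and hp: "homotopic_paths \<Omega> (H \<circ> linepath (r,0) (\<rho>,1)) (linepath (g r) (\<gamma> \<rho>))"
    and hp': "homotopic_paths \<Omega> (H' \<circ> linepath (r',0) (\<rho>',1)) (linepath (g' r') (\<gamma> \<rho>'))"
    and arc: "\<And>x. x \<in> closed_segment \<rho> \<rho>' \<Longrightarrow> \<gamma> x \<in> B" and B: "convex B" "B \<subseteq> \<Omega>"
  shows "link \<Omega> (tpaste H (trev H')) r r' (linepath (g r) (g' r'))"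
proof -
  let ?S = "{0<..<1::real} \<times> {0..1::real}"
  let ?G = "tpaste H (trev H')"
  have G: "epe_hom \<Omega> p q g g' ?G" by (rule epe_hom_trans[OF H epe_hom_sym[OF H']])
  have S: "convex ?S" by (intro convex_Times) auto
  have GS: "continuous_on ?S ?G" using epe_homD(1)[OF G] by (rule continuous_on_subset) auto
  have G\<Omega>: "?G ` ?S \<subseteq> \<Omega>" using epe_homD(6)[OF G] by auto
  define a where "a = linepath (r,0::real) (\<rho>,1/2::real)"
  define b where "b = linepath (\<rho>,1/2::real) (\<rho>',1/2::real)"
  define c where "c = linepath (\<rho>',1/2::real) (r',1::real)"
  have pS: "(r,0) \<in> ?S" "(\<rho>,1/2) \<in> ?S" "(\<rho>',1/2) \<in> ?S" "(r',1) \<in> ?S" using r by auto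
  have im: "path_image a \<subseteq> ?S" "path_image b \<subseteq> ?S" "path_image c \<subseteq> ?S" "path_image (linepath (r,0) (r',1)) \<subseteq> ?S"
    unfolding a_def b_def c_def path_image_linepath using pS S by (intro closed_segment_subset; simp)+
  have pa: "path a" "path b" "path c" by (simp_all add: a_def b_def c_def)
  have pabc: "path (a +++ (b +++ c))" "path_image (a +++ (b +++ c)) \<subseteq> ?S"
  proof -
    show "path (a +++ (b +++ c))" by (auto simp: a_def b_def c_def intro!: path_join_imp)
    show "path_image (a +++ (b +++ c)) \<subseteq> ?S" by (intro subset_path_image_join im)
  qed
  have 1: "homotopic_paths ?S (linepath (r,0) (r',1)) (a +++ (b +++ c))"
    by (rule homotopic_in_convex[OF S]) (use im pabc in \<open>auto simp: a_def b_def c_def\<close>)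
  have 2: "homotopic_paths \<Omega> (?G \<circ> linepath (r,0) (r',1)) (?G \<circ> (a +++ (b +++ c)))"
    by (rule homotopic_paths_continuous_image[OF 1 GS]) (use G\<Omega> in auto)
  have 3: "?G \<circ> (a +++ (b +++ c)) = (?G \<circ> a) +++ ((?G \<circ> b) +++ (?G \<circ> c))"
    by (simp add: path_compose_join)
  have pG: "path (?G \<circ> x)" "path_image (?G \<circ> x) \<subseteq> \<Omega>" if "path x" "path_image x \<subseteq> ?S" for x
  proof -
    show "path (?G \<circ> x)" using that GS by (meson continuous_on_subset path_continuous_image)
    show "path_image (?G \<circ> x) \<subseteq> \<Omega>" using that G\<Omega> by (auto simp: path_image_compose)
  qed
  have Ga: "homotopic_paths \<Omega> (?G \<circ> a) (linepath (g r) (\<gamma> \<rho>))"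
  proof -
    have "homotopic_paths \<Omega> (?G \<circ> a) (H \<circ> linepath (r,0) (\<rho>,1))"
    proof (rule homotopic_paths_eq)
      show "path (?G \<circ> a)" "path_image (?G \<circ> a) \<subseteq> \<Omega>" using pG[of a] pa im by auto
      show "(?G \<circ> a) t = (H \<circ> linepath (r,0) (\<rho>,1)) t" if "t \<in> {0..1}" for t
        using that by (simp add: a_def tpaste_def linepath_def)
    qed
    then show ?thesis using hp by (rule homotopic_paths_trans)
  qed
  have Gb: "homotopic_paths \<Omega> (?G \<circ> b) (linepath (\<gamma> \<rho>) (\<gamma> \<rho>'))"
  proof -
    have seg01: "x \<in> {0..1}" if "x \<in> closed_segment \<rho> \<rho>'" for x
      using that r closed_segment_subset[of \<rho> "{0..1}" \<rho>'] by auto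
    have eqb: "(?G \<circ> b) t = \<gamma> (linepath \<rho> \<rho>' t)" "linepath \<rho> \<rho>' t \<in> closed_segment \<rho> \<rho>'" if "t \<in> {0..1}" for t
    proof -
      show s: "linepath \<rho> \<rho>' t \<in> closed_segment \<rho> \<rho>'" using that by (metis path_image_linepath path_image_def imageI)
      have "b t = (linepath \<rho> \<rho>' t, 1/2)" by (simp add: b_def linepath_def field_simps)
      then show "(?G \<circ> b) t = \<gamma> (linepath \<rho> \<rho>' t)" using epe_homD(3)[OF H seg01[OF s]] by (simp add: tpaste_def)
    qed
    have "path_image (?G \<circ> b) \<subseteq> B" using eqb arc by (auto simp: path_image_def)
    moreover have "pathstart (?G \<circ> b) = \<gamma> \<rho>" "pathfinish (?G \<circ> b) = \<gamma> \<rho>'"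
      using eqb(1)[of 0] eqb(1)[of 1] by (auto simp: pathstart_def pathfinish_def linepath_def)
    moreover have "\<gamma> \<rho> \<in> B" "\<gamma> \<rho>' \<in> B" using arc by auto
    ultimately have "homotopic_paths B (?G \<circ> b) (linepath (\<gamma> \<rho>) (\<gamma> \<rho>'))"
      using pG(1)[of b] pa im B(1) by (intro homotopic_in_convex) (auto simp: closed_segment_subset)
    then show ?thesis using B(2) homotopic_paths_subset by blast
  qed
  have Gc: "homotopic_paths \<Omega> (?G \<circ> c) (linepath (\<gamma> \<rho>') (g' r'))"
  proof -
    have "homotopic_paths \<Omega> (reversepath (H' \<circ> linepath (r',0) (\<rho>',1))) (reversepath (linepath (g' r') (\<gamma> \<rho>')))"
      using hp' homotopic_paths_reversepath by blast
    then have 1: "homotopic_paths \<Omega> (reversepath (H' \<circ> linepath (r',0) (\<rho>',1))) (linepath (\<gamma> \<rho>') (g' r'))" by simp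
    have "homotopic_paths \<Omega> (?G \<circ> c) (reversepath (H' \<circ> linepath (r',0) (\<rho>',1)))"
    proof (rule homotopic_paths_eq)
      fix t :: real assume t: "t \<in> {0..1}"
      have ct: "c t = ((1-t)*\<rho>' + t*r', 1/2 + t/2)" by (simp add: c_def linepath_def field_simps)
      have "reversepath (H' \<circ> linepath (r',0) (\<rho>',1)) t = H' ((1-t)*\<rho>' + t*r', 1 - t)"
        by (simp add: reversepath_def linepath_def algebra_simps)
      moreover have "(?G \<circ> c) t = H' ((1-t)*\<rho>' + t*r', 1 - t)"
      proof (cases "t = 0")
        case True
        then have "c t = (\<rho>', 1/2)" using ct by simp
        then show ?thesis using True epe_homD(3)[OF H, of \<rho>'] epe_homD(3)[OF H', of \<rho>'] r by (simp add: tpaste_def)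
      next
        case False
        then show ?thesis using t by (simp add: ct tpaste_def trev_def)
      qed
      ultimately show "(?G \<circ> c) t = reversepath (H' \<circ> linepath (r',0) (\<rho>',1)) t" by simp
    qed (use pG[of c] pa im in auto)
    then show ?thesis using 1 by (rule homotopic_paths_trans)
  qed
  define I where "I = closed_segment (g r) (\<gamma> \<rho>) \<union> closed_segment (\<gamma> \<rho>) (\<gamma> \<rho>') \<union> closed_segment (\<gamma> \<rho>') (g' r')"
  have sub: "closed_segment (g r) (\<gamma> \<rho>) \<subseteq> \<Omega>" "closed_segment (\<gamma> \<rho>) (\<gamma> \<rho>') \<subseteq> \<Omega>" "closed_segment (\<gamma> \<rho>') (g' r') \<subseteq> \<Omega>"
    using homotopic_paths_imp_subset[OF Ga] homotopic_paths_imp_subset[OF Gb] homotopic_paths_imp_subset[OF Gc] by auto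
  have "connected I"
  proof -
    have U: "connected (A \<union> closed_segment x y)" if "connected A" "x \<in> A" for A and x y :: complex
      using that ends_in_segment(1)[of x y] by (intro connected_Un) auto
    show ?thesis unfolding I_def by (intro U) auto
  qed
  moreover have "u \<bullet> z = v" if "z \<in> I" for z
  proof -
    have *: "u \<bullet> z = v" if z: "z \<in> closed_segment x y" "u \<bullet> x = v" "u \<bullet> y = v" for x y
    proof -
      obtain t where "z = (1 - t) *\<^sub>R x + t *\<^sub>R y" using z(1) by (auto simp: in_segment)
      then have "u \<bullet> z = (1 - t) * (u \<bullet> x) + t * (u \<bullet> y)" by (simp add: inner_add_right)
      then show ?thesis using z(2,3) by (simp add: algebra_simps)
    qed
    show ?thesis using that * lv unfolding I_def by blast
  qed
  ultimately have "convex I" by (rule line_connected_convex[OF u])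
  have gI: "g r \<in> I" "g' r' \<in> I" by (auto simp: I_def)
  have "homotopic_paths I (linepath (g r) (\<gamma> \<rho>) +++ (linepath (\<gamma> \<rho>) (\<gamma> \<rho>') +++ linepath (\<gamma> \<rho>') (g' r'))) (linepath (g r) (g' r'))"
  proof (rule homotopic_in_convex[OF \<open>convex I\<close>])
    show "path_image (linepath (g r) (g' r')) \<subseteq> I" using closed_segment_subset[OF gI \<open>convex I\<close>] by simp
  qed (auto simp: I_def path_image_join)
  then have 4: "homotopic_paths \<Omega> (linepath (g r) (\<gamma> \<rho>) +++ (linepath (\<gamma> \<rho>) (\<gamma> \<rho>') +++ linepath (\<gamma> \<rho>') (g' r'))) (linepath (g r) (g' r'))"
    using sub homotopic_paths_subset[of I _ _ \<Omega>] by (auto simp: I_def)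
  have 5: "homotopic_paths \<Omega> ((?G \<circ> a) +++ ((?G \<circ> b) +++ (?G \<circ> c))) (linepath (g r) (\<gamma> \<rho>) +++ (linepath (\<gamma> \<rho>) (\<gamma> \<rho>') +++ linepath (\<gamma> \<rho>') (g' r')))"
    by (intro homotopic_paths_join Ga Gb Gc) (auto simp: a_def b_def c_def pathstart_compose pathfinish_compose)
  show ?thesis
    unfolding link_def using homotopic_paths_trans[OF 2[unfolded 3] homotopic_paths_trans[OF 5 4]] by blast
qed


section \<open>Paths whose variations survive straightening\<close>

lemma rational_dir_near:
  assumes "0 < e"
  obtains x y where "cmod (Complex (of_rat x) (of_rat y) - u) < e"
proof -
  obtain x where x: "Re u < of_rat x" "of_rat x < Re u + e/2" using of_rat_dense[of "Re u" "Re u + e/2"] assms by auto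
  obtain y where y: "Im u < of_rat y" "of_rat y < Im u + e/2" using of_rat_dense[of "Im u" "Im u + e/2"] assms by auto
  have "cmod (Complex (of_rat x) (of_rat y) - u) \<le> \<bar>of_rat x - Re u\<bar> + \<bar>of_rat y - Im u\<bar>"
    using cmod_le[of "Complex (of_rat x) (of_rat y) - u"] by simp
  also have "\<dots> < e" using x y by linarith
  finally show ?thesis by (rule that)
qed

lemma tv_drop:
  assumes g: "continuous_on {0..1} g" and ab: "0 \<le> a" "a < b" "b \<le> 1" and s: "a \<le> s1" "s1 \<le> s2" "s2 \<le> s3" "s3 \<le> b"
    and u: "dirn j = u" and d: "\<bar>u \<bullet> g s1 - u \<bullet> g s3\<bar> + 2 * d \<le> \<bar>u \<bullet> g s1 - u \<bullet> g s2\<bar> + \<bar>u \<bullet> g s2 - u \<bullet> g s3\<bar>"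
  shows "tv j (straighten g a b) \<le> tv j g - (2 * d - 6 * epsn j)"
  unfolding tv_def inner_straighten u using TV_patch_drop[OF cont_inner[OF g] epsn_pos ab s d] by simp

lemma small_index:
  assumes "0 < d"
  obtains j where "dirn j = Complex (of_rat x) (of_rat y)" "epsn j < d"
proof -
  obtain b :: nat where b: "1 / (real b + 1) < d"
    using reals_Archimedean[OF assms] by (auto simp: inverse_eq_divide add.commute)
  then show ?thesis using index_exists[of x y b] that by metis
qed

text \<open>Backtracking in a rational direction, however slight, exceeds some truncation threshold
  by far; straightening would then lower the corresponding variation.\<close>

lemma tv_equal_between:
  assumes g: "continuous_on {0..1} g" and ab: "0 \<le> a" "a < b" "b \<le> 1"
    and eq: "\<And>j. tv j (straighten g a b) = tv j g" and s: "a \<le> s1" "s1 \<le> s2" "s2 \<le> s3" "s3 \<le> b"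
    and u: "u = Complex (of_rat x) (of_rat y)"
  shows "\<bar>u \<bullet> g s1 - u \<bullet> g s2\<bar> + \<bar>u \<bullet> g s2 - u \<bullet> g s3\<bar> \<le> \<bar>u \<bullet> g s1 - u \<bullet> g s3\<bar>"
proof (rule ccontr)
  assume neg: "\<not> ?thesis"
  define d where "d = (\<bar>u \<bullet> g s1 - u \<bullet> g s2\<bar> + \<bar>u \<bullet> g s2 - u \<bullet> g s3\<bar> - \<bar>u \<bullet> g s1 - u \<bullet> g s3\<bar>) / 2"
  have d: "0 < d" using neg by (simp add: d_def)
  \<comment> \<open>With a threshold below \<open>d/3\<close> the loss \<open>6 * epsn j\<close> in
    \<open>tv_drop\<close> is less than the gain \<open>2 * d\<close>.\<close>
  obtain j where j: "dirn j = u" "epsn j < d/3" using small_index[of "d/3" x y] d u by auto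
  have "tv j (straighten g a b) \<le> tv j g - (2 * d - 6 * epsn j)"
    by (rule tv_drop[OF g ab s j(1)]) (simp add: d_def field_simps)
  then show False using eq[of j] j(2) by simp
qed

text \<open>Between \<open>a\<close> and \<open>b\<close> every projection to a rational direction
  is monotone, and by density the same holds for every direction \<open>u\<close> with
  \<open>u \<bullet> D > 0\<close>. A direction orthogonal to \<open>D\<close> and its negative are
  both limits of such directions, so increments of \<open>g\<close> have no orthogonal component.
  Hence \<open>g\<close> runs monotonically along the segment.\<close>

lemma tv_equal_imp_reparam:
  assumes g: "continuous_on {0..1} g" and ab: "0 \<le> a" "a < b" "b \<le> 1"
    and eq: "\<And>j. tv j (straighten g a b) = tv j g"
  shows "reparam_equiv g (straighten g a b)"
proof -
  note betw = tv_equal_between[OF g ab eq]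
  define D where "D = g b - g a"
  show ?thesis
  proof (cases "D = 0")
    case True
    \<comment> \<open>For \<open>D = 0\<close> both coordinates return to their starting values
      without backtracking, so they never move.\<close>
    have cst: "g s = g a" if "s \<in> {a..b}" for s
    proof -
      have "\<bar>u \<bullet> g a - u \<bullet> g s\<bar> + \<bar>u \<bullet> g s - u \<bullet> g b\<bar> \<le> \<bar>u \<bullet> g a - u \<bullet> g b\<bar>" if "u = Complex (of_rat x) (of_rat y)" for u x y
        using that \<open>s \<in> {a..b}\<close> by (intro betw) auto
      from this[of 1 1 0] this[of \<i> 0 1] show ?thesis using True by (auto simp: D_def complex_eq_iff inner_complex_def)
    qed
    have "straighten g a b s = g s" for s
      using cst[of s] cst[of b] ab by (auto simp: straighten_def linepath_def algebra_simps)
    then show ?thesis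
      unfolding reparam_equiv_def by (intro exI[of _ "\<lambda>s. s"]) (auto simp: mono_on_def)
  next
    case False
    have DD: "0 < D \<bullet> D" using False by simp
    have rat: "0 \<le> w \<bullet> (g s' - g s)" if w: "w = Complex (of_rat x) (of_rat y)" "0 < w \<bullet> D" and s: "a \<le> s" "s \<le> s'" "s' \<le> b" for w x y s s'
    proof -
      have "\<bar>w \<bullet> g a - w \<bullet> g s\<bar> + \<bar>w \<bullet> g s - w \<bullet> g b\<bar> \<le> \<bar>w \<bullet> g a - w \<bullet> g b\<bar>" using s ab by (intro betw[OF _ _ _ _ w(1)]) auto
      moreover have "\<bar>w \<bullet> g s - w \<bullet> g s'\<bar> + \<bar>w \<bullet> g s' - w \<bullet> g b\<bar> \<le> \<bar>w \<bullet> g s - w \<bullet> g b\<bar>" using s ab by (intro betw[OF _ _ _ _ w(1)]) auto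
      moreover have "w \<bullet> g a < w \<bullet> g b" using w(2) by (simp add: D_def inner_diff_right)
      ultimately have "w \<bullet> g s \<le> w \<bullet> g s'" by linarith
      then show ?thesis by (simp add: inner_diff_right)
    qed
    have gen: "0 \<le> u \<bullet> (g s' - g s)" if u: "0 < u \<bullet> D" and s: "a \<le> s" "s \<le> s'" "s' \<le> b" for u s s'
    proof (rule ccontr)
      let ?\<Delta> = "g s' - g s"
      assume "\<not> ?thesis"
      then have neg: "u \<bullet> ?\<Delta> < 0" by simp
      \<comment> \<open>Small enough for the passage from \<open>u\<close> to a rational direction
        to preserve the strict signs of \<open>u \<bullet> D\<close> and of
        \<open>u \<bullet> ?\<Delta>\<close>.\<close>
      define e where "e = min (u \<bullet> D / (norm D + 1)) (- (u \<bullet> ?\<Delta>) / (norm ?\<Delta> + 1))"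
      have p: "0 < norm D + 1" "0 < norm ?\<Delta> + 1" using norm_ge_zero[of D] norm_ge_zero[of ?\<Delta>] by linarith+
      have e: "0 < e" using u neg p by (auto simp: e_def divide_neg_pos)
      obtain x y where w: "cmod (Complex (of_rat x) (of_rat y) - u) < e" using rational_dir_near[OF e, of u] by metis
      define w where "w = Complex (of_rat x) (of_rat y)"
      have b: "\<bar>(w - u) \<bullet> z\<bar> \<le> e * norm z" for z
        using Cauchy_Schwarz_ineq2[of "w - u" z] w mult_right_mono[of "norm (w - u)" e "norm z"] by (simp add: w_def)
      have "e * norm D < e * (norm D + 1)" using e by simp
      also have "\<dots> \<le> u \<bullet> D" using p(1) by (simp add: e_def pos_le_divide_eq[symmetric])
      finally have "0 < w \<bullet> D" using b[of D] by (simp add: inner_diff_left)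
      moreover have "e * norm ?\<Delta> < e * (norm ?\<Delta> + 1)" using e by simp
      then have "e * norm ?\<Delta> < - (u \<bullet> ?\<Delta>)"
        using p(2) pos_le_divide_eq[of "norm ?\<Delta> + 1" e "- (u \<bullet> ?\<Delta>)"] by (simp add: e_def)
      then have "w \<bullet> ?\<Delta> < 0" using b[of ?\<Delta>] by (simp add: inner_diff_left)
      ultimately show False using rat[OF w_def _ s] by simp
    qed
    have perp: "0 \<le> w \<bullet> (g s' - g s)" if w: "w \<bullet> D = 0" and s: "a \<le> s" "s \<le> s'" "s' \<le> b" for w s s'
    proof (rule field_le_epsilon)
      fix e :: real assume e: "0 < e"
      have D0: "0 \<le> D \<bullet> (g s' - g s)" using gen[OF DD s] .
      define t where "t = e / (D \<bullet> (g s' - g s) + 1)"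
      have t: "0 < t" "t * (D \<bullet> (g s' - g s)) \<le> e" using e D0 by (auto simp: t_def field_simps)
      have "0 < (w + t *\<^sub>R D) \<bullet> D" using w t DD by (simp add: inner_add_left)
      from gen[OF this s] show "0 \<le> w \<bullet> (g s' - g s) + e" using t by (simp add: inner_add_left)
    qed
    have iD: "(\<i> * D) \<bullet> D = 0" "(- (\<i> * D)) \<bullet> D = 0" by (auto simp: inner_complex_def)
    have par: "g s' - g s = ((D \<bullet> (g s' - g s)) / (D \<bullet> D)) *\<^sub>R D" if s: "a \<le> s" "s \<le> s'" "s' \<le> b" for s s'
    proof -
      let ?\<Delta> = "g s' - g s" and ?n = "norm D"
      have z: "(\<i> * D) \<bullet> ?\<Delta> = 0" using perp[OF iD(1) s] perp[OF iD(2) s] by simp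
      have n: "0 < ?n" using False by simp
      define u where "u = D /\<^sub>R ?n"
      have u: "norm u = 1" using n by (simp add: u_def)
      have "\<i> * u = (\<i> * D) /\<^sub>R ?n" by (simp add: u_def)
      then have "(\<i> * u) \<bullet> ?\<Delta> = 0" using z by simp
      then have "?\<Delta> = (u \<bullet> ?\<Delta>) *\<^sub>R u" using ortho_expand[OF u, of ?\<Delta>] by simp
      also have "\<dots> = ((D \<bullet> ?\<Delta>) / (?n * ?n)) *\<^sub>R D" using n by (simp add: u_def divide_inverse mult.assoc mult.commute)
      also have "?n * ?n = D \<bullet> D" by (simp add: dot_square_norm power2_eq_square)
      finally show ?thesis .
    qed
    define c where "c = (\<lambda>s. (D \<bullet> (g (max a (min s b)) - g a)) / (D \<bullet> D))"
    have cc: "continuous_on {0..1} c"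
      unfolding c_def using ab DD by (intro continuous_intros continuous_on_compose2[OF g]) auto
    have cmono: "c s \<le> c s'" if "s \<le> s'" for s s'
    proof -
      let ?x = "max a (min s b)" and ?y = "max a (min s' b)"
      have "0 \<le> D \<bullet> (g ?y - g ?x)" using that ab by (intro gen[OF DD]) auto
      then have "D \<bullet> (g ?x - g a) \<le> D \<bullet> (g ?y - g a)" by (simp add: inner_diff_right)
      then show ?thesis unfolding c_def using DD by (intro divide_right_mono) auto
    qed
    have ca: "c s = 0" if "s \<le> a" for s using that ab by (simp add: c_def)
    have cb: "c s = 1" if "b \<le> s" for s using that ab DD by (simp add: c_def D_def)
    have c01: "0 \<le> c s" "c s \<le> 1" if "a \<le> s" "s \<le> b" for s
      using cmono[OF that(1)] cmono[OF that(2)] ca[of a] cb[of b] by auto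
    \<comment> \<open>The identity outside \<open>[a,b]\<close>; inside, the time at which the
      uniformly traversed segment reaches \<open>g s\<close>.\<close>
    define \<psi> where "\<psi> = (\<lambda>s. min s a + (max s b - b) + c s * (b - a))"
    have \<psi>c: "continuous_on {0..1} \<psi>" unfolding \<psi>_def using cc by (intro continuous_intros)
    have \<psi>m: "\<psi> s \<le> \<psi> s'" if "s \<le> s'" for s s'
      unfolding \<psi>_def using that cmono[OF that] ab by (intro add_mono mult_right_mono) auto
    have \<psi>e: "\<psi> 0 = 0" "\<psi> 1 = 1" using ab ca[of 0] cb[of 1] by (auto simp: \<psi>_def)
    have \<psi>im: "\<psi> ` {0..1} = {0..1}"
    proof
      show "\<psi> ` {0..1} \<subseteq> {0..1}" using \<psi>m[of 0] \<psi>m[of _ 1] \<psi>e by force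
      show "{0..1} \<subseteq> \<psi> ` {0..1}"
      proof
        fix y :: real assume "y \<in> {0..1}"
        then obtain x where "0 \<le> x" "x \<le> 1" "\<psi> x = y" using IVT'[of \<psi> 0 y 1] \<psi>c \<psi>e by auto
        then show "y \<in> \<psi> ` {0..1}" by auto
      qed
    qed
    have "g s = straighten g a b (\<psi> s)" for s
    proof -
      consider "s \<le> a" | "b \<le> s" | "a \<le> s" "s \<le> b" by linarith
      then show ?thesis
      proof cases
        case 1
        then have "\<psi> s = s" using ca[of s] ab by (simp add: \<psi>_def)
        then show ?thesis using 1 straighten_off[of s a b g] ab by simp
      next
        case 2
        then have "\<psi> s = s" using cb[of s] ab by (simp add: \<psi>_def)
        then show ?thesis using 2 straighten_off[of s a b g] ab by simp
      next
        case 3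
        then have p: "\<psi> s = a + c s * (b - a)" by (simp add: \<psi>_def)
        have "0 \<le> c s * (b - a)" "c s * (b - a) \<le> b - a" using c01[OF 3] ab mult_right_mono[of "c s" 1 "b - a"] by auto
        then have "a \<le> \<psi> s" "\<psi> s \<le> b" unfolding p by linarith+
        then have "straighten g a b (\<psi> s) = linepath (g a) (g b) (c s)"
          using ab straighten_on[of a "\<psi> s" b g] by (simp add: p)
        also have "\<dots> = g a + c s *\<^sub>R D" by (simp add: linepath_def D_def algebra_simps)
        also have "\<dots> = g s" using par[of a s] 3 ab by (simp add: c_def algebra_simps)
        finally show ?thesis by simp
      qed
    qed
    then show ?thesis
      unfolding reparam_equiv_def using \<psi>c \<psi>m \<psi>im
      by (intro exI[of _ "\<lambda>s. s"] exI[of _ \<psi>]) (auto simp: mono_on_def)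
  qed
qed

section \<open>Existence of efficient paths\<close>

text \<open>A bump in \<open>cross_or_bump\<close> would lower the variation in direction
  \<open>u\<close> by more than tightness permits, so the level set crosses to \<gamma>. Direction,
  level and index are chosen before \<open>n\<close> and \<open>H\<close>, which later allows
  finitely many cells to be handled together.\<close>

lemma crossing_link:
  fixes \<nu> :: "nat \<Rightarrow> real \<Rightarrow> complex"
  assumes \<Omega>: "open \<Omega>" and \<nu>: "\<And>n. epeh \<Omega> p q \<gamma> (\<nu> n)"
    and lim: "\<And>e. 0 < e \<Longrightarrow> \<exists>N. \<forall>n\<ge>N. \<forall>s\<in>{0..1}. dist (\<nu> n s) (lam s) < e"
    and tight: "\<And>j \<kappa>. 0 < \<kappa> \<Longrightarrow> \<exists>N. \<forall>n\<ge>N. \<forall>g. epeh \<Omega> p q \<gamma> g \<and> (\<forall>i. tv i g \<le> tv i (\<nu> n)) \<longrightarrow> tv j (\<nu> n) - \<kappa> < tv j g"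
    and ab: "\<alpha> \<in> {0..1}" "\<beta> \<in> {0..1}" "\<alpha> < \<beta>" "lam \<alpha> \<noteq> lam \<beta>"
  shows "\<exists>u v N. norm (u::complex) = 1 \<and> v \<noteq> u \<bullet> p \<and> v \<noteq> u \<bullet> q \<and> (\<forall>n\<ge>N. \<forall>H. epe_hom \<Omega> p q (\<nu> n) \<gamma> H \<longrightarrow>
    (\<exists>r \<rho>. \<alpha> < r \<and> r < \<beta> \<and> 0 < \<rho> \<and> \<rho> < 1 \<and> u \<bullet> \<nu> n r = v \<and> u \<bullet> \<gamma> \<rho> = v \<and>
      homotopic_paths \<Omega> (H \<circ> linepath (r,0) (\<rho>,1)) (linepath (\<nu> n r) (\<gamma> \<rho>))))"
proof -
  have "\<exists>x y. cmod (Complex (of_rat x) (of_rat y)) = 1 \<and> Complex (of_rat x) (of_rat y) \<bullet> lam \<alpha> < Complex (of_rat x) (of_rat y) \<bullet> lam \<beta>"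
  proof -
    have d: "Re (lam \<alpha>) < Re (lam \<beta>) \<or> Re (lam \<beta>) < Re (lam \<alpha>) \<or> Im (lam \<alpha>) < Im (lam \<beta>) \<or> Im (lam \<beta>) < Im (lam \<alpha>)"
      using ab(4) by (auto simp: complex_eq_iff)
    have c: "cmod (Complex (of_rat 1) (of_rat 0)) = 1" "cmod (Complex (of_rat (-1)) (of_rat 0)) = 1"
      "cmod (Complex (of_rat 0) (of_rat 1)) = 1" "cmod (Complex (of_rat 0) (of_rat (-1))) = 1"
      by (simp_all add: complex_norm of_rat_minus)
    from d show ?thesis
    proof (elim disjE)
      show "Re (lam \<alpha>) < Re (lam \<beta>) \<Longrightarrow> ?thesis" using c(1) by (intro exI[of _ 1] exI[of _ 0]) (simp add: inner_complex_def)
      show "Re (lam \<beta>) < Re (lam \<alpha>) \<Longrightarrow> ?thesis" using c(2) by (intro exI[of _ "-1"] exI[of _ 0]) (simp add: inner_complex_def of_rat_minus)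
      show "Im (lam \<alpha>) < Im (lam \<beta>) \<Longrightarrow> ?thesis" using c(3) by (intro exI[of _ 0] exI[of _ 1]) (simp add: inner_complex_def)
      show "Im (lam \<beta>) < Im (lam \<alpha>) \<Longrightarrow> ?thesis" using c(4) by (intro exI[of _ 0] exI[of _ "-1"]) (simp add: inner_complex_def of_rat_minus)
    qed
  qed
  then obtain x y where xy: "cmod (Complex (of_rat x) (of_rat y)) = 1" "Complex (of_rat x) (of_rat y) \<bullet> lam \<alpha> < Complex (of_rat x) (of_rat y) \<bullet> lam \<beta>"
    by blast
  define u where "u = Complex (of_rat x) (of_rat y)"
  have u: "norm u = 1" using xy by (simp add: u_def)
  \<comment> \<open>Levels at three, four and five eighths of the gap are at least
    \<open>3 * d\<close> away from both values of \<open>lam\<close>; with \<open>\<nu> n\<close>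
    within \<open>d\<close> of \<open>lam\<close>, a margin of \<open>2 * d\<close> remains.\<close>
  define d where "d = (u \<bullet> lam \<beta> - u \<bullet> lam \<alpha>) / 8"
  have d: "0 < d" using xy by (simp add: d_def u_def)
  \<comment> \<open>Of three candidate levels at most two are ruled out by \<open>p\<close> and
    \<open>q\<close>.\<close>
  have "\<exists>k\<in>{3,4,5::real}. u \<bullet> lam \<alpha> + k * d \<noteq> u \<bullet> p \<and> u \<bullet> lam \<alpha> + k * d \<noteq> u \<bullet> q"
    using d by auto
  then obtain k where k0: "k \<in> {3,4,5}" and k': "u \<bullet> lam \<alpha> + k * d \<noteq> u \<bullet> p" "u \<bullet> lam \<alpha> + k * d \<noteq> u \<bullet> q"
    by blast
  have k: "3 \<le> k" "k \<le> 5" "u \<bullet> lam \<alpha> + k * d \<noteq> u \<bullet> p" "u \<bullet> lam \<alpha> + k * d \<noteq> u \<bullet> q"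
    using k0 k' by auto
  define v where "v = u \<bullet> lam \<alpha> + k * d"
  have "3 * d \<le> k * d" "k * d \<le> 5 * d" using k d by (auto intro!: mult_right_mono)
  then have v: "u \<bullet> lam \<alpha> \<le> v - 3 * d" "v + 3 * d \<le> u \<bullet> lam \<beta>" by (auto simp: v_def d_def field_simps)
  obtain N1 where N1: "\<forall>n\<ge>N1. \<forall>s\<in>{0..1}. dist (\<nu> n s) (lam s) < d" using lim[OF d] by blast
  \<comment> \<open>The drop \<open>2 * (2 * d) - 6 * epsn j\<close> caused by a bump then exceeds
    the \<open>2 * d\<close> tolerated for this index.\<close>
  obtain j where j: "dirn j = u" "epsn j < d/3" using small_index[of "d/3" x y] d by (auto simp: u_def)
  obtain N2 where N2: "\<forall>n\<ge>N2. \<forall>g. epeh \<Omega> p q \<gamma> g \<and> (\<forall>i. tv i g \<le> tv i (\<nu> n)) \<longrightarrow> tv j (\<nu> n) - 2 * d < tv j g"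
    using tight[of "2 * d" j] d by auto
  have main: "\<exists>r \<rho>. \<alpha> < r \<and> r < \<beta> \<and> 0 < \<rho> \<and> \<rho> < 1 \<and> u \<bullet> \<nu> n r = v \<and> u \<bullet> \<gamma> \<rho> = v \<and>
      homotopic_paths \<Omega> (H \<circ> linepath (r,0) (\<rho>,1)) (linepath (\<nu> n r) (\<gamma> \<rho>))"
    if n: "n \<ge> max N1 N2" and H: "epe_hom \<Omega> p q (\<nu> n) \<gamma> H" for n H
  proof -
    have nc: "continuous_on {0..1} (\<nu> n)" using epeh_cont[OF \<nu>] .
    have near: "\<bar>u \<bullet> \<nu> n s - u \<bullet> lam s\<bar> < d" if "s \<in> {0..1}" for s
    proof -
      have "dist (\<nu> n s) (lam s) < d" using N1 n that by auto
      then show ?thesis using inner_dist_le[of u "\<nu> n s" "lam s"] u by simp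
    qed
    have va: "u \<bullet> \<nu> n \<alpha> < v - 2 * d" "v + 2 * d < u \<bullet> \<nu> n \<beta>" using near[OF ab(1)] near[OF ab(2)] v by linarith+
    have va': "u \<bullet> \<nu> n \<alpha> < v" "v < u \<bullet> \<nu> n \<beta>" using va d by linarith+
    have vp: "v \<noteq> u \<bullet> p" "v \<noteq> u \<bullet> q" using k by (auto simp: v_def)
    show ?thesis
    proof (rule cross_or_bump[OF \<Omega> H u ab(1-3) va' vp])
      fix r \<rho> assume "\<alpha> < r" "r < \<beta>" "0 < \<rho>" "\<rho> < 1" "u \<bullet> \<nu> n r = v" "u \<bullet> \<gamma> \<rho> = v"
        "homotopic_paths \<Omega> (H \<circ> linepath (r,0) (\<rho>,1)) (linepath (\<nu> n r) (\<gamma> \<rho>))"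
      then show ?thesis by blast
    next
      fix a b s assume abs: "0 < a" "a < s" "s < b" "b < 1" "s = \<alpha> \<or> s = \<beta>" "u \<bullet> \<nu> n a = v" "u \<bullet> \<nu> n b = v"
        and ep: "epeh \<Omega> p q (straighten (\<nu> n) a b) (\<nu> n)"
      have "2 * d \<le> \<bar>v - u \<bullet> \<nu> n s\<bar>" using abs(5) va d by auto
      then have drop: "tv j (straighten (\<nu> n) a b) \<le> tv j (\<nu> n) - (2 * (2 * d) - 6 * epsn j)"
        using abs by (intro tv_drop[OF nc, of a b a s b]) (auto simp: j)
      have "epeh \<Omega> p q \<gamma> (straighten (\<nu> n) a b)" using epeh_trans[OF \<nu> epeh_sym[OF ep]] .
      moreover have "\<forall>i. tv i (straighten (\<nu> n) a b) \<le> tv i (\<nu> n)" using abs by (auto intro!: tv_straighten_le[OF nc])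
      ultimately have "tv j (\<nu> n) - 2 * d < tv j (straighten (\<nu> n) a b)" using N2 n by auto
      then show ?thesis using drop j(2) by linarith
    qed
  qed
  show ?thesis
    using u k main by (intro exI[of _ u] exI[of _ v] exI[of _ "max N1 N2"]) (auto simp: v_def)
qed

text \<open>The points of \<gamma> on level \<open>v\<close> stay away from the endpoints, which may
  lie outside \<Omega>. So their images form a compact subset of \<Omega>, around which balls of one
  radius fit into \<Omega>; \<eta> is a modulus of continuity for that radius.\<close>

lemma base_arc:
  assumes \<Omega>: "open \<Omega>" and \<gamma>: "epe_path \<Omega> p q \<gamma>" and v: "v \<noteq> u \<bullet> p" "v \<noteq> u \<bullet> q"
  shows "\<exists>\<eta>>0. \<forall>\<rho>\<in>{0..1}. \<forall>\<rho>'\<in>{0..1}. (u::complex) \<bullet> \<gamma> \<rho> = v \<and> \<bar>\<rho> - \<rho>'\<bar> < \<eta> \<longrightarrow>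
    (\<exists>B. convex B \<and> B \<subseteq> \<Omega> \<and> (\<forall>x\<in>closed_segment \<rho> \<rho>'. \<gamma> x \<in> B))"
proof -
  have gc: "continuous_on {0..1} \<gamma>" using \<gamma> by (simp add: epe_path_def path_def)
  have ge: "\<gamma> 0 = p" "\<gamma> 1 = q" "\<And>s. 0 < s \<Longrightarrow> s < 1 \<Longrightarrow> \<gamma> s \<in> \<Omega>"
    using \<gamma> by (auto simp: epe_path_def pathstart_def pathfinish_def)
  define K where "K = {x\<in>{0..1}. u \<bullet> \<gamma> x = v}"
  have "closed K"
    unfolding K_def using continuous_closed_preimage[OF cont_inner[OF gc], of "{v}" u] by (auto simp: vimage_def Int_def)
  moreover have "bounded K" unfolding K_def by (rule bounded_subset[of "{0..1}"]) auto
  ultimately have "compact K" by (simp add: compact_eq_bounded_closed)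
  moreover have "continuous_on K \<gamma>" using gc by (rule continuous_on_subset) (auto simp: K_def)
  ultimately have cK: "compact (\<gamma> ` K)" by (intro compact_continuous_image)
  have "\<gamma> ` K \<subseteq> \<Omega>"
  proof
    fix z assume "z \<in> \<gamma> ` K"
    then obtain x where x: "x \<in> {0..1}" "u \<bullet> \<gamma> x = v" "z = \<gamma> x" by (auto simp: K_def)
    then have "x \<noteq> 0" "x \<noteq> 1" using v ge by auto
    then show "z \<in> \<Omega>" using x ge(3)[of x] by auto
  qed
  then obtain e where e: "e > 0" "(\<Union>x\<in>\<gamma> ` K. ball x e) \<subseteq> \<Omega>"
    using compact_subset_open_imp_ball_epsilon_subset[OF cK \<Omega>] by blast
  obtain \<eta> where \<eta>: "0 < \<eta>" "\<And>x y. x \<in> {0..1} \<Longrightarrow> y \<in> {0..1} \<Longrightarrow> \<bar>x - y\<bar> < \<eta> \<Longrightarrow> dist (\<gamma> x) (\<gamma> y) < e"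
    using uniform_modulus[OF gc e(1)] by metis
  show ?thesis
  proof (intro exI[of _ \<eta>] conjI ballI impI \<eta>(1))
    fix \<rho> \<rho>' :: real assume r: "\<rho> \<in> {0..1}" "\<rho>' \<in> {0..1}" "u \<bullet> \<gamma> \<rho> = v \<and> \<bar>\<rho> - \<rho>'\<bar> < \<eta>"
    show "\<exists>B. convex B \<and> B \<subseteq> \<Omega> \<and> (\<forall>x\<in>closed_segment \<rho> \<rho>'. \<gamma> x \<in> B)"
    proof (intro exI[of _ "ball (\<gamma> \<rho>) e"] conjI ballI)
      show "ball (\<gamma> \<rho>) e \<subseteq> \<Omega>" using e(2) r by (auto simp: K_def)
      fix x assume x: "x \<in> closed_segment \<rho> \<rho>'"
      have "x \<in> {0..1}" "\<bar>\<rho> - x\<bar> < \<eta>" using x r by (auto simp: closed_segment_eq_real_ivl split: if_splits)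
      then show "\<gamma> x \<in> ball (\<gamma> \<rho>) e" using \<eta>(2)[of \<rho> x] r by auto
    qed auto
  qed
qed

text \<open>In each cell where \<open>lam\<close> is not constant the late paths are connected to
  \<gamma> by level sets, but these may arrive at different times of \<gamma>, and the arc between
  two such times could wind around holes. The pigeonhole principle for these finitely many arrival
  times gives a subsequence in which they are close enough for \<open>base_arc\<close>; then
  \<open>link_via_base\<close> supplies the links needed by \<open>small_homotopy\<close>.\<close>

lemma tight_limit_in_class:
  fixes \<nu> :: "nat \<Rightarrow> real \<Rightarrow> complex"
  assumes \<Omega>: "open \<Omega>" and \<gamma>: "epe_path \<Omega> p q \<gamma>" and \<nu>: "\<And>n. epeh \<Omega> p q \<gamma> (\<nu> n)" and lam: "continuous_on {0..1} lam"
    and lim: "\<And>e. 0 < e \<Longrightarrow> \<exists>N. \<forall>n\<ge>N. \<forall>s\<in>{0..1}. dist (\<nu> n s) (lam s) < e"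
    and tight: "\<And>j \<kappa>. 0 < \<kappa> \<Longrightarrow> \<exists>N. \<forall>n\<ge>N. \<forall>g. epeh \<Omega> p q \<gamma> g \<and> (\<forall>i. tv i g \<le> tv i (\<nu> n)) \<longrightarrow> tv j (\<nu> n) - \<kappa> < tv j g"
  shows "lam \<in> closure_class \<Omega> p q \<gamma>"
proof (rule class_of_limit[OF \<nu>])
  show "path lam" using lam by (simp add: path_def)
  fix \<kappa>0 :: real and \<xi> :: "nat \<Rightarrow> nat" assume \<kappa>0: "0 < \<kappa>0" and \<xi>: "strict_mono \<xi>"
  \<comment> \<open>The homotopy obtained from \<open>small_homotopy\<close> stays within
    \<open>9 * \<kappa>\<close>.\<close>
  define \<kappa> where "\<kappa> = \<kappa>0 / 9"
  have \<kappa>: "0 < \<kappa>" using \<kappa>0 by (simp add: \<kappa>_def)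
  obtain d where d: "0 < d" "\<And>x y. x \<in> {0..1} \<Longrightarrow> y \<in> {0..1} \<Longrightarrow> \<bar>x - y\<bar> < d \<Longrightarrow> dist (lam x) (lam y) < \<kappa>"
    using uniform_modulus[OF lam \<kappa>] by metis
  obtain N0 :: nat where N0: "1 / (real N0 + 1) < d" using reals_Archimedean[OF d(1)] by (auto simp: inverse_eq_divide add.commute)
  define N where "N = Suc N0"
  have N: "0 < N" "1 / real N < d" using N0 by (auto simp: N_def add.commute)
  define cell where "cell = (\<lambda>i. {real i / real N..real (Suc i) / real N})"
  have cell01: "cell i \<subseteq> {0..1}" if "i < N" for i
  proof -
    have "real (Suc i) / real N \<le> 1" using that N by simp
    moreover have "0 \<le> real i / real N" by simp
    ultimately show ?thesis by (auto simp: cell_def)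
  qed
  have celld: "dist (lam x) (lam y) < \<kappa>" if "i < N" "x \<in> cell i" "y \<in> cell i" for i x y
  proof -
    have "real (Suc i) / real N - real i / real N = 1 / real N" by (simp add: diff_divide_distrib[symmetric])
    then have "\<bar>x - y\<bar> < d" using that N by (auto simp: cell_def)
    then show ?thesis using d(2) cell01[OF that(1)] that by blast
  qed
  define I where "I = {i. i < N \<and> (\<exists>x\<in>cell i. \<exists>y\<in>cell i. lam x \<noteq> lam y)}"
  have finI: "finite I" by (auto simp: I_def)
  have "\<forall>i\<in>I. \<exists>a b. a \<in> cell i \<and> b \<in> cell i \<and> a < b \<and> lam a \<noteq> lam b"
  proof
    fix i assume "i \<in> I"
    then obtain x y where "x \<in> cell i" "y \<in> cell i" "lam x \<noteq> lam y" by (auto simp: I_def)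
    then show "\<exists>a b. a \<in> cell i \<and> b \<in> cell i \<and> a < b \<and> lam a \<noteq> lam b"
      by (cases "x < y") (metis, metis linorder_neqE_linordered_idom)
  qed
  then obtain a b where ab: "\<And>i. i \<in> I \<Longrightarrow> a i \<in> cell i" "\<And>i. i \<in> I \<Longrightarrow> b i \<in> cell i" "\<And>i. i \<in> I \<Longrightarrow> a i < b i" "\<And>i. i \<in> I \<Longrightarrow> lam (a i) \<noteq> lam (b i)"
    by metis
  have "\<forall>i\<in>I. \<exists>u v N. norm (u::complex) = 1 \<and> v \<noteq> u \<bullet> p \<and> v \<noteq> u \<bullet> q \<and> (\<forall>n\<ge>N. \<forall>H. epe_hom \<Omega> p q (\<nu> n) \<gamma> H \<longrightarrow>
    (\<exists>r \<rho>. a i < r \<and> r < b i \<and> 0 < \<rho> \<and> \<rho> < 1 \<and> u \<bullet> \<nu> n r = v \<and> u \<bullet> \<gamma> \<rho> = v \<and>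
      homotopic_paths \<Omega> (H \<circ> linepath (r,0) (\<rho>,1)) (linepath (\<nu> n r) (\<gamma> \<rho>))))"
  proof
    fix i assume i: "i \<in> I"
    have ai: "a i \<in> {0..1}" "b i \<in> {0..1}" using ab(1,2)[OF i] cell01[of i] i by (auto simp: I_def)
    show "\<exists>u v N. norm (u::complex) = 1 \<and> v \<noteq> u \<bullet> p \<and> v \<noteq> u \<bullet> q \<and> (\<forall>n\<ge>N. \<forall>H. epe_hom \<Omega> p q (\<nu> n) \<gamma> H \<longrightarrow>
    (\<exists>r \<rho>. a i < r \<and> r < b i \<and> 0 < \<rho> \<and> \<rho> < 1 \<and> u \<bullet> \<nu> n r = v \<and> u \<bullet> \<gamma> \<rho> = v \<and>
      homotopic_paths \<Omega> (H \<circ> linepath (r,0) (\<rho>,1)) (linepath (\<nu> n r) (\<gamma> \<rho>))))"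
      by (rule crossing_link[OF \<Omega> \<nu> lim tight ai ab(3)[OF i] ab(4)[OF i]])
  qed
  then obtain u v M where uv: "\<And>i. i \<in> I \<Longrightarrow> norm (u i) = 1" "\<And>i. i \<in> I \<Longrightarrow> v i \<noteq> u i \<bullet> p" "\<And>i. i \<in> I \<Longrightarrow> v i \<noteq> u i \<bullet> q"
    and M: "\<And>i n H. i \<in> I \<Longrightarrow> n \<ge> M i \<Longrightarrow> epe_hom \<Omega> p q (\<nu> n) \<gamma> H \<Longrightarrow>
    (\<exists>r \<rho>. a i < r \<and> r < b i \<and> 0 < \<rho> \<and> \<rho> < 1 \<and> u i \<bullet> \<nu> n r = v i \<and> u i \<bullet> \<gamma> \<rho> = v i \<and>
      homotopic_paths \<Omega> (H \<circ> linepath (r,0) (\<rho>,1)) (linepath (\<nu> n r) (\<gamma> \<rho>)))"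
    by metis
  obtain M0 where M0: "\<And>n s. n \<ge> M0 \<Longrightarrow> s \<in> {0..1} \<Longrightarrow> dist (\<nu> n s) (lam s) < \<kappa>" using lim[OF \<kappa>] by blast
  define n0 where "n0 = Max (insert M0 (M ` I))"
  have n0: "M0 \<le> n0" "\<And>i. i \<in> I \<Longrightarrow> M i \<le> n0" using finI by (auto simp: n0_def)
  have "\<forall>n. \<exists>H. epe_hom \<Omega> p q (\<nu> n) \<gamma> H" using epeh_sym[OF \<nu>] by (simp add: epeh_def)
  then obtain H where H: "\<And>n. epe_hom \<Omega> p q (\<nu> n) \<gamma> (H n)" by metis
  have "\<forall>n i. \<exists>r \<rho>. n \<ge> n0 \<and> i \<in> I \<longrightarrow> a i < r \<and> r < b i \<and> 0 < \<rho> \<and> \<rho> < 1 \<and> u i \<bullet> \<nu> n r = v i \<and> u i \<bullet> \<gamma> \<rho> = v i \<and>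
      homotopic_paths \<Omega> (H n \<circ> linepath (r,0) (\<rho>,1)) (linepath (\<nu> n r) (\<gamma> \<rho>))"
    using M[OF _ _ H] n0(2) by (meson order_trans)
  then obtain r \<rho> where r: "\<And>n i. n \<ge> n0 \<Longrightarrow> i \<in> I \<Longrightarrow> a i < r n i \<and> r n i < b i \<and> 0 < \<rho> n i \<and> \<rho> n i < 1 \<and>
      u i \<bullet> \<nu> n (r n i) = v i \<and> u i \<bullet> \<gamma> (\<rho> n i) = v i \<and>
      homotopic_paths \<Omega> (H n \<circ> linepath (r n i,0) (\<rho> n i,1)) (linepath (\<nu> n (r n i)) (\<gamma> (\<rho> n i)))"
    by metis
  have "\<forall>i\<in>I. \<exists>\<eta>>0. \<forall>\<rho>\<in>{0..1}. \<forall>\<rho>'\<in>{0..1}. u i \<bullet> \<gamma> \<rho> = v i \<and> \<bar>\<rho> - \<rho>'\<bar> < \<eta> \<longrightarrow>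
    (\<exists>B. convex B \<and> B \<subseteq> \<Omega> \<and> (\<forall>x\<in>closed_segment \<rho> \<rho>'. \<gamma> x \<in> B))"
    using base_arc[OF \<Omega> \<gamma>] uv(2,3) by blast
  then obtain \<eta> where \<eta>: "\<And>i. i \<in> I \<Longrightarrow> 0 < \<eta> i" "\<And>i \<rho> \<rho>'. i \<in> I \<Longrightarrow> \<rho> \<in> {0..1} \<Longrightarrow> \<rho>' \<in> {0..1} \<Longrightarrow> u i \<bullet> \<gamma> \<rho> = v i \<Longrightarrow> \<bar>\<rho> - \<rho>'\<bar> < \<eta> i \<Longrightarrow>
    (\<exists>B. convex B \<and> B \<subseteq> \<Omega> \<and> (\<forall>x\<in>closed_segment \<rho> \<rho>'. \<gamma> x \<in> B))"
    by metis
  \<comment> \<open>The position of the arrival time in a grid of mesh \<open>\<eta> i\<close>;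
    equal positions mean a distance below \<open>\<eta> i\<close>. Restriction to \<open>I\<close>
    places \<open>F n\<close> in a finite product.\<close>
  define F where "F = (\<lambda>n. \<lambda>i\<in>I. \<lfloor>\<rho> (\<xi> n) i / \<eta> i\<rfloor>)"
  define A where "A = {n. n0 \<le> \<xi> n}"
  have "{n0..} \<subseteq> A" using seq_suble[OF \<xi>] by (auto simp: A_def intro: order_trans)
  then have infA: "infinite A" using infinite_Ici finite_subset by blast
  have "F ` A \<subseteq> PiE I (\<lambda>i. {0..\<lfloor>1 / \<eta> i\<rfloor>})"
  proof
    fix f assume "f \<in> F ` A"
    then obtain n where n: "n0 \<le> \<xi> n" "f = F n" by (auto simp: A_def)
    have "0 \<le> \<lfloor>\<rho> (\<xi> n) i / \<eta> i\<rfloor> \<and> \<lfloor>\<rho> (\<xi> n) i / \<eta> i\<rfloor> \<le> \<lfloor>1 / \<eta> i\<rfloor>" if "i \<in> I" for i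
    proof
      show "0 \<le> \<lfloor>\<rho> (\<xi> n) i / \<eta> i\<rfloor>" using r[OF n(1) that] \<eta>(1)[OF that] by simp
      show "\<lfloor>\<rho> (\<xi> n) i / \<eta> i\<rfloor> \<le> \<lfloor>1 / \<eta> i\<rfloor>" using r[OF n(1) that] \<eta>(1)[OF that] by (intro floor_mono divide_right_mono) auto
    qed
    then show "f \<in> PiE I (\<lambda>i. {0..\<lfloor>1 / \<eta> i\<rfloor>})" using n(2) by (auto simp: F_def)
  qed
  then have finF: "finite (F ` A)" by (rule finite_subset) (auto intro!: finite_PiE finI)
  obtain a0 where inf0: "infinite {n\<in>A. F n = F a0}" using pigeonhole_infinite[OF infA finF] by blast
  obtain \<psi> :: "nat \<Rightarrow> nat" where \<psi>: "strict_mono \<psi>" "\<And>n. \<psi> n \<in> {n\<in>A. F n = F a0}"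
    using infinite_enumerate[OF inf0] by blast
  show "\<exists>\<psi>'::nat \<Rightarrow> nat. strict_mono \<psi>' \<and> (\<forall>n m. small_hom \<Omega> p q lam \<kappa>0 (\<nu> (\<xi> (\<psi>' n))) (\<nu> (\<xi> (\<psi>' m))))"
  proof (intro exI[of _ \<psi>] conjI allI \<psi>(1))
    fix n m
    define n1 n2 where "n1 = \<xi> (\<psi> n)" and "n2 = \<xi> (\<psi> m)"
    have n12: "n0 \<le> n1" "n0 \<le> n2" using \<psi>(2)[of n] \<psi>(2)[of m] by (auto simp: A_def n1_def n2_def)
    have fl: "\<lfloor>\<rho> n1 i / \<eta> i\<rfloor> = \<lfloor>\<rho> n2 i / \<eta> i\<rfloor>" if "i \<in> I" for i
    proof -
      have "F (\<psi> n) i = F (\<psi> m) i" using \<psi>(2)[of n] \<psi>(2)[of m] by simp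
      then show ?thesis using that by (simp add: F_def n1_def n2_def)
    qed
    define G where "G = tpaste (H n1) (trev (H n2))"
    have G: "epe_hom \<Omega> p q (\<nu> n1) (\<nu> n2) G" unfolding G_def by (rule epe_hom_trans[OF H epe_hom_sym[OF H]])
    have "\<exists>F. epe_hom \<Omega> p q (\<nu> n1) (\<nu> n2) F \<and> (\<forall>z\<in>sq. dist (F z) (lam (fst z)) \<le> 9 * \<kappa>)"
    proof (rule small_homotopy[OF G N(1) \<kappa>])
      show "dist (lam s) (lam s') < \<kappa>" if "i < N" "s \<in> {real i/N..real (Suc i)/N}" "s' \<in> {real i/N..real (Suc i)/N}" for i s s'
        using celld[OF that(1), of s s'] that by (simp add: cell_def)
      show "dist (\<nu> n1 s) (lam s) < \<kappa>" "dist (\<nu> n2 s) (lam s) < \<kappa>" if "s \<in> {0..1}" for s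
        using M0 that n0(1) n12 by (meson order_trans)+
      fix i s s' assume i: "i < N" "s \<in> {real i/N..real (Suc i)/N}" "s' \<in> {real i/N..real (Suc i)/N}" "lam s \<noteq> lam s'"
      have iI: "i \<in> I" unfolding I_def cell_def using i by blast
      note r1 = r[OF n12(1) iI] and r2 = r[OF n12(2) iI]
      have "\<bar>\<rho> n1 i / \<eta> i - \<rho> n2 i / \<eta> i\<bar> < 1" using fl[OF iI] by linarith
      then have "\<bar>\<rho> n1 i - \<rho> n2 i\<bar> < \<eta> i" using \<eta>(1)[OF iI] by (simp add: diff_divide_distrib[symmetric] pos_divide_less_eq)
      then obtain B where B: "convex B" "B \<subseteq> \<Omega>" "\<forall>x\<in>closed_segment (\<rho> n1 i) (\<rho> n2 i). \<gamma> x \<in> B"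
        using \<eta>(2)[OF iI, of "\<rho> n1 i" "\<rho> n2 i"] r1 r2 by (metis atLeastAtMost_iff less_imp_le)
      have c: "r n1 i \<in> cell i" "r n2 i \<in> cell i" using r1 r2 ab(1,2)[OF iI] by (auto simp: cell_def)
      have c': "real i/N < r n1 i" "r n1 i < real (Suc i)/N" "real i/N < r n2 i" "r n2 i < real (Suc i)/N"
        using r1 r2 ab(1,2)[OF iI] by (auto simp: cell_def)
      have s1: "real (Suc i)/N \<le> 1" "0 \<le> real i/N" using i(1) N by auto
      have c'': "0 < r n1 i" "0 < r n2 i" "r n1 i < 1" "r n2 i < 1" using c' s1 by linarith+
      have L: "link \<Omega> G (r n1 i) (r n2 i) (linepath (\<nu> n1 (r n1 i)) (\<nu> n2 (r n2 i)))"
        unfolding G_def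
        by (rule link_via_base[OF H H uv(1)[OF iI], where v = "v i" and \<rho> = "\<rho> n1 i" and \<rho>' = "\<rho> n2 i" and B = B]) (use r1 r2 B c'' in auto)
      have dd: "dist (\<nu> k (r k i)) (lam (real i/N)) < 2 * \<kappa>" if "k = n1 \<or> k = n2" for k
      proof -
        have rk: "r k i \<in> cell i" using c that by auto
        have ic: "real i/N \<in> cell i" by (simp add: cell_def divide_right_mono)
        have "dist (lam (r k i)) (lam (real i/N)) < \<kappa>" by (rule celld[OF i(1) rk ic])
        moreover have "r k i \<in> {0..1}" using cell01[OF i(1)] rk by blast
        moreover have "dist (\<nu> k (r k i)) (lam (r k i)) < \<kappa>" using M0[of k "r k i"] \<open>r k i \<in> {0..1}\<close> n0(1) n12 that by auto
        ultimately show ?thesis using dist_triangle[of "\<nu> k (r k i)" "lam (real i/N)" "lam (r k i)"] by linarith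
      qed
      have "dist (linepath (\<nu> n1 (r n1 i)) (\<nu> n2 (r n2 i)) t) (lam (real i/N)) < 3 * \<kappa>" if "t \<in> {0..1}" for t
      proof -
        have "linepath (\<nu> n1 (r n1 i)) (\<nu> n2 (r n2 i)) t \<in> closed_segment (\<nu> n1 (r n1 i)) (\<nu> n2 (r n2 i))"
          using that by (metis path_image_linepath path_image_def imageI)
        also have "\<dots> \<subseteq> ball (lam (real i/N)) (2 * \<kappa>)"
          using dd[of n1] dd[of n2] by (intro closed_segment_subset) (auto simp: dist_commute)
        finally show ?thesis using \<kappa> by (simp add: dist_commute)
      qed
      then show "\<exists>r r' \<sigma>. real i/N < r \<and> r < real (Suc i)/N \<and> real i/N < r' \<and> r' < real (Suc i)/N \<and> link \<Omega> G r r' \<sigma> \<and>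
        (\<forall>t\<in>{0..1}. dist (\<sigma> t) (lam (real i/N)) < 3 * \<kappa>)"
        using L c' by blast
    qed
    then show "small_hom \<Omega> p q lam \<kappa>0 (\<nu> (\<xi> (\<psi> n))) (\<nu> (\<xi> (\<psi> m)))"
      unfolding small_hom_def n1_def n2_def \<kappa>_def by simp
  qed
qed

lemma exists_efficient:
  assumes \<Omega>: "open \<Omega>" and \<gamma>: "epe_path \<Omega> p q \<gamma>"
  shows "\<exists>lam. efficient \<Omega> p q \<gamma> lam"
proof -
  obtain l :: "nat \<Rightarrow> real \<Rightarrow> complex" where l: "\<And>n. epeh \<Omega> p q \<gamma> (l n)" "\<And>j. \<exists>B. \<forall>n. tv j (l n) \<le> B"
    and l3: "\<And>j \<kappa>. 0 < \<kappa> \<Longrightarrow> \<exists>N. \<forall>n\<ge>N. \<forall>g. epeh \<Omega> p q \<gamma> g \<and> (\<forall>i. tv i g \<le> tv i (l n)) \<longrightarrow> tv j (l n) - \<kappa> < tv j g"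
    and l4: "\<And>(\<psi>::nat \<Rightarrow> nat) L \<nu> j. strict_mono \<psi> \<Longrightarrow> (\<And>j. (\<lambda>n. tv j (l (\<psi> n))) \<longlonglongrightarrow> L j) \<Longrightarrow> \<nu> \<in> closure_class \<Omega> p q \<gamma> \<Longrightarrow>
       (\<And>j. tv j \<nu> \<le> L j) \<Longrightarrow> tv j \<nu> = L j"
  proof (rule minimizing_sequence[OF \<gamma>])
    fix l :: "nat \<Rightarrow> real \<Rightarrow> complex"
    assume a: "\<And>n. epeh \<Omega> p q \<gamma> (l n)" "\<And>j. \<exists>B. \<forall>n. tv j (l n) \<le> B"
      "\<And>j \<kappa>. 0 < \<kappa> \<Longrightarrow> \<exists>N. \<forall>n\<ge>N. \<forall>g. epeh \<Omega> p q \<gamma> g \<and> (\<forall>i. tv i g \<le> tv i (l n)) \<longrightarrow> tv j (l n) - \<kappa> < tv j g"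
      "\<And>(\<psi>::nat \<Rightarrow> nat) L \<nu> j. strict_mono \<psi> \<Longrightarrow> (\<And>j. (\<lambda>n. tv j (l (\<psi> n))) \<longlonglongrightarrow> L j) \<Longrightarrow> \<nu> \<in> closure_class \<Omega> p q \<gamma> \<Longrightarrow>
       (\<And>j. tv j \<nu> \<le> L j) \<Longrightarrow> tv j \<nu> = L j"
    show thesis
    proof (rule that[of l, OF a(1-3)])
      fix \<psi> :: "nat \<Rightarrow> nat" and L \<nu> j
      assume "strict_mono \<psi>" "\<And>j. (\<lambda>n. tv j (l (\<psi> n))) \<longlonglongrightarrow> L j" "\<nu> \<in> closure_class \<Omega> p q \<gamma>" "\<And>j. tv j \<nu> \<le> L j"
      then show "tv j \<nu> = L j" by (rule a(4)[of \<psi> L \<nu> j])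
    qed
  qed
  have lc: "continuous_on {0..1} (l n)" for n using epeh_cont[OF l(1)] .
  obtain \<rho> :: "nat \<Rightarrow> real \<Rightarrow> real" where \<rho>: "\<And>n. continuous_on {0..1} (\<rho> n)" "\<And>n. strict_mono_on {0..1} (\<rho> n)"
    "\<And>n. \<rho> n 0 = 0" "\<And>n. \<rho> n 1 = 1" "\<And>n. \<rho> n ` {0..1} = {0..1}"
    and eqc: "\<And>e. 0 < e \<Longrightarrow> \<exists>d>0. \<forall>n. \<forall>s\<in>{0..1}. \<forall>s'\<in>{0..1}. \<bar>s - s'\<bar> < d \<longrightarrow> dist (l n (\<rho> n s)) (l n (\<rho> n s')) < e"
  proof (rule equicontinuous_reparam[OF lc l(2)])
    fix \<rho> :: "nat \<Rightarrow> real \<Rightarrow> real"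
    assume a: "\<And>n. continuous_on {0..1} (\<rho> n)" "\<And>n. strict_mono_on {0..1} (\<rho> n)"
      "\<And>n. \<rho> n 0 = 0" "\<And>n. \<rho> n 1 = 1" "\<And>n. \<rho> n ` {0..1} = {0..1}"
      "\<And>e. 0 < e \<Longrightarrow> \<exists>d>0. \<forall>n. \<forall>s\<in>{0..1}. \<forall>s'\<in>{0..1}. \<bar>s - s'\<bar> < d \<longrightarrow> dist (l n (\<rho> n s)) (l n (\<rho> n s')) < e"
    show thesis by (rule that[of \<rho>, OF a])
  qed
  define L where "L = (\<lambda>n s. l n (\<rho> n s))"
  have L1: "epeh \<Omega> p q \<gamma> (L n)" for n unfolding L_def by (rule epeh_reparam[OF l(1) \<rho>(1-4)])
  have Lc: "continuous_on {0..1} (L n)" for n using epeh_cont[OF L1] .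
  have Ltv: "tv j (L n) = tv j (l n)" for j n
    unfolding L_def using \<rho>(2) by (intro tv_reparam lc \<rho>) (simp add: strict_mono_on_imp_mono_on)
  \<comment> \<open>All paths start at \<open>p\<close>, and the variations with threshold 1 in the
    two coordinate directions bound the distance from \<open>p\<close> up to a constant.\<close>
  have "\<exists>M. \<forall>n. \<forall>s\<in>{0..1}. cmod (L n s) \<le> M"
  proof -
    obtain j1 where j1: "dirn j1 = 1" "epsn j1 = 1" using index_exists[of 1 0 0] by (auto simp: complex_eq_iff)
    obtain j2 where j2: "dirn j2 = \<i>" "epsn j2 = 1" using index_exists[of 0 1 0] by (auto simp: complex_eq_iff)
    obtain B1 B2 where B: "\<forall>n. tv j1 (l n) \<le> B1" "\<forall>n. tv j2 (l n) \<le> B2" using l(2) by metis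
    have one: "\<bar>u \<bullet> p - u \<bullet> L n s\<bar> \<le> 1 + B" if "dirn j = u" "epsn j = 1" "tv j (l n) \<le> B" "s \<in> {0..1}" for j u n s B
    proof -
      have c: "continuous_on {0..1} (\<lambda>s. u \<bullet> L n s)" using cont_inner[OF Lc] .
      have L0: "L n 0 = p" using epeh_path[OF L1] by (auto simp: epe_path_def pathstart_def)
      have "trunc 1 (u \<bullet> L n 0) (u \<bullet> L n s) \<le> TV 1 (\<lambda>s. u \<bullet> L n s) s"
        using TV_step[OF c, of 1 0 s] TV_nonneg[OF c, of 1 0] that by auto
      also have "\<dots> \<le> TV 1 (\<lambda>s. u \<bullet> L n s) 1" using TV_mono[OF c, of 1 s 1] that by auto
      also have "\<dots> = tv j (L n)" using that by (simp add: tv_def)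
      finally show ?thesis using that(3) L0 by (simp add: Ltv trunc_def)
    qed
    have "cmod (L n s) \<le> cmod p + (1 + B1) + (1 + B2)" if "s \<in> {0..1}" for n s
    proof -
      have "\<bar>Re (p - L n s)\<bar> \<le> 1 + B1" "\<bar>Im (p - L n s)\<bar> \<le> 1 + B2"
        using one[OF j1 _ that, of n B1] one[OF j2 _ that, of n B2] B by (auto simp: inner_complex_def)
      then have "cmod (p - L n s) \<le> (1 + B1) + (1 + B2)" using cmod_le[of "p - L n s"] by linarith
      then show ?thesis using norm_triangle_ineq4[of p "p - L n s"] by simp
    qed
    then show ?thesis by blast
  qed
  then obtain M where M: "\<And>n s. s \<in> {0..1} \<Longrightarrow> cmod (L n s) \<le> M" by blast
  obtain lam \<psi> where lam: "continuous_on {0..1} lam" and \<psi>: "strict_mono (\<psi> :: nat \<Rightarrow> nat)"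
    and conv: "\<And>e. 0 < e \<Longrightarrow> \<exists>N. \<forall>n x. n \<ge> N \<and> x \<in> {0..1} \<longrightarrow> cmod (L (\<psi> n) x - lam x) < e"
  proof (rule Arzela_Ascoli[of "{0..1::real}" L M])
    show "\<exists>d>0. \<forall>n y. y \<in> {0..1} \<and> norm (x - y) < d \<longrightarrow> cmod (L n x - L n y) < e" if "x \<in> {0..1}" "0 < e" for x e :: real
      using eqc[OF that(2)] that(1) unfolding L_def by (fastforce simp: dist_norm)
  qed (use M in auto)
  define \<nu> where "\<nu> = (\<lambda>n. L (\<psi> n))"
  have lim: "\<exists>N. \<forall>n\<ge>N. \<forall>s\<in>{0..1}. dist (\<nu> n s) (lam s) < e" if "0 < e" for e
    using conv[OF that] unfolding \<nu>_def dist_norm by blast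
  have cls: "lam \<in> closure_class \<Omega> p q \<gamma>"
  proof (rule tight_limit_in_class[OF \<Omega> \<gamma> _ lam lim])
    show "epeh \<Omega> p q \<gamma> (\<nu> n)" for n unfolding \<nu>_def by (rule L1)
    fix j :: nat and \<kappa> :: real assume "0 < \<kappa>"
    then obtain N where N: "\<forall>n\<ge>N. \<forall>g. epeh \<Omega> p q \<gamma> g \<and> (\<forall>i. tv i g \<le> tv i (l n)) \<longrightarrow> tv j (l n) - \<kappa> < tv j g"
      using l3 by blast
    show "\<exists>N. \<forall>n\<ge>N. \<forall>g. epeh \<Omega> p q \<gamma> g \<and> (\<forall>i. tv i g \<le> tv i (\<nu> n)) \<longrightarrow> tv j (\<nu> n) - \<kappa> < tv j g"
    proof (intro exI[of _ N] allI impI)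
      fix n g assume "N \<le> n" "epeh \<Omega> p q \<gamma> g \<and> (\<forall>i. tv i g \<le> tv i (\<nu> n))"
      moreover have "N \<le> \<psi> n" using seq_suble[OF \<psi>, of n] \<open>N \<le> n\<close> by linarith
      ultimately show "tv j (\<nu> n) - \<kappa> < tv j g" using N by (simp add: \<nu>_def Ltv)
    qed
  qed auto
  have conv_tv: "(\<lambda>n. tv j (l (\<psi> n))) \<longlonglongrightarrow> tv j lam" for j
  proof -
    have "(\<lambda>n. tv j (\<nu> n)) \<longlonglongrightarrow> tv j lam"
      by (rule tv_tendsto[OF lam _ lim]) (auto simp: \<nu>_def Lc)
    then show ?thesis by (simp add: \<nu>_def Ltv)
  qed
  \<comment> \<open>Straightening never raises a variation, so by the minimality property
    \<open>l4\<close> a straightened path in the closed class has exactly the variations of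
    \<open>lam\<close>, and rigidity applies.\<close>
  have "reparam_equiv lam (straighten lam s1 s2)"
    if s: "0 \<le> s1" "s1 < s2" "s2 \<le> 1" and c: "straighten lam s1 s2 \<in> closure_class \<Omega> p q \<gamma>" for s1 s2
  proof (rule tv_equal_imp_reparam[OF lam s])
    show "tv j (straighten lam s1 s2) = tv j lam" for j
      by (rule l4[OF \<psi> conv_tv c]) (rule tv_straighten_le[OF lam s])
  qed
  then show ?thesis using cls unfolding efficient_def by blast
qed

section \<open>Efficient paths do not cross level sets twice\<close>

text \<open>The map \<Phi> turns the strip between the curves \<open>A\<close> and \<open>B\<close>
  into the square. Level \<open>v\<close> separates its sides, so a level continuum runs from bottom
  to top. The bottom and the top are mapped to segments that cross the level exactly once; therefore
  the continuum ends at the prescribed points, and \<open>leaf\<close> applies.\<close>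

lemma straight_link:
  assumes \<Omega>: "open \<Omega>" and G: "epe_hom \<Omega> p q g g' G" and AB: "continuous_on {0..1} A" "continuous_on {0..1} B"
    and AB01: "\<And>t. t \<in> {0..1} \<Longrightarrow> 0 < A t" "\<And>t. t \<in> {0..1} \<Longrightarrow> A t < B t" "\<And>t. t \<in> {0..1} \<Longrightarrow> B t < 1"
    and e: "norm (e::complex) = 1" and v: "\<And>t. t \<in> {0..1} \<Longrightarrow> e \<bullet> G (A t,t) < v" "\<And>t. t \<in> {0..1} \<Longrightarrow> v < e \<bullet> G (B t,t)"
    and g: "\<And>x. x \<in> {0..1} \<Longrightarrow> g (A 0 + x * (B 0 - A 0)) = linepath P Q x"
    and g': "\<And>x. x \<in> {0..1} \<Longrightarrow> g' (A 1 + x * (B 1 - A 1)) = linepath P' Q' x"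
    and x: "x0 \<in> {0..1}" "e \<bullet> linepath P Q x0 = v" "x1 \<in> {0..1}" "e \<bullet> linepath P' Q' x1 = v"
    and r: "r = A 0 + x0 * (B 0 - A 0)" "r' = A 1 + x1 * (B 1 - A 1)"
  shows "homotopic_paths \<Omega> (G \<circ> linepath (r,0) (r',1)) (linepath (g r) (g' r'))"
proof -
  define \<Phi> where "\<Phi> = (\<lambda>z::real\<times>real. (A (snd z) + fst z * (B (snd z) - A (snd z)), snd z))"
  define R where "R = (\<lambda>z. G (\<Phi> z))"
  let ?S = "{0<..<1::real} \<times> {0..1::real}"
  have \<Phi>c: "continuous_on sq \<Phi>"
    unfolding \<Phi>_def by (intro continuous_intros continuous_on_compose2[OF AB(1)] continuous_on_compose2[OF AB(2)]) auto
  have \<Phi>S: "\<Phi> z \<in> ?S" if zs: "z \<in> sq" for z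
  proof -
    obtain x t where z: "z = (x,t)" "x \<in> {0..1}" "t \<in> {0..1}" using zs by (cases z) auto
    have "0 \<le> x * (B t - A t)" "x * (B t - A t) \<le> B t - A t" using AB01(2)[OF z(3)] z(2) mult_right_mono[of x 1 "B t - A t"] by auto
    then have "0 < A t + x * (B t - A t)" "A t + x * (B t - A t) < 1" using AB01[OF z(3)] by linarith+
    then show ?thesis using z by (auto simp: \<Phi>_def)
  qed
  have Rc: "continuous_on sq R" unfolding R_def 
  proof (rule continuous_on_compose2[OF epe_homD(1)[OF G] \<Phi>c])
    have "?S \<subseteq> sq" by auto
    then show "\<Phi> ` sq \<subseteq> sq" using \<Phi>S by blast
  qed
  have R\<Omega>: "R ` sq \<subseteq> \<Omega>"
  proof
    fix w assume "w \<in> R ` sq"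
    then obtain z where z: "z \<in> sq" "w = G (\<Phi> z)" by (auto simp: R_def)
    then show "w \<in> \<Omega>" using \<Phi>S[OF z(1)] epe_homD(6)[OF G, of "fst (\<Phi> z)" "snd (\<Phi> z)"] by (auto simp: mem_Times_iff)
  qed
  have fc: "continuous_on sq (\<lambda>z. e \<bullet> R z)" using Rc by (intro continuous_intros)
  have side: "e \<bullet> R (0,t) < v" "v < e \<bullet> R (1,t)" if "t \<in> {0..1}" for t using v[OF that] by (auto simp: R_def \<Phi>_def)
  have A01: "A t + x * (B t - A t) \<in> {0..1}" if "t \<in> {0..1}" "x \<in> {0..1}" for x t
    using \<Phi>S[of "(x,t)"] that by (auto simp: \<Phi>_def)
  have bot: "R (x,0) = linepath P Q x" "R (x,1) = linepath P' Q' x" if "x \<in> {0..1}" for x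
    using g[OF that] g'[OF that] epe_homD(2)[OF G A01[OF _ that, of 0]] epe_homD(3)[OF G A01[OF _ that, of 1]] by (simp_all add: R_def \<Phi>_def)
  have inj: "y = y'" if "e \<bullet> linepath P0 Q0 y = v" "e \<bullet> linepath P0 Q0 y' = v" "e \<bullet> P0 < v" "v < e \<bullet> Q0" for y y' :: real and P0 Q0
  proof -
    have *: "e \<bullet> linepath P0 Q0 y = e \<bullet> P0 + y * (e \<bullet> Q0 - e \<bullet> P0)" for y
      by (simp add: linepath_def inner_add_right algebra_simps)
    have "y * (e \<bullet> Q0 - e \<bullet> P0) = y' * (e \<bullet> Q0 - e \<bullet> P0)" using that *[of y] *[of y'] by linarith
    then show ?thesis using that by simp
  qed
  have ends: "e \<bullet> P < v" "v < e \<bullet> Q" "e \<bullet> P' < v" "v < e \<bullet> Q'"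
    using side[of 0] side[of 1] bot[of 0] bot[of 1] by (auto simp: linepath_def)
  define C where "C = connected_component_set {z \<in> sq. e \<bullet> R z \<le> v} (0,0)"
  have aC: "(0,0) \<in> C" using side[of 0] by (auto simp: C_def intro!: connected_component_refl)
  have Csub: "C \<subseteq> {z \<in> sq. e \<bullet> R z \<le> v}" unfolding C_def by (rule connected_component_subset)
  have bC: "(1,0) \<notin> C" using Csub side(2)[of 0] by auto
  obtain D where D: "compact D" "connected D" "D \<subseteq> C" "\<And>z. z \<in> D \<Longrightarrow> e \<bullet> R z = v"
    and hit: "\<And>\<Gamma>. connected \<Gamma> \<Longrightarrow> \<Gamma> \<subseteq> sq \<Longrightarrow> (1,0) \<in> \<Gamma> \<Longrightarrow> \<Gamma> \<inter> C \<noteq> {} \<Longrightarrow> \<Gamma> \<inter> D \<noteq> {}"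
    by (rule level_separation[OF sq_convex sq_compact fc _ _ _ C_def bC]) (use side[of 0] in \<open>auto simp: less_imp_le\<close>)
  have Dsq: "D \<subseteq> sq" using D(3) Csub by auto
  have "({0..1} \<times> {0}) \<inter> D \<noteq> {}"
  proof (intro hit)
    have "(0,0) \<in> {0..1} \<times> {0} \<inter> C" using aC by auto
    then show "{0..1} \<times> {0} \<inter> C \<noteq> {}" by blast
  qed (auto intro!: connected_Times)
  then obtain y0 where "0 \<le> y0" "y0 \<le> 1" "(y0,0) \<in> D" by auto
  then have y0: "y0 \<in> {0..1}" "(y0,0) \<in> D" by auto
  have "y0 = x0" using inj[of P Q y0 x0] D(4)[OF y0(2)] bot(1)[OF y0(1)] x(2) ends by auto
  then have x0D: "(x0,0) \<in> D" using y0 by simp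
  let ?\<Gamma> = "{0..0} \<times> {0} \<union> {0} \<times> {0..1} \<union> {0..1} \<times> {1} \<union> {1} \<times> {0..1} \<union> {1..1} \<times> {0} :: (real \<times> real) set"
  have "?\<Gamma> \<inter> D \<noteq> {}"
  proof (intro hit connected_U)
    have "(0,0) \<in> ?\<Gamma> \<inter> C" using aC by auto
    then show "?\<Gamma> \<inter> C \<noteq> {}" by blast
  qed auto
  then obtain y1 t where w: "(y1,t) \<in> ?\<Gamma>" "(y1,t) \<in> D" by (metis Int_emptyI prod.exhaust)
  have yt: "y1 \<in> {0..1}" "t \<in> {0..1}" using w(2) Dsq by auto
  have "y1 \<noteq> 0" "y1 \<noteq> 1" using side[OF yt(2)] D(4)[OF w(2)] by auto
  then have t1: "t = 1" using w(1) by auto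
  have "y1 = x1" using inj[of P' Q' y1 x1] D(4)[OF w(2)] bot(2)[OF yt(1)] x(4) ends t1 by auto
  then have x1D: "(x1,1) \<in> D" using w(2) t1 by simp
  have seg: "path_image (linepath (x0,0) (x1,1)) \<subseteq> sq"
    unfolding path_image_linepath by (rule closed_segment_subset) (use sq_convex x in auto)
  have "homotopic_paths \<Omega> (R \<circ> linepath (x0,0) (x1,1)) (linepath (R (x0,0)) (R (x1,1)))"
    by (rule leaf[OF \<Omega> sq_convex Rc R\<Omega> D(1,2) Dsq e D(4) x0D x1D]) (use seg in auto)
  moreover have "R (x0,0) = g r" "R (x1,1) = g' r'" using bot x g g' r by auto
  ultimately have 1: "homotopic_paths \<Omega> (R \<circ> linepath (x0,0) (x1,1)) (linepath (g r) (g' r'))" by simp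
  have S: "convex ?S" by (intro convex_Times) auto
  have rS: "(r,0) \<in> ?S" "(r',1) \<in> ?S" using \<Phi>S[of "(x0,0)"] \<Phi>S[of "(x1,1)"] x r by (auto simp: \<Phi>_def)
  have "homotopic_paths ?S (linepath (r,0) (r',1)) (\<Phi> \<circ> linepath (x0,0) (x1,1))"
  proof (rule homotopic_in_convex[OF S])
    show "path (\<Phi> \<circ> linepath (x0,0) (x1,1))"
      by (rule path_continuous_image) (use \<Phi>c seg continuous_on_subset in auto)
    show "path_image (linepath (r, 0) (r', 1)) \<subseteq> ?S"
      unfolding path_image_linepath by (rule closed_segment_subset[OF rS S])
    show "path_image (\<Phi> \<circ> linepath (x0, 0) (x1, 1)) \<subseteq> ?S" using \<Phi>S seg unfolding path_image_compose by blast
  qed (auto simp: pathstart_compose pathfinish_compose \<Phi>_def r)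
  then have "homotopic_paths \<Omega> (G \<circ> linepath (r,0) (r',1)) (G \<circ> (\<Phi> \<circ> linepath (x0,0) (x1,1)))"
  proof (rule homotopic_paths_continuous_image)
    show "continuous_on ?S G" using epe_homD(1)[OF G] by (rule continuous_on_subset) auto
    show "G \<in> ?S \<rightarrow> \<Omega>" using epe_homD(6)[OF G] by auto
  qed
  moreover have "G \<circ> (\<Phi> \<circ> linepath (x0,0) (x1,1)) = R \<circ> linepath (x0,0) (x1,1)" by (auto simp: R_def)
  ultimately show ?thesis using 1 homotopic_paths_trans by metis
qed

text \<open>By \<open>straighten_eq\<close> the straightened path depends continuously on
  \<open>s\<close>, \<open>a\<close> and \<open>b\<close> jointly while \<open>a\<close> and
  \<open>b\<close> stay apart, and compactness makes this uniform. Passing from \<open>g\<close> to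
  \<open>g'\<close> moves a chord by no more than its ends are moved.\<close>

lemma straighten_uniform:
  assumes g: "continuous_on {0..1} g" and ab: "0 \<le> a0" "a0 < b0" "b0 \<le> 1" and \<kappa>: "0 < \<kappa>"
  shows "\<exists>\<eta>>0. \<forall>a b s g'. \<bar>a - a0\<bar> < \<eta> \<and> \<bar>b - b0\<bar> < \<eta> \<and> 0 \<le> a \<and> b \<le> 1 \<and> a < b \<and> s \<in> {0..1} \<and> (\<forall>x\<in>{0..1}. dist (g' x) (g x) < \<eta>) \<longrightarrow>
    dist (straighten g' a b s) (straighten g a0 b0 s) < \<kappa>"
proof -
  \<comment> \<open>With a third of the gap, \<open>a \<le> a0 + m\<close> and
    \<open>b0 - m \<le> b\<close> still imply \<open>a < b\<close>.\<close>
  define m where "m = (b0 - a0) / 3"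
  have m: "0 < m" using ab by (simp add: m_def)
  define T where "T = {0..1::real} \<times> {0..a0 + m} \<times> {b0 - m..1}"
  define F where "F = (\<lambda>z::real \<times> real \<times> real. g (min (fst z) (fst (snd z))) + (g (max (fst z) (snd (snd z))) - g (snd (snd z)))
    + max 0 (min 1 ((fst z - fst (snd z)) / (snd (snd z) - fst (snd z)))) *\<^sub>R (g (snd (snd z)) - g (fst (snd z))))"
  have lt: "a < b" if "a \<le> a0 + m" "b0 - m \<le> b" for a b using that m by (simp add: m_def field_simps)
  have T: "a0 + m \<le> 1" "0 \<le> b0 - m" using ab by (auto simp: m_def field_simps)
  have Tz: "0 \<le> fst z \<and> fst z \<le> 1 \<and> 0 \<le> fst (snd z) \<and> fst (snd z) \<le> 1 \<and> 0 \<le> snd (snd z) \<and> snd (snd z) \<le> 1 \<and> fst (snd z) < snd (snd z)"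
    if "z \<in> T" for z
  proof -
    have "0 \<le> fst z" "fst z \<le> 1" "0 \<le> fst (snd z)" "fst (snd z) \<le> a0 + m" "b0 - m \<le> snd (snd z)" "snd (snd z) \<le> 1"
      using that by (auto simp: T_def)
    then show ?thesis using T lt[of "fst (snd z)" "snd (snd z)"] by linarith
  qed
  have "continuous_on T F"
    unfolding F_def by (intro continuous_intros continuous_on_compose2[OF g]) (auto dest!: Tz simp: min_def max_def)
  moreover have "compact T" unfolding T_def by (intro compact_Times) auto
  ultimately have "uniformly_continuous_on T F" by (rule compact_uniformly_continuous)
  then obtain d where d: "0 < d" "\<And>z w. z \<in> T \<Longrightarrow> w \<in> T \<Longrightarrow> dist w z < d \<Longrightarrow> dist (F w) (F z) < \<kappa>/2"
    using \<kappa> unfolding uniformly_continuous_on_def by (metis half_gt_zero)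
  define \<eta> where "\<eta> = min (min m (d/2)) (\<kappa>/2)"
  have \<eta>: "0 < \<eta>" "\<eta> \<le> m" "\<eta> \<le> d/2" "\<eta> \<le> \<kappa>/2" using m d \<kappa> by (auto simp: \<eta>_def)
  have "dist (straighten g' a b s) (straighten g a0 b0 s) < \<kappa>"
    if h: "\<bar>a - a0\<bar> < \<eta>" "\<bar>b - b0\<bar> < \<eta>" "0 \<le> a" "b \<le> 1" "a < b" "s \<in> {0..1}" "\<forall>x\<in>{0..1}. dist (g' x) (g x) < \<eta>" for a b s g'
  proof -
    have T1: "(s,a,b) \<in> T" "(s,a0,b0) \<in> T" using h ab \<eta> m by (auto simp: T_def)
    have "dist (s,a,b) (s,a0,b0) \<le> dist s s + dist (a,b) (a0,b0)" by (simp add: dist_Pair_Pair)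
    also have "dist (a,b) (a0,b0) \<le> \<bar>a - a0\<bar> + \<bar>b - b0\<bar>"
      unfolding dist_Pair_Pair dist_real_def by (rule sqrt_sum_squares_le_sum_abs[THEN order_trans]) auto
    finally have "dist (s,a,b) (s,a0,b0) < d" using h \<eta> by simp
    then have "dist (F (s,a,b)) (F (s,a0,b0)) < \<kappa>/2" by (rule d(2)[OF T1(2,1)])
    moreover have "F (s,a',b') = straighten g a' b' s" if "a' < b'" for a' b'
      unfolding F_def fst_conv snd_conv straighten_eq[OF that] ..
    ultimately have 1: "dist (straighten g a b s) (straighten g a0 b0 s) < \<kappa>/2" using h(5) ab(2) by metis
    have "dist (straighten g' a b s) (straighten g a b s) < \<eta>"
    proof (cases "a \<le> s \<and> s \<le> b")
      case False
      then show ?thesis using h by (auto simp: straighten_def)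
    next
      case True
      define t where "t = (s - a) / (b - a)"
      have t: "0 \<le> t" "t \<le> 1" using True h by (auto simp: t_def)
      have "a \<in> {0..1}" "b \<in> {0..1}" using h by auto
      then have "g' a - g a \<in> ball 0 \<eta>" "g' b - g b \<in> ball 0 \<eta>" using h(7) unfolding mem_ball_0 dist_norm by blast+
      then have "(1 - t) *\<^sub>R (g' a - g a) + t *\<^sub>R (g' b - g b) \<in> ball 0 \<eta>"
        using t by (intro convexD) auto
      moreover have "straighten g' a b s - straighten g a b s = (1 - t) *\<^sub>R (g' a - g a) + t *\<^sub>R (g' b - g b)"
        using True by (simp add: straighten_def linepath_def t_def algebra_simps)
      ultimately show ?thesis unfolding mem_ball_0 dist_norm by simp
    qed
    then show ?thesis using 1 \<eta> dist_triangle[of "straighten g' a b s" "straighten g a0 b0 s" "straighten g a b s"] by linarith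
  qed
  then show ?thesis using \<eta>(1) by (intro exI[of _ \<eta>]) blast
qed

text \<open>If the open cell contains a point \<open>r\<close> outside \<open>[a0,b0]\<close>, then
  \<open>G\<close> is close to \<open>lam\<close> above \<open>r\<close>, and the vertical line
  there is a link in the trivial sense. Otherwise the cell lies in \<open>[a0,b0]\<close>, where the
  limit traverses a segment, of nonzero direction since it is not constant on the cell, and
  \<open>straight_link\<close> provides the link. The tolerance is fixed before the paths and
  \<open>G\<close> are.\<close>

lemma patch_cell_link:
  assumes \<Omega>: "open \<Omega>" and lam: "continuous_on {0..1} lam" and ab: "0 \<le> a0" "a0 < b0" "b0 \<le> 1"
    and cd: "0 \<le> c" "c < d" "d \<le> 1" and \<kappa>: "0 < \<kappa>"
    and osc: "\<And>s s'. s \<in> {c..d} \<Longrightarrow> s' \<in> {c..d} \<Longrightarrow> dist (straighten lam a0 b0 s) (straighten lam a0 b0 s') < \<kappa>"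
    and nc: "s1 \<in> {c..d}" "s2 \<in> {c..d}" "straighten lam a0 b0 s1 \<noteq> straighten lam a0 b0 s2"
  shows "\<exists>\<eta>>0. \<forall>p q g g' A B G. epe_hom \<Omega> p q (straighten g (A 0) (B 0)) (straighten g' (A 1) (B 1)) G \<and>
     continuous_on {0..1} A \<and> continuous_on {0..1} B \<and> (\<forall>t\<in>{0..1}. 0 < A t \<and> A t < B t \<and> B t < 1 \<and> \<bar>A t - a0\<bar> < \<eta> \<and> \<bar>B t - b0\<bar> < \<eta>) \<and>
     (\<forall>s\<in>{0..1}. \<forall>t\<in>{0..1}. s \<le> A t \<or> B t \<le> s \<longrightarrow> dist (G (s,t)) (lam s) < \<eta>) \<and>
     (\<forall>s\<in>{0..1}. dist (g s) (lam s) < \<eta> \<and> dist (g' s) (lam s) < \<eta>) \<longrightarrow>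
     (\<exists>r r' \<sigma>. c < r \<and> r < d \<and> c < r' \<and> r' < d \<and> link \<Omega> G r r' \<sigma> \<and> (\<forall>t\<in>{0..1}. dist (\<sigma> t) (straighten lam a0 b0 c) < 3 * \<kappa>))"
proof -
  define \<nu> where "\<nu> = straighten lam a0 b0"
  have outer: ?thesis if r: "c < r" "r < d" "r < a0 \<or> b0 < r" for r
  proof -
    define \<eta> where "\<eta> = min \<kappa> (if r < a0 then a0 - r else r - b0)"
    have \<eta>: "0 < \<eta>" "\<eta> \<le> \<kappa>" "r < a0 \<Longrightarrow> \<eta> \<le> a0 - r" "\<not> r < a0 \<Longrightarrow> \<eta> \<le> r - b0" using \<kappa> r by (auto simp: \<eta>_def)
    have \<nu>r: "\<nu> r = lam r" unfolding \<nu>_def using r ab by (intro straighten_off) auto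
    have c\<nu>: "dist (lam r) (\<nu> c) < \<kappa>" using osc[of r c] r cd by (simp add: \<nu>_def \<nu>r[unfolded \<nu>_def])
    show ?thesis
    proof (rule exI[of _ \<eta>], intro conjI \<eta>(1) allI impI)
      fix p q g g' A B and G :: "real \<times> real \<Rightarrow> complex"
      assume h: "epe_hom \<Omega> p q (straighten g (A 0) (B 0)) (straighten g' (A 1) (B 1)) G \<and>
     continuous_on {0..1} A \<and> continuous_on {0..1} B \<and> (\<forall>t\<in>{0..1}. 0 < A t \<and> A t < B t \<and> B t < 1 \<and> \<bar>A t - a0\<bar> < \<eta> \<and> \<bar>B t - b0\<bar> < \<eta>) \<and>
     (\<forall>s\<in>{0..1}. \<forall>t\<in>{0..1}. s \<le> A t \<or> B t \<le> s \<longrightarrow> dist (G (s,t)) (lam s) < \<eta>) \<and>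
     (\<forall>s\<in>{0..1}. dist (g s) (lam s) < \<eta> \<and> dist (g' s) (lam s) < \<eta>)"
      have L: "link \<Omega> G r r (\<lambda>t. G (r,t))" unfolding link_def by (auto simp: algebra_simps)
      have "dist (G (r,t)) (straighten lam a0 b0 c) < 3 * \<kappa>" if t: "t \<in> {0..1}" for t
      proof -
        have "r \<le> A t \<or> B t \<le> r"
        proof -
          have "\<bar>A t - a0\<bar> < \<eta>" "\<bar>B t - b0\<bar> < \<eta>" using h t by auto
          then show ?thesis using \<eta>(3,4) by (cases "r < a0") linarith+
        qed
        moreover have "r \<in> {0..1}" using r cd by auto
        ultimately have "dist (G (r,t)) (lam r) < \<eta>" using h t by blast
        then show ?thesis using c\<nu> \<eta>(2) \<kappa> dist_triangle[of "G (r,t)" "\<nu> c" "lam r"] unfolding \<nu>_def by linarith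
      qed
      then show "\<exists>r r' \<sigma>. c < r \<and> r < d \<and> c < r' \<and> r' < d \<and> link \<Omega> G r r' \<sigma> \<and> (\<forall>t\<in>{0..1}. dist (\<sigma> t) (straighten lam a0 b0 c) < 3 * \<kappa>)"
        using L r by blast
    qed
  qed
  consider "c < a0" | "b0 < d" | "a0 \<le> c" "d \<le> b0" by linarith
  then show ?thesis
  proof cases
    case 1
    then show ?thesis using cd by (intro outer[of "(c + min d a0) / 2"]) (auto simp: min_def field_simps)
  next
    case 2
    then show ?thesis using cd by (intro outer[of "(d + max c b0) / 2"]) (auto simp: max_def field_simps)
  next
    case 3
    define w where "w = lam b0 - lam a0"
    have \<nu>on: "\<nu> s = lam a0 + ((s - a0) / (b0 - a0)) *\<^sub>R w" if "s \<in> {a0..b0}" for s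
      using that by (simp add: \<nu>_def straighten_def linepath_def w_def algebra_simps)
    have w0: "w \<noteq> 0"
    proof
      assume "w = 0"
      then have "\<nu> s1 = \<nu> s2" using \<nu>on[of s1] \<nu>on[of s2] nc(1,2) 3 by auto
      then show False using nc(3) by (simp add: \<nu>_def)
    qed
    define e where "e = w /\<^sub>R norm w"
    have e: "norm e = 1" "0 < e \<bullet> w" using w0 by (auto simp: e_def)
    have e\<nu>: "e \<bullet> \<nu> s = e \<bullet> lam a0 + ((s - a0) / (b0 - a0)) * (e \<bullet> w)" if "s \<in> {a0..b0}" for s
      using \<nu>on[OF that] by (simp add: inner_add_right)
    have mono: "e \<bullet> \<nu> s < e \<bullet> \<nu> s'" if "s \<in> {a0..b0}" "s' \<in> {a0..b0}" "s < s'" for s s'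
    proof -
      have "(s - a0) / (b0 - a0) < (s' - a0) / (b0 - a0)" using that ab by (intro divide_strict_right_mono) auto
      then show ?thesis unfolding e\<nu>[OF that(1)] e\<nu>[OF that(2)] using e(2) by (intro add_strict_left_mono mult_strict_right_mono)
    qed
    \<comment> \<open>Midpoint and quarter points: a crossing located between \<open>c'\<close> and
      \<open>d'\<close> is strictly inside the cell.\<close>
    define m where "m = (c + d) / 2"
    define c' where "c' = (c + m) / 2"
    define d' where "d' = (m + d) / 2"
    have ord: "c < c'" "c' < m" "m < d'" "d' < d" using cd by (auto simp: m_def c'_def d'_def)
    define v where "v = e \<bullet> \<nu> m"
    have v: "e \<bullet> \<nu> c' < v" "v < e \<bullet> \<nu> d'" unfolding v_def using ord 3 by (auto intro!: mono)
    have \<nu>ab: "\<nu> a0 = lam a0" "\<nu> b0 = lam b0" using ab by (auto simp: \<nu>_def straighten_def linepath_def)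
    have va: "e \<bullet> lam a0 < v" "v < e \<bullet> lam b0"
      using mono[of a0 m] mono[of m b0] ord 3 ab by (auto simp: v_def \<nu>ab)
    \<comment> \<open>The halves serve the sides of the strip, where two errors add up: from
      \<open>G (A t,t)\<close> to \<open>lam (A t)\<close> and from there to \<open>lam a0\<close>,
      and likewise at \<open>B\<close>.\<close>
    define gap where "gap = min \<kappa> (min (min (v - e \<bullet> \<nu> c') (e \<bullet> \<nu> d' - v)) (min ((v - e \<bullet> lam a0) / 2) ((e \<bullet> lam b0 - v) / 2)))"
    have gap: "0 < gap" "gap \<le> \<kappa>" "gap \<le> v - e \<bullet> \<nu> c'" "gap \<le> e \<bullet> \<nu> d' - v"
      using \<kappa> v va by (auto simp: gap_def)
    have gap2: "gap \<le> (v - e \<bullet> lam a0) / 2" "gap \<le> (e \<bullet> lam b0 - v) / 2"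
      by (simp_all only: gap_def min_le_iff_disj order_refl simp_thms)
    obtain \<eta>1 where \<eta>1: "0 < \<eta>1" "\<And>a b s g'. \<bar>a - a0\<bar> < \<eta>1 \<Longrightarrow> \<bar>b - b0\<bar> < \<eta>1 \<Longrightarrow> 0 \<le> a \<Longrightarrow> b \<le> 1 \<Longrightarrow> a < b \<Longrightarrow> s \<in> {0..1} \<Longrightarrow> (\<forall>x\<in>{0..1}. dist (g' x) (lam x) < \<eta>1) \<Longrightarrow>
      dist (straighten g' a b s) (\<nu> s) < gap"
      using straighten_uniform[OF lam ab gap(1)] unfolding \<nu>_def by metis
    obtain \<eta>2 where \<eta>2: "0 < \<eta>2" "\<And>x y. x \<in> {0..1} \<Longrightarrow> y \<in> {0..1} \<Longrightarrow> \<bar>x - y\<bar> < \<eta>2 \<Longrightarrow> dist (lam x) (lam y) < gap"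
      using uniform_modulus[OF lam gap(1)] by metis
    define \<eta> where "\<eta> = min (min \<eta>1 \<eta>2) (min gap (min (c' - a0) (b0 - d')))"
    have \<eta>: "0 < \<eta>" "\<eta> \<le> \<eta>1" "\<eta> \<le> \<eta>2" "\<eta> \<le> gap" "\<eta> \<le> c' - a0" "\<eta> \<le> b0 - d'"
      using \<eta>1 \<eta>2 gap ord 3 by (auto simp: \<eta>_def)
    show ?thesis
    proof (rule exI[of _ \<eta>], intro conjI \<eta>(1) allI impI)
      fix p q g g' A B and G :: "real \<times> real \<Rightarrow> complex"
      assume h: "epe_hom \<Omega> p q (straighten g (A 0) (B 0)) (straighten g' (A 1) (B 1)) G \<and>
     continuous_on {0..1} A \<and> continuous_on {0..1} B \<and> (\<forall>t\<in>{0..1}. 0 < A t \<and> A t < B t \<and> B t < 1 \<and> \<bar>A t - a0\<bar> < \<eta> \<and> \<bar>B t - b0\<bar> < \<eta>) \<and>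
     (\<forall>s\<in>{0..1}. \<forall>t\<in>{0..1}. s \<le> A t \<or> B t \<le> s \<longrightarrow> dist (G (s,t)) (lam s) < \<eta>) \<and>
     (\<forall>s\<in>{0..1}. dist (g s) (lam s) < \<eta> \<and> dist (g' s) (lam s) < \<eta>)"
      then have G: "epe_hom \<Omega> p q (straighten g (A 0) (B 0)) (straighten g' (A 1) (B 1)) G"
        and AB: "continuous_on {0..1} A" "continuous_on {0..1} B"
        and AB1: "\<And>t. t \<in> {0..1} \<Longrightarrow> 0 < A t" "\<And>t. t \<in> {0..1} \<Longrightarrow> A t < B t" "\<And>t. t \<in> {0..1} \<Longrightarrow> B t < 1"
        and AB2: "\<And>t. t \<in> {0..1} \<Longrightarrow> \<bar>A t - a0\<bar> < \<eta>" "\<And>t. t \<in> {0..1} \<Longrightarrow> \<bar>B t - b0\<bar> < \<eta>"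
        and near: "\<And>s t. s \<in> {0..1} \<Longrightarrow> t \<in> {0..1} \<Longrightarrow> s \<le> A t \<or> B t \<le> s \<Longrightarrow> dist (G (s,t)) (lam s) < \<eta>"
        and gn: "\<forall>s\<in>{0..1}. dist (g s) (lam s) < \<eta>" "\<forall>s\<in>{0..1}. dist (g' s) (lam s) < \<eta>" by blast+
      have le: "\<bar>e \<bullet> x - e \<bullet> y\<bar> \<le> dist x y" for x y using inner_dist_le[of e x y] e by simp
      have cross: "\<exists>x\<in>{0..1}. e \<bullet> linepath (k a) (k b) x = v \<and> a + x * (b - a) \<in> {c'..d'}"
        and close: "\<forall>s\<in>{0..1}. dist (straighten k a b s) (\<nu> s) < gap"
        if k: "\<forall>s\<in>{0..1}. dist (k s) (lam s) < \<eta>" "0 < a" "a < b" "b < 1" "\<bar>a - a0\<bar> < \<eta>" "\<bar>b - b0\<bar> < \<eta>" for k a b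
      proof -
        have k1: "\<forall>s\<in>{0..1}. dist (k s) (lam s) < \<eta>1" using k(1) \<eta>(2) by fastforce
        show close: "\<forall>s\<in>{0..1}. dist (straighten k a b s) (\<nu> s) < gap"
          using k k1 \<eta> by (intro ballI \<eta>1(2)) auto
        have in01: "c' \<in> {0..1}" "d' \<in> {0..1}" using ord cd by auto
        have cdab: "a \<le> c'" "d' \<le> b" using k \<eta> by auto
        define X where "X = (\<lambda>s. (s - a) / (b - a))"
        have st: "straighten k a b s = linepath (k a) (k b) (X s)" if "s \<in> {c'..d'}" for s
          using that cdab by (simp add: straighten_def X_def)
        define f where "f = (\<lambda>s. e \<bullet> linepath (k a) (k b) (X s))"
        have fc: "f c' \<le> v"
          using le[of "straighten k a b c'" "\<nu> c'"] close in01(1) st[of c'] gap(3) ord by (force simp: f_def)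
        have fd: "v \<le> f d'"
          using le[of "straighten k a b d'" "\<nu> d'"] close in01(2) st[of d'] gap(4) ord by (force simp: f_def)
        have "continuous_on {c'..d'} f"
          unfolding f_def X_def linepath_def using k by (intro continuous_intros) auto
        then obtain s where s: "c' \<le> s" "s \<le> d'" "f s = v" using IVT'[of f c' v d'] fc fd ord by auto
        have "X s \<in> {0..1}" using s cdab k by (auto simp: X_def)
        moreover have "a + X s * (b - a) = s" using k by (simp add: X_def)
        ultimately show "\<exists>x\<in>{0..1}. e \<bullet> linepath (k a) (k b) x = v \<and> a + x * (b - a) \<in> {c'..d'}"
          using s by (intro bexI[of _ "X s"]) (auto simp: f_def)
      qed
      have z: "(0::real) \<in> {0..1}" "(1::real) \<in> {0..1}" by auto
      note c0 = cross[OF gn(1) AB1(1-3)[OF z(1)] AB2[OF z(1)]] and c1 = cross[OF gn(2) AB1(1-3)[OF z(2)] AB2[OF z(2)]]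
      note cl0 = close[OF gn(1) AB1(1-3)[OF z(1)] AB2[OF z(1)]] and cl1 = close[OF gn(2) AB1(1-3)[OF z(2)] AB2[OF z(2)]]
      obtain x0 where x0: "x0 \<in> {0..1}" "e \<bullet> linepath (g (A 0)) (g (B 0)) x0 = v" "A 0 + x0 * (B 0 - A 0) \<in> {c'..d'}" using c0 by blast
      obtain x1 where x1: "x1 \<in> {0..1}" "e \<bullet> linepath (g' (A 1)) (g' (B 1)) x1 = v" "A 1 + x1 * (B 1 - A 1) \<in> {c'..d'}" using c1 by blast
      define r where "r = A 0 + x0 * (B 0 - A 0)"
      define r' where "r' = A 1 + x1 * (B 1 - A 1)"
      have aff: "straighten k a b (a + x * (b - a)) = linepath (k a) (k b) x" if "x \<in> {0..1}" "a < b" for k a b x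
      proof -
        have "0 \<le> x * (b - a)" "x * (b - a) \<le> b - a" using that mult_right_mono[of x 1 "b - a"] by auto
        then have "a \<le> a + x * (b - a)" "a + x * (b - a) \<le> b" by linarith+
        then show ?thesis using that straighten_on[of a "a + x * (b - a)" b k] by simp
      qed
      have side: "e \<bullet> G (A t,t) < v" "v < e \<bullet> G (B t,t)" if t: "t \<in> {0..1}" for t
      proof -
        have A01: "A t \<in> {0..1}" "B t \<in> {0..1}" using AB1[OF t] by auto
        have "dist (G (A t,t)) (lam (A t)) < gap" "dist (G (B t,t)) (lam (B t)) < gap"
          using near[OF A01(1) t] near[OF A01(2) t] \<eta>(4) by auto
        moreover have "dist (lam (A t)) (lam a0) < gap" "dist (lam (B t)) (lam b0) < gap"
          using A01 ab AB2[OF t] \<eta>(3) by (auto intro!: \<eta>2(2))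
        ultimately show "e \<bullet> G (A t,t) < v" "v < e \<bullet> G (B t,t)"
          using le[of "G (A t,t)" "lam (A t)"] le[of "lam (A t)" "lam a0"] le[of "G (B t,t)" "lam (B t)"] le[of "lam (B t)" "lam b0"] gap2
          unfolding abs_le_iff by (simp_all add: field_simps)
      qed
      have "homotopic_paths \<Omega> (G \<circ> linepath (r,0) (r',1)) (linepath (straighten g (A 0) (B 0) r) (straighten g' (A 1) (B 1) r'))"
        by (rule straight_link[OF \<Omega> G AB AB1 e(1) side aff[OF _ AB1(2)[OF z(1)]] aff[OF _ AB1(2)[OF z(2)]] x0(1,2) x1(1,2) r_def r'_def]) auto
      then have L: "link \<Omega> G r r' (linepath (straighten g (A 0) (B 0) r) (straighten g' (A 1) (B 1) r'))"
        unfolding link_def by blast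
      have rr: "r \<in> {c'..d'}" "r' \<in> {c'..d'}" using x0(3) x1(3) by (auto simp: r_def r'_def)
      then have rr': "r \<in> {c..d}" "r' \<in> {c..d}" "r \<in> {0..1}" "r' \<in> {0..1}" using ord cd by auto
      have cin: "c \<in> {c..d}" using cd by auto
      have B0: "straighten g (A 0) (B 0) r \<in> ball (\<nu> c) (2 * \<kappa>)"
        using cl0 rr' gap(2) osc[OF rr'(1) cin] dist_triangle[of "straighten g (A 0) (B 0) r" "\<nu> c" "\<nu> r"] unfolding \<nu>_def[symmetric]
        by (force simp: dist_commute)
      have B1: "straighten g' (A 1) (B 1) r' \<in> ball (\<nu> c) (2 * \<kappa>)"
        using cl1 rr' gap(2) osc[OF rr'(2) cin] dist_triangle[of "straighten g' (A 1) (B 1) r'" "\<nu> c" "\<nu> r'"] unfolding \<nu>_def[symmetric]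
        by (force simp: dist_commute)
      have "dist (linepath (straighten g (A 0) (B 0) r) (straighten g' (A 1) (B 1) r') t) (straighten lam a0 b0 c) < 3 * \<kappa>" if t: "t \<in> {0..1}" for t
      proof -
        have "linepath (straighten g (A 0) (B 0) r) (straighten g' (A 1) (B 1) r') t \<in> closed_segment (straighten g (A 0) (B 0) r) (straighten g' (A 1) (B 1) r')"
          using t by (metis path_image_linepath path_image_def imageI)
        also have "\<dots> \<subseteq> ball (\<nu> c) (2 * \<kappa>)" using B0 B1 by (intro closed_segment_subset) auto
        finally show ?thesis using \<kappa> by (simp add: dist_commute \<nu>_def)
      qed
      moreover have "c < r" "r < d" "c < r'" "r' < d" using rr ord by auto
      ultimately show "\<exists>r r' \<sigma>. c < r \<and> r < d \<and> c < r' \<and> r' < d \<and> link \<Omega> G r r' \<sigma> \<and> (\<forall>t\<in>{0..1}. dist (\<sigma> t) (straighten lam a0 b0 c) < 3 * \<kappa>)"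
        using L by blast
    qed
  qed
qed

section \<open>Straightened slices of a homotopy and their limits\<close>

definition bump :: "complex set \<Rightarrow> complex \<Rightarrow> complex \<Rightarrow> (real \<times> real \<Rightarrow> complex) \<Rightarrow> real \<Rightarrow> real \<Rightarrow> real \<Rightarrow> bool" where
  "bump \<Omega> p q H \<tau> a b \<longleftrightarrow> 0 < \<tau> \<and> \<tau> < 1 \<and> 0 < a \<and> a < b \<and> b < 1 \<and>
     (\<exists>J. epe_hom \<Omega> p q (straighten (\<lambda>s. H (s,\<tau>)) a b) (\<lambda>s. H (s,\<tau>)) J \<and>
       (\<forall>s\<in>{0..1}. \<forall>t\<in>{0..1}. s \<le> a \<or> b \<le> s \<longrightarrow> J (s,t) = H (s,\<tau>)))"

text \<open>Open at both edges, because the path on the lower edge and, in the uniqueness argument,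
  also the one on the upper edge may touch the boundary of \<Omega>.\<close>

definition collar :: "complex set \<Rightarrow> complex \<Rightarrow> complex \<Rightarrow> (real \<Rightarrow> complex) \<Rightarrow> (real \<Rightarrow> complex) \<Rightarrow> (real \<times> real \<Rightarrow> complex) \<Rightarrow> bool" where
  "collar \<Omega> p q \<gamma> lam H \<longleftrightarrow> continuous_on sq H \<and> (\<forall>s\<in>{0..1}. H (s,0) = lam s) \<and>
     (\<forall>t\<in>{0..1}. H (0,t) = p \<and> H (1,t) = q) \<and> (\<forall>s\<in>{0<..<1}. \<forall>t\<in>{0<..<1}. H (s,t) \<in> \<Omega>) \<and>
     (\<forall>t\<in>{0<..<1}. epeh \<Omega> p q \<gamma> (\<lambda>s. H (s,t)))"

lemma collarD:
  assumes "collar \<Omega> p q \<gamma> lam H"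
  shows "continuous_on sq H" "\<And>s. s \<in> {0..1} \<Longrightarrow> H (s,0) = lam s" "\<And>t. t \<in> {0..1} \<Longrightarrow> H (0,t) = p" "\<And>t. t \<in> {0..1} \<Longrightarrow> H (1,t) = q"
    "\<And>s t. 0 < s \<Longrightarrow> s < 1 \<Longrightarrow> 0 < t \<Longrightarrow> t < 1 \<Longrightarrow> H (s,t) \<in> \<Omega>" "\<And>t. 0 < t \<Longrightarrow> t < 1 \<Longrightarrow> epeh \<Omega> p q \<gamma> (\<lambda>s. H (s,t))"
  using assms unfolding collar_def by auto

lemma collar_strip:
  assumes H: "collar \<Omega> p q \<gamma> lam H" and f: "continuous_on {0..1} f" "\<And>t. t \<in> {0..1} \<Longrightarrow> 0 < f t" "\<And>t. t \<in> {0..1} \<Longrightarrow> f t < 1"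
  shows "epe_hom \<Omega> p q (\<lambda>s. H (s, f 0)) (\<lambda>s. H (s, f 1)) (\<lambda>(s,t). H (s, f t))"
proof (rule epe_homI)
  have "continuous_on sq (\<lambda>z. H (fst z, f (snd z)))"
  proof (rule continuous_on_compose2[OF collarD(1)[OF H]])
    show "continuous_on sq (\<lambda>z. (fst z, f (snd z)))" by (intro continuous_intros continuous_on_compose2[OF f(1)]) auto
    show "(\<lambda>z. (fst z, f (snd z))) ` sq \<subseteq> sq" using f(2,3) by (auto simp: less_imp_le)
  qed
  then show "continuous_on sq (\<lambda>(s,t). H (s, f t))" by (simp add: case_prod_unfold)
next
  fix t :: real assume "t \<in> {0..1}"
  then have "f t \<in> {0..1}" using f(2,3)[of t] by auto
  then show "(case (0,t) of (s,t) \<Rightarrow> H (s, f t)) = p" "(case (1,t) of (s,t) \<Rightarrow> H (s, f t)) = q" using collarD(3,4)[OF H] by auto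
next
  fix s t :: real assume "0 < s" "s < 1" "t \<in> {0..1}"
  then show "(case (s,t) of (s,t) \<Rightarrow> H (s, f t)) \<in> \<Omega>" using collarD(5)[OF H, of s "f t"] f(2,3)[of t] by auto
qed auto

text \<open>Two straightened slices are joined by undoing the first straightening, moving to the
  other slice and redoing the second one. Straightening homotopies are fixed outside their interval,
  so this composite can stray only between \<open>A t\<close> and \<open>B t\<close>. Hence
  \<open>patch_cell_link\<close> gives links in all cells where the limit is not constant, and
  \<open>small_homotopy\<close> shrinks the whole.\<close>

lemma bump_small_hom:
  assumes \<Omega>: "open \<Omega>" and H: "collar \<Omega> p q \<gamma> lam H" and lam: "continuous_on {0..1} lam" and ab: "0 \<le> a0" "a0 < b0" "b0 \<le> 1" and \<kappa>: "0 < \<kappa>"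
  shows "\<exists>\<eta>>0. \<forall>\<tau> a b \<tau>' a' b'. bump \<Omega> p q H \<tau> a b \<and> bump \<Omega> p q H \<tau>' a' b' \<and> \<tau> < \<eta> \<and> \<tau>' < \<eta> \<and> \<bar>a - a0\<bar> < \<eta> \<and> \<bar>a' - a0\<bar> < \<eta> \<and> \<bar>b - b0\<bar> < \<eta> \<and> \<bar>b' - b0\<bar> < \<eta> \<longrightarrow>
    small_hom \<Omega> p q (straighten lam a0 b0) (9 * \<kappa>) (straighten (\<lambda>s. H (s,\<tau>)) a b) (straighten (\<lambda>s. H (s,\<tau>')) a' b')"
proof -
  define \<nu> where "\<nu> = straighten lam a0 b0"
  have \<nu>c: "continuous_on {0..1} \<nu>" unfolding \<nu>_def by (rule straighten_cont[OF lam ab])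
  obtain d where d: "0 < d" "\<And>x y. x \<in> {0..1} \<Longrightarrow> y \<in> {0..1} \<Longrightarrow> \<bar>x - y\<bar> < d \<Longrightarrow> dist (\<nu> x) (\<nu> y) < \<kappa>"
    using uniform_modulus[OF \<nu>c \<kappa>] by metis
  obtain N0 :: nat where N0: "1 / (real N0 + 1) < d" using reals_Archimedean[OF d(1)] by (auto simp: inverse_eq_divide add.commute)
  define N where "N = Suc N0"
  have N: "0 < N" "1 / real N < d" using N0 by (auto simp: N_def add.commute)
  have cell01: "0 \<le> real i / real N" "real i / real N < real (Suc i) / real N" "real (Suc i) / real N \<le> 1" if "i < N" for i
    using that N by (auto simp: divide_strict_right_mono)
  have osc: "dist (\<nu> s) (\<nu> s') < \<kappa>" if i: "i < N" "s \<in> {real i/N..real (Suc i)/N}" "s' \<in> {real i/N..real (Suc i)/N}" for i s s'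
  proof -
    have "real (Suc i) / real N - real i / real N = 1 / real N" by (simp add: diff_divide_distrib[symmetric])
    then have "\<bar>s - s'\<bar> < d" using i N by auto
    moreover have "s \<in> {0..1}" "s' \<in> {0..1}" using cell01[OF i(1)] i(2,3) by (meson atLeastAtMost_iff order_trans)+
    ultimately show ?thesis using d(2) by blast
  qed
  define P where "P = (\<lambda>i \<eta>. \<forall>p q g g' A B G. epe_hom \<Omega> p q (straighten g (A 0) (B 0)) (straighten g' (A 1) (B 1)) G \<and>
     continuous_on {0..1} A \<and> continuous_on {0..1} B \<and> (\<forall>t\<in>{0..1}. 0 < A t \<and> A t < B t \<and> B t < 1 \<and> \<bar>A t - a0\<bar> < \<eta> \<and> \<bar>B t - b0\<bar> < \<eta>) \<and>
     (\<forall>s\<in>{0..1}. \<forall>t\<in>{0..1}. s \<le> A t \<or> B t \<le> s \<longrightarrow> dist (G (s,t)) (lam s) < \<eta>) \<and>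
     (\<forall>s\<in>{0..1}. dist (g s) (lam s) < \<eta> \<and> dist (g' s) (lam s) < \<eta>) \<longrightarrow>
     (\<exists>r r' \<sigma>. real i/N < r \<and> r < real (Suc i)/N \<and> real i/N < r' \<and> r' < real (Suc i)/N \<and> link \<Omega> G r r' \<sigma> \<and> (\<forall>t\<in>{0..1}. dist (\<sigma> t) (straighten lam a0 b0 (real i/N)) < 3 * \<kappa>)))"
  define I where "I = {i. i < N \<and> (\<exists>s\<in>{real i/N..real (Suc i)/N}. \<exists>s'\<in>{real i/N..real (Suc i)/N}. \<nu> s \<noteq> \<nu> s')}"
  have finI: "finite I" by (auto simp: I_def)
  have "\<forall>i\<in>I. \<exists>\<eta>>0. P i \<eta>"
  proof
    fix i assume "i \<in> I"
    then obtain s s' where i: "i < N" and s: "s \<in> {real i/N..real (Suc i)/N}" "s' \<in> {real i/N..real (Suc i)/N}" "\<nu> s \<noteq> \<nu> s'"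
      unfolding I_def by blast
    show "\<exists>\<eta>>0. P i \<eta>" unfolding P_def
      by (rule patch_cell_link[OF \<Omega> lam ab cell01[OF i] \<kappa> osc[OF i, unfolded \<nu>_def] s[unfolded \<nu>_def]])
  qed
  then obtain E where E: "\<And>i. i \<in> I \<Longrightarrow> 0 < E i" "\<And>i. i \<in> I \<Longrightarrow> P i (E i)" by metis
  obtain \<eta>1 where \<eta>1: "0 < \<eta>1" "\<And>a b s g'. \<bar>a - a0\<bar> < \<eta>1 \<Longrightarrow> \<bar>b - b0\<bar> < \<eta>1 \<Longrightarrow> 0 \<le> a \<Longrightarrow> b \<le> 1 \<Longrightarrow> a < b \<Longrightarrow> s \<in> {0..1} \<Longrightarrow> (\<forall>x\<in>{0..1}. dist (g' x) (lam x) < \<eta>1) \<Longrightarrow>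
      dist (straighten g' a b s) (\<nu> s) < \<kappa>"
    using straighten_uniform[OF lam ab \<kappa>] unfolding \<nu>_def by metis
  define \<eta>2 where "\<eta>2 = Min (insert \<eta>1 (insert ((b0 - a0) / 2) (E ` I)))"
  have \<eta>2: "0 < \<eta>2" "\<eta>2 \<le> \<eta>1" "\<eta>2 \<le> (b0 - a0) / 2" "\<And>i. i \<in> I \<Longrightarrow> \<eta>2 \<le> E i"
  proof -
    have fin: "finite (insert \<eta>1 (insert ((b0 - a0) / 2) (E ` I)))" using finI by simp
    show "0 < \<eta>2" unfolding \<eta>2_def using fin E(1) \<eta>1(1) ab by (subst Min_gr_iff) auto
    show "\<eta>2 \<le> \<eta>1" "\<eta>2 \<le> (b0 - a0) / 2" "\<And>i. i \<in> I \<Longrightarrow> \<eta>2 \<le> E i"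
      unfolding \<eta>2_def by (rule Min_le[OF fin], blast)+
  qed
  obtain \<eta>3 where \<eta>3: "0 < \<eta>3" "\<And>s t. s \<in> {0..1} \<Longrightarrow> t \<in> {0..1} \<Longrightarrow> t < \<eta>3 \<Longrightarrow> dist (H (s,t)) (lam s) < \<eta>2"
  proof -
    have "uniformly_continuous_on sq H" using collarD(1)[OF H] sq_compact by (rule compact_uniformly_continuous)
    then obtain \<delta> where \<delta>: "0 < \<delta>" "\<And>z w. z \<in> sq \<Longrightarrow> w \<in> sq \<Longrightarrow> dist w z < \<delta> \<Longrightarrow> dist (H w) (H z) < \<eta>2"
      using \<eta>2(1) unfolding uniformly_continuous_on_def by metis
    show thesis
    proof (rule that[OF \<delta>(1)])
      fix s t :: real assume st: "s \<in> {0..1}" "t \<in> {0..1}" "t < \<delta>"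
      have "dist (s,t) (s,0) < \<delta>" using st by (simp add: dist_Pair_Pair dist_real_def)
      then have "dist (H (s,t)) (H (s,0)) < \<eta>2" using st by (intro \<delta>(2)) auto
      then show "dist (H (s,t)) (lam s) < \<eta>2" using collarD(2)[OF H st(1)] by simp
    qed
  qed
  define \<eta> where "\<eta> = min \<eta>2 \<eta>3"
  have \<eta>: "0 < \<eta>" "\<eta> \<le> \<eta>2" "\<eta> \<le> \<eta>3" using \<eta>2 \<eta>3 by (auto simp: \<eta>_def)
  have "small_hom \<Omega> p q \<nu> (9 * \<kappa>) (straighten (\<lambda>s. H (s,\<tau>)) a b) (straighten (\<lambda>s. H (s,\<tau>')) a' b')"
    if bp: "bump \<Omega> p q H \<tau> a b" "bump \<Omega> p q H \<tau>' a' b'" and n: "\<tau> < \<eta>" "\<tau>' < \<eta>" "\<bar>a - a0\<bar> < \<eta>" "\<bar>a' - a0\<bar> < \<eta>" "\<bar>b - b0\<bar> < \<eta>" "\<bar>b' - b0\<bar> < \<eta>"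
    for \<tau> a b \<tau>' a' b'
  proof -
    let ?g = "\<lambda>s. H (s,\<tau>)" and ?g' = "\<lambda>s. H (s,\<tau>')"
    have t: "0 < \<tau>" "\<tau> < 1" "0 < a" "a < b" "b < 1" "0 < \<tau>'" "\<tau>' < 1" "0 < a'" "a' < b'" "b' < 1" using bp by (auto simp: bump_def)
    obtain J where J: "epe_hom \<Omega> p q (straighten ?g a b) ?g J"
      "\<And>s t. s \<in> {0..1} \<Longrightarrow> t \<in> {0..1} \<Longrightarrow> s \<le> a \<or> b \<le> s \<Longrightarrow> J (s,t) = H (s,\<tau>)" using bp(1) unfolding bump_def by blast
    obtain J' where J': "epe_hom \<Omega> p q (straighten ?g' a' b') ?g' J'"
      "\<And>s t. s \<in> {0..1} \<Longrightarrow> t \<in> {0..1} \<Longrightarrow> s \<le> a' \<or> b' \<le> s \<Longrightarrow> J' (s,t) = H (s,\<tau>')" using bp(2) unfolding bump_def by blast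
    define f where "f = (\<lambda>x. \<tau> + x * (\<tau>' - \<tau>))"
    have f: "0 < f x" "f x < 1" "f x < \<eta>" if "x \<in> {0..1}" for x
    proof -
      have "f x = (1 - x) * \<tau> + x * \<tau>'" by (simp add: f_def algebra_simps)
      then have fx: "f x \<in> closed_segment \<tau> \<tau>'" using that by (auto simp: in_segment)
      then show "0 < f x" "f x < 1" "f x < \<eta>" using t n by (auto simp: closed_segment_eq_real_ivl split: if_splits)
    qed
    have fe: "f 0 = \<tau>" "f 1 = \<tau>'" by (auto simp: f_def)
    have fc: "continuous_on {0..1} f" unfolding f_def by (intro continuous_intros)
    define M where "M = (\<lambda>(s,x). H (s, f x))"
    have M: "epe_hom \<Omega> p q ?g ?g' M" using collar_strip[OF H fc f(1,2)] by (simp add: M_def fe)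
    define G where "G = tpaste (tpaste J M) (trev J')"
    have G: "epe_hom \<Omega> p q (straighten ?g a b) (straighten ?g' a' b') G"
      unfolding G_def by (rule epe_hom_trans[OF epe_hom_trans[OF J(1) M] epe_hom_sym[OF J'(1)]])
    \<comment> \<open>The pasting runs \<open>J\<close> on [0,1/4], the motion between the slices on
      [1/4,1/2] and the reversed \<open>J'\<close> on [1/2,1]; \<open>c\<close> changes from 0 to 1
      during the middle part.\<close>
    define c where "c = (\<lambda>t::real. max 0 (min 1 (4 * t - 1)))"
    have c01: "c t \<in> {0..1}" for t by (auto simp: c_def)
    have cc: "continuous_on {0..1} c" unfolding c_def by (intro continuous_intros)
    define A where "A = (\<lambda>t. a + c t * (a' - a))"
    define B where "B = (\<lambda>t. b + c t * (b' - b))"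
    have ABc: "continuous_on {0..1} A" "continuous_on {0..1} B" unfolding A_def B_def using cc by (auto intro!: continuous_intros)
    have ABe: "A 0 = a" "B 0 = b" "A 1 = a'" "B 1 = b'" by (auto simp: A_def B_def c_def)
    have seg: "x + c t * (y - x) \<in> closed_segment x y" for x y t
    proof -
      have "x + c t * (y - x) = (1 - c t) *\<^sub>R x + c t *\<^sub>R y" by (simp add: algebra_simps)
      then show ?thesis using c01[of t] by (auto simp: in_segment)
    qed
    have AB: "0 < A t" "B t < 1" "\<bar>A t - a0\<bar> < \<eta>" "\<bar>B t - b0\<bar> < \<eta>" for t
      using seg[of a t a'] seg[of b t b'] t(3-5) t(8-10) n by (auto simp: A_def B_def closed_segment_eq_real_ivl split: if_splits)
    have e2: "2 * \<eta> \<le> b0 - a0" using \<eta>(2) \<eta>2(3) by (simp add: field_simps)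
    have AB': "A t < B t" for t using AB(3,4)[of t] e2 by linarith
    have Hn: "dist (H (s,t)) (lam s) < \<eta>2" if "s \<in> {0..1}" "0 < t" "t < 1" "t < \<eta>" for s t
      using that \<eta>(3) by (intro \<eta>3(2)) auto
    have Gn: "dist (G (s,t)) (lam s) < \<eta>2" if st: "s \<in> {0..1}" "t \<in> {0..1}" "s \<le> A t \<or> B t \<le> s" for s t
    proof -
      consider "t \<le> 1/4" | "1/4 < t" "t \<le> 1/2" | "1/2 < t" by linarith
      then show ?thesis
      proof cases
        case 1
        then have "c t = 0" by (simp add: c_def)
        then have "J (s, 4 * t) = H (s,\<tau>)" using st 1 by (intro J(2)) (auto simp: A_def B_def)
        moreover have "G (s,t) = J (s, 4 * t)" using 1 by (simp add: G_def tpaste_def)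
        ultimately show ?thesis using Hn[OF st(1) t(1,2) n(1)] by simp
      next
        case 2
        then have "G (s,t) = H (s, f (4 * t - 1))" by (simp add: G_def tpaste_def M_def)
        then show ?thesis using Hn[OF st(1) f[of "4 * t - 1"]] 2 by simp
      next
        case 3
        then have "c t = 1" by (simp add: c_def)
        then have "J' (s, 2 - 2 * t) = H (s,\<tau>')" using st 3 by (intro J'(2)) (auto simp: A_def B_def)
        moreover have "G (s,t) = J' (s, 2 - 2 * t)" using 3 by (simp add: G_def tpaste_def trev_def)
        ultimately show ?thesis using Hn[OF st(1) t(6,7) n(2)] by simp
      qed
    qed
    have gn: "dist (H (s,\<tau>)) (lam s) < \<eta>2" "dist (H (s,\<tau>')) (lam s) < \<eta>2" if "s \<in> {0..1}" for s
      using Hn[OF that t(1,2) n(1)] Hn[OF that t(6,7) n(2)] by auto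
    have cl: "dist (straighten ?g a b s) (\<nu> s) < \<kappa>" "dist (straighten ?g' a' b' s) (\<nu> s) < \<kappa>" if s: "s \<in> {0..1}" for s
    proof -
      have gn1: "\<forall>x\<in>{0..1}. dist (H (x,\<tau>)) (lam x) < \<eta>1" "\<forall>x\<in>{0..1}. dist (H (x,\<tau>')) (lam x) < \<eta>1"
        using gn \<eta>2(2) by (meson less_le_trans)+
      show "dist (straighten ?g a b s) (\<nu> s) < \<kappa>" using t n \<eta> \<eta>2(2) s by (intro \<eta>1(2) gn1) auto
      show "dist (straighten ?g' a' b' s) (\<nu> s) < \<kappa>" using t n \<eta> \<eta>2(2) s by (intro \<eta>1(2) gn1) auto
    qed
    have "\<exists>F. epe_hom \<Omega> p q (straighten ?g a b) (straighten ?g' a' b') F \<and> (\<forall>z\<in>sq. dist (F z) (\<nu> (fst z)) \<le> 9 * \<kappa>)"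
    proof (rule small_homotopy[OF G N(1) \<kappa> osc cl])
      fix i s s' assume i: "i < N" "s \<in> {real i/N..real (Suc i)/N}" "s' \<in> {real i/N..real (Suc i)/N}" "\<nu> s \<noteq> \<nu> s'"
      have iI: "i \<in> I" unfolding I_def using i by blast
      have e: "\<eta> \<le> E i" "\<eta>2 \<le> E i" using \<eta>2(4)[OF iI] \<eta> by auto
      have G': "epe_hom \<Omega> p q (straighten ?g (A 0) (B 0)) (straighten ?g' (A 1) (B 1)) G" using G by (simp add: ABe)
      have 1: "\<forall>t\<in>{0..1}. 0 < A t \<and> A t < B t \<and> B t < 1 \<and> \<bar>A t - a0\<bar> < E i \<and> \<bar>B t - b0\<bar> < E i"
        using AB AB' e(1) by (meson less_le_trans)
      have 2: "\<forall>s\<in>{0..1}. \<forall>t\<in>{0..1}. s \<le> A t \<or> B t \<le> s \<longrightarrow> dist (G (s,t)) (lam s) < E i" using Gn e(2) by (meson less_le_trans)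
      have 3: "\<forall>s\<in>{0..1}. dist (?g s) (lam s) < E i \<and> dist (?g' s) (lam s) < E i" using gn e(2) by (meson less_le_trans)
      show "\<exists>r r' \<sigma>. real i/N < r \<and> r < real (Suc i)/N \<and> real i/N < r' \<and> r' < real (Suc i)/N \<and> link \<Omega> G r r' \<sigma> \<and>
        (\<forall>t\<in>{0..1}. dist (\<sigma> t) (\<nu> (real i/N)) < 3 * \<kappa>)"
        unfolding \<nu>_def by (rule E(2)[OF iI, unfolded P_def, rule_format, of p q ?g A B ?g' G]) (intro conjI G' ABc 1 2 3)
    qed
    then show ?thesis unfolding small_hom_def .
  qed
  then show ?thesis using \<eta>(1) unfolding \<nu>_def by blast
qed

text \<open>In the homotopy compressed to heights between \<tau> and 1 - \<tau>, a level continuum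
  separates the high set \<open>K\<close> from the low point \<open>(s,0)\<close>. It has to meet
  the lower edge on both sides of \<open>s\<close>, which yields the two ends of a straightening of
  the slice at \<tau>. Compression changes values by less than \<epsilon>; the margins around
  \<open>v\<close> absorb this.\<close>

lemma bump_exists:
  assumes \<Omega>: "open \<Omega>" and H: "collar \<Omega> p q \<gamma> lam H" and u: "norm (u::complex) = 1"
    and K: "connected K" "K \<subseteq> sq" "(\<alpha>,0) \<in> K" "(\<beta>,0) \<in> K" and s: "\<alpha> < s" "s < \<beta>"
    and hi: "\<And>z. z \<in> K \<Longrightarrow> v + \<epsilon> \<le> u \<bullet> H z" and lo: "u \<bullet> lam s < v - \<epsilon>" and v: "v \<noteq> u \<bullet> p" "v \<noteq> u \<bullet> q"
    and \<tau>: "0 < \<tau>" "\<tau> < 1/2"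
    and uc: "\<And>x t t'. x \<in> {0..1} \<Longrightarrow> t \<in> {0..1} \<Longrightarrow> t' \<in> {0..1} \<Longrightarrow> \<bar>t - t'\<bar> \<le> \<tau> \<Longrightarrow> dist (H (x,t)) (H (x,t')) < \<epsilon>"
  shows "\<exists>a b. bump \<Omega> p q H \<tau> a b \<and> \<alpha> < a \<and> a < s \<and> s < b \<and> b < \<beta> \<and> u \<bullet> H (a,\<tau>) = v \<and> u \<bullet> H (b,\<tau>) = v"
proof -
  define f where "f = (\<lambda>t. max \<tau> (min t (1 - \<tau>)))"
  have f: "0 < f t" "f t < 1" for t using \<tau> by (auto simp: f_def max_def min_def)
  have fn: "\<bar>f t - t\<bar> \<le> \<tau>" if "t \<in> {0..1}" for t using that \<tau> by (auto simp: f_def max_def min_def)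
  have f0: "f 0 = \<tau>" using \<tau> by (simp add: f_def)
  have fc: "continuous_on {0..1} f" unfolding f_def by (intro continuous_intros)
  define M where "M = (\<lambda>(x,t). H (x, f t))"
  have M: "epe_hom \<Omega> p q (\<lambda>s. H (s,\<tau>)) (\<lambda>s. H (s, f 1)) M"
    using collar_strip[OF H fc f] by (simp add: M_def f0)
  have near: "\<bar>u \<bullet> M z - u \<bullet> H z\<bar> < \<epsilon>" if z: "z \<in> sq" for z
  proof -
    obtain x t where xt: "z = (x,t)" "x \<in> {0..1}" "t \<in> {0..1}" using z by (cases z) auto
    have "dist (H (x, f t)) (H (x,t)) < \<epsilon>" using xt f[of t] fn[of t] by (intro uc) auto
    then show ?thesis using inner_dist_le[of u "M z" "H z"] u xt by (simp add: M_def)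
  qed
  have KM: "v < u \<bullet> M z" if "z \<in> K" for z using hi[OF that] near[of z] K(2) that by fastforce
  have ab01: "\<alpha> \<in> {0..1}" "\<beta> \<in> {0..1}" using K by auto
  then have s01: "s \<in> {0..1}" using s by auto
  have sM: "u \<bullet> M (s,0) < v" using near[of "(s,0)"] lo collarD(2)[OF H s01] s01 by auto
  have Mc: "continuous_on sq (\<lambda>z. - (u \<bullet> M z))" using epe_homD(1)[OF M] by (intro continuous_intros)
  define C where "C = connected_component_set {z \<in> sq. - (u \<bullet> M z) \<le> - v} (\<alpha>,0)"
  have Csub: "C \<subseteq> {z \<in> sq. - (u \<bullet> M z) \<le> - v}" unfolding C_def by (rule connected_component_subset)
  have KC: "K \<subseteq> C" unfolding C_def using K KM by (intro connected_component_maximal) (auto simp: less_imp_le)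
  have sC: "(s,0) \<notin> C" using Csub sM by auto
  have a1: "(\<alpha>,0) \<in> sq" "- (u \<bullet> M (\<alpha>,0)) \<le> - v" "(s,0) \<in> sq" using K KM[OF K(3)] s01 by auto
  obtain D where D: "compact D" "connected D" "D \<subseteq> C" "\<And>z. z \<in> D \<Longrightarrow> - (u \<bullet> M z) = - v"
    and hit: "\<And>\<Gamma>. connected \<Gamma> \<Longrightarrow> \<Gamma> \<subseteq> sq \<Longrightarrow> (s,0) \<in> \<Gamma> \<Longrightarrow> \<Gamma> \<inter> C \<noteq> {} \<Longrightarrow> \<Gamma> \<inter> D \<noteq> {}"
  proof (rule level_separation[OF sq_convex sq_compact Mc a1 C_def sC])
    fix G assume a: "compact G" "connected G" "G \<subseteq> C" "\<And>z. z \<in> G \<Longrightarrow> - (u \<bullet> M z) = - v"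
      "\<And>\<Gamma>. connected \<Gamma> \<Longrightarrow> \<Gamma> \<subseteq> sq \<Longrightarrow> (s,0) \<in> \<Gamma> \<Longrightarrow> \<Gamma> \<inter> C \<noteq> {} \<Longrightarrow> \<Gamma> \<inter> G \<noteq> {}"
    show thesis by (rule that[OF a])
  qed
  have Dv: "u \<bullet> M z = v" if "z \<in> D" for z using D(4)[OF that] by simp
  have DS: "D \<subseteq> {0<..<1} \<times> {0..1}"
  proof
    fix z assume z: "z \<in> D"
    obtain x t where xt: "z = (x,t)" "x \<in> {0..1}" "t \<in> {0..1}" using D(3) Csub z by (cases z) auto
    have "x \<noteq> 0" "x \<noteq> 1" using Dv[OF z] v epe_homD(4,5)[OF M xt(3)] xt(1) by auto
    then show "z \<in> {0<..<1} \<times> {0..1}" using xt by auto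
  qed
  have "({\<alpha>..s} \<times> {0}) \<inter> D \<noteq> {}"
  proof (intro hit)
    have "(\<alpha>,0) \<in> {\<alpha>..s} \<times> {0} \<inter> C" using s K(3) KC by auto
    then show "{\<alpha>..s} \<times> {0} \<inter> C \<noteq> {}" by blast
  qed (use ab01 s in \<open>auto intro!: connected_Times\<close>)
  then obtain a where a: "\<alpha> \<le> a" "a \<le> s" "(a,0) \<in> D" by auto
  have "({s..\<beta>} \<times> {0}) \<inter> D \<noteq> {}"
  proof (intro hit)
    have "(\<beta>,0) \<in> {s..\<beta>} \<times> {0} \<inter> C" using s K(4) KC by auto
    then show "{s..\<beta>} \<times> {0} \<inter> C \<noteq> {}" by blast
  qed (use ab01 s in \<open>auto intro!: connected_Times\<close>)
  then obtain b where b: "s \<le> b" "b \<le> \<beta>" "(b,0) \<in> D" by auto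
  have neq: "a \<noteq> \<alpha>" "a \<noteq> s" "b \<noteq> s" "b \<noteq> \<beta>"
    using Dv[OF a(3)] Dv[OF b(3)] KM[OF K(3)] KM[OF K(4)] sM by auto
  then have ord: "\<alpha> < a" "a < s" "s < b" "b < \<beta>" using a b by auto
  have "a < b" using ord by simp
  obtain J where J: "epe_hom \<Omega> p q (straighten (\<lambda>s. H (s,\<tau>)) a b) (\<lambda>s. H (s,\<tau>)) J"
    "\<And>s t. s \<in> {0..1} \<Longrightarrow> t \<in> {0..1} \<Longrightarrow> s \<le> a \<or> b \<le> s \<Longrightarrow> J (s,t) = H (s,\<tau>)"
  proof (rule level_straighten[OF \<Omega> M u D(1,2) DS Dv a(3) b(3) \<open>a < b\<close>])
    fix J assume a: "epe_hom \<Omega> p q (straighten (\<lambda>s. H (s,\<tau>)) a b) (\<lambda>s. H (s,\<tau>)) J"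
      "\<And>s t. s \<in> {0..1} \<Longrightarrow> t \<in> {0..1} \<Longrightarrow> s \<le> a \<or> b \<le> s \<Longrightarrow> J (s,t) = H (s,\<tau>)"
    show thesis by (rule that[OF a])
  qed
  have "bump \<Omega> p q H \<tau> a b"
    unfolding bump_def using J ord ab01 \<tau> by auto
  moreover have "M (a,0) = H (a,\<tau>)" "M (b,0) = H (b,\<tau>)" by (auto simp: M_def f0)
  ultimately show ?thesis using ord Dv[OF a(3)] Dv[OF b(3)] by auto
qed

text \<open>\<open>bump_small_hom\<close> asks only that the parameters be close to their limits, so
  a tail of any subsequence satisfies the requirement of \<open>class_of_limit\<close>.\<close>

lemma bump_limit:
  assumes \<Omega>: "open \<Omega>" and H: "collar \<Omega> p q \<gamma> lam H" and lam: "continuous_on {0..1} lam" and ab: "0 \<le> a0" "a0 < b0" "b0 \<le> 1"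
    and bp: "\<And>n. bump \<Omega> p q H (\<tau> n) (a n) (b n)" and lim: "\<tau> \<longlonglongrightarrow> 0" "a \<longlonglongrightarrow> a0" "b \<longlonglongrightarrow> b0"
  shows "straighten lam a0 b0 \<in> closure_class \<Omega> p q \<gamma>"
proof (rule class_of_limit[where \<nu> = "\<lambda>n. straighten (\<lambda>s. H (s, \<tau> n)) (a n) (b n)"])
  show "path (straighten lam a0 b0)" using straighten_cont[OF lam ab] by (simp add: path_def)
  show "epeh \<Omega> p q \<gamma> (straighten (\<lambda>s. H (s, \<tau> n)) (a n) (b n))" for n
  proof (rule epeh_trans[OF collarD(6)[OF H] epeh_sym])
    show "0 < \<tau> n" "\<tau> n < 1" using bp[of n] by (auto simp: bump_def)
    show "epeh \<Omega> p q (straighten (\<lambda>s. H (s, \<tau> n)) (a n) (b n)) (\<lambda>s. H (s, \<tau> n))" using bp[of n] unfolding bump_def epeh_def by blast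
  qed
  fix \<kappa> :: real and \<psi> :: "nat \<Rightarrow> nat" assume \<kappa>: "0 < \<kappa>" and \<psi>: "strict_mono \<psi>"
  have "0 < \<kappa>/9" using \<kappa> by simp
  from bump_small_hom[OF \<Omega> H lam ab this] obtain \<eta> where \<eta>: "0 < \<eta>"
    "\<And>\<tau> a b \<tau>' a' b'. bump \<Omega> p q H \<tau> a b \<Longrightarrow> bump \<Omega> p q H \<tau>' a' b' \<Longrightarrow> \<tau> < \<eta> \<Longrightarrow> \<tau>' < \<eta> \<Longrightarrow> \<bar>a - a0\<bar> < \<eta> \<Longrightarrow> \<bar>a' - a0\<bar> < \<eta> \<Longrightarrow> \<bar>b - b0\<bar> < \<eta> \<Longrightarrow> \<bar>b' - b0\<bar> < \<eta> \<Longrightarrow>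
    small_hom \<Omega> p q (straighten lam a0 b0) (9 * (\<kappa>/9)) (straighten (\<lambda>s. H (s,\<tau>)) a b) (straighten (\<lambda>s. H (s,\<tau>')) a' b')"
    by blast
  have "\<forall>\<^sub>F n in sequentially. \<bar>\<tau> n - 0\<bar> < \<eta> \<and> \<bar>a n - a0\<bar> < \<eta> \<and> \<bar>b n - b0\<bar> < \<eta>"
    using lim[THEN tendstoD, OF \<eta>(1)] by (intro eventually_conj) (auto simp: dist_real_def)
  then obtain n0 where n0: "\<And>n. n0 \<le> n \<Longrightarrow> \<bar>\<tau> n - 0\<bar> < \<eta> \<and> \<bar>a n - a0\<bar> < \<eta> \<and> \<bar>b n - b0\<bar> < \<eta>"
    unfolding eventually_sequentially by blast
  show "\<exists>\<psi>'::nat \<Rightarrow> nat. strict_mono \<psi>' \<and> (\<forall>n m. small_hom \<Omega> p q (straighten lam a0 b0) \<kappa> (straighten (\<lambda>s. H (s, \<tau> (\<psi> (\<psi>' n)))) (a (\<psi> (\<psi>' n))) (b (\<psi> (\<psi>' n))))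
    (straighten (\<lambda>s. H (s, \<tau> (\<psi> (\<psi>' m)))) (a (\<psi> (\<psi>' m))) (b (\<psi> (\<psi>' m)))))"
  proof (rule exI[of _ "\<lambda>n. n + n0"], intro conjI allI)
    show "strict_mono (\<lambda>n. n + n0)" by (simp add: strict_mono_def)
    fix n m
    have big: "n0 \<le> \<psi> (k + n0)" for k using seq_suble[OF \<psi>, of "k + n0"] by linarith
    have t: "\<tau> k < \<eta>" if "\<bar>\<tau> k - 0\<bar> < \<eta>" for k using that by simp
    have "small_hom \<Omega> p q (straighten lam a0 b0) (9 * (\<kappa>/9)) (straighten (\<lambda>s. H (s, \<tau> (\<psi> (n + n0)))) (a (\<psi> (n + n0))) (b (\<psi> (n + n0))))
      (straighten (\<lambda>s. H (s, \<tau> (\<psi> (m + n0)))) (a (\<psi> (m + n0))) (b (\<psi> (m + n0))))"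
      using n0[OF big[of n]] n0[OF big[of m]] by (intro \<eta>(2) bp t) auto
    then show "small_hom \<Omega> p q (straighten lam a0 b0) \<kappa> (straighten (\<lambda>s. H (s, \<tau> (\<psi> (n + n0)))) (a (\<psi> (n + n0))) (b (\<psi> (n + n0))))
      (straighten (\<lambda>s. H (s, \<tau> (\<psi> (m + n0)))) (a (\<psi> (m + n0))) (b (\<psi> (m + n0))))" by simp
  qed
qed

lemma TV_cong: "(\<And>s. s \<in> {0..1} \<Longrightarrow> f s = g s) \<Longrightarrow> TV e f 1 = TV e g 1"
  unfolding TV_def by (intro SUP_cong refl tvsum_cong) (auto simp: partitions_def)

lemma reparam_equiv_TV:
  assumes "reparam_equiv g g'" and g: "continuous_on {0..1} g" and g': "continuous_on {0..1} g'" and e: "0 < e"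
  shows "TV e (\<lambda>s. u \<bullet> g s) 1 = TV e (\<lambda>s. (u::complex) \<bullet> g' s) 1"
proof -
  obtain \<phi> \<psi> :: "real \<Rightarrow> real" where h: "continuous_on {0..1} \<phi>" "continuous_on {0..1} \<psi>" "mono_on {0..1} \<phi>" "mono_on {0..1} \<psi>"
     "\<phi> ` {0..1} = {0..1}" "\<psi> ` {0..1} = {0..1}" "\<forall>s\<in>{0..1}. g (\<phi> s) = g' (\<psi> s)"
    using assms(1) unfolding reparam_equiv_def by blast
  have "TV e (\<lambda>s. u \<bullet> g (\<phi> s)) 1 = TV e (\<lambda>s. u \<bullet> g s) 1" by (rule TV_reparam[OF cont_inner[OF g] e h(3,5,1)])
  moreover have "TV e (\<lambda>s. u \<bullet> g' (\<psi> s)) 1 = TV e (\<lambda>s. u \<bullet> g' s) 1" by (rule TV_reparam[OF cont_inner[OF g'] e h(4,6,2)])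
  moreover have "TV e (\<lambda>s. u \<bullet> g (\<phi> s)) 1 = TV e (\<lambda>s. u \<bullet> g' (\<psi> s)) 1" using h(7) by (intro TV_cong) auto
  ultimately show ?thesis by simp
qed

lemma efficient_cont: "efficient \<Omega> p q \<gamma> lam \<Longrightarrow> continuous_on {0..1} lam"
  unfolding efficient_def closure_class_def path_def by blast

text \<open>If \<open>lam\<close> dipped below \<open>c\<close> between the contacts of
  \<open>K\<close>, the slices near the lower edge could be straightened across the dip. By
  compactness the ends of these straightenings converge to some \<open>a0 < s < b0\<close>, and
  \<open>lam\<close> straightened there belongs to the closed class. Efficiency makes it a
  reparameterization of \<open>lam\<close>, with the same truncated variations, whereas removing the
  dip loses variation.\<close>

lemma efficient_level_ge:
  assumes \<Omega>: "open \<Omega>" and eff: "efficient \<Omega> p q \<gamma> lam" and H: "collar \<Omega> p q \<gamma> lam H" and u: "norm (u::complex) = 1"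
    and K: "connected K" "K \<subseteq> sq" "(\<alpha>,0) \<in> K" "(\<beta>,0) \<in> K" and hi: "\<And>z. z \<in> K \<Longrightarrow> c \<le> u \<bullet> H z" and s: "s \<in> {\<alpha>..\<beta>}"
  shows "c \<le> u \<bullet> lam s"
proof (rule ccontr)
  assume neg: "\<not> c \<le> u \<bullet> lam s"
  have lam: "continuous_on {0..1} lam" using efficient_cont[OF eff] .
  have ab01: "\<alpha> \<in> {0..1}" "\<beta> \<in> {0..1}" using K by auto
  have s01: "s \<in> {0..1}" using s ab01 by auto
  have "s \<noteq> \<alpha>" "s \<noteq> \<beta>" using hi[OF K(3)] hi[OF K(4)] collarD(2)[OF H] ab01 neg by auto
  then have s': "\<alpha> < s" "s < \<beta>" using s by auto
  \<comment> \<open>As in \<open>crossing_link\<close>, three levels in the middle of the gap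
    guarantee one that avoids \<open>p\<close> and \<open>q\<close>, here with a margin of at least
    \<epsilon> on both sides.\<close>
  define \<epsilon> where "\<epsilon> = (c - u \<bullet> lam s) / 8"
  have \<epsilon>: "0 < \<epsilon>" using neg by (simp add: \<epsilon>_def)
  have "\<exists>k\<in>{3,4,5::real}. u \<bullet> lam s + k * \<epsilon> \<noteq> u \<bullet> p \<and> u \<bullet> lam s + k * \<epsilon> \<noteq> u \<bullet> q"
    using \<epsilon> by auto
  then obtain k where k0: "k \<in> {3,4,5}" and k': "u \<bullet> lam s + k * \<epsilon> \<noteq> u \<bullet> p" "u \<bullet> lam s + k * \<epsilon> \<noteq> u \<bullet> q" by blast
  define v where "v = u \<bullet> lam s + k * \<epsilon>"
  have "3 * \<epsilon> \<le> k * \<epsilon>" "k * \<epsilon> \<le> 5 * \<epsilon>" using k0 \<epsilon> by (auto intro!: mult_right_mono)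
  moreover have "c = u \<bullet> lam s + 8 * \<epsilon>" by (simp add: \<epsilon>_def field_simps)
  ultimately have v: "u \<bullet> lam s < v - \<epsilon>" "v + \<epsilon> \<le> c" unfolding v_def using \<epsilon> by linarith+
  have hi': "v + \<epsilon> \<le> u \<bullet> H z" if "z \<in> K" for z using hi[OF that] v by simp
  have vpq: "v \<noteq> u \<bullet> p" "v \<noteq> u \<bullet> q" using k' by (auto simp: v_def)
  have "uniformly_continuous_on sq H" using collarD(1)[OF H] sq_compact by (rule compact_uniformly_continuous)
  then obtain \<delta> where \<delta>: "0 < \<delta>" "\<And>z w. z \<in> sq \<Longrightarrow> w \<in> sq \<Longrightarrow> dist w z < \<delta> \<Longrightarrow> dist (H w) (H z) < \<epsilon>"
    using \<epsilon> unfolding uniformly_continuous_on_def by metis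
  define T where "T = (\<lambda>n::nat. min (1/4) (\<delta>/2) / real (Suc n))"
  have T: "0 < T n" "T n \<le> 1/4" "T n \<le> \<delta>/2" for n
  proof -
    have m: "0 < min (1/4) (\<delta>/2)" using \<delta> by simp
    then show "0 < T n" by (simp add: T_def)
    have "T n \<le> min (1/4) (\<delta>/2) / 1" unfolding T_def using m by (intro divide_left_mono) auto
    then show "T n \<le> 1/4" "T n \<le> \<delta>/2" by auto
  qed
  have "(\<lambda>n. min (1/4) (\<delta>/2) * (1 / real (Suc n))) \<longlonglongrightarrow> min (1/4) (\<delta>/2) * 0"
    by (intro tendsto_mult tendsto_const LIMSEQ_Suc[OF lim_1_over_n])
  then have T0: "T \<longlonglongrightarrow> 0" by (simp add: T_def)
  have "\<forall>n. \<exists>a b. bump \<Omega> p q H (T n) a b \<and> \<alpha> < a \<and> a < s \<and> s < b \<and> b < \<beta> \<and> u \<bullet> H (a,T n) = v \<and> u \<bullet> H (b,T n) = v"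
  proof
    fix n
    have T12: "T n < 1/2" using T(2)[of n] by simp
    have uc: "dist (H (x,t)) (H (x,t')) < \<epsilon>" if "x \<in> {0..1}" "t \<in> {0..1}" "t' \<in> {0..1}" "\<bar>t - t'\<bar> \<le> T n" for x t t'
      using that T(3)[of n] \<delta>(1) by (intro \<delta>(2)) (auto simp: dist_Pair_Pair dist_real_def)
    show "\<exists>a b. bump \<Omega> p q H (T n) a b \<and> \<alpha> < a \<and> a < s \<and> s < b \<and> b < \<beta> \<and> u \<bullet> H (a,T n) = v \<and> u \<bullet> H (b,T n) = v"
      by (rule bump_exists[OF \<Omega> H u K s' hi' v(1) vpq T(1) T12 uc])
  qed
  then obtain a b where ab: "\<And>n. bump \<Omega> p q H (T n) (a n) (b n)" "\<And>n. \<alpha> < a n" "\<And>n. a n < s" "\<And>n. s < b n" "\<And>n. b n < \<beta>"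
    "\<And>n. u \<bullet> H (a n,T n) = v" "\<And>n. u \<bullet> H (b n,T n) = v" by metis
  have absq: "(a n, b n) \<in> sq" for n using ab(2-5)[of n] ab01 s01 by auto
  from sq_compact[unfolded compact_def, rule_format, of "\<lambda>n. (a n, b n)", OF absq] obtain l r where l: "l \<in> sq" and r: "strict_mono (r :: nat \<Rightarrow> nat)" and lim: "((\<lambda>n. (a n, b n)) \<circ> r) \<longlonglongrightarrow> l"
    by blast
  obtain a0 b0 where l0: "l = (a0,b0)" by (cases l)
  have lima: "(\<lambda>n. a (r n)) \<longlonglongrightarrow> a0" and limb: "(\<lambda>n. b (r n)) \<longlonglongrightarrow> b0"
    using tendsto_fst[OF lim] tendsto_snd[OF lim] by (auto simp: l0 o_def)
  have limT: "(\<lambda>n. T (r n)) \<longlonglongrightarrow> 0" using LIMSEQ_subseq_LIMSEQ[OF T0 r] by (simp add: o_def)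
  have lev: "u \<bullet> lam c0 = v" if c: "(\<lambda>n. c (r n)) \<longlonglongrightarrow> c0" "\<And>n. u \<bullet> H (c n, T n) = v" "\<And>n. c n \<in> {0..1}" "c0 \<in> {0..1}" for c c0
  proof -
    have "((\<lambda>n. H (c (r n), T (r n))) \<longlongrightarrow> H (c0,0)) sequentially"
    proof (rule continuous_on_tendsto_compose[OF collarD(1)[OF H]])
      show "((\<lambda>n. (c (r n), T (r n))) \<longlongrightarrow> (c0, 0)) sequentially" using c(1) limT by (rule tendsto_Pair)
      show "(c0,0) \<in> sq" using c(4) by simp
      have "(c (r n), T (r n)) \<in> sq" for n using c(3)[of "r n"] T(1)[of "r n"] T(2)[of "r n"] by auto
      then show "\<forall>\<^sub>F n in sequentially. (c (r n), T (r n)) \<in> sq" by simp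
    qed
    then have "(\<lambda>n. u \<bullet> H (c (r n), T (r n))) \<longlonglongrightarrow> u \<bullet> H (c0,0)" by (intro tendsto_intros)
    then have "(\<lambda>n::nat. v) \<longlonglongrightarrow> u \<bullet> H (c0,0)" by (simp add: c(2))
    then have "v = u \<bullet> H (c0,0)" using LIMSEQ_unique tendsto_const by blast
    then show ?thesis using collarD(2)[OF H c(4)] by simp
  qed
  have l01: "a0 \<in> {0..1}" "b0 \<in> {0..1}" using l l0 by auto
  have ua: "u \<bullet> lam a0 = v" using absq by (intro lev[OF lima ab(6) _ l01(1)]) auto
  have ub: "u \<bullet> lam b0 = v" using absq by (intro lev[OF limb ab(7) _ l01(2)]) auto
  have "a0 \<le> s" using ab(3) by (intro LIMSEQ_le_const2[OF lima]) (auto simp: less_imp_le)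
  moreover have "s \<le> b0" using ab(4) by (intro LIMSEQ_le_const[OF limb]) (auto simp: less_imp_le)
  moreover have "a0 \<noteq> s" "b0 \<noteq> s" using ua ub v \<epsilon> by auto
  ultimately have ord: "a0 < s" "s < b0" by auto
  have o: "0 \<le> a0" "a0 < b0" "b0 \<le> 1" using l01 ord by auto
  have "straighten lam a0 b0 \<in> closure_class \<Omega> p q \<gamma>"
    by (rule bump_limit[OF \<Omega> H lam o ab(1) limT lima limb])
  then have rp: "reparam_equiv lam (straighten lam a0 b0)" using eff o unfolding efficient_def by blast
  \<comment> \<open>For this threshold the drop \<open>2 * \<epsilon> - 6 * e\<close> equals
    \<epsilon> and is still positive.\<close>
  define e where "e = \<epsilon>/6"
  have e: "0 < e" using \<epsilon> by (simp add: e_def)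
  have eqTV: "TV e (\<lambda>s. u \<bullet> lam s) 1 = TV e (\<lambda>s. u \<bullet> straighten lam a0 b0 s) 1"
    by (rule reparam_equiv_TV[OF rp lam straighten_cont[OF lam o] e])
  have "TV e (affine_patch (\<lambda>s. u \<bullet> lam s) a0 b0) 1 \<le> TV e (\<lambda>s. u \<bullet> lam s) 1 - (2 * \<epsilon> - 6 * e)"
    by (rule TV_patch_drop[OF cont_inner[OF lam] e o order_refl _ _ order_refl, of s]) (use ord ua ub v in auto)
  then show False using eqTV \<epsilon> by (simp add: inner_straighten e_def)
qed

section \<open>Uniqueness of efficient paths\<close>

text \<open>If the paths share no endpoint, the square is enlarged by a strip below and a strip
  above. Extended through these, \<open>f\<close> runs from the lower left to the upper right corner
  and \<open>g\<close> from bottom to top, so they meet by Fashoda's theorem. Since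
  \<open>a < b\<close> and \<open>b' < a'\<close>, the added pieces create no new
  intersection.\<close>

lemma paths_cross:
  fixes f g :: "real \<Rightarrow> real \<times> real"
  assumes f: "path f" "path_image f \<subseteq> sq" "pathstart f = (a,0)" "pathfinish f = (a',1)"
    and g: "path g" "path_image g \<subseteq> sq" "pathstart g = (b,0)" "pathfinish g = (b',1)"
    and ord: "a \<le> b" "b' \<le> a'"
  shows "path_image f \<inter> path_image g \<noteq> {}"
proof (cases "a = b \<or> a' = b'")
  case True
  then show ?thesis
    using pathstart_in_path_image[of f] pathstart_in_path_image[of g] pathfinish_in_path_image[of f] pathfinish_in_path_image[of g] f g
    by (metis disjoint_iff)
next
  case False
  then have lt: "a < b" "b' < a'" using ord by auto
  have fe: "(a,0) \<in> path_image f" "(a',1) \<in> path_image f" using f pathstart_in_path_image[of f] pathfinish_in_path_image[of f] by auto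
  have ge: "(b,0) \<in> path_image g" "(b',1) \<in> path_image g" using g pathstart_in_path_image[of g] pathfinish_in_path_image[of g] by auto
  have sq01: "a \<in> {0..1}" "b \<in> {0..1}" "a' \<in> {0..1}" "b' \<in> {0..1}" using fe ge f(2) g(2) by auto
  define F where "F = linepath (0,-1) (a,0) +++ (f +++ linepath (a',1) (1,2))"
  define G where "G = linepath (b,-1) (b,0) +++ (g +++ linepath (b',1) (b',2))"
  have paths: "path F" "path G" using f g by (auto simp: F_def G_def intro!: path_join_imp)
  have Fi: "path_image F = closed_segment (0,-1) (a,0) \<union> (path_image f \<union> closed_segment (a',1) (1,2))"
    and Gi: "path_image G = closed_segment (b,-1) (b,0) \<union> (path_image g \<union> closed_segment (b',1) (b',2))"
    using f g by (simp_all add: F_def G_def path_image_join)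
  have S1: "closed_segment (0,-1) (a,0) \<subseteq> {0..a} \<times> {-1..0::real}" using sq01 by (intro closed_segment_subset convex_Times) auto
  have S3: "closed_segment (a',1) (1,2) \<subseteq> {a'..1} \<times> {1..2::real}" using sq01 by (intro closed_segment_subset convex_Times) auto
  have T1: "closed_segment (b,-1) (b,0) \<subseteq> {b..b} \<times> {-1..0::real}" using sq01 by (intro closed_segment_subset convex_Times) auto
  have T3: "closed_segment (b',1) (b',2) \<subseteq> {b'..b'} \<times> {1..2::real}" using sq01 by (intro closed_segment_subset convex_Times) auto
  have box: "path_image F \<subseteq> {0..1} \<times> {-1..2}" "path_image G \<subseteq> {0..1} \<times> {-1..2}"
  proof -
    have bx: "{0..a} \<times> {-1..0} \<subseteq> {0..1} \<times> {-1..2::real}" "{a'..1} \<times> {1..2} \<subseteq> {0..1} \<times> {-1..2::real}" "sq \<subseteq> {0..1} \<times> {-1..2}"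
      "{b..b} \<times> {-1..0} \<subseteq> {0..1} \<times> {-1..2::real}" "{b'..b'} \<times> {1..2} \<subseteq> {0..1} \<times> {-1..2::real}" using sq01 by auto
    show "path_image F \<subseteq> {0..1} \<times> {-1..2}"
      unfolding Fi by (intro Un_least subset_trans[OF S1 bx(1)] subset_trans[OF f(2) bx(3)] subset_trans[OF S3 bx(2)])
    show "path_image G \<subseteq> {0..1} \<times> {-1..2}"
      unfolding Gi by (intro Un_least subset_trans[OF T1 bx(4)] subset_trans[OF g(2) bx(3)] subset_trans[OF T3 bx(5)])
  qed
  define V :: "real \<times> real \<Rightarrow> real^2" where "V = (\<lambda>z. vector [fst z, snd z])"
  have V1: "V z $ 1 = fst z" "V z $ 2 = snd z" for z by (auto simp: V_def)
  have Vinj: "z = w" if "V z = V w" for z w using that V1[of z] V1[of w] by (auto simp: prod_eq_iff)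
  have Vc: "continuous_on S V" for S
  proof -
    have "V = (\<lambda>z. fst z *\<^sub>R axis 1 1 + snd z *\<^sub>R axis 2 1)" by (auto simp: V_def vec_eq_iff forall_2 axis_def)
    then show ?thesis by (auto intro!: continuous_intros)
  qed
  have Vbox: "V ` ({0..1} \<times> {-1..2}) \<subseteq> cbox (V (0,-1)) (V (1,2))"
    by (auto simp: mem_box_cart forall_2 V1)
  obtain z where z: "z \<in> path_image (V \<circ> F)" "z \<in> path_image (V \<circ> G)"
  proof (rule fashoda[of "V \<circ> F" "V \<circ> G" "V (0,-1)" "V (1,2)"])
    show "path (V \<circ> F)" "path (V \<circ> G)" using paths Vc by (auto intro!: path_continuous_image)
    show "path_image (V \<circ> F) \<subseteq> cbox (V (0,-1)) (V (1,2))" "path_image (V \<circ> G) \<subseteq> cbox (V (0,-1)) (V (1,2))"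
      unfolding path_image_compose by (rule order_trans[OF image_mono[OF box(1)] Vbox], rule order_trans[OF image_mono[OF box(2)] Vbox])
    show "pathstart (V \<circ> F) $ 1 = V (0,-1) $ 1" "pathfinish (V \<circ> F) $ 1 = V (1,2) $ 1"
      "pathstart (V \<circ> G) $ 2 = V (0,-1) $ 2" "pathfinish (V \<circ> G) $ 2 = V (1,2) $ 2"
      by (simp_all add: pathstart_compose pathfinish_compose F_def G_def V1)
  qed
  then obtain w w' where "z = V w" "w \<in> path_image F" "z = V w'" "w' \<in> path_image G" unfolding path_image_compose by blast
  then have w: "w \<in> path_image F" "w \<in> path_image G" using Vinj by metis+
  have e1: "w = (a,0)" if "w \<in> closed_segment (0,-1) (a,0)" "snd w = 0" using that by (auto simp: in_segment)
  have e3: "w = (a',1)" if "w \<in> closed_segment (a',1) (1,2)" "snd w = 1" using that by (auto simp: in_segment algebra_simps)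
  have h1: "w = (b,0)" if "w \<in> closed_segment (b,-1) (b,0)" "snd w = 0" using that T1 by (auto simp: prod_eq_iff)
  have h3: "w = (b',1)" if "w \<in> closed_segment (b',1) (b',2)" "snd w = 1" using that T3 by (auto simp: prod_eq_iff)
  have r1: "fst w \<le> a \<and> snd w \<le> 0" if "w \<in> closed_segment (0,-1) (a,0)" using that S1 by auto
  have r3: "a' \<le> fst w \<and> 1 \<le> snd w" if "w \<in> closed_segment (a',1) (1,2)" using that S3 by auto
  have q1: "fst w = b \<and> snd w \<le> 0" if "w \<in> closed_segment (b,-1) (b,0)" using that T1 by auto
  have q3: "fst w = b' \<and> 1 \<le> snd w" if "w \<in> closed_segment (b',1) (b',2)" using that T3 by auto
  have m: "0 \<le> snd w \<and> snd w \<le> 1" if "w \<in> path_image f \<or> w \<in> path_image g" using that f(2) g(2) by auto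
  consider "w \<in> closed_segment (0,-1) (a,0)" | "w \<in> path_image f" | "w \<in> closed_segment (a',1) (1,2)" using w(1) Fi by blast
  then have "w \<in> path_image f \<inter> path_image g"
  proof cases
    case 1
    consider "w \<in> closed_segment (b,-1) (b,0)" | "w \<in> path_image g" | "w \<in> closed_segment (b',1) (b',2)" using w(2) Gi by blast
    then show ?thesis
    proof cases
      case 2
      then have "snd w = 0" using r1[OF 1] m by auto
      then show ?thesis using e1[OF 1] fe 2 by auto
    qed (use r1[OF 1] q1 q3 lt in auto)
  next
    case 2
    consider "w \<in> closed_segment (b,-1) (b,0)" | "w \<in> path_image g" | "w \<in> closed_segment (b',1) (b',2)" using w(2) Gi by blast
    then show ?thesis
    proof cases
      case 1
      then have "snd w = 0" using q1[OF 1] m 2 by auto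
      then show ?thesis using h1[OF 1] ge 2 by auto
    next
      case 3
      then have "snd w = 1" using q3[OF 3] m 2 by auto
      then show ?thesis using h3[OF 3] ge 2 by auto
    qed (use 2 in auto)
  next
    case 3
    consider "w \<in> closed_segment (b,-1) (b,0)" | "w \<in> path_image g" | "w \<in> closed_segment (b',1) (b',2)" using w(2) Gi by blast
    then show ?thesis
    proof cases
      case 2
      then have "snd w = 1" using r3[OF 3] m by auto
      then show ?thesis using e3[OF 3] fe 2 by auto
    qed (use r3[OF 3] q1 q3 lt in auto)
  qed
  then show ?thesis by blast
qed

lemma matching_limit:
  fixes M :: "(real \<times> real) set"
  assumes M: "closed M" "M \<subseteq> sq" and x: "x \<longlonglongrightarrow> a"
    and P: "\<And>n::nat. \<exists>r s'. (r,s') \<in> M \<and> r \<le> x n \<and> 2 * u - x n \<le> s'"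
  shows "\<exists>r s'. (r,s') \<in> M \<and> r \<le> a \<and> 2 * u - a \<le> s'"
proof -
  have cM: "compact M" using M sq_compact by (metis bounded_subset compact_eq_bounded_closed)
  obtain r s' where rs: "\<And>n. (r n, s' n) \<in> M" "\<And>n. r n \<le> x n" "\<And>n. 2 * u - x n \<le> s' n" using P by metis
  from cM[unfolded compact_def, rule_format, of "\<lambda>n. (r n, s' n)", OF rs(1)] obtain l k where l: "l \<in> M" and k: "strict_mono (k :: nat \<Rightarrow> nat)"
    and lim: "((\<lambda>n. (r n, s' n)) \<circ> k) \<longlonglongrightarrow> l" by blast
  have l1: "(\<lambda>n. r (k n)) \<longlonglongrightarrow> fst l" and l2: "(\<lambda>n. s' (k n)) \<longlonglongrightarrow> snd l"
    using tendsto_fst[OF lim] tendsto_snd[OF lim] by (auto simp: o_def)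
  have xk: "(\<lambda>n. x (k n)) \<longlonglongrightarrow> a" using LIMSEQ_subseq_LIMSEQ[OF x k] by (simp add: o_def)
  have "fst l \<le> a" using rs(2) by (intro LIMSEQ_le[OF l1 xk]) auto
  moreover have "2 * u - a \<le> snd l"
    using rs(3) by (intro LIMSEQ_le[OF tendsto_diff[OF tendsto_const xk] l2]) auto
  ultimately show ?thesis using l by (intro exI[of _ "fst l"] exI[of _ "snd l"]) auto
qed

text \<open>Let m(s) be the largest partner of any \<open>r \<le> s\<close>. The graph of m,
  completed by vertical segments at its jumps, is a monotone curve, and it is parameterized by the
  sum of its coordinates: \<open>\<phi> u\<close> and \<open>\<psi> u\<close> are the coordinates of
  the point with sum \<open>2 * u\<close>. Neither coordinate grows faster than the sum, which makes
  both Lipschitz.\<close>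

lemma matching_reparam:
  fixes f g :: "real \<Rightarrow> complex" and M :: "(real \<times> real) set"
  assumes M: "closed M" "M \<subseteq> sq" "(0,0) \<in> M" "(1,1) \<in> M" and tot: "\<And>s. s \<in> {0..1} \<Longrightarrow> \<exists>s'. (s,s') \<in> M"
    and cross: "\<And>s1 s1' s2 s2' y. (s1,s1') \<in> M \<Longrightarrow> (s2,s2') \<in> M \<Longrightarrow> s1 \<le> s2 \<Longrightarrow> s2' \<le> y \<Longrightarrow> y \<le> s1' \<Longrightarrow> g y = f s2"
  shows "reparam_equiv f g"
proof -
  \<comment> \<open>The point 0 is inserted to keep the set nonempty when already 0 has a partner
    beyond \<open>2 * u\<close>.\<close>
  define W where "W = (\<lambda>u. insert 0 {s\<in>{0..1}. \<forall>r s'. (r,s') \<in> M \<and> r \<le> s \<longrightarrow> s + s' \<le> 2 * u})"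
  define \<phi> where "\<phi> = (\<lambda>u. Sup (W u))"
  define \<psi> where "\<psi> = (\<lambda>u. 2 * u - \<phi> u)"
  have W01: "W u \<subseteq> {0..1}" for u by (auto simp: W_def)
  then have bdd: "bdd_above (W u)" for u by (meson bdd_above.I2 atLeastAtMost_iff subsetD bdd_above_mono bdd_above_Icc)
  have \<phi>01: "0 \<le> \<phi> u" "\<phi> u \<le> 1" for u
  proof -
    show "0 \<le> \<phi> u" unfolding \<phi>_def by (rule cSup_upper[OF _ bdd]) (simp add: W_def)
    show "\<phi> u \<le> 1" unfolding \<phi>_def by (rule cSup_least) (use W01[of u] in \<open>auto simp: W_def\<close>)
  qed
  have above: "\<exists>r s'. (r,s') \<in> M \<and> r \<le> x \<and> 2 * u < x + s'" if "\<phi> u < x" "x \<le> 1" for u x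
  proof -
    have "x \<notin> W u" using that(1) cSup_upper[OF _ bdd, of x u] by (auto simp: \<phi>_def)
    moreover have "0 \<le> x" using that \<phi>01[of u] by simp
    ultimately show ?thesis using that(2) by (auto simp: W_def not_le)
  qed
  have below: "x + s' \<le> 2 * u" if x: "0 \<le> x" "x < \<phi> u" and "(r,s') \<in> M" "r \<le> x" for u x r s'
  proof -
    obtain s where "s \<in> W u" "x < s" using x(2) less_cSup_iff[of "W u" x] bdd[of u] by (auto simp: \<phi>_def W_def)
    moreover have "r \<le> s" "s \<noteq> 0" using calculation x(1) that(4) by auto
    ultimately have "s + s' \<le> 2 * u" using that(3) by (auto simp: W_def)
    then show ?thesis using \<open>x < s\<close> by simp
  qed
  have mono: "\<phi> u \<le> \<phi> v" if "u \<le> v" for u v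
    unfolding \<phi>_def
  proof (rule cSup_subset_mono)
    show "W u \<subseteq> W v" using that by (force simp: W_def)
  qed (use bdd in \<open>auto simp: W_def\<close>)
  have lip: "\<phi> v \<le> \<phi> u + 2 * (v - u)" if "u \<le> v" for u v
  proof -
    have "s \<le> \<phi> u + 2 * (v - u)" if s: "s \<in> W v" for s
    proof (cases "s \<le> \<phi> u")
      case True
      then show ?thesis using \<open>u \<le> v\<close> by simp
    next
      case False
      have "s - 2 * (v - u) \<le> \<phi> u"
      proof (rule dense_ge_bounded)
        show "\<phi> u < s" using False by simp
        fix x assume x: "\<phi> u < x" "x < s"
        have s1: "s \<le> 1" using s W01[of v] by auto
        obtain r s' where rs: "(r,s') \<in> M" "r \<le> x" "2 * u < x + s'" using above[of u x] x s1 by auto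
        have "s \<noteq> 0" using False \<phi>01[of u] by auto
        moreover have "r \<le> s" using rs x by simp
        ultimately have "s + s' \<le> 2 * v" using s rs(1) by (auto simp: W_def)
        then show "s - 2 * (v - u) \<le> x" using rs by simp
      qed
      then show ?thesis by simp
    qed
    then have "Sup (W v) \<le> \<phi> u + 2 * (v - u)" by (intro cSup_least) (auto simp: W_def)
    then show ?thesis by (simp add: \<phi>_def)
  qed
  have lips: "\<bar>\<phi> u - \<phi> v\<bar> \<le> 2 * \<bar>u - v\<bar>" for u v
    using mono[of u v] mono[of v u] lip[of u v] lip[of v u] by (cases "u \<le> v") auto
  have \<phi>c: "continuous_on {0..1} \<phi>"
  proof (rule continuous_onI)
    fix x e :: real assume "0 < e"
    then show "\<exists>d>0. \<forall>x'\<in>{0..1}. dist x' x < d \<longrightarrow> dist (\<phi> x') (\<phi> x) \<le> e"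
      using lips by (intro exI[of _ "e/2"]) (auto simp: dist_real_def intro: order_trans[OF lips])
  qed
  have \<psi>c: "continuous_on {0..1} \<psi>" unfolding \<psi>_def by (intro continuous_intros \<phi>c)
  have \<psi>m: "\<psi> u \<le> \<psi> v" if "u \<le> v" for u v using lip[OF that] by (simp add: \<psi>_def)
  have "\<phi> 0 \<le> 0" unfolding \<phi>_def
  proof (rule cSup_least)
    fix x assume x: "x \<in> W 0"
    show "x \<le> 0"
    proof (rule ccontr)
      assume "\<not> x \<le> 0"
      then have "x + 0 \<le> 2 * 0" using x M(3) by (force simp: W_def)
      then show False using \<open>\<not> x \<le> 0\<close> by simp
    qed
  qed (simp add: W_def)
  then have \<phi>0: "\<phi> 0 = 0" using \<phi>01[of 0] by simp
  have "1 \<in> W 1"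
  proof -
    have "s' \<le> 1" if "(r,s') \<in> M" for r s' using that M(2) by auto
    then show ?thesis by (auto simp: W_def)
  qed
  then have "1 \<le> \<phi> 1" unfolding \<phi>_def by (rule cSup_upper[OF _ bdd])
  then have \<phi>1: "\<phi> 1 = 1" using \<phi>01[of 1] by simp
  have \<psi>e: "\<psi> 0 = 0" "\<psi> 1 = 1" by (auto simp: \<psi>_def \<phi>0 \<phi>1)
  have onto: "h ` {0..1} = {0..1}" if h: "continuous_on {0..1} h" "\<And>u v. u \<le> v \<Longrightarrow> h u \<le> h v" "h 0 = 0" "h 1 = 1" for h :: "real \<Rightarrow> real"
  proof
    show "h ` {0..1} \<subseteq> {0..1}" using h(2)[of 0] h(2)[of _ 1] h(3,4) by force
    show "{0..1} \<subseteq> h ` {0..1}"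
    proof
      fix y :: real assume "y \<in> {0..1}"
      then obtain x where "0 \<le> x" "x \<le> 1" "h x = y" using IVT'[of h 0 y 1] h by auto
      then show "y \<in> h ` {0..1}" by auto
    qed
  qed
  \<comment> \<open>Limits from the right give a pair at or before \<open>a\<close> with partner at
    or above \<open>\<psi> u\<close>; limits from the left give a partner of \<open>a\<close> itself
    at or below \<open>\<psi> u\<close>. These two pairs are in the position described by
    \<open>cross\<close>, with \<open>y = \<psi> u\<close>.\<close>
  have eq: "f (\<phi> u) = g (\<psi> u)" if u: "u \<in> {0..1}" for u
  proof -
    define a where "a = \<phi> u"
    have a: "0 \<le> a" "a \<le> 1" using \<phi>01 by (auto simp: a_def)
    have y: "\<psi> u = 2 * u - a" by (simp add: \<psi>_def a_def)
    have A: "\<exists>r s'. (r,s') \<in> M \<and> r \<le> a \<and> 2 * u - a \<le> s'"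
    proof (cases "a = 1")
      case True
      then show ?thesis using M(4) u by (intro exI[of _ 1]) auto
    next
      case False
      define x where "x = (\<lambda>n::nat. a + (1 - a) * (1 / real (Suc n)))"
      have xn: "a < x n" "x n \<le> 1" for n
      proof -
        show "a < x n" using False a by (simp add: x_def)
        have "(1 - a) * (1 / real (Suc n)) \<le> (1 - a) * 1" using a by (intro mult_left_mono) auto
        from add_left_mono[OF this, of a] show "x n \<le> 1" unfolding x_def by simp
      qed
      have "x \<longlonglongrightarrow> a + (1 - a) * 0" unfolding x_def by (intro tendsto_add tendsto_diff tendsto_mult tendsto_const LIMSEQ_Suc[OF lim_1_over_n])
      then have x: "x \<longlonglongrightarrow> a" by simp
      show ?thesis
      proof (rule matching_limit[OF M(1,2) x])
        fix n
        obtain r s' where "(r,s') \<in> M" "r \<le> x n" "2 * u < x n + s'" using above[of u "x n"] xn[of n] by (auto simp: a_def)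
        then show "\<exists>r s'. (r,s') \<in> M \<and> r \<le> x n \<and> 2 * u - x n \<le> s'" by (intro exI[of _ r] exI[of _ s']) auto
      qed
    qed
    have B: "\<exists>y0. (a,y0) \<in> M \<and> y0 \<le> 2 * u - a"
    proof (cases "a = 0")
      case True
      then show ?thesis using M(3) u by (intro exI[of _ 0]) auto
    next
      case False
      define x where "x = (\<lambda>n::nat. a - a * (1 / real (Suc n)))"
      have xn: "0 \<le> x n" "x n < a" for n
      proof -
        show "x n < a" using False a by (simp add: x_def)
        have "a * (1 / real (Suc n)) \<le> a * 1" using a by (intro mult_left_mono) auto
        from diff_left_mono[OF this, of a] show "0 \<le> x n" unfolding x_def by simp
      qed
      have "x \<longlonglongrightarrow> a - a * 0" unfolding x_def by (intro tendsto_add tendsto_diff tendsto_mult tendsto_const LIMSEQ_Suc[OF lim_1_over_n])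
      then have x: "x \<longlonglongrightarrow> a" by simp
      have "\<forall>n. \<exists>s'. (x n, s') \<in> M"
      proof
        fix n
        have "x n \<in> {0..1}" using xn[of n] a by auto
        then show "\<exists>s'. (x n, s') \<in> M" by (rule tot)
      qed
      then obtain s' where s': "\<And>n. (x n, s' n) \<in> M" by metis
      have le: "s' n \<le> 2 * u - x n" for n using below[of "x n" u "x n" "s' n"] xn[of n] s'[of n] by (simp add: a_def)
      have cM: "compact M" using M sq_compact by (metis bounded_subset compact_eq_bounded_closed)
      from cM[unfolded compact_def, rule_format, of "\<lambda>n. (x n, s' n)", OF s'] obtain l k where l: "l \<in> M" and k: "strict_mono (k :: nat \<Rightarrow> nat)"
        and lim: "((\<lambda>n. (x n, s' n)) \<circ> k) \<longlonglongrightarrow> l" by blast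
      have l1: "(\<lambda>n. x (k n)) \<longlonglongrightarrow> fst l" and l2: "(\<lambda>n. s' (k n)) \<longlonglongrightarrow> snd l"
        using tendsto_fst[OF lim] tendsto_snd[OF lim] by (auto simp: o_def)
      have xk: "(\<lambda>n. x (k n)) \<longlonglongrightarrow> a" using LIMSEQ_subseq_LIMSEQ[OF x k] by (simp add: o_def)
      have "fst l = a" using LIMSEQ_unique[OF l1 xk] .
      moreover have "snd l \<le> 2 * u - a" using le by (intro LIMSEQ_le[OF l2 tendsto_diff[OF tendsto_const xk]]) auto
      ultimately show ?thesis using l by (intro exI[of _ "snd l"]) auto
    qed
    obtain r s' where rs: "(r,s') \<in> M" "r \<le> a" "2 * u - a \<le> s'" using A by blast
    obtain y0 where y0: "(a,y0) \<in> M" "y0 \<le> 2 * u - a" using B by blast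
    show ?thesis using cross[OF rs(1) y0(1) rs(2) y0(2) rs(3)] by (simp add: y a_def)
  qed
  show ?thesis
    unfolding reparam_equiv_def
    using \<phi>c \<psi>c mono \<psi>m onto[OF \<phi>c mono \<phi>0 \<phi>1] onto[OF \<psi>c \<psi>m \<psi>e] eq
    by (intro exI[of _ \<phi>] exI[of _ \<psi>]) (auto simp: mono_on_def)
qed

section \<open>Level sets matching the two edges of a square\<close>

lemma cis_inner_eq_0:
  assumes "cis \<theta> \<bullet> z = 0" "cis \<theta>' \<bullet> z = 0" "\<theta> < \<theta>'" "\<theta>' < \<theta> + pi"
  shows "z = 0"
proof -
  have 1: "cos \<theta> * Re z = - (sin \<theta> * Im z)" "cos \<theta>' * Re z = - (sin \<theta>' * Im z)"
    using assms(1,2) by (auto simp: inner_complex_def)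
  have s: "0 < sin (\<theta>' - \<theta>)" using assms(3,4) by (intro sin_gt_zero) auto
  have "sin (\<theta>' - \<theta>) * Re z = sin \<theta>' * (cos \<theta> * Re z) - sin \<theta> * (cos \<theta>' * Re z)" by (simp add: sin_diff algebra_simps)
  also have "\<dots> = 0" unfolding 1 by (simp add: algebra_simps)
  finally have x: "Re z = 0" using s by simp
  have "sin (\<theta>' - \<theta>) * Im z = cos \<theta> * (sin \<theta>' * Im z) - cos \<theta>' * (sin \<theta> * Im z)" by (simp add: sin_diff algebra_simps)
  also have "\<dots> = 0" using 1 x by auto
  finally have "Im z = 0" using s by simp
  then show ?thesis using x by (simp add: complex_eq_iff)
qed

text \<open>Efficiency of the two edges enters through \<open>bot\<close> and \<open>top\<close>.
  Used for \<open>u\<close> and for \<open>- u\<close> they say that a connected set inside a slab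
  confines the edge between its contacts to the closed slab.\<close>

locale taut_square =
  fixes H :: "real \<times> real \<Rightarrow> complex" and p q :: complex
  assumes cont: "continuous_on sq H" and left: "\<And>t. t \<in> {0..1} \<Longrightarrow> H (0,t) = p" and right: "\<And>t. t \<in> {0..1} \<Longrightarrow> H (1,t) = q"
    and bot: "\<And>u c K \<alpha> \<beta> s. norm (u::complex) = 1 \<Longrightarrow> connected K \<Longrightarrow> K \<subseteq> sq \<Longrightarrow> (\<alpha>,0) \<in> K \<Longrightarrow> (\<beta>,0) \<in> K \<Longrightarrow>
      (\<And>z. z \<in> K \<Longrightarrow> c \<le> u \<bullet> H z) \<Longrightarrow> s \<in> {\<alpha>..\<beta>} \<Longrightarrow> c \<le> u \<bullet> H (s,0)"
    and top: "\<And>u c K \<alpha> \<beta> s. norm (u::complex) = 1 \<Longrightarrow> connected K \<Longrightarrow> K \<subseteq> sq \<Longrightarrow> (\<alpha>,1) \<in> K \<Longrightarrow> (\<beta>,1) \<in> K \<Longrightarrow>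
      (\<And>z. z \<in> K \<Longrightarrow> c \<le> u \<bullet> H z) \<Longrightarrow> s \<in> {\<alpha>..\<beta>} \<Longrightarrow> c \<le> u \<bullet> H (s,1)"
begin

definition slab :: "real \<Rightarrow> real \<Rightarrow> real \<Rightarrow> (real \<times> real) set" where
  "slab \<theta> c \<epsilon> = {z \<in> sq. \<bar>cis \<theta> \<bullet> H z - c\<bar> < \<epsilon>}"

text \<open>For fixed \<open>\<theta>\<close>, this matches points of the lower and the upper edge that can be joined along level sets of the projection in direction \<open>\<theta>\<close>. For fixed \<open>s\<close>, the matched \<open>s'\<close> form a compact interval depending semicontinuously on \<open>\<theta>\<close>, and a one-dimensional Helly argument finds an \<open>s'\<close> common to all \<open>\<theta>\<close>.\<close>

definition level_rel :: "real \<Rightarrow> real \<Rightarrow> real \<Rightarrow> bool" where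
  "level_rel \<theta> s s' \<longleftrightarrow> (\<forall>\<epsilon>>0. path_component (slab \<theta> (cis \<theta> \<bullet> H (s,0)) \<epsilon>) (s,0) (s',1))"

text \<open>A slab is relatively open in the square, hence locally path connected. This is why open
  slabs of every width replace exact level sets: the crossing argument requires curves.\<close>

lemma slab_path_component:
  assumes "connected K" "K \<subseteq> slab \<theta> c \<epsilon>" "x \<in> K" "y \<in> K"
  shows "path_component (slab \<theta> c \<epsilon>) x y"
proof -
  have "openin (top_of_set sq) (sq \<inter> (\<lambda>z. cis \<theta> \<bullet> H z - c) -` {-\<epsilon><..<\<epsilon>})"
    by (rule continuous_openin_preimage_gen) (use cont in \<open>auto intro!: continuous_intros\<close>)
  moreover have "sq \<inter> (\<lambda>z. cis \<theta> \<bullet> H z - c) -` {-\<epsilon><..<\<epsilon>} = slab \<theta> c \<epsilon>" by (auto simp: slab_def)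
  ultimately have "locally path_connected (slab \<theta> c \<epsilon>)"
    using locally_open_subset[OF convex_imp_locally_path_connected[OF sq_convex]] by simp
  then have "path_component (slab \<theta> c \<epsilon>) = connected_component (slab \<theta> c \<epsilon>)"
    using path_component_eq_connected_component by blast
  then show ?thesis using assms unfolding connected_component_def by auto
qed

lemma slab_segment:
  assumes "a \<in> {0..1}" "b \<in> {0..1}" "t \<in> {0..1}" "\<And>x. x \<in> closed_segment a b \<Longrightarrow> \<bar>cis \<theta> \<bullet> H (x,t) - c\<bar> < \<epsilon>"
  shows "path_component (slab \<theta> c \<epsilon>) (a,t) (b,t)"
proof (rule slab_path_component[of "closed_segment a b \<times> {t}"])
  have "closed_segment a b \<subseteq> {0..1}" using assms by (intro closed_segment_subset) auto
  then show "closed_segment a b \<times> {t} \<subseteq> slab \<theta> c \<epsilon>" using assms by (auto simp: slab_def)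
qed (auto intro!: connected_Times)

lemma top_level:
  assumes K: "connected K" "K \<subseteq> slab \<theta> c \<epsilon>" "(a,1) \<in> K" "(b,1) \<in> K" and y: "y \<in> {a..b}"
  shows "\<bar>cis \<theta> \<bullet> H (y,1) - c\<bar> \<le> \<epsilon>"
proof -
  have Ks: "K \<subseteq> sq" using K(2) by (auto simp: slab_def)
  have n: "\<bar>cis \<theta> \<bullet> H z - c\<bar> < \<epsilon>" if "z \<in> K" for z using that K(2) by (auto simp: slab_def)
  have "c - \<epsilon> \<le> cis \<theta> \<bullet> H (y,1)" by (rule top[OF _ K(1) Ks K(3,4) _ y]) (use n in force)+
  moreover have "- c - \<epsilon> \<le> (- cis \<theta>) \<bullet> H (y,1)" by (rule top[OF _ K(1) Ks K(3,4) _ y]) (use n in force)+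
  ultimately show ?thesis by auto
qed

lemma path_component_slab_top_level:
  assumes "path_component (slab \<theta> c \<epsilon>) (a,1) (b,1)" "y \<in> {a..b}"
  shows "\<bar>cis \<theta> \<bullet> H (y,1) - c\<bar> \<le> \<epsilon>"
proof -
  obtain g where g: "path g" "path_image g \<subseteq> slab \<theta> c \<epsilon>" "pathstart g = (a,1)" "pathfinish g = (b,1)"
    using assms(1) unfolding path_component_def by blast
  show ?thesis
    using g pathstart_in_path_image[of g] pathfinish_in_path_image[of g] connected_path_image[of g]
    by (intro top_level[of "path_image g", OF _ _ _ _ assms(2)]) auto
qed

lemma level_rel_level:
  assumes "level_rel \<theta> s s'"
  shows "cis \<theta> \<bullet> H (s',1) = cis \<theta> \<bullet> H (s,0)"
proof -
  have "\<bar>cis \<theta> \<bullet> H (s',1) - cis \<theta> \<bullet> H (s,0)\<bar> \<le> 0 + \<epsilon>" if "0 < \<epsilon>" for \<epsilon>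
    using assms that path_component_mem(2)[of "slab \<theta> (cis \<theta> \<bullet> H (s,0)) \<epsilon>"] unfolding level_rel_def slab_def by fastforce
  then have "\<bar>cis \<theta> \<bullet> H (s',1) - cis \<theta> \<bullet> H (s,0)\<bar> \<le> 0" by (rule field_le_epsilon)
  then show ?thesis by simp
qed

lemma level_rel_extend:
  assumes "level_rel \<theta> s s'" "s' \<in> {0..1}" "m \<in> {0..1}" "\<And>x. x \<in> closed_segment s' m \<Longrightarrow> cis \<theta> \<bullet> H (x,1) = cis \<theta> \<bullet> H (s,0)"
  shows "level_rel \<theta> s m"
  unfolding level_rel_def
proof (intro allI impI)
  fix \<epsilon> :: real assume e: "0 < \<epsilon>"
  have "path_component (slab \<theta> (cis \<theta> \<bullet> H (s,0)) \<epsilon>) (s',1) (m,1)" using assms(2-) e by (intro slab_segment) auto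
  then show "path_component (slab \<theta> (cis \<theta> \<bullet> H (s,0)) \<epsilon>) (s,0) (m,1)"
    using assms(1) e path_component_trans unfolding level_rel_def by blast
qed

lemma level_rel_interval:
  assumes "level_rel \<theta> s a" "level_rel \<theta> s b" "a \<in> {0..1}" "b \<in> {0..1}" "m \<in> {a..b}"
  shows "level_rel \<theta> s m"
proof (rule level_rel_extend[OF assms(1,3)])
  show "m \<in> {0..1}" using assms by auto
  fix x assume "x \<in> closed_segment a m"
  then have x: "x \<in> {a..b}" using assms(5) by (auto simp: closed_segment_eq_real_ivl split: if_splits)
  have "\<bar>cis \<theta> \<bullet> H (x,1) - cis \<theta> \<bullet> H (s,0)\<bar> \<le> 0 + \<epsilon>" if e: "0 < \<epsilon>" for \<epsilon>
  proof -
    have "path_component (slab \<theta> (cis \<theta> \<bullet> H (s,0)) \<epsilon>) (a,1) (b,1)"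
      using assms(1,2) e path_component_trans path_component_sym unfolding level_rel_def by blast
    from path_component_slab_top_level[OF this x] show ?thesis by simp
  qed
  then have "\<bar>cis \<theta> \<bullet> H (x,1) - cis \<theta> \<bullet> H (s,0)\<bar> \<le> 0" by (rule field_le_epsilon)
  then show "cis \<theta> \<bullet> H (x,1) = cis \<theta> \<bullet> H (s,0)" by simp
qed

text \<open>Suppose the component \<open>C\<close> of the narrower closed slab misses the upper
  edge. Then it also misses the vertical edges, on which \<open>H\<close> is constant, so a
  continuum \<open>G\<close> separating it from the top meets the lower edge on both sides of
  \<open>s\<close>. On \<open>G\<close> the projection is \<open>c + \<epsilon>/2\<close> or
  \<open>c - \<epsilon>/2\<close>, by connectedness the same throughout, and \<open>bot\<close> for
  \<open>cis \<theta>\<close> or its negative contradicts the value \<open>c\<close> at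
  \<open>s\<close>.\<close>

lemma reach_top:
  assumes s: "s \<in> {0..1}" and e: "0 < \<epsilon>"
  shows "\<exists>s'\<in>{0..1}. path_component (slab \<theta> (cis \<theta> \<bullet> H (s,0)) \<epsilon>) (s,0) (s',1)"
proof (rule ccontr)
  assume neg: "\<not> ?thesis"
  define c where "c = cis \<theta> \<bullet> H (s,0)"
  define f where "f = (\<lambda>z. \<bar>cis \<theta> \<bullet> H z - c\<bar>)"
  have fc: "continuous_on sq f" unfolding f_def using cont by (intro continuous_intros)
  define C where "C = connected_component_set {z \<in> sq. f z \<le> \<epsilon>/2} (s,0)"
  have Csub: "C \<subseteq> {z \<in> sq. f z \<le> \<epsilon>/2}" unfolding C_def by (rule connected_component_subset)
  have Cslab: "C \<subseteq> slab \<theta> c \<epsilon>" using Csub e by (force simp: slab_def f_def)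
  have sC: "(s,0) \<in> C" using s e by (auto simp: C_def f_def c_def intro!: connected_component_refl)
  have Cconn: "connected C" unfolding C_def by (rule connected_connected_component)
  have ntop: "(x,1) \<notin> C" if "x \<in> {0..1}" for x
  proof
    assume "(x,1) \<in> C"
    then have "path_component (slab \<theta> c \<epsilon>) (s,0) (x,1)" using slab_path_component[OF Cconn Cslab sC] by blast
    then show False using neg that by (auto simp: c_def)
  qed
  have nside: "(x,t) \<notin> C" if x: "x = 0 \<or> x = 1" and t: "t \<in> {0..1}" for x t
  proof
    assume xC: "(x,t) \<in> C"
    have "H (x,t') = H (x,t)" if "t' \<in> {0..1}" for t' using x left[OF that] left[OF t] right[OF that] right[OF t] by auto
    then have "{x} \<times> {0..1} \<subseteq> {z \<in> sq. f z \<le> \<epsilon>/2}" using xC Csub x by (auto simp: f_def)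
    moreover have "connected (C \<union> {x} \<times> {0..1})" using Cconn xC t by (intro connected_Un) (auto intro!: connected_Times)
    ultimately have "C \<union> {x} \<times> {0..1} \<subseteq> C" unfolding C_def[of] using sC Csub
      by (intro connected_component_maximal) (auto simp: C_def)
    moreover have "(x,1) \<in> {x} \<times> {0..1::real}" by simp
    ultimately have "(x,1) \<in> C" by blast
    then show False using ntop[of x] x by auto
  qed
  have a1: "(s,0) \<in> sq" "f (s,0) \<le> \<epsilon>/2" "(0,1) \<in> sq" using s e by (auto simp: f_def c_def)
  have yC: "(0,1) \<notin> C" using ntop[of 0] by simp
  obtain G where G: "compact G" "connected G" "G \<subseteq> C" "\<And>z. z \<in> G \<Longrightarrow> f z = \<epsilon>/2"
    and hit: "\<And>\<Gamma>. connected \<Gamma> \<Longrightarrow> \<Gamma> \<subseteq> sq \<Longrightarrow> (0,1) \<in> \<Gamma> \<Longrightarrow> \<Gamma> \<inter> C \<noteq> {} \<Longrightarrow> \<Gamma> \<inter> G \<noteq> {}"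
  proof (rule level_separation[OF sq_convex sq_compact fc a1 C_def yC])
    fix G assume a: "compact G" "connected G" "G \<subseteq> C" "\<And>z. z \<in> G \<Longrightarrow> f z = \<epsilon>/2"
      "\<And>\<Gamma>. connected \<Gamma> \<Longrightarrow> \<Gamma> \<subseteq> sq \<Longrightarrow> (0,1) \<in> \<Gamma> \<Longrightarrow> \<Gamma> \<inter> C \<noteq> {} \<Longrightarrow> \<Gamma> \<inter> G \<noteq> {}"
    show thesis by (rule that[OF a])
  qed
  have bott: "\<exists>x. (x,0) \<in> G \<and> (x \<in> {0..s} \<and> A = 0 \<or> x \<in> {s..1} \<and> A = 1)" if A: "A = 0 \<or> A = (1::real)" for A
  proof -
    define \<Gamma> where "\<Gamma> = closed_segment A s \<times> {0::real} \<union> ({A} \<times> {0..1} \<union> {0..1} \<times> {1::real})"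
    have A01: "A \<in> {0..1}" using A by auto
    have "connected ({A} \<times> {0..1} \<union> {0..1} \<times> {1::real})"
    proof (rule connected_Un)
      have "(A,1) \<in> {A} \<times> {0..1} \<inter> {0..1} \<times> {1::real}" using A01 by auto
      then show "{A} \<times> {0..1} \<inter> {0..1} \<times> {1::real} \<noteq> {}" by blast
    qed (auto intro!: connected_Times)
    then have conn: "connected \<Gamma>" unfolding \<Gamma>_def
    proof (rule connected_Un[rotated])
      have "(A,0) \<in> closed_segment A s \<times> {0} \<inter> ({A} \<times> {0..1} \<union> {0..1} \<times> {1::real})" by auto
      then show "closed_segment A s \<times> {0} \<inter> ({A} \<times> {0..1} \<union> {0..1} \<times> {1::real}) \<noteq> {}" by blast
    qed (auto intro!: connected_Times)
    have seg: "closed_segment A s \<subseteq> {0..1}" using A01 s by (intro closed_segment_subset) auto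
    have "\<Gamma> \<inter> G \<noteq> {}"
    proof (rule hit[OF conn])
      show "\<Gamma> \<subseteq> sq" unfolding \<Gamma>_def using seg A01 by auto
      show "(0,1) \<in> \<Gamma>" by (simp add: \<Gamma>_def)
      have "(s,0) \<in> \<Gamma> \<inter> C" using sC by (simp add: \<Gamma>_def)
      then show "\<Gamma> \<inter> C \<noteq> {}" by blast
    qed
    then obtain x t where xt: "(x,t) \<in> \<Gamma>" "(x,t) \<in> G" by (metis Int_emptyI prod.exhaust)
    have "(x,t) \<in> C" using xt(2) G(3) by blast
    then have "\<not> (x = A \<and> t \<in> {0..1})" "\<not> (x \<in> {0..1} \<and> t = 1)" using nside[of x t] ntop[of x] A by auto
    then have xs: "x \<in> closed_segment A s" "t = 0" using xt(1) by (auto simp: \<Gamma>_def)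
    then have "(A = 0 \<longrightarrow> x \<in> {0..s}) \<and> (A = 1 \<longrightarrow> x \<in> {s..1})" using s by (auto simp: closed_segment_eq_real_ivl split: if_splits)
    then show ?thesis using xt(2) xs(2) A by blast
  qed
  obtain a where a: "(a,0) \<in> G" "a \<le> s" using bott[of 0] by auto
  obtain b where b: "(b,0) \<in> G" "s \<le> b" using bott[of 1] by auto
  have sab: "s \<in> {a..b}" using a b by auto
  have Gsq: "G \<subseteq> sq" using G(3) Csub by blast
  have "(\<forall>z\<in>G. c + \<epsilon>/2 \<le> cis \<theta> \<bullet> H z) \<or> (\<forall>z\<in>G. - c + \<epsilon>/2 \<le> (- cis \<theta>) \<bullet> H z)"
  proof (rule ccontr)
    assume "\<not> ?thesis"
    then obtain z w where zw: "z \<in> G" "w \<in> G" "cis \<theta> \<bullet> H z < c + \<epsilon>/2" "c - \<epsilon>/2 < cis \<theta> \<bullet> H w" by (force simp: not_le)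
    have "cis \<theta> \<bullet> H z = c - \<epsilon>/2" "cis \<theta> \<bullet> H w = c + \<epsilon>/2" using G(4)[OF zw(1)] G(4)[OF zw(2)] zw(3,4) unfolding f_def by linarith+
    then have le: "cis \<theta> \<bullet> H z \<le> c" "c \<le> cis \<theta> \<bullet> H w" using e by auto
    have "connected ((\<lambda>z. cis \<theta> \<bullet> H z) ` G)"
      using cont Gsq G(2) by (intro connected_continuous_image continuous_intros) (auto intro: continuous_on_subset)
    then have "c \<in> (\<lambda>z. cis \<theta> \<bullet> H z) ` G" using le zw(1,2) connectedD_interval by blast
    then obtain x where "x \<in> G" "cis \<theta> \<bullet> H x = c" by blast
    then show False using G(4)[of x] e by (simp add: f_def)
  qed
  then show False
  proof
    assume "\<forall>z\<in>G. c + \<epsilon>/2 \<le> cis \<theta> \<bullet> H z"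
    then have "c + \<epsilon>/2 \<le> cis \<theta> \<bullet> H (s,0)" by (intro bot[OF _ G(2) Gsq a(1) b(1) _ sab]) auto
    then show False using e by (simp add: c_def)
  next
    assume "\<forall>z\<in>G. - c + \<epsilon>/2 \<le> (- cis \<theta>) \<bullet> H z"
    then have "- c + \<epsilon>/2 \<le> (- cis \<theta>) \<bullet> H (s,0)" by (intro bot[OF _ G(2) Gsq a(1) b(1) _ sab]) auto
    then show False using e by (simp add: c_def)
  qed
qed

text \<open>A slab for a nearby angle and a nearby starting point is contained in a slightly wider
  slab for \<theta>, and short horizontal segments connect its ends to \<open>s\<close> and
  \<open>s'\<close>. So matching is a closed condition in angle and both points together.\<close>

lemma level_rel_limit:
  assumes s: "s \<in> {0..1}" "s' \<in> {0..1}"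
    and ap: "\<And>\<epsilon>. 0 < \<epsilon> \<Longrightarrow> \<exists>\<theta>1 s1 s1'. \<bar>\<theta>1 - \<theta>\<bar> < \<epsilon> \<and> \<bar>s1 - s\<bar> < \<epsilon> \<and> \<bar>s1' - s'\<bar> < \<epsilon> \<and> s1 \<in> {0..1} \<and> s1' \<in> {0..1} \<and>
      path_component (slab \<theta>1 (cis \<theta>1 \<bullet> H (s1,0)) \<epsilon>) (s1,0) (s1',1)"
  shows "level_rel \<theta> s s'"
  unfolding level_rel_def
proof (intro allI impI)
  fix \<epsilon> :: real assume e: "0 < \<epsilon>"
  let ?c = "cis \<theta> \<bullet> H (s,0)"
  \<comment> \<open>An eighth leaves room for the accumulated errors: \<open>4 * e8\<close> for the
    transferred slab and \<open>5 * e8\<close> along the segment on the upper edge.\<close>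
  define e8 where "e8 = \<epsilon> / 8"
  have e8: "0 < e8" "\<epsilon> = 8 * e8" using e by (auto simp: e8_def)
  obtain B where B: "0 < B" "\<And>z. z \<in> sq \<Longrightarrow> norm (H z) \<le> B"
  proof -
    have "bounded (H ` sq)" using compact_continuous_image[OF cont sq_compact] by (rule compact_imp_bounded)
    then show thesis using that unfolding bounded_pos by blast
  qed
  have "continuous (at \<theta>) cis" using continuous_on_cis[of UNIV "\<lambda>x. x"] by (simp add: continuous_on_eq_continuous_at)
  then obtain d1 where d1: "0 < d1" "\<And>x. dist x \<theta> < d1 \<Longrightarrow> dist (cis x) (cis \<theta>) < e8 / B"
    using e8 B(1) unfolding continuous_at_eps_delta by (metis divide_pos_pos)
  obtain d2 where d2: "0 < d2" "\<And>x y. x \<in> {0..1} \<Longrightarrow> y \<in> {0..1} \<Longrightarrow> \<bar>x - y\<bar> < d2 \<Longrightarrow> dist (H (x,0)) (H (y,0)) < e8"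
    using uniform_modulus[OF continuous_slice[OF cont, of 0] e8(1)] by auto
  obtain d3 where d3: "0 < d3" "\<And>x y. x \<in> {0..1} \<Longrightarrow> y \<in> {0..1} \<Longrightarrow> \<bar>x - y\<bar> < d3 \<Longrightarrow> dist (H (x,1)) (H (y,1)) < e8"
    using uniform_modulus[OF continuous_slice[OF cont, of 1] e8(1)] by auto
  define d where "d = min (min d1 d2) (min d3 e8)"
  have d: "0 < d" "d \<le> d1" "d \<le> d2" "d \<le> d3" "d \<le> e8" using d1 d2 d3 e8 by (auto simp: d_def)
  obtain \<theta>1 s1 s1' where n: "\<bar>\<theta>1 - \<theta>\<bar> < d" "\<bar>s1 - s\<bar> < d" "\<bar>s1' - s'\<bar> < d" "s1 \<in> {0..1}" "s1' \<in> {0..1}"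
    and pc: "path_component (slab \<theta>1 (cis \<theta>1 \<bullet> H (s1,0)) d) (s1,0) (s1',1)" using ap[OF d(1)] by blast
  have rot: "\<bar>cis \<theta>1 \<bullet> H z - cis \<theta> \<bullet> H z\<bar> \<le> e8" if z: "z \<in> sq" for z
  proof -
    have "\<bar>(cis \<theta>1 - cis \<theta>) \<bullet> H z\<bar> \<le> norm (cis \<theta>1 - cis \<theta>) * norm (H z)" by (rule Cauchy_Schwarz_ineq2)
    also have "\<dots> \<le> (e8 / B) * B"
      using d1(2)[of \<theta>1] n(1) d(2) B(2)[OF z] e8(1) B(1) by (intro mult_mono) (auto simp: dist_norm dist_real_def)
    finally show ?thesis using B(1) by (simp add: inner_diff_left)
  qed
  have i: "\<bar>cis \<theta> \<bullet> x - cis \<theta> \<bullet> y\<bar> \<le> dist x y" for x y using inner_dist_le[of "cis \<theta>" x y] by simp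
  have bs: "dist (H (x,0)) (H (s,0)) < e8" if "x \<in> closed_segment s s1" for x
  proof -
    have "x \<in> {0..1}" "\<bar>x - s\<bar> < d2" using that n s d(3) by (auto simp: closed_segment_eq_real_ivl split: if_splits)
    then show ?thesis using d2(2) s by blast
  qed
  have b1: "\<bar>cis \<theta> \<bullet> H (s1,0) - ?c\<bar> < e8" using i[of "H (s1,0)" "H (s,0)"] bs[of s1] by simp
  have sub: "slab \<theta>1 (cis \<theta>1 \<bullet> H (s1,0)) d \<subseteq> slab \<theta> ?c (4 * e8)"
  proof
    fix z assume "z \<in> slab \<theta>1 (cis \<theta>1 \<bullet> H (s1,0)) d"
    then have z: "z \<in> sq" "\<bar>cis \<theta>1 \<bullet> H z - cis \<theta>1 \<bullet> H (s1,0)\<bar> < d" by (auto simp: slab_def)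
    have s1: "(s1,0) \<in> sq" using n(4) by simp
    have "\<bar>cis \<theta> \<bullet> H z - ?c\<bar> < 4 * e8" using z(2) rot[OF z(1)] rot[OF s1] b1 d(5) by linarith
    then show "z \<in> slab \<theta> ?c (4 * e8)" using z(1) by (simp add: slab_def)
  qed
  have sub2: "slab \<theta> ?c (4 * e8) \<subseteq> slab \<theta> ?c \<epsilon>" using e8 by (auto simp: slab_def)
  note pc4 = path_component_of_subset[OF sub pc]
  note m = path_component_of_subset[OF sub2 pc4]
  have t1: "\<bar>cis \<theta> \<bullet> H (s1',1) - ?c\<bar> < 4 * e8" using path_component_mem(2)[OF pc4] by (simp add: slab_def)
  have b: "path_component (slab \<theta> ?c \<epsilon>) (s,0) (s1,0)"
  proof (rule slab_segment[OF s(1) n(4)])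
    fix x assume "x \<in> closed_segment s s1"
    then have "\<bar>cis \<theta> \<bullet> H (x,0) - ?c\<bar> < e8" using i[of "H (x,0)" "H (s,0)"] bs[of x] by simp
    then show "\<bar>cis \<theta> \<bullet> H (x,0) - ?c\<bar> < \<epsilon>" using e8 by linarith
  qed simp
  have t: "path_component (slab \<theta> ?c \<epsilon>) (s1',1) (s',1)"
  proof (rule slab_segment[OF n(5) s(2)])
    fix x assume x: "x \<in> closed_segment s1' s'"
    have "x \<in> {0..1}" "\<bar>x - s1'\<bar> < d3" using x n s d(4) by (auto simp: closed_segment_eq_real_ivl split: if_splits)
    then have "dist (H (x,1)) (H (s1',1)) < e8" using d3(2) n(5) by blast
    then have "\<bar>cis \<theta> \<bullet> H (x,1) - ?c\<bar> < 5 * e8" using i[of "H (x,1)" "H (s1',1)"] t1 by linarith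
    then show "\<bar>cis \<theta> \<bullet> H (x,1) - ?c\<bar> < \<epsilon>" using e8 by linarith
  qed simp
  show "path_component (slab \<theta> ?c \<epsilon>) (s,0) (s',1)" using path_component_trans[OF path_component_trans[OF b m] t] .
qed

lemma level_rel_exists:
  assumes s: "s \<in> {0..1}"
  shows "\<exists>s'\<in>{0..1}. level_rel \<theta> s s'"
proof -
  have "\<forall>n::nat. \<exists>s'\<in>{0..1}. path_component (slab \<theta> (cis \<theta> \<bullet> H (s,0)) (1 / real (Suc n))) (s,0) (s',1)"
    using reach_top[OF s] by (simp del: of_nat_Suc)
  then obtain x where x: "\<And>n. x n \<in> {0..1}" "\<And>n. path_component (slab \<theta> (cis \<theta> \<bullet> H (s,0)) (1 / real (Suc n))) (s,0) (x n,1)"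
    by metis
  from compact_Icc[of 0 "1::real", unfolded compact_def, rule_format, of x, OF x(1)] obtain l k where l: "l \<in> {0..1}" and k: "strict_mono (k :: nat \<Rightarrow> nat)"
    and lim: "(x \<circ> k) \<longlonglongrightarrow> l" by blast
  have "level_rel \<theta> s l"
  proof (rule level_rel_limit[OF s l])
    fix \<epsilon> :: real assume e: "0 < \<epsilon>"
    have "\<forall>\<^sub>F n in sequentially. dist ((x \<circ> k) n) l < \<epsilon> \<and> 1 / real (Suc n) < \<epsilon>"
      using tendstoD[OF lim e] order_tendstoD(2)[OF LIMSEQ_Suc[OF lim_1_over_n] e] by (rule eventually_conj)
    then obtain n where n: "dist (x (k n)) l < \<epsilon>" "1 / real (Suc n) < \<epsilon>"
      unfolding eventually_sequentially o_def by blast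
    have "1 / real (Suc (k n)) \<le> 1 / real (Suc n)" using seq_suble[OF k, of n] by (intro divide_left_mono) auto
    then have "slab \<theta> (cis \<theta> \<bullet> H (s,0)) (1 / real (Suc (k n))) \<subseteq> slab \<theta> (cis \<theta> \<bullet> H (s,0)) \<epsilon>"
      using n(2) by (auto simp: slab_def)
    from path_component_of_subset[OF this x(2)]
    show "\<exists>\<theta>1 s1 s1'. \<bar>\<theta>1 - \<theta>\<bar> < \<epsilon> \<and> \<bar>s1 - s\<bar> < \<epsilon> \<and> \<bar>s1' - l\<bar> < \<epsilon> \<and> s1 \<in> {0..1} \<and> s1' \<in> {0..1} \<and>
      path_component (slab \<theta>1 (cis \<theta>1 \<bullet> H (s1,0)) \<epsilon>) (s1,0) (s1',1)"
      using n(1) x(1)[of "k n"] s e by (intro exI[of _ \<theta>] exI[of _ s] exI[of _ "x (k n)"]) (auto simp: dist_real_def)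
  qed
  then show ?thesis using l by blast
qed

lemma level_rel_closed: "closed {z. snd z \<in> sq \<and> level_rel (fst z) (fst (snd z)) (snd (snd z))}"
  unfolding closed_sequential_limits
proof (intro allI impI)
  fix x :: "nat \<Rightarrow> real \<times> real \<times> real" and l
  assume a: "(\<forall>n. x n \<in> {z. snd z \<in> sq \<and> level_rel (fst z) (fst (snd z)) (snd (snd z))}) \<and> x \<longlonglongrightarrow> l"
  then have x: "\<And>n. snd (x n) \<in> sq" "\<And>n. level_rel (fst (x n)) (fst (snd (x n))) (snd (snd (x n)))" and lim: "x \<longlonglongrightarrow> l" by auto
  have lsq: "snd l \<in> sq" using closed_sequentially[OF sq_closed x(1) tendsto_snd[OF lim]] .
  have "level_rel (fst l) (fst (snd l)) (snd (snd l))"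
  proof (rule level_rel_limit)
    show "fst (snd l) \<in> {0..1}" "snd (snd l) \<in> {0..1}" using lsq by (auto simp: mem_Times_iff)
    fix \<epsilon> :: real assume e: "0 < \<epsilon>"
    obtain n where n: "dist (x n) l < \<epsilon>" using tendstoD[OF lim e] unfolding eventually_sequentially by blast
    have "dist (fst (x n)) (fst l) < \<epsilon>" "dist (fst (snd (x n))) (fst (snd l)) < \<epsilon>" "dist (snd (snd (x n))) (snd (snd l)) < \<epsilon>"
      using n dist_fst_le[of "x n" l] dist_snd_le[of "x n" l] dist_fst_le[of "snd (x n)" "snd l"] dist_snd_le[of "snd (x n)" "snd l"] by linarith+
    then show "\<exists>\<theta>1 s1 s1'. \<bar>\<theta>1 - fst l\<bar> < \<epsilon> \<and> \<bar>s1 - fst (snd l)\<bar> < \<epsilon> \<and> \<bar>s1' - snd (snd l)\<bar> < \<epsilon> \<and> s1 \<in> {0..1} \<and> s1' \<in> {0..1} \<and>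
      path_component (slab \<theta>1 (cis \<theta>1 \<bullet> H (s1,0)) \<epsilon>) (s1,0) (s1',1)"
      using x(2)[of n] x(1)[of n] e unfolding level_rel_def
      by (intro exI[of _ "fst (x n)"] exI[of _ "fst (snd (x n))"] exI[of _ "snd (snd (x n))"]) (auto simp: dist_real_def mem_Times_iff)
  qed
  then show "l \<in> {z. snd z \<in> sq \<and> level_rel (fst z) (fst (snd z)) (snd (snd z))}" using lsq by simp
qed

lemma level_rel_pi: "level_rel (\<theta> + pi) s s' \<longleftrightarrow> level_rel \<theta> s s'"
proof -
  have c: "cis (\<theta> + pi) = - cis \<theta>" by (simp add: complex_eq_iff)
  have "slab (\<theta> + pi) (cis (\<theta> + pi) \<bullet> H (s,0)) \<epsilon> = slab \<theta> (cis \<theta> \<bullet> H (s,0)) \<epsilon>" for \<epsilon>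
    unfolding slab_def c by (auto simp: abs_minus_commute)
  then show ?thesis unfolding level_rel_def by simp
qed

lemma closed_level_angles:
  assumes s: "s \<in> {0..1}" and S: "compact S" "S \<subseteq> {0..1}"
  shows "closed {\<theta>\<in>{a..b}. \<exists>s'\<in>S. level_rel \<theta> s s'}"
proof -
  let ?R = "{z. snd z \<in> sq \<and> level_rel (fst z) (fst (snd z)) (snd (snd z))}"
  have "compact (?R \<inter> {a..b} \<times> {s} \<times> S)" using S by (intro closed_Int_compact level_rel_closed compact_Times) auto
  then have "compact (fst ` (?R \<inter> {a..b} \<times> {s} \<times> S))" by (intro compact_continuous_image continuous_intros)
  moreover have "fst ` (?R \<inter> {a..b} \<times> {s} \<times> S) = {\<theta>\<in>{a..b}. \<exists>s'\<in>S. level_rel \<theta> s s'}"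
  proof (intro set_eqI iffI)
    fix \<theta> assume "\<theta> \<in> {\<theta>\<in>{a..b}. \<exists>s'\<in>S. level_rel \<theta> s s'}"
    then obtain s' where s': "\<theta> \<in> {a..b}" "s' \<in> S" "level_rel \<theta> s s'" by blast
    then have "(\<theta>,s,s') \<in> ?R \<inter> {a..b} \<times> {s} \<times> S" using s S(2) by auto
    then show "\<theta> \<in> fst ` (?R \<inter> {a..b} \<times> {s} \<times> S)" by (rule rev_image_eqI) simp
  qed auto
  ultimately show ?thesis using compact_imp_closed by simp
qed

text \<open>An intermediate value theorem for the interval-valued map from angles to partners of
  \<open>s\<close>. The angles with a partner at most \<open>m\<close> and those with a partner at
  least \<open>m\<close> are closed sets covering a connected interval; at a common angle
  \<open>m\<close> itself is a partner by \<open>level_rel_interval\<close>.\<close>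

lemma level_rel_between:
  assumes s: "s \<in> {0..1}" and \<theta>: "\<theta>1 \<le> \<theta>2" and x: "x1 \<in> {0..1}" "x2 \<in> {0..1}" "level_rel \<theta>1 s x1" "level_rel \<theta>2 s x2"
    and m: "x1 < m \<and> m < x2 \<or> x2 < m \<and> m < x1"
  shows "\<exists>\<theta>\<in>{\<theta>1..\<theta>2}. level_rel \<theta> s m"
proof -
  let ?A = "{\<theta>\<in>{\<theta>1..\<theta>2}. \<exists>s'\<in>{0..m}. level_rel \<theta> s s'}" and ?B = "{\<theta>\<in>{\<theta>1..\<theta>2}. \<exists>s'\<in>{m..1}. level_rel \<theta> s s'}"
  have m01: "0 \<le> m" "m \<le> 1" using m x by auto
  have clA: "closed ?A" by (rule closed_level_angles[OF s]) (use m01 in auto)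
  have clB: "closed ?B" by (rule closed_level_angles[OF s]) (use m01 in auto)
  have cov: "{\<theta>1..\<theta>2} \<subseteq> ?A \<union> ?B"
  proof
    fix \<theta> assume t: "\<theta> \<in> {\<theta>1..\<theta>2}"
    obtain s' where s': "s' \<in> {0..1}" "level_rel \<theta> s s'" using level_rel_exists[OF s] by blast
    then have "s' \<in> {0..m} \<or> s' \<in> {m..1}" by auto
    then show "\<theta> \<in> ?A \<union> ?B" using s' t by blast
  qed
  have ne: "?A \<inter> {\<theta>1..\<theta>2} \<noteq> {} \<and> ?B \<inter> {\<theta>1..\<theta>2} \<noteq> {}"
  proof -
    have t: "\<theta>1 \<in> {\<theta>1..\<theta>2}" "\<theta>2 \<in> {\<theta>1..\<theta>2}" using \<theta> by auto
    from m show ?thesis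
    proof
      assume "x1 < m \<and> m < x2"
      then have "x1 \<in> {0..m}" "x2 \<in> {m..1}" using x by auto
      then have "\<theta>1 \<in> ?A" "\<theta>2 \<in> ?B" using t x by blast+
      then show ?thesis using t by blast
    next
      assume "x2 < m \<and> m < x1"
      then have "x2 \<in> {0..m}" "x1 \<in> {m..1}" using x by auto
      then have "\<theta>2 \<in> ?A" "\<theta>1 \<in> ?B" using t x by blast+
      then show ?thesis using t by blast
    qed
  qed
  have "?A \<inter> ?B \<inter> {\<theta>1..\<theta>2} \<noteq> {}"
  proof
    assume "?A \<inter> ?B \<inter> {\<theta>1..\<theta>2} = {}"
    from connected_closedD[OF connected_Icc this cov clA clB] show False using ne by blast
  qed
  then obtain \<theta> l r where t: "\<theta> \<in> {\<theta>1..\<theta>2}" "l \<in> {0..m}" "level_rel \<theta> s l" "r \<in> {m..1}" "level_rel \<theta> s r" by blast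
  have "level_rel \<theta> s m" using t m01 by (intro level_rel_interval[OF t(3,5)]) auto
  then show ?thesis using t(1) by blast
qed

text \<open>From \<theta>1 to \<theta>2 the partners pass over \<open>m\<close>. Going on from
  \<theta>2 to \<open>\<theta>1 + pi\<close>, which matches as \<theta>1 does, they pass over
  \<open>m\<close> again. The two angles found give independent directions in which
  \<open>H (m,1)\<close> and \<open>H (s,0)\<close> have equal projections.\<close>

lemma level_rel_common_pair:
  assumes s: "s \<in> {0..1}" and \<theta>: "\<theta>1 < \<theta>2" "\<theta>2 < \<theta>1 + pi"
    and x: "x1 \<in> {0..1}" "x2 \<in> {0..1}" "level_rel \<theta>1 s x1" "level_rel \<theta>2 s x2"
    and m: "x1 < m \<and> m < x2 \<or> x2 < m \<and> m < x1" "\<not> level_rel \<theta>1 s m" "\<not> level_rel \<theta>2 s m"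
  shows "H (m,1) = H (s,0)"
proof -
  obtain \<theta>3 where t3: "\<theta>3 \<in> {\<theta>1..\<theta>2}" "level_rel \<theta>3 s m" using level_rel_between[OF s _ x m(1)] \<theta> by auto
  have "level_rel (\<theta>1 + pi) s x1" using x(3) by (simp add: level_rel_pi)
  then obtain \<theta>4 where t4: "\<theta>4 \<in> {\<theta>2..\<theta>1 + pi}" "level_rel \<theta>4 s m"
    using level_rel_between[OF s _ x(2,1,4), of "\<theta>1 + pi" m] m(1) \<theta> by auto
  have "\<theta>3 \<noteq> \<theta>1" "\<theta>3 \<noteq> \<theta>2" "\<theta>4 \<noteq> \<theta>2" "\<theta>4 \<noteq> \<theta>1 + pi" using t3 t4 m(2,3) level_rel_pi by auto
  then have "\<theta>3 < \<theta>4" "\<theta>4 < \<theta>3 + pi" using t3(1) t4(1) by auto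
  moreover have "cis \<theta>3 \<bullet> (H (m,1) - H (s,0)) = 0" "cis \<theta>4 \<bullet> (H (m,1) - H (s,0)) = 0"
    using level_rel_level[OF t3(2)] level_rel_level[OF t4(2)] by (auto simp: inner_diff_right)
  ultimately show ?thesis using cis_inner_eq_0 by fastforce
qed


lemma level_rel_compact:
  assumes "s \<in> {0..1}"
  shows "compact {m\<in>{0..1}. level_rel \<theta> s m}"
proof -
  have "closed ((\<lambda>m. (\<theta>, s, m)) -` {z. snd z \<in> sq \<and> level_rel (fst z) (fst (snd z)) (snd (snd z))})"
    by (intro continuous_closed_vimage[OF level_rel_closed] continuous_intros)
  also have "(\<lambda>m. (\<theta>, s, m)) -` {z. snd z \<in> sq \<and> level_rel (fst z) (fst (snd z)) (snd (snd z))} = {m\<in>{0..1}. level_rel \<theta> s m}"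
    using assms by auto
  finally have "closed {m\<in>{0..1}. level_rel \<theta> s m}" .
  moreover have "bounded {m\<in>{0..1}. level_rel \<theta> s m}" by (rule bounded_subset[of "{0..1}"]) auto
  ultimately show ?thesis by (simp add: compact_eq_bounded_closed)
qed

text \<open>If the sets of partners were disjoint, take a closest pair \<open>x\<close>,
  \<open>y\<close>. By \<open>level_rel_common_pair\<close> the upper edge has the value
  \<open>H (s,0)\<close> strictly between them, so the midpoint is also a partner at \<theta>1,
  against the minimal distance.\<close>

lemma level_rel_pair:
  assumes s: "s \<in> {0..1}" and \<theta>: "\<theta>1 < \<theta>2" "\<theta>2 < \<theta>1 + pi"
  shows "\<exists>m\<in>{0..1}. level_rel \<theta>1 s m \<and> level_rel \<theta>2 s m"
proof (rule ccontr)
  assume neg: "\<not> ?thesis"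
  let ?I = "\<lambda>\<theta>. {m\<in>{0..1}. level_rel \<theta> s m}"
  have "compact (?I \<theta>1 \<times> ?I \<theta>2)" by (intro compact_Times level_rel_compact s)
  moreover have "?I \<theta>1 \<times> ?I \<theta>2 \<noteq> {}" using level_rel_exists[OF s, of \<theta>1] level_rel_exists[OF s, of \<theta>2] by blast
  moreover have "continuous_on (?I \<theta>1 \<times> ?I \<theta>2) (\<lambda>z. \<bar>fst z - snd z\<bar>)" by (intro continuous_intros)
  ultimately obtain w where w: "w \<in> ?I \<theta>1 \<times> ?I \<theta>2" "\<And>z. z \<in> ?I \<theta>1 \<times> ?I \<theta>2 \<Longrightarrow> \<bar>fst w - snd w\<bar> \<le> \<bar>fst z - snd z\<bar>"
    using continuous_attains_inf by (metis (no_types, lifting))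
  obtain x y where wxy: "w = (x,y)" by (cases w)
  have x: "x \<in> {0..1}" "level_rel \<theta>1 s x" and y: "y \<in> {0..1}" "level_rel \<theta>2 s y" using w(1) by (auto simp: wxy)
  have ne: "x \<noteq> y" using neg x y by blast
  have min: "\<bar>x - y\<bar> \<le> \<bar>x' - y'\<bar>" if "x' \<in> {0..1}" "level_rel \<theta>1 s x'" "y' \<in> {0..1}" "level_rel \<theta>2 s y'" for x' y'
    using w(2)[of "(x',y')"] that by (simp add: wxy)
  have btw: "H (m,1) = H (s,0) \<and> \<not> level_rel \<theta>1 s m" if m: "x < m \<and> m < y \<or> y < m \<and> m < x" for m
  proof -
    have m01: "m \<in> {0..1}" using m x y by auto
    have "\<not> level_rel \<theta>1 s m" using min[OF m01 _ y] m by auto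
    moreover have "\<not> level_rel \<theta>2 s m" using min[OF x m01] m by auto
    ultimately show ?thesis using level_rel_common_pair[OF s \<theta> x(1) y(1) x(2) y(2) m] by blast
  qed
  define m where "m = (x + y) / 2"
  have m: "x < m \<and> m < y \<or> y < m \<and> m < x" using ne by (auto simp: m_def)
  have "level_rel \<theta>1 s m"
  proof (rule level_rel_extend[OF x(2,1)])
    show "m \<in> {0..1}" using m x y by auto
    fix z assume z: "z \<in> closed_segment x m"
    show "cis \<theta>1 \<bullet> H (z,1) = cis \<theta>1 \<bullet> H (s,0)"
    proof (cases "z = x")
      case True
      then show ?thesis using level_rel_level[OF x(2)] by simp
    next
      case False
      then have "x < z \<and> z < y \<or> y < z \<and> z < x" using z m by (auto simp: closed_segment_eq_real_ivl split: if_splits)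
      then show ?thesis using btw by simp
    qed
  qed
  then show False using btw[OF m] by blast
qed

text \<open>The sets of partners are compact intervals that meet in pairs, so no left end exceeds a
  right end, and the supremum of the left ends is common to all of them.\<close>

lemma level_rel_common:
  assumes s: "s \<in> {0..1}"
  shows "\<exists>m\<in>{0..1}. \<forall>\<theta>\<in>{0..<pi}. level_rel \<theta> s m"
proof -
  define I where "I = (\<lambda>\<theta>. {m\<in>{0..1}. level_rel \<theta> s m})"
  have cI: "compact (I \<theta>)" for \<theta> unfolding I_def by (rule level_rel_compact[OF s])
  have nI: "I \<theta> \<noteq> {}" for \<theta> using level_rel_exists[OF s, of \<theta>] by (auto simp: I_def)
  have bI: "bdd_below (I \<theta>)" "bdd_above (I \<theta>)" for \<theta> 
    by (auto simp: I_def intro!: bdd_belowI[of _ 0] bdd_aboveI[of _ 1])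
  have inI: "Inf (I \<theta>) \<in> I \<theta>" "Sup (I \<theta>) \<in> I \<theta>" for \<theta>
    by (rule closed_contains_Inf[OF nI bI(1) compact_imp_closed[OF cI]], rule closed_contains_Sup[OF nI bI(2) compact_imp_closed[OF cI]])
  have le: "Inf (I \<theta>) \<le> Sup (I \<theta>')" if t: "\<theta> \<in> {0..<pi}" "\<theta>' \<in> {0..<pi}" for \<theta> \<theta>'
  proof -
    have "\<exists>m. m \<in> I \<theta> \<and> m \<in> I \<theta>'"
    proof -
      consider "\<theta> = \<theta>'" | "\<theta> < \<theta>'" | "\<theta>' < \<theta>" by linarith
      then show ?thesis
      proof cases
        case 1
        then show ?thesis using nI by blast
      next
        case 2
        then show ?thesis using level_rel_pair[OF s 2] t by (auto simp: I_def)
      next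
        case 3
        then show ?thesis using level_rel_pair[OF s 3] t by (auto simp: I_def)
      qed
    qed
    then obtain m where "m \<in> I \<theta>" "m \<in> I \<theta>'" by blast
    then show ?thesis using cInf_lower[OF _ bI(1)] cSup_upper[OF _ bI(2)] by (meson order_trans)
  qed
  define l where "l = (SUP \<theta>\<in>{0..<pi}. Inf (I \<theta>))"
  have z: "(0::real) \<in> {0..<pi}" by simp
  have bd: "bdd_above ((\<lambda>\<theta>. Inf (I \<theta>)) ` {0..<pi})" using le[OF _ z] by (intro bdd_aboveI2)
  have "level_rel \<theta> s l \<and> l \<in> {0..1}" if t: "\<theta> \<in> {0..<pi}" for \<theta>
  proof -
    have "Inf (I \<theta>) \<le> l" unfolding l_def using bd t by (rule cSUP_upper2) simp
    moreover have "l \<le> Sup (I \<theta>)" unfolding l_def using le t z by (intro cSUP_least) auto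
    moreover have i: "level_rel \<theta> s (Inf (I \<theta>))" "level_rel \<theta> s (Sup (I \<theta>))" "Inf (I \<theta>) \<in> {0..1}" "Sup (I \<theta>) \<in> {0..1}"
      using inI[of \<theta>] by (auto simp: I_def)
    ultimately show ?thesis using level_rel_interval[OF i, of l] by auto
  qed
  then show ?thesis using z by blast
qed

text \<open>Half a turn of angles represents all directions up to sign, by
  \<open>level_rel_pi\<close>.\<close>

definition matching :: "(real \<times> real) set" where
  "matching = (\<Inter>\<theta>\<in>{0..<pi}. {z. z \<in> sq \<and> level_rel \<theta> (fst z) (snd z)})"

lemma matchingD: "(s,s') \<in> matching \<Longrightarrow> \<theta> \<in> {0..<pi} \<Longrightarrow> level_rel \<theta> s s' \<and> s \<in> {0..1} \<and> s' \<in> {0..1}"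
  unfolding matching_def by auto

lemma matching_closed: "closed matching"
  unfolding matching_def
proof (intro closed_INT ballI)
  fix \<theta> :: real
  have "closed ((\<lambda>z. (\<theta>, z)) -` {z. snd z \<in> sq \<and> level_rel (fst z) (fst (snd z)) (snd (snd z))})"
    by (intro continuous_closed_vimage[OF level_rel_closed] continuous_intros)
  then show "closed {z. z \<in> sq \<and> level_rel \<theta> (fst z) (snd z)}" by (simp add: vimage_def)
qed

lemma matching_side:
  assumes "x = 0 \<or> x = 1"
  shows "(x,x) \<in> matching"
proof -
  have Hx: "H (x,t) = H (x,0)" if "t \<in> {0..1}" for t using assms left[OF that] right[OF that] left[of 0] right[of 0] by auto
  have v: "path_component (slab \<theta> (cis \<theta> \<bullet> H (x,0)) \<epsilon>) (x,0) (x,1)" if e: "0 < \<epsilon>" for \<theta> \<epsilon>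
  proof (rule slab_path_component[of "{x} \<times> {0..1}"])
    show "{x} \<times> {0..1} \<subseteq> slab \<theta> (cis \<theta> \<bullet> H (x,0)) \<epsilon>"
    proof
      fix z assume "z \<in> {x} \<times> {0..1::real}"
      then obtain t where t: "z = (x,t)" "t \<in> {0..1}" by blast
      then have "H z = H (x,0)" using Hx by blast
      then show "z \<in> slab \<theta> (cis \<theta> \<bullet> H (x,0)) \<epsilon>" using t assms e by (auto simp: slab_def)
    qed
  qed (auto intro!: connected_Times)
  have "level_rel \<theta> x x" for \<theta> unfolding level_rel_def using v by blast
  then show ?thesis using assms unfolding matching_def by auto
qed

text \<open>For pairs in crossed position the two curves in their slabs meet by
  \<open>paths_cross\<close>. So the two levels nearly agree, and the union of the curves is a
  connected set in a single slab, which confines the upper edge between \<open>s2'\<close> and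
  \<open>s1'\<close>. Two independent angles then determine the value.\<close>

lemma matching_cross:
  assumes M: "(s1,s1') \<in> matching" "(s2,s2') \<in> matching" and s: "s1 \<le> s2" and y: "s2' \<le> y" "y \<le> s1'"
  shows "H (y,1) = H (s2,0)"
proof -
  have lev: "cis \<theta> \<bullet> H (y,1) = cis \<theta> \<bullet> H (s2,0)" if t: "\<theta> \<in> {0..<pi}" for \<theta>
  proof -
    let ?c1 = "cis \<theta> \<bullet> H (s1,0)" and ?c2 = "cis \<theta> \<bullet> H (s2,0)"
    have "\<bar>cis \<theta> \<bullet> H (y,1) - ?c2\<bar> \<le> 0 + e" if e: "0 < e" for e
    proof -
      define \<epsilon> where "\<epsilon> = e / 3"
      have \<epsilon>: "0 < \<epsilon>" "e = 3 * \<epsilon>" using e by (auto simp: \<epsilon>_def)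
      obtain g1 where g1: "path g1" "path_image g1 \<subseteq> slab \<theta> ?c1 \<epsilon>" "pathstart g1 = (s1,0)" "pathfinish g1 = (s1',1)"
        using matchingD[OF M(1) t] \<epsilon>(1) unfolding level_rel_def path_component_def by blast
      obtain g2 where g2: "path g2" "path_image g2 \<subseteq> slab \<theta> ?c2 \<epsilon>" "pathstart g2 = (s2,0)" "pathfinish g2 = (s2',1)"
        using matchingD[OF M(2) t] \<epsilon>(1) unfolding level_rel_def path_component_def by blast
      have sub: "path_image g1 \<subseteq> sq" "path_image g2 \<subseteq> sq" using g1(2) g2(2) unfolding slab_def by blast+
      have int: "path_image g1 \<inter> path_image g2 \<noteq> {}"
        by (rule paths_cross[OF g1(1) sub(1) g1(3,4) g2(1) sub(2) g2(3,4) s]) (use y in simp)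
      then obtain w where w: "w \<in> path_image g1" "w \<in> path_image g2" by blast
      have "\<bar>cis \<theta> \<bullet> H w - ?c1\<bar> < \<epsilon>" "\<bar>cis \<theta> \<bullet> H w - ?c2\<bar> < \<epsilon>" using w g1(2) g2(2) unfolding slab_def by blast+
      then have c12: "\<bar>?c1 - ?c2\<bar> < 2 * \<epsilon>" by linarith
      \<comment> \<open>The levels differ by less than \<open>2 * \<epsilon>\<close>, one \<epsilon>
        for each slab at the common point; the slab's own half-width adds the third.\<close>
      have "slab \<theta> ?c1 \<epsilon> \<subseteq> slab \<theta> ?c2 (3 * \<epsilon>)" "slab \<theta> ?c2 \<epsilon> \<subseteq> slab \<theta> ?c2 (3 * \<epsilon>)" using c12 \<epsilon>(1) by (auto simp: slab_def)
      then have K: "path_image g1 \<union> path_image g2 \<subseteq> slab \<theta> ?c2 (3 * \<epsilon>)" using g1(2) g2(2) by blast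
      have conn: "connected (path_image g1 \<union> path_image g2)" using g1 g2 int by (intro connected_Un connected_path_image)
      have ends: "(s2',1) \<in> path_image g1 \<union> path_image g2" "(s1',1) \<in> path_image g1 \<union> path_image g2"
        using g1(4) g2(4) pathfinish_in_path_image[of g1] pathfinish_in_path_image[of g2] by auto
      have "\<bar>cis \<theta> \<bullet> H (y,1) - ?c2\<bar> \<le> 3 * \<epsilon>" by (rule top_level[OF conn K ends]) (use y in simp)
      then show ?thesis using \<epsilon>(2) by simp
    qed
    then have "\<bar>cis \<theta> \<bullet> H (y,1) - ?c2\<bar> \<le> 0" by (rule field_le_epsilon)
    then show ?thesis by simp
  qed
  have "cis 0 \<bullet> (H (y,1) - H (s2,0)) = 0" "cis (pi/2) \<bullet> (H (y,1) - H (s2,0)) = 0"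
    using lev[of 0] lev[of "pi/2"] pi_gt_zero by (auto simp: inner_diff_right)
  then have "H (y,1) - H (s2,0) = 0" by (rule cis_inner_eq_0) (use pi_gt_zero in auto)
  then show ?thesis by simp
qed

lemma reparam_equiv_edges: "reparam_equiv (\<lambda>s. H (s,0)) (\<lambda>s. H (s,1))"
proof (rule matching_reparam[OF matching_closed])
  show "matching \<subseteq> sq"
  proof -
    have "(0::real) \<in> {0..<pi}" by simp
    then show ?thesis unfolding matching_def by blast
  qed
  show "(0,0) \<in> matching" "(1,1) \<in> matching" by (auto intro: matching_side)
  show "\<exists>s'. (s,s') \<in> matching" if s: "s \<in> {0..1}" for s
  proof -
    obtain m where "m \<in> {0..1}" "\<forall>\<theta>\<in>{0..<pi}. level_rel \<theta> s m" using level_rel_common[OF s] by blast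
    then have "(s,m) \<in> matching" using s unfolding matching_def by auto
    then show ?thesis by blast
  qed
qed (rule matching_cross)

end

lemma cc_slice:
  assumes h: "cc_hom \<Omega> p q \<gamma> lam h" and \<tau>: "0 \<le> \<tau>" "\<tau> < 1"
  shows "epeh \<Omega> p q \<gamma> (\<lambda>s. h (s,\<tau>))"
proof -
  have t: "0 \<le> \<tau> * t \<and> \<tau> * t < 1" if "t \<in> {0..1}" for t
    using that \<tau> mult_left_mono[of t 1 \<tau>] by auto
  have "epe_hom \<Omega> p q \<gamma> (\<lambda>s. h (s,\<tau>)) (\<lambda>z. h (fst z, \<tau> * snd z))"
  proof (rule epe_homI)
    show "continuous_on sq (\<lambda>z. h (fst z, \<tau> * snd z))"
    proof (rule continuous_on_compose2[OF cc_homD(1)[OF h]])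
      show "continuous_on sq (\<lambda>z. (fst z, \<tau> * snd z))" by (intro continuous_intros)
      show "(\<lambda>z. (fst z, \<tau> * snd z)) ` sq \<subseteq> sq" using t by (auto simp: less_imp_le)
    qed
  next
    fix s t' :: real assume "0 < s" "s < 1" "t' \<in> {0..1}"
    then show "h (fst (s,t'), \<tau> * snd (s,t')) \<in> \<Omega>" using cc_homD(6)[OF h, of s "\<tau> * t'"] t[of t'] by auto
  next
    fix t' :: real assume "t' \<in> {0..1}"
    then show "h (fst (0,t'), \<tau> * snd (0,t')) = p" "h (fst (1,t'), \<tau> * snd (1,t')) = q"
      using cc_homD(4,5)[OF h, of "\<tau> * t'"] t[of t'] by auto
  qed (use cc_homD(2)[OF h] in auto)
  then show ?thesis unfolding epeh_def by blast
qed

text \<open>The way leads from \<open>lam\<close> back to \<gamma> and on to \<open>mu\<close>. For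
  t strictly between 0 and 1 it uses only levels of \<open>h\<close> and \<open>k\<close> below 1,
  which lie in the homotopy class of \<gamma>.\<close>

lemma collar_between:
  assumes h: "cc_hom \<Omega> p q \<gamma> lam h" and k: "cc_hom \<Omega> p q \<gamma> mu k"
  shows "collar \<Omega> p q \<gamma> lam (tpaste (trev h) k)"
proof -
  let ?H = "tpaste (trev h) k"
  have slice: "epeh \<Omega> p q \<gamma> (\<lambda>s. ?H (s,t))" if t: "0 < t" "t < 1" for t
  proof (cases "t \<le> 1/2")
    case True
    then have "(\<lambda>s. ?H (s,t)) = (\<lambda>s. h (s, 1 - 2 * t))" by (simp add: tpaste_def trev_def)
    then show ?thesis using cc_slice[OF h, of "1 - 2 * t"] t True by simp
  next
    case False
    then have "(\<lambda>s. ?H (s,t)) = (\<lambda>s. k (s, 2 * t - 1))" by (simp add: tpaste_def)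
    then show ?thesis using cc_slice[OF k, of "2 * t - 1"] t False by simp
  qed
  have c: "continuous_on sq ?H"
  proof (rule continuous_tpaste)
    show "continuous_on sq (trev h)"
      unfolding trev_def case_prod_unfold by (intro continuous_on_compose2[OF cc_homD(1)[OF h]] continuous_intros) auto
    show "continuous_on sq k" by (rule cc_homD(1)[OF k])
    show "trev h (s,1) = k (s,0)" if "s \<in> {0..1}" for s using cc_homD(2)[OF h that] cc_homD(2)[OF k that] by (simp add: trev_def)
  qed
  have e: "?H (s,0) = lam s" if "s \<in> {0..1}" for s using cc_homD(3)[OF h that] by (simp add: tpaste_def trev_def)
  have pq: "?H (0,t) = p" "?H (1,t) = q" if "t \<in> {0..1}" for t
    using cc_homD(4,5)[OF h, of "1 - 2 * t"] cc_homD(4,5)[OF k, of "2 * t - 1"] that by (auto simp: tpaste_def trev_def)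
  have om: "?H (s,t) \<in> \<Omega>" if "0 < s" "s < 1" "0 < t" "t < 1" for s t
    using epeh_path[OF slice[OF that(3,4)]] that(1,2) by (auto simp: epe_path_def)
  show ?thesis unfolding collar_def using c e pq om slice by auto
qed

text \<open>Each of the two paths is the lower edge of its own collar, and the collars are
  reflections of one another. Applying \<open>efficient_level_ge\<close> to both therefore makes one
  square taut at its lower and at its upper edge.\<close>

lemma efficient_unique:
  assumes \<Omega>: "open \<Omega>" and lam: "efficient \<Omega> p q \<gamma> lam" and mu: "efficient \<Omega> p q \<gamma> mu"
  shows "reparam_equiv lam mu"
proof -
  obtain h where h: "cc_hom \<Omega> p q \<gamma> lam h" using lam cc_hom_exists unfolding efficient_def by blast
  obtain k where k: "cc_hom \<Omega> p q \<gamma> mu k" using mu cc_hom_exists unfolding efficient_def by blast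
  define H where "H = tpaste (trev h) k"
  define H' where "H' = tpaste (trev k) h"
  have C: "collar \<Omega> p q \<gamma> lam H" unfolding H_def by (rule collar_between[OF h k])
  have C': "collar \<Omega> p q \<gamma> mu H'" unfolding H'_def by (rule collar_between[OF k h])
  have flip: "H' (s,1 - t) = H (s,t)" if "s \<in> {0..1}" "t \<in> {0..1}" for s t
  proof (cases "t = 1/2")
    case True
    \<comment> \<open>At t = 1/2 both pastings take their first branch and give
      \<open>k (s,0)\<close> and \<open>h (s,0)\<close>; these agree because both homotopies start
      at \<gamma>.\<close>
    show ?thesis unfolding True using cc_homD(2)[OF h that(1)] cc_homD(2)[OF k that(1)] by (simp add: H_def H'_def tpaste_def trev_def)
  next
    case False
    then show ?thesis by (auto simp: H_def H'_def tpaste_def trev_def algebra_simps)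
  qed
  interpret taut_square H p q
  proof
    show "continuous_on sq H" by (rule collarD(1)[OF C])
    show "H (0,t) = p" "H (1,t) = q" if "t \<in> {0..1}" for t using collarD(3,4)[OF C that] .
  next
    fix u :: complex and c K \<alpha> \<beta> s
    assume a: "norm u = 1" "connected K" "K \<subseteq> sq" "(\<alpha>,0) \<in> K" "(\<beta>,0) \<in> K" "\<And>z. z \<in> K \<Longrightarrow> c \<le> u \<bullet> H z" "s \<in> {\<alpha>..\<beta>}"
    have "s \<in> {0..1}" using a(3-5,7) by auto
    then show "c \<le> u \<bullet> H (s,0)" using efficient_level_ge[OF \<Omega> lam C a] collarD(2)[OF C] by simp
  next
    fix u :: complex and c K \<alpha> \<beta> s
    assume a: "norm u = 1" "connected K" "K \<subseteq> sq" "(\<alpha>,1) \<in> K" "(\<beta>,1) \<in> K" "\<And>z. z \<in> K \<Longrightarrow> c \<le> u \<bullet> H z" "s \<in> {\<alpha>..\<beta>}"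
    let ?K = "(\<lambda>z. (fst z, 1 - snd z)) ` K"
    have s01: "s \<in> {0..1}" using a(3-5,7) by auto
    have 1: "connected ?K" using a(2) by (intro connected_continuous_image continuous_intros)
    have 2: "?K \<subseteq> sq" using a(3) by auto
    have 3: "(\<alpha>,0) \<in> ?K" "(\<beta>,0) \<in> ?K" by (rule rev_image_eqI[OF a(4)], simp, rule rev_image_eqI[OF a(5)], simp)
    have 4: "c \<le> u \<bullet> H' w" if w: "w \<in> ?K" for w
    proof -
      obtain z where z: "z \<in> K" "w = (fst z, 1 - snd z)" using w by blast
      have "fst z \<in> {0..1}" "snd z \<in> {0..1}" using z(1) a(3) by auto
      then show ?thesis using a(6)[OF z(1)] flip[of "fst z" "snd z"] z(2) by simp
    qed
    have "c \<le> u \<bullet> mu s" by (rule efficient_level_ge[OF \<Omega> mu C' a(1) 1 2 3 4 a(7)])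
    moreover have "H (s,1) = mu s" using flip[OF s01, of 1] collarD(2)[OF C' s01] by simp
    ultimately show "c \<le> u \<bullet> H (s,1)" by simp
  qed
  have e: "H (s,0) = lam s" "H (s,1) = mu s" if "s \<in> {0..1}" for s
    using collarD(2)[OF C that] flip[OF that, of 1] collarD(2)[OF C' that] by auto
  obtain \<phi> \<psi> :: "real \<Rightarrow> real" where r: "continuous_on {0..1} \<phi>" "continuous_on {0..1} \<psi>" "mono_on {0..1} \<phi>" "mono_on {0..1} \<psi>"
      "\<phi> ` {0..1} = {0..1}" "\<psi> ` {0..1} = {0..1}" "\<forall>s\<in>{0..1}. H (\<phi> s,0) = H (\<psi> s,1)"
    using reparam_equiv_edges unfolding reparam_equiv_def by blast
  have "\<forall>s\<in>{0..1}. lam (\<phi> s) = mu (\<psi> s)"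
  proof
    fix s :: real assume s: "s \<in> {0..1}"
    then have "\<phi> s \<in> {0..1}" "\<psi> s \<in> {0..1}" using r(5,6) by blast+
    then show "lam (\<phi> s) = mu (\<psi> s)" using r(7) s e by metis
  qed
  then show ?thesis unfolding reparam_equiv_def using r(1-6) by blast
qed

theorem theorem1p1:
  fixes \<Omega> :: "complex set" and p q :: complex and \<gamma> :: "real \<Rightarrow> complex"
  assumes "open \<Omega>" and "connected \<Omega>"
    and "p \<in> closure \<Omega>" and "q \<in> closure \<Omega>"
    and "epe_path \<Omega> p q \<gamma>"
  shows "(\<exists>lam. efficient \<Omega> p q \<gamma> lam) \<and>
         (\<forall>lam mu. efficient \<Omega> p q \<gamma> lam \<and> efficient \<Omega> p q \<gamma> mu \<longrightarrow> reparam_equiv lam mu)"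
  using exists_efficient[OF assms(1,5)] efficient_unique[OF assms(1)] by blast

end
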